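(* Let $F$ be a field or a principal ideal domain and let $\equiv$ be an equivalence relation on the set of positive integers. Then the following are equivalent: (i) For all positive integers $n$, $m$ and $k$: $n \equiv m \iff nk \equiv mk$. (ii) There is a (unique) subgroup $H$ of the multiplicative group $\mathbb{Q}_+^\times$ of positive rational numbers such that for all positive integers $n$ and $m$: $n \equiv m \iff \frac{n}{m} \in H$. (iii) There exists an ultramatricial $F$-algebra with matrix type $\equiv$.
   Context: Rings and algebras are associative with unit, and subalgebras contain the unit. An ultramatricial algebra over $F$ is an $F$-algebra which is a union of an upward directed countable set of $F$-subalgebras, each of which is (isomorphic to) a direct product of finitely many matrix algebras over $F$. $M_n(R)$ is the ring of $n\times n$ matrices over the ring $R$. The matrix type of a ring $R$ is the equivalence relation on positive integers $\operatorname{mt}(R) := \{(n,m) \mid M_n(R) \cong M_m(R)\}$, where $\cong$ is isomorphism of rings. *)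

theory Defs
  imports "HOL-Library.Countable_Set" "HOL-Algebra.Algebra"
begin

text \<open>The library locale \<^locale>\<open>algebra\<close> requires a commutative multiplication, hence the
  following associative unital variant.\<close>

locale assoc_algebra = module + ring M +
  assumes smult_mult_left:
      "\<lbrakk>a \<in> carrier R; x \<in> carrier M; y \<in> carrier M\<rbrakk> \<Longrightarrow>
        (a \<odot>\<^bsub>M\<^esub> x) \<otimes>\<^bsub>M\<^esub> y = a \<odot>\<^bsub>M\<^esub> (x \<otimes>\<^bsub>M\<^esub> y)"
    and smult_mult_right:
      "\<lbrakk>a \<in> carrier R; x \<in> carrier M; y \<in> carrier M\<rbrakk> \<Longrightarrow>
        x \<otimes>\<^bsub>M\<^esub> (a \<odot>\<^bsub>M\<^esub> y) = a \<odot>\<^bsub>M\<^esub> (x \<otimes>\<^bsub>M\<^esub> y)"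

text \<open>\<^const>\<open>subring\<close> already demands the unit of the ambient ring.\<close>

definition unital_subalgebra ::
    "'b set \<Rightarrow> ('a, 'm) ring_scheme \<Rightarrow> ('a, 'b, 'n) module_scheme \<Rightarrow> bool" where
  "unital_subalgebra B F A \<longleftrightarrow>
     subring B A \<and> (\<forall>a \<in> carrier F. \<forall>x \<in> B. a \<odot>\<^bsub>A\<^esub> x \<in> B)"

definition algebra_isomorphic ::
    "('a, 'm) ring_scheme \<Rightarrow> ('a, 'b, 'n) module_scheme \<Rightarrow> ('a, 'c, 'k) module_scheme \<Rightarrow> bool" where
  "algebra_isomorphic F A B \<longleftrightarrow>
     (\<exists>h \<in> ring_iso A B. \<forall>a \<in> carrier F. \<forall>x \<in> carrier A. h (a \<odot>\<^bsub>A\<^esub> x) = a \<odot>\<^bsub>B\<^esub> h x)"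

definition matrix_ring :: "nat \<Rightarrow> ('a, 'm) ring_scheme \<Rightarrow> (nat \<times> nat \<Rightarrow> 'a) ring" where
  "matrix_ring n R =
     \<lparr>carrier = ({..<n} \<times> {..<n}) \<rightarrow>\<^sub>E carrier R,
      monoid.mult = (\<lambda>x y. restrict (\<lambda>(i, j). \<Oplus>\<^bsub>R\<^esub>k\<in>{..<n}. x (i, k) \<otimes>\<^bsub>R\<^esub> y (k, j))
        ({..<n} \<times> {..<n})),
      one = restrict (\<lambda>(i, j). if i = j then \<one>\<^bsub>R\<^esub> else \<zero>\<^bsub>R\<^esub>) ({..<n} \<times> {..<n}),
      ring.zero = (\<lambda>p \<in> {..<n} \<times> {..<n}. \<zero>\<^bsub>R\<^esub>),
      ring.add = (\<lambda>x y. \<lambda>p \<in> {..<n} \<times> {..<n}. x p \<oplus>\<^bsub>R\<^esub> y p)\<rparr>"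

definition matrix_algebra :: "nat \<Rightarrow> ('a, 'm) ring_scheme \<Rightarrow> ('a, nat \<times> nat \<Rightarrow> 'a) module" where
  "matrix_algebra n F =
     ring.extend (matrix_ring n F)
       \<lparr>smult = (\<lambda>a x. \<lambda>p \<in> {..<n} \<times> {..<n}. a \<otimes>\<^bsub>F\<^esub> x p)\<rparr>"

definition product_algebra ::
    "'i set \<Rightarrow> ('i \<Rightarrow> ('a, 'b, 'n) module_scheme) \<Rightarrow> ('a, 'i \<Rightarrow> 'b) module" where
  "product_algebra I A =
     \<lparr>carrier = (\<Pi>\<^sub>E i \<in> I. carrier (A i)),
      monoid.mult = (\<lambda>x y. \<lambda>i \<in> I. x i \<otimes>\<^bsub>A i\<^esub> y i),
      one = (\<lambda>i \<in> I. \<one>\<^bsub>A i\<^esub>),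
      ring.zero = (\<lambda>i \<in> I. \<zero>\<^bsub>A i\<^esub>),
      ring.add = (\<lambda>x y. \<lambda>i \<in> I. x i \<oplus>\<^bsub>A i\<^esub> y i),
      smult = (\<lambda>a x. \<lambda>i \<in> I. a \<odot>\<^bsub>A i\<^esub> x i)\<rparr>"

text \<open>The empty product (\<open>r = 0\<close>) is allowed, so the zero algebra is ultramatricial.\<close>

definition matricial :: "('a, 'm) ring_scheme \<Rightarrow> ('a, 'b, 'n) module_scheme \<Rightarrow> bool" where
  "matricial F A \<longleftrightarrow>
     (\<exists>(r::nat) d. (\<forall>i<r. 0 < d i) \<and>
        algebra_isomorphic F A (product_algebra {..<r} (\<lambda>i. matrix_algebra (d i) F)))"

definition ultramatricial :: "('a, 'm) ring_scheme \<Rightarrow> ('a, 'b) module \<Rightarrow> bool" where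
  "ultramatricial F A \<longleftrightarrow>
     assoc_algebra F A \<and>
     (\<exists>\<B>. countable \<B> \<and> \<B> \<noteq> {} \<and>
        (\<forall>B \<in> \<B>. \<forall>C \<in> \<B>. \<exists>D \<in> \<B>. B \<subseteq> D \<and> C \<subseteq> D) \<and>
        (\<forall>B \<in> \<B>. unital_subalgebra B F A \<and> matricial F (A\<lparr>carrier := B\<rparr>)) \<and>
        carrier A = \<Union>\<B>)"

definition matrix_type :: "('a, 'm) ring_scheme \<Rightarrow> (nat \<times> nat) set" where
  "matrix_type R = {(n, m). 0 < n \<and> 0 < m \<and> matrix_ring n R \<simeq> matrix_ring m R}"

definition pos_rat_group :: "rat monoid" where
  "pos_rat_group = \<lparr>carrier = {q. 0 < q}, monoid.mult = (*), one = 1\<rparr>"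

text \<open>HOL cannot quantify over types inside a formula, so the existence of an ultramatricial
  \<open>F\<close>-algebra must name the type of its elements.  For \<open>F :: 'a ring\<close> with \<open>\<one> \<noteq> \<zero>\<close> the type
  \<open>nat \<Rightarrow> 'a\<close> is large enough: an ultramatricial algebra is a countable union of finitely generated
  \<open>F\<close>-modules, so it has at most as many elements as there are sequences in \<open>F\<close> and can be
  transported along an injection.  The theorem also asserts, for every element type \<open>'b\<close>, that an
  ultramatricial algebra with elements in \<open>'b\<close> yields one with elements in \<open>nat \<Rightarrow> 'a\<close> of the same matrix type.\<close>

end

theory Submission
  imports Defs "HOL-Library.Multiset"
begin

text \<open>An idempotent in a finite product of matrix rings over a principal ideal domain is an orthogonal
  sum of minimal idempotents, and the multiset of factors in which these lie determines it up to
  equivalence. Multisets admit cancellation of multiples: if the unit of some \<open>M\<^sub>n\<^sub>k(A)\<close>, with \<open>A\<close>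
  ultramatricial, is the sum of \<open>k\<close> copies of \<open>e\<close> and also of \<open>k\<close> copies of \<open>f\<close>, then \<open>e\<close> and \<open>f\<close>
  are equivalent. This yields (i) for matrix types.

  Conversely, a subgroup \<open>H\<close> is realised by an algebra of families of block diagonal matrices whose
  coordinates are indexed by \<open>H \<times> \<nat>\<close>: at level \<open>i\<close>, the blocks at the coordinate \<open>(h, c)\<close> have size
  \<open>h K\<^sub>i\<close>, where \<open>K\<^sub>i\<close> is the product of the \<open>(l + 3)!\<close> for \<open>l < i\<close>. Its ring of \<open>n \<times> n\<close> matrices is
  the algebra with blocks of size \<open>n h K\<^sub>i\<close>, which up to relabelling the coordinates depends on the
  class of \<open>n\<close> modulo \<open>H\<close> only. To tell the classes apart, every coordinate carries two kinds of
  blocks, refined in such a way that the ordered \<open>K\<^sub>0\<close> group belonging to a coordinate is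
  \<open>\<rat> + \<int>\<theta>\<close> with \<open>\<theta>\<close> irrational and order unit \<open>n h\<close>. Its only order automorphism is the identity.
  An isomorphism between the \<open>n\<close>-th and the \<open>m\<close>-th algebra permutes the coordinates, so it forces
  \<open>n h = m h'\<close> for some \<open>h\<close> and \<open>h'\<close> in \<open>H\<close>.\<close>

text \<open>The arithmetic of \<open>F\<close> enters through freeness of submodules of free
  modules, which gives every idempotent a type; uniqueness of the type is a rank argument without
  division.

  In the converse a single tower of matrix algebras is too symmetric. A limit that absorbs the
  factor 4 absorbs 2 as well, so a group such as the one generated by 4 needs a family of algebras
  permuted by \<open>H\<close>. With one kind of blocks and factorial growth, the ordered group of
  each coordinate would be the rationals, on which every positive rational acts, and the order unit
  could not be recognised. The number \<theta> removes these automorphisms. Factorials make it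
  irrational, and they make every integer divide the block sizes eventually, which is what a
  relabelling of coordinates needs.

  A level has to be a finite product, so only finitely many coordinates have blocks of their own;
  the others wait in one common block.

  Irrationality is used in integer form: a bounded integer sequence in which each term is an
  unbounded factor times the previous one plus a constant is eventually zero.\<close>

section \<open>Idempotents of a given type\<close>

text \<open>Murray-von Neumann equivalence: the right modules \<open>eR\<close> and
  \<open>fR\<close> are isomorphic. The equations force \<open>e\<close> and \<open>f\<close> to be
  idempotent, so later statements need not assume it.\<close>

definition idem_eqv :: "('a, 'm) ring_scheme \<Rightarrow> 'a \<Rightarrow> 'a \<Rightarrow> bool" where
  "idem_eqv R e f \<longleftrightarrow> (\<exists>x\<in>carrier R. \<exists>y\<in>carrier R.
     x \<otimes>\<^bsub>R\<^esub> y = e \<and> y \<otimes>\<^bsub>R\<^esub> x = f \<and> e \<otimes>\<^bsub>R\<^esub> x = x \<and> x \<otimes>\<^bsub>R\<^esub> f = x \<and>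
     f \<otimes>\<^bsub>R\<^esub> y = y \<and> y \<otimes>\<^bsub>R\<^esub> e = y)"

text \<open>\<open>f\<close> is an orthogonal sum of idempotents equivalent to the \<open>p t\<close>, where \<open>t\<close> runs through the multiset.\<close>
inductive has_type :: "('a, 'm) ring_scheme \<Rightarrow> 'i set \<Rightarrow> ('i \<Rightarrow> 'a) \<Rightarrow> 'a \<Rightarrow> 'i multiset \<Rightarrow> bool"
  for R I p where
  zero: "has_type R I p \<zero>\<^bsub>R\<^esub> {#}"
| add: "\<lbrakk>has_type R I p f M; t \<in> I; idem_eqv R g (p t); f \<otimes>\<^bsub>R\<^esub> g = \<zero>\<^bsub>R\<^esub>; g \<otimes>\<^bsub>R\<^esub> f = \<zero>\<^bsub>R\<^esub>\<rbrakk>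
        \<Longrightarrow> has_type R I p (f \<oplus>\<^bsub>R\<^esub> g) (add_mset t M)"

context ring begin

lemma idem_eqvE:
  assumes "idem_eqv R e f"
  obtains x y where "x \<in> carrier R" "y \<in> carrier R" "x \<otimes> y = e" "y \<otimes> x = f"
    "e \<otimes> x = x" "x \<otimes> f = x" "f \<otimes> y = y" "y \<otimes> e = y"
    "e \<in> carrier R" "f \<in> carrier R" "e \<otimes> e = e" "f \<otimes> f = f"
proof -
  obtain x y where xy: "x \<in> carrier R" "y \<in> carrier R" "x \<otimes> y = e" "y \<otimes> x = f"
    "e \<otimes> x = x" "x \<otimes> f = x" "f \<otimes> y = y" "y \<otimes> e = y"
    using assms unfolding idem_eqv_def by blast
  have "e \<in> carrier R" "f \<in> carrier R" using xy by auto
  moreover have "e \<otimes> e = e" using xy by (metis m_assoc m_closed)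
  moreover have "f \<otimes> f = f" using xy by (metis m_assoc m_closed)
  ultimately show thesis using that xy by blast
qed

lemma idem_eqvI:
  assumes "x \<in> carrier R" "y \<in> carrier R" "x \<otimes> y = e" "y \<otimes> x = f"
    "e \<otimes> x = x" "x \<otimes> f = x" "f \<otimes> y = y" "y \<otimes> e = y"
  shows "idem_eqv R e f"
  using assms unfolding idem_eqv_def by blast

lemma idem_eqv_refl: "\<lbrakk>e \<in> carrier R; e \<otimes> e = e\<rbrakk> \<Longrightarrow> idem_eqv R e e"
  by (rule idem_eqvI[of e e]) auto

lemma idem_eqv_sym: "idem_eqv R e f \<Longrightarrow> idem_eqv R f e"
  unfolding idem_eqv_def by blast

lemma cancel_mid:
  assumes "a \<in> carrier R" "b \<in> carrier R" "c \<in> carrier R" "d \<in> carrier R"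
    "b \<otimes> c = e" "a \<otimes> e = a"
  shows "(a \<otimes> b) \<otimes> (c \<otimes> d) = a \<otimes> d"
  using assms by (metis m_assoc m_closed)

lemma idem_eqv_trans:
  assumes "idem_eqv R e f" "idem_eqv R f g"
  shows "idem_eqv R e g"
proof -
  obtain x y where xy: "x \<in> carrier R" "y \<in> carrier R" "x \<otimes> y = e" "y \<otimes> x = f"
    "e \<otimes> x = x" "x \<otimes> f = x" "f \<otimes> y = y" "y \<otimes> e = y"
    "e \<in> carrier R" "f \<in> carrier R" "e \<otimes> e = e" "f \<otimes> f = f"
    using idem_eqvE[OF assms(1)] by blast
  obtain u v where uv: "u \<in> carrier R" "v \<in> carrier R" "u \<otimes> v = f" "v \<otimes> u = g"
    "f \<otimes> u = u" "u \<otimes> g = u" "g \<otimes> v = v" "v \<otimes> f = v"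
    "f \<in> carrier R" "g \<in> carrier R" "f \<otimes> f = f" "g \<otimes> g = g"
    using idem_eqvE[OF assms(2)] by blast
  show ?thesis
  proof (rule idem_eqvI[of "x \<otimes> u" "v \<otimes> y"])
    show "x \<otimes> u \<otimes> (v \<otimes> y) = e" using xy uv by (metis cancel_mid)
    show "v \<otimes> y \<otimes> (x \<otimes> u) = g" using xy uv by (metis cancel_mid)
    show "e \<otimes> (x \<otimes> u) = x \<otimes> u" using xy uv by (metis m_assoc)
    show "x \<otimes> u \<otimes> g = x \<otimes> u" using xy uv by (metis m_assoc)
    show "g \<otimes> (v \<otimes> y) = v \<otimes> y" using xy uv by (metis m_assoc)
    show "v \<otimes> y \<otimes> e = v \<otimes> y" using xy uv by (metis m_assoc)
  qed (use xy uv in auto)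
qed

lemma zero_eqv_zero: "idem_eqv R \<zero> \<zero>"
  by (rule idem_eqv_refl) auto

lemma orth_prod:
  assumes "a \<in> carrier R" "b \<in> carrier R" "e \<in> carrier R" "f \<in> carrier R"
    "a \<otimes> e = a" "f \<otimes> b = b" "e \<otimes> f = \<zero>"
  shows "a \<otimes> b = \<zero>"
proof -
  have "a \<otimes> b = (a \<otimes> e) \<otimes> (f \<otimes> b)" using assms by simp
  also have "\<dots> = a \<otimes> ((e \<otimes> f) \<otimes> b)" using assms(1-4) by (simp add: m_assoc)
  finally show ?thesis using assms by simp
qed

lemma sum_idem:
  assumes "e \<in> carrier R" "f \<in> carrier R" "e \<otimes> e = e" "f \<otimes> f = f" "e \<otimes> f = \<zero>" "f \<otimes> e = \<zero>"
  shows "(e \<oplus> f) \<otimes> (e \<oplus> f) = e \<oplus> f"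
  using assms by (simp add: l_distr r_distr)

lemma idem_eqv_add:
  assumes "idem_eqv R e e'" "idem_eqv R f f'" "e \<otimes> f = \<zero>" "f \<otimes> e = \<zero>" "e' \<otimes> f' = \<zero>" "f' \<otimes> e' = \<zero>"
  shows "idem_eqv R (e \<oplus> f) (e' \<oplus> f')"
proof -
  obtain x y where xy: "x \<in> carrier R" "y \<in> carrier R" "x \<otimes> y = e" "y \<otimes> x = e'"
    "e \<otimes> x = x" "x \<otimes> e' = x" "e' \<otimes> y = y" "y \<otimes> e = y"
    "e \<in> carrier R" "e' \<in> carrier R" "e \<otimes> e = e" "e' \<otimes> e' = e'"
    using idem_eqvE[OF assms(1)] by blast
  obtain u v where uv: "u \<in> carrier R" "v \<in> carrier R" "u \<otimes> v = f" "v \<otimes> u = f'"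
    "f \<otimes> u = u" "u \<otimes> f' = u" "f' \<otimes> v = v" "v \<otimes> f = v"
    "f \<in> carrier R" "f' \<in> carrier R" "f \<otimes> f = f" "f' \<otimes> f' = f'"
    using idem_eqvE[OF assms(2)] by blast
  have z: "x \<otimes> v = \<zero>" "u \<otimes> y = \<zero>" "y \<otimes> u = \<zero>" "v \<otimes> x = \<zero>"
    using orth_prod[of x v e' f'] orth_prod[of u y f' e'] orth_prod[of y u e f] orth_prod[of v x f e] xy uv assms
    by auto
  have z2: "e \<otimes> u = \<zero>" "f \<otimes> x = \<zero>" "x \<otimes> f' = \<zero>" "u \<otimes> e' = \<zero>"
    "e' \<otimes> v = \<zero>" "f' \<otimes> y = \<zero>" "y \<otimes> f = \<zero>" "v \<otimes> e = \<zero>"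
    using orth_prod[of e u e f] orth_prod[of f x f e] orth_prod[of x f' e' f'] orth_prod[of u e' f' e'] 
      orth_prod[of e' v e' f'] orth_prod[of f' y f' e'] orth_prod[of y f e f] orth_prod[of v e f e] xy uv assms
    by auto
  show ?thesis
    by (rule idem_eqvI[of "x \<oplus> u" "y \<oplus> v"]) (simp_all add: l_distr r_distr xy uv z z2)
qed

lemma has_type_idem:
  assumes "has_type R I p f M"
  shows "f \<in> carrier R \<and> f \<otimes> f = f"
  using assms
proof induction
  case (add f M t g)
  then show ?case by (metis idem_eqvE sum_idem a_closed)
qed auto

lemma has_type_subset:
  assumes "has_type R I p f M"
  shows "set_mset M \<subseteq> I"
  using assms by induction auto

text \<open>Multiplying by \<open>f\<close> cuts the sum down to one summand:
  \<open>f \<otimes> h\<close> equals \<open>f \<otimes> ((f \<oplus> g) \<otimes> h)\<close>, and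
  similarly on the other side and for \<open>g\<close>.\<close>

lemma orth_summand:
  assumes "f \<in> carrier R" "g \<in> carrier R" "h \<in> carrier R" "f \<otimes> f = f" "g \<otimes> g = g"
    "f \<otimes> g = \<zero>" "g \<otimes> f = \<zero>" "(f \<oplus> g) \<otimes> h = \<zero>" "h \<otimes> (f \<oplus> g) = \<zero>"
  shows "f \<otimes> h = \<zero>" "h \<otimes> f = \<zero>" "g \<otimes> h = \<zero>" "h \<otimes> g = \<zero>"
proof -
  have "f \<otimes> h = f \<otimes> ((f \<oplus> g) \<otimes> h)" "g \<otimes> h = g \<otimes> ((f \<oplus> g) \<otimes> h)"
    "h \<otimes> f = (h \<otimes> (f \<oplus> g)) \<otimes> f" "h \<otimes> g = (h \<otimes> (f \<oplus> g)) \<otimes> g"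
    using assms(1-7) by (simp_all add: m_assoc[symmetric] r_distr) (simp_all add: m_assoc l_distr)
  then show "f \<otimes> h = \<zero>" "h \<otimes> f = \<zero>" "g \<otimes> h = \<zero>" "h \<otimes> g = \<zero>" using assms by auto
qed

text \<open>The inductive definition exposes only the summand added last. Orthogonal summands may be
  reordered, so any label of the multiset can be brought to the end.\<close>

lemma has_type_extract:
  assumes "has_type R I p f N" "N = add_mset t M"
  shows "\<exists>f' g. f = f' \<oplus> g \<and> has_type R I p f' M \<and> t \<in> I \<and> idem_eqv R g (p t) \<and> f' \<otimes> g = \<zero> \<and> g \<otimes> f' = \<zero>"
  using assms
proof (induction arbitrary: M)
  case zero
  then show ?case by simp
next
  case (add f N s h)
  show ?case
  proof (cases "s = t")
    case True
    then show ?thesis using add by auto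
  next
    case False
    then obtain K where K: "N = add_mset t K" "M = add_mset s K"
      using add.prems by (metis add_eq_conv_ex)
    then obtain f' g where fg: "f = f' \<oplus> g" "has_type R I p f' K" "t \<in> I" "idem_eqv R g (p t)"
      "f' \<otimes> g = \<zero>" "g \<otimes> f' = \<zero>" using add.IH[of K] by blast
    have c: "f' \<in> carrier R" "f' \<otimes> f' = f'" using has_type_idem[OF fg(2)] by auto
    have g: "g \<in> carrier R" "g \<otimes> g = g" using idem_eqvE[OF fg(4)] by metis+
    have h: "h \<in> carrier R" "h \<otimes> h = h" using idem_eqvE[OF add.hyps(3)] by metis+
    have o: "f' \<otimes> h = \<zero>" "h \<otimes> f' = \<zero>" "g \<otimes> h = \<zero>" "h \<otimes> g = \<zero>"
      using orth_summand[of f' g h] c g h fg add.hyps by auto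
    have "has_type R I p (f' \<oplus> h) M"
      using has_type.add[OF fg(2) add.hyps(2,3)] o K by simp
    moreover have "f \<oplus> h = (f' \<oplus> h) \<oplus> g" using fg c g h by (simp add: a_ac)
    moreover have "(f' \<oplus> h) \<otimes> g = \<zero>" "g \<otimes> (f' \<oplus> h) = \<zero>"
      using c g h fg o by (simp_all add: l_distr r_distr)
    ultimately show ?thesis using fg by blast
  qed
qed

lemma has_type_empty:
  assumes "has_type R I p f {#}"
  shows "f = \<zero>"
  using assms by (cases rule: has_type.cases) auto

text \<open>That \<open>x \<otimes> y\<close> acts as an identity on \<open>f\<close> passes to the
  orthogonal summands of \<open>f\<close>, which the stronger equation
  \<open>x \<otimes> y = f\<close> would not; hence this form for the induction.\<close>

lemma conj_type:
  assumes "has_type R I p f M" "x \<in> carrier R" "y \<in> carrier R" "f \<otimes> (x \<otimes> y) = f" "(x \<otimes> y) \<otimes> f = f"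
  shows "has_type R I p (y \<otimes> f \<otimes> x) M"
  using assms
proof induction
  case zero
  then show ?case by (auto intro: has_type.zero)
next
  case (add f M t g)
  have f: "f \<in> carrier R" "f \<otimes> f = f" using has_type_idem add by auto
  have g: "g \<in> carrier R" "g \<otimes> g = g" using idem_eqvE[OF add.hyps(3)] by metis+
  let ?s = "x \<otimes> y"
  have s: "?s \<in> carrier R" using add by auto
  have f1: "f = f \<otimes> (f \<oplus> g)" "f = (f \<oplus> g) \<otimes> f" "g = g \<otimes> (f \<oplus> g)" "g = (f \<oplus> g) \<otimes> g"
    using f g add.hyps by (auto simp: l_distr r_distr)
  have fs: "f \<otimes> ?s = f" "?s \<otimes> f = f" "g \<otimes> ?s = g" "?s \<otimes> g = g"
    using f1 f g s add.prems(3,4) by (metis a_closed m_assoc)+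
  have 1: "has_type R I p (y \<otimes> f \<otimes> x) M" using add.IH fs add.prems by auto
  have "idem_eqv R (y \<otimes> g \<otimes> x) g"
  proof (rule idem_eqvI[of "y \<otimes> g" "g \<otimes> x"])
    have 2: "g \<otimes> x \<otimes> (y \<otimes> g) = g"
      using fs g add.prems by (metis m_assoc m_closed)
    show "y \<otimes> g \<otimes> (g \<otimes> x) = y \<otimes> g \<otimes> x" using g add.prems by (metis m_assoc m_closed)
    show "g \<otimes> x \<otimes> (y \<otimes> g) = g" by fact
    show "y \<otimes> g \<otimes> x \<otimes> (y \<otimes> g) = y \<otimes> g" using 2 g add.prems by (metis m_assoc m_closed)
    show "g \<otimes> x \<otimes> (y \<otimes> g \<otimes> x) = g \<otimes> x" using 2 g add.prems by (metis m_assoc m_closed)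
    show "y \<otimes> g \<otimes> g = y \<otimes> g" using g add.prems by (metis m_assoc)
    show "g \<otimes> (g \<otimes> x) = g \<otimes> x" using g add.prems by (metis m_assoc)
  qed (use g add in auto)
  then have 2: "idem_eqv R (y \<otimes> g \<otimes> x) (p t)" using add idem_eqv_trans by blast
  have "(y \<otimes> f \<otimes> x) \<otimes> (y \<otimes> g \<otimes> x) = y \<otimes> ((f \<otimes> ?s) \<otimes> g) \<otimes> x"
    using f g add.prems by (simp add: m_assoc)
  also have "\<dots> = \<zero>" using fs add by simp
  finally have 3: "(y \<otimes> f \<otimes> x) \<otimes> (y \<otimes> g \<otimes> x) = \<zero>" .
  have "(y \<otimes> g \<otimes> x) \<otimes> (y \<otimes> f \<otimes> x) = y \<otimes> ((g \<otimes> ?s) \<otimes> f) \<otimes> x"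
    using f g add.prems by (simp add: m_assoc)
  also have "\<dots> = \<zero>" using fs add by simp
  finally have 4: "(y \<otimes> g \<otimes> x) \<otimes> (y \<otimes> f \<otimes> x) = \<zero>" .
  have "y \<otimes> (f \<oplus> g) \<otimes> x = (y \<otimes> f \<otimes> x) \<oplus> (y \<otimes> g \<otimes> x)"
    using f g add.prems by (simp add: l_distr r_distr)
  then show ?case using has_type.add[OF 1 add.hyps(2) 2 3 4] by simp
qed

lemma has_type_eqv:
  assumes "has_type R I p f M" "idem_eqv R f f'"
  shows "has_type R I p f' M"
proof -
  obtain x y where xy: "x \<in> carrier R" "y \<in> carrier R" "x \<otimes> y = f" "y \<otimes> x = f'"
    "f \<otimes> x = x" "x \<otimes> f' = x" "f' \<otimes> y = y" "y \<otimes> f = y"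
    "f \<in> carrier R" "f' \<in> carrier R" "f \<otimes> f = f" "f' \<otimes> f' = f'"
    using idem_eqvE[OF assms(2)] by blast
  then show ?thesis using conj_type[OF assms(1), of x y] by simp
qed

lemma has_type_single:
  assumes "t \<in> I" "idem_eqv R g (p t)"
  shows "has_type R I p g {#t#}"
proof -
  have "g \<in> carrier R" using idem_eqvE[OF assms(2)] by metis
  then show ?thesis using has_type.add[where p = p, OF has_type.zero assms] by simp
qed

lemma has_type_sum:
  assumes "has_type R I p g N" "has_type R I p f M" "f \<otimes> g = \<zero>" "g \<otimes> f = \<zero>"
  shows "has_type R I p (f \<oplus> g) (M + N)"
  using assms
proof induction
  case zero
  then show ?case using has_type_idem[OF zero.prems(1)] by auto
next
  case (add g N t h)
  have f: "f \<in> carrier R" "f \<otimes> f = f" using has_type_idem add by auto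
  have g: "g \<in> carrier R" "g \<otimes> g = g" using has_type_idem add by auto
  have h: "h \<in> carrier R" "h \<otimes> h = h" using idem_eqvE[OF add.hyps(3)] by metis+
  have o: "g \<otimes> f = \<zero>" "f \<otimes> g = \<zero>" "h \<otimes> f = \<zero>" "f \<otimes> h = \<zero>"
    using orth_summand[of g h f] f g h add by auto
  have 1: "has_type R I p (f \<oplus> g) (M + N)" using add o by auto
  have "(f \<oplus> g) \<otimes> h = \<zero>" "h \<otimes> (f \<oplus> g) = \<zero>"
    using f g h o add by (simp_all add: l_distr r_distr)
  from has_type.add[OF 1 add.hyps(2,3) this] show ?case using f g h by (simp add: a_assoc)
qed

text \<open>Summands with equal labels are matched one by one, and equivalences between orthogonal
  summands add up.\<close>

lemma same_type_eqv:
  assumes "has_type R I p f M" "has_type R I p f' M"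
  shows "idem_eqv R f f'"
  using assms
proof (induction arbitrary: f')
  case zero
  then show ?case using has_type_empty[OF zero] zero_eqv_zero by simp
next
  case (add f M t g)
  obtain f1 g1 where 1: "f' = f1 \<oplus> g1" "has_type R I p f1 M" "idem_eqv R g1 (p t)" "f1 \<otimes> g1 = \<zero>" "g1 \<otimes> f1 = \<zero>"
    using has_type_extract[OF add.prems refl] by blast
  have 2: "idem_eqv R g g1" using idem_eqv_trans[OF add.hyps(3) idem_eqv_sym[OF 1(3)]] .
  show ?case unfolding 1(1) by (rule idem_eqv_add[OF add.IH[OF 1(2)] 2]) (use 1 add.hyps in auto)
qed

text \<open>Substitution of decompositions, the multiset form of multiplying the multiplicity
  matrices of a Bratteli diagram.\<close>

lemma has_type_comp:
  assumes "has_type R J q f M" "\<And>s. s \<in> J \<Longrightarrow> has_type R I p (q s) (N s)"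
  shows "has_type R I p f (\<Sum>s\<in>#M. N s)"
  using assms
proof induction
  case zero
  then show ?case by (simp add: has_type.zero)
next
  case (add f M s g)
  have "has_type R I p g (N s)" using add has_type_eqv idem_eqv_sym by metis
  from has_type_sum[OF this add.IH[OF add.prems] add.hyps(4,5)] show ?case by (simp add: union_commute)
qed

end

lemma idem_eqv_hom:
  assumes "idem_eqv R e f"
    "\<And>x. x \<in> carrier R \<Longrightarrow> \<phi> x \<in> carrier S"
    "\<And>x y. x \<in> carrier R \<Longrightarrow> y \<in> carrier R \<Longrightarrow> \<phi> (x \<otimes>\<^bsub>R\<^esub> y) = \<phi> x \<otimes>\<^bsub>S\<^esub> \<phi> y"
    "e \<in> carrier R" "f \<in> carrier R"
  shows "idem_eqv S (\<phi> e) (\<phi> f)"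
  using assms(1) unfolding idem_eqv_def by (metis assms(2-))

text \<open>The map is not asked to preserve the unit, because the lemma is applied to corner
  embeddings into matrix rings and to maps followed by multiplication with a central
  idempotent.\<close>

lemma has_type_hom:
  assumes "has_type R I p f M" "ring R"
    "\<And>x. x \<in> carrier R \<Longrightarrow> \<phi> x \<in> carrier S"
    "\<And>x y. x \<in> carrier R \<Longrightarrow> y \<in> carrier R \<Longrightarrow> \<phi> (x \<otimes>\<^bsub>R\<^esub> y) = \<phi> x \<otimes>\<^bsub>S\<^esub> \<phi> y"
    "\<And>x y. x \<in> carrier R \<Longrightarrow> y \<in> carrier R \<Longrightarrow> \<phi> (x \<oplus>\<^bsub>R\<^esub> y) = \<phi> x \<oplus>\<^bsub>S\<^esub> \<phi> y"
    "\<phi> \<zero>\<^bsub>R\<^esub> = \<zero>\<^bsub>S\<^esub>"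
  shows "has_type S I (\<lambda>i. \<phi> (p i)) (\<phi> f) M"
  using assms(1)
proof induction
  case zero
  then show ?case using assms by (simp add: has_type.zero)
next
  case (add f M t g)
  have c: "f \<in> carrier R" "g \<in> carrier R" "p t \<in> carrier R"
    using ring.has_type_idem[OF assms(2)] ring.idem_eqvE[OF assms(2)] add by metis+
  have 1: "idem_eqv S (\<phi> g) (\<phi> (p t))" by (rule idem_eqv_hom[OF add.hyps(3)]) (use assms c in auto)
  have 2: "\<phi> f \<otimes>\<^bsub>S\<^esub> \<phi> g = \<zero>\<^bsub>S\<^esub>" "\<phi> g \<otimes>\<^bsub>S\<^esub> \<phi> f = \<zero>\<^bsub>S\<^esub>"
    using assms(4)[OF c(1,2)] assms(4)[OF c(2,1)] add.hyps(4,5) assms(6) by simp_all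
  show ?case using has_type.add[OF add.IH add.hyps(2) 1 2] assms(5)[OF c(1,2)] by simp
qed

section \<open>Matricial frames\<close>

text \<open>The properties of a system of minimal idempotents, one for each factor, of a finite product of
  matrix rings over principal ideal domains; \<open>p_central\<close> says that the corners consist of scalars.\<close>
locale matricial_frame = ring +
  fixes I :: "'i set" and p :: "'i \<Rightarrow> 'a"
  assumes p_closed: "t \<in> I \<Longrightarrow> p t \<in> carrier R"
    and p_idem: "t \<in> I \<Longrightarrow> p t \<otimes> p t = p t"
    and p_nonzero: "t \<in> I \<Longrightarrow> p t \<noteq> \<zero>"
    and p_orth: "\<lbrakk>s \<in> I; t \<in> I; s \<noteq> t; x \<in> carrier R\<rbrakk> \<Longrightarrow> p s \<otimes> x \<otimes> p t = \<zero>"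
    and p_central: "\<lbrakk>t \<in> I; x \<in> carrier R\<rbrakk> \<Longrightarrow>
      \<exists>z\<in>carrier R. (\<forall>b\<in>carrier R. z \<otimes> b = b \<otimes> z) \<and> p t \<otimes> x \<otimes> p t = z \<otimes> p t"
    and p_domain: "\<lbrakk>t \<in> I; c \<in> carrier R; d \<in> carrier R; p t \<otimes> c = c; c \<otimes> p t = c; p t \<otimes> d = d;
      d \<otimes> p t = d; c \<otimes> d = \<zero>\<rbrakk> \<Longrightarrow> c = \<zero> \<or> d = \<zero>"
    and p_principal: "\<lbrakk>t \<in> I; J \<subseteq> carrier R; \<zero> \<in> J; \<And>x. x \<in> J \<Longrightarrow> p t \<otimes> x = x \<and> x \<otimes> p t = x;
      \<And>x y. \<lbrakk>x \<in> J; y \<in> J\<rbrakk> \<Longrightarrow> x \<oplus> y \<in> J; \<And>x b. \<lbrakk>x \<in> J; b \<in> carrier R\<rbrakk> \<Longrightarrow> x \<otimes> b \<otimes> p t \<in> J\<rbrakk> \<Longrightarrow>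
      \<exists>a\<in>J. \<forall>x\<in>J. \<exists>b\<in>carrier R. p t \<otimes> b = b \<and> b \<otimes> p t = b \<and> x = a \<otimes> b"
    and one_type: "\<exists>M. has_type R I p \<one> M"
begin

text \<open>Here \<open>u\<close> is a row with the corner elements
  \<open>u \<otimes> b \<otimes> p t\<close> as entries: if \<open>a\<close> divides every entry on
  the left, it divides the whole row. The induction adds the columns one at a time. A column of
  label \<open>s\<close> other than \<open>t\<close> contributes nothing by
  \<open>p_orth\<close>.\<close>

lemma factor_row:
  assumes "has_type R I p g N" "t \<in> I" "a \<in> carrier R" "u \<in> carrier R" "p t \<otimes> u = u" "u \<otimes> g = u"
    "\<And>b. b \<in> carrier R \<Longrightarrow> \<exists>d\<in>carrier R. p t \<otimes> d = d \<and> u \<otimes> b \<otimes> p t = a \<otimes> d"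
  shows "\<exists>w\<in>carrier R. p t \<otimes> w = w \<and> w \<otimes> g = w \<and> u = a \<otimes> w"
  using assms
proof (induction arbitrary: u)
  case zero
  then show ?case by (metis r_null zero_closed p_closed)
next
  case (add g N s h)
  have g: "g \<in> carrier R" "g \<otimes> g = g" using has_type_idem add by auto
  obtain x y where xy: "x \<in> carrier R" "y \<in> carrier R" "x \<otimes> y = h" "y \<otimes> x = p s"
    "h \<otimes> x = x" "x \<otimes> p s = x" "p s \<otimes> y = y" "y \<otimes> h = y"
    "h \<in> carrier R" "p s \<in> carrier R" "h \<otimes> h = h" "p s \<otimes> p s = p s"
    using idem_eqvE[OF add.hyps(3)] by blast
  note pt = p_closed[OF \<open>t \<in> I\<close>]
  have u: "u \<in> carrier R" "p t \<otimes> u = u" "u = u \<otimes> g \<oplus> u \<otimes> h"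
    using add.prems(3-5) g xy by (auto simp: r_distr)
  have "\<exists>w\<in>carrier R. p t \<otimes> w = w \<and> w \<otimes> g = w \<and> u \<otimes> g = a \<otimes> w"
  proof (rule add.IH)
    show "p t \<otimes> (u \<otimes> g) = u \<otimes> g" using u(1,2) g pt by (simp add: m_assoc[symmetric])
    show "\<exists>d\<in>carrier R. p t \<otimes> d = d \<and> u \<otimes> g \<otimes> b \<otimes> p t = a \<otimes> d" if "b \<in> carrier R" for b
      using add.prems(6)[of "g \<otimes> b"] that u(1) g by (simp add: m_assoc)
    show "u \<otimes> g \<otimes> g = u \<otimes> g" using u(1) g by (simp add: m_assoc)
  qed (use add.prems u g in auto)
  then obtain w where w: "w \<in> carrier R" "p t \<otimes> w = w" "w \<otimes> g = w" "u \<otimes> g = a \<otimes> w" by blast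
  have wh: "w \<otimes> h = \<zero>" using orth_prod[of w h g h] w xy g add.hyps by auto
  show ?case
  proof (cases "s = t")
    case True
    obtain d where d: "d \<in> carrier R" "p t \<otimes> d = d" "u \<otimes> x \<otimes> p t = a \<otimes> d"
      using add.prems(6)[OF xy(1)] by blast
    \<comment> \<open>The entry of the row in the new column \<open>h\<close>, moved into the corner
      of \<open>p t\<close> by the equivalence \<open>x\<close>.\<close>
    have ux: "u \<otimes> x = a \<otimes> d" using d xy True u(1) pt by (simp add: m_assoc)
    have "u \<otimes> h = (u \<otimes> x) \<otimes> y" using xy(1,2,3) u(1) by (simp add: m_assoc[symmetric] flip: xy(3))
    then have uh: "u \<otimes> h = a \<otimes> (d \<otimes> y)" using ux d xy add.prems by (simp add: m_assoc)
    have yg: "y \<otimes> g = \<zero>" using orth_prod[of y g h g] xy g add.hyps by auto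
    have dg: "d \<otimes> y \<otimes> g = \<zero>" "d \<otimes> y \<otimes> h = d \<otimes> y" using d xy g yg by (simp_all add: m_assoc)
    have "u = a \<otimes> (w \<oplus> d \<otimes> y)" using u uh w d xy add.prems by (simp add: r_distr)
    moreover have "p t \<otimes> (w \<oplus> d \<otimes> y) = w \<oplus> d \<otimes> y"
      using w d xy pt by (simp add: r_distr m_assoc[symmetric])
    moreover have "(w \<oplus> d \<otimes> y) \<otimes> (g \<oplus> h) = w \<oplus> d \<otimes> y"
      using w d xy g wh dg by (simp add: r_distr l_distr)
    ultimately show ?thesis using w d xy by blast
  next
    case False
    have "u \<otimes> h = (p t \<otimes> (u \<otimes> x) \<otimes> p s) \<otimes> y"
    proof -
      have "(p t \<otimes> (u \<otimes> x) \<otimes> p s) \<otimes> y = (p t \<otimes> u) \<otimes> (x \<otimes> (p s \<otimes> y))"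
        using u(1) xy(1,2) xy(10) pt by (simp add: m_assoc)
      then show ?thesis using u(2) xy by simp
    qed
    then have uh: "u \<otimes> h = \<zero>" using p_orth[of t s "u \<otimes> x"] False add.hyps add.prems xy u(1) by simp
    have "u = a \<otimes> w" using u(3) uh w add.prems by simp
    moreover have "w \<otimes> (g \<oplus> h) = w" using w g xy wh by (simp add: r_distr)
    ultimately show ?thesis using w by blast
  qed
qed

lemma row_zero:
  assumes "has_type R I p g N" "t \<in> I" "u \<in> carrier R" "p t \<otimes> u = u" "u \<otimes> g = u"
    "\<And>b. b \<in> carrier R \<Longrightarrow> u \<otimes> b \<otimes> p t = \<zero>"
  shows "u = \<zero>"
proof -
  have "\<exists>w\<in>carrier R. p t \<otimes> w = w \<and> w \<otimes> g = w \<and> u = \<zero> \<otimes> w"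
  proof (rule factor_row[OF assms(1,2) zero_closed assms(3-5)])
    show "\<exists>d\<in>carrier R. p t \<otimes> d = d \<and> u \<otimes> b \<otimes> p t = \<zero> \<otimes> d" if "b \<in> carrier R" for b
      using assms(6)[OF that] p_closed[OF assms(2)] by (intro bexI[of _ \<zero>]) auto
  qed
  then show ?thesis by auto
qed

text \<open>The left-right dual of \<open>row_zero\<close>: a column all of whose corner entries
  vanish is zero.\<close>

lemma column_zero:
  assumes "has_type R I p k N" "t \<in> I" "v \<in> carrier R" "v \<otimes> p t = v" "k \<otimes> v = v"
    "\<And>b. b \<in> carrier R \<Longrightarrow> p t \<otimes> b \<otimes> v = \<zero>"
  shows "v = \<zero>"
  using assms
proof (induction arbitrary: v)
  case zero
  then show ?case by simp
next
  case (add k N s h)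
  have k: "k \<in> carrier R" "k \<otimes> k = k" using has_type_idem add by auto
  obtain x y where xy: "x \<in> carrier R" "y \<in> carrier R" "x \<otimes> y = h" "y \<otimes> x = p s"
    "h \<otimes> x = x" "x \<otimes> p s = x" "p s \<otimes> y = y" "y \<otimes> h = y"
    "h \<in> carrier R" "p s \<in> carrier R" "h \<otimes> h = h" "p s \<otimes> p s = p s"
    using idem_eqvE[OF add.hyps(3)] by blast
  note pt = p_closed[OF \<open>t \<in> I\<close>]
  note v = \<open>v \<in> carrier R\<close> \<open>v \<otimes> p t = v\<close>
  have "k \<otimes> v = \<zero>"
  proof (rule add.IH)
    show "k \<otimes> v \<otimes> p t = k \<otimes> v" using v k pt by (simp add: m_assoc)
    show "k \<otimes> (k \<otimes> v) = k \<otimes> v" using v k by (simp add: m_assoc[symmetric])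
    show "p t \<otimes> b \<otimes> (k \<otimes> v) = \<zero>" if "b \<in> carrier R" for b
      using add.prems(5)[of "b \<otimes> k"] v k pt that by (simp add: m_assoc)
  qed (use add v k in auto)
  moreover have "h \<otimes> v = \<zero>"
  proof -
    have "y \<otimes> v = \<zero>"
    proof (cases "s = t")
      case True
      then show ?thesis using add.prems(5)[OF xy(2)] xy by simp
    next
      case False
      have "y \<otimes> v = p s \<otimes> (y \<otimes> v) \<otimes> p t" using xy v pt by (simp add: m_assoc) (simp add: m_assoc[symmetric])
      also have "\<dots> = \<zero>" using p_orth[of s t "y \<otimes> v"] False add.hyps add.prems xy v by simp
      finally show ?thesis .
    qed
    then show ?thesis using xy(1,2) v(1) unfolding xy(3)[symmetric] by (simp add: m_assoc)
  qed
  moreover have "v = k \<otimes> v \<oplus> h \<otimes> v" using add.prems(4) k xy v by (simp add: l_distr)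
  ultimately show ?case by simp
qed

lemma typed_below:
  assumes "has_type R I p g N" "f \<in> carrier R" "f \<otimes> f = f" "g \<otimes> f = f" "f \<otimes> g = f"
  shows "\<exists>M. has_type R I p f M"
  using assms
proof (induction arbitrary: f)
  case zero
  then show ?case by (metis l_null has_type.zero)
next
  case (add g N t h)
  have g: "g \<in> carrier R" "g \<otimes> g = g" using has_type_idem add by auto
  have G: "has_type R I p (g \<oplus> h) (add_mset t N)" using has_type.add add.hyps by metis
  obtain x y where xy: "x \<in> carrier R" "y \<in> carrier R" "x \<otimes> y = h" "y \<otimes> x = p t"
    "h \<otimes> x = x" "x \<otimes> p t = x" "p t \<otimes> y = y" "y \<otimes> h = y"
    "h \<in> carrier R" "p t \<in> carrier R" "h \<otimes> h = h" "p t \<otimes> p t = p t"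
    using idem_eqvE[OF add.hyps(3)] by blast
  \<comment> \<open>If \<open>h \<otimes> f\<close> vanishes, \<open>f\<close> need not lie below
    \<open>g\<close>, since \<open>f \<otimes> h\<close> may survive. But
    \<open>f \<otimes> g\<close> is an idempotent below \<open>g\<close> that is equivalent to
    \<open>f\<close>.\<close>
  have caseA: "\<exists>M. has_type R I p f M"
    if f: "f \<in> carrier R" "f \<otimes> f = f" "(g \<oplus> h) \<otimes> f = f" "f \<otimes> (g \<oplus> h) = f" and hf: "h \<otimes> f = \<zero>" for f
  proof -
    have gf: "g \<otimes> f = f" using f(1,3) g xy(9) hf by (simp add: l_distr)
    let ?f' = "f \<otimes> g"
    have 1: "?f' \<otimes> f = f" using f g gf by (simp add: m_assoc)
    have 2: "f \<otimes> ?f' = ?f'" using f(1,2) g by (simp add: m_assoc[symmetric])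
    have 3: "?f' \<otimes> ?f' = ?f'" using 1 f(1) g by (simp add: m_assoc[symmetric])
    have 4: "g \<otimes> ?f' = ?f'" using f(1) g gf by (simp add: m_assoc[symmetric])
    have 5: "?f' \<otimes> g = ?f'" using f(1) g by (simp add: m_assoc)
    obtain M where M: "has_type R I p ?f' M" using add.IH[of ?f'] 3 4 5 f(1) g by auto
    have "idem_eqv R ?f' f"
      by (rule idem_eqvI[of f ?f']) (use 1 2 3 f g in auto)
    then show ?thesis using has_type_eqv[OF M] by blast
  qed
  note f = add.prems
  \<comment> \<open>The entries of the \<open>h\<close>-row of \<open>f\<close>, read in the corner
    of \<open>p t\<close>.\<close>
  define J where "J = (\<lambda>b. y \<otimes> f \<otimes> b \<otimes> p t) ` carrier R"
  have J: "z \<in> J \<longleftrightarrow> (\<exists>b\<in>carrier R. z = y \<otimes> f \<otimes> b \<otimes> p t)" for z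
    unfolding J_def by auto
  have J1: "J \<subseteq> carrier R" using xy(2,10) f(1) unfolding J_def by auto
  have 0: "y \<otimes> f \<otimes> \<zero> \<otimes> p t = \<zero>" using xy(2,10) f(1) by simp
  have J2: "\<zero> \<in> J" unfolding J_def by (rule image_eqI[where x = \<zero>], rule 0[symmetric], rule zero_closed)
  have J3: "p t \<otimes> z = z \<and> z \<otimes> p t = z" if zJ: "z \<in> J" for z
  proof -
    obtain b where b: "b \<in> carrier R" "z = y \<otimes> f \<otimes> b \<otimes> p t" using zJ[unfolded J] by blast
    have "z = y \<otimes> (f \<otimes> b \<otimes> p t)" using b f xy by (simp add: m_assoc)
    moreover have "p t \<otimes> (y \<otimes> (f \<otimes> b \<otimes> p t)) = (p t \<otimes> y) \<otimes> (f \<otimes> b \<otimes> p t)"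
      using b(1) f(1) xy(2,10) by (simp add: m_assoc)
    ultimately have "p t \<otimes> z = z" using xy(7) by simp
    moreover have "z \<otimes> p t = z" using b f xy by (simp add: m_assoc)
    ultimately show ?thesis by simp
  qed
  have J4: "z \<oplus> z' \<in> J" if z: "z \<in> J" "z' \<in> J" for z z'
  proof -
    obtain b b' where b: "b \<in> carrier R" "z = y \<otimes> f \<otimes> b \<otimes> p t" "b' \<in> carrier R" "z' = y \<otimes> f \<otimes> b' \<otimes> p t"
      using z[unfolded J] by blast
    then have "z \<oplus> z' = y \<otimes> f \<otimes> (b \<oplus> b') \<otimes> p t" using f xy by (simp add: r_distr l_distr)
    then show ?thesis unfolding J by (rule bexI) (use b in simp)
  qed
  have J5: "z \<otimes> b' \<otimes> p t \<in> J" if z: "z \<in> J" "b' \<in> carrier R" for z b'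
  proof -
    obtain b where b: "b \<in> carrier R" "z = y \<otimes> f \<otimes> b \<otimes> p t" using z(1)[unfolded J] by blast
    then have "z \<otimes> b' \<otimes> p t = y \<otimes> f \<otimes> (b \<otimes> p t \<otimes> b') \<otimes> p t" using f xy z by (simp add: m_assoc)
    then show ?thesis unfolding J by (rule bexI) (use b(1) z(2) xy(10) in simp)
  qed
  have "\<exists>a\<in>J. \<forall>z\<in>J. \<exists>b\<in>carrier R. p t \<otimes> b = b \<and> b \<otimes> p t = b \<and> z = a \<otimes> b"
    by (rule p_principal[OF add.hyps(2) J1 J2 J3 J4 J5])
  then obtain a where aJ: "a \<in> J"
    and a: "\<And>z. z \<in> J \<Longrightarrow> \<exists>b\<in>carrier R. p t \<otimes> b = b \<and> b \<otimes> p t = b \<and> z = a \<otimes> b" by blast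
  obtain b0 where b0: "b0 \<in> carrier R" "a = y \<otimes> f \<otimes> b0 \<otimes> p t" using aJ[unfolded J] by blast
  have ac: "a \<in> carrier R" "p t \<otimes> a = a" "a \<otimes> p t = a"
  proof -
    show "a \<in> carrier R" using b0 f xy by simp
    have "a = y \<otimes> (f \<otimes> b0 \<otimes> p t)" using b0 f xy by (simp add: m_assoc)
    moreover have "p t \<otimes> (y \<otimes> (f \<otimes> b0 \<otimes> p t)) = (p t \<otimes> y) \<otimes> (f \<otimes> b0 \<otimes> p t)"
      using b0(1) f(1) xy(2,10) by (simp add: m_assoc)
    ultimately show "p t \<otimes> a = a" using xy(7) by simp
    show "a \<otimes> p t = a" using b0 f xy by (simp add: m_assoc)
  qed
  have yf: "y \<otimes> f \<in> carrier R" "p t \<otimes> (y \<otimes> f) = y \<otimes> f" "y \<otimes> f \<otimes> (g \<oplus> h) = y \<otimes> f"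
    using f g xy by (simp_all add: m_assoc) (simp add: m_assoc[symmetric])
  show ?case
  proof (cases "a = \<zero>")
    case True
    have "y \<otimes> f = \<zero>"
    proof (rule row_zero[OF G add.hyps(2) yf])
      show "y \<otimes> f \<otimes> b \<otimes> p t = \<zero>" if "b \<in> carrier R" for b
        using a[of "y \<otimes> f \<otimes> b \<otimes> p t"] that True J by auto
    qed
    then have "h \<otimes> f = \<zero>" using xy(1,2) f(1) unfolding xy(3)[symmetric] by (simp add: m_assoc)
    then show ?thesis using caseA f by blast
  next
    case False
    have "\<exists>d\<in>carrier R. p t \<otimes> d = d \<and> y \<otimes> f \<otimes> b \<otimes> p t = a \<otimes> d" if b: "b \<in> carrier R" for b
      using a[of "y \<otimes> f \<otimes> b \<otimes> p t"] b J by blast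
    then obtain w0 where w0: "w0 \<in> carrier R" "p t \<otimes> w0 = w0" "y \<otimes> f = a \<otimes> w0"
      using factor_row[OF G add.hyps(2) ac(1) yf] by blast
    \<comment> \<open>Multiplying by \<open>f\<close> keeps the factorisation of the row and gives
      \<open>w \<otimes> f = w\<close>.\<close>
    define w where "w = w0 \<otimes> f"
    have w: "w \<in> carrier R" "p t \<otimes> w = w" "y \<otimes> f = a \<otimes> w" "w \<otimes> f = w"
    proof -
      show "w \<in> carrier R" using w0 f unfolding w_def by simp
      show "p t \<otimes> w = w" using w0 f xy unfolding w_def by (simp add: m_assoc[symmetric])
      have "a \<otimes> w = (y \<otimes> f) \<otimes> f" using w0 f ac unfolding w_def by (simp add: m_assoc[symmetric])
      then show "y \<otimes> f = a \<otimes> w" using xy f by (simp add: m_assoc)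
      show "w \<otimes> f = w" using w0 f unfolding w_def by (simp add: m_assoc)
    qed
    \<comment> \<open>A column of \<open>f\<close> whose \<open>h\<close>-entry is the generator
      \<open>a\<close>.\<close>
    define z where "z = f \<otimes> b0 \<otimes> p t"
    have z: "z \<in> carrier R" "f \<otimes> z = z" "z \<otimes> p t = z" "y \<otimes> z = a"
      using b0 f xy unfolding z_def by (simp_all add: m_assoc) (simp add: m_assoc[symmetric])
    \<comment> \<open>Both \<open>w \<otimes> z\<close> and \<open>p t\<close> give \<open>a\<close>
      when multiplied by \<open>a\<close> on the left, and the nonzero \<open>a\<close> can be
      cancelled in the corner, a domain.\<close>
    have wz: "w \<otimes> z = p t"
    proof -
      have "a \<otimes> (w \<otimes> z) = (y \<otimes> f) \<otimes> z" using w z ac by (simp add: m_assoc)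
      also have "\<dots> = a" using z xy f by (simp add: m_assoc)
      finally have "a \<otimes> (w \<otimes> z \<ominus> p t) = \<zero>" using w z ac xy by (simp add: a_minus_def r_distr r_minus r_neg)
      moreover have "p t \<otimes> (w \<otimes> z \<ominus> p t) = w \<otimes> z \<ominus> p t"
        using w z xy by (simp add: a_minus_def r_distr r_minus m_assoc[symmetric])
      moreover have "(w \<otimes> z \<ominus> p t) \<otimes> p t = w \<otimes> z \<ominus> p t"
        using w z xy by (simp add: a_minus_def l_distr l_minus m_assoc)
      ultimately have "w \<otimes> z \<ominus> p t = \<zero>"
        using p_domain[OF add.hyps(2) ac(1) _ ac(2,3), of "w \<otimes> z \<ominus> p t"] False w z xy by auto
      then show ?thesis using w z xy by simp
    qed
    let ?f2 = "z \<otimes> w" let ?f1 = "f \<ominus> z \<otimes> w"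
    have f2: "?f2 \<otimes> ?f2 = ?f2" "f \<otimes> ?f2 = ?f2" "?f2 \<otimes> f = ?f2" "?f2 \<otimes> z = z" "w \<otimes> ?f2 = w"
    proof -
      show 1: "?f2 \<otimes> z = z" using w z wz by (simp add: m_assoc)
      show "?f2 \<otimes> ?f2 = ?f2" using w z 1 by (simp add: m_assoc[symmetric])
      show "f \<otimes> ?f2 = ?f2" using f z w by (simp add: m_assoc[symmetric])
      show "?f2 \<otimes> f = ?f2" using f z w by (simp add: m_assoc)
      show "w \<otimes> ?f2 = w" using w z wz by (simp add: m_assoc[symmetric])
    qed
    have f2t: "idem_eqv R ?f2 (p t)"
      by (rule idem_eqvI[of z w]) (use f2 w z wz in auto)
    have f2c: "?f2 \<in> carrier R" "?f1 \<in> carrier R" using w z f by auto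
    have G2: "(g \<oplus> h) \<otimes> ?f2 = ?f2" "?f2 \<otimes> (g \<oplus> h) = ?f2"
    proof -
      have "(g \<oplus> h) \<otimes> (f \<otimes> ?f2) = f \<otimes> ?f2" using f(1,3) f2c g xy(9) by (simp add: m_assoc[symmetric])
      then show "(g \<oplus> h) \<otimes> ?f2 = ?f2" using f2 by simp
      have "(?f2 \<otimes> f) \<otimes> (g \<oplus> h) = ?f2 \<otimes> f" using f(1,4) f2c(1) g xy(9) by (simp add: m_assoc)
      then show "?f2 \<otimes> (g \<oplus> h) = ?f2" using f2 by simp
    qed
    have f1: "?f1 \<otimes> ?f2 = \<zero>" "?f2 \<otimes> ?f1 = \<zero>" "?f1 \<otimes> ?f1 = ?f1" "?f1 \<oplus> ?f2 = f"
    proof -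
      show "?f1 \<otimes> ?f2 = \<zero>" "?f2 \<otimes> ?f1 = \<zero>"
        using f f2 f2c by (simp_all add: a_minus_def l_distr r_distr l_minus r_minus r_neg)
      show "?f1 \<otimes> ?f1 = ?f1"
        using f f2 f2c by (simp add: a_minus_def l_distr r_distr l_minus r_minus r_neg)
      show "?f1 \<oplus> ?f2 = f" using f f2c by (simp add: a_minus_def a_assoc l_neg)
    qed
    \<comment> \<open>The split-off summand \<open>z \<otimes> w\<close> has the same
      \<open>h\<close>-row as \<open>f\<close>, namely \<open>a \<otimes> w\<close>, so the
      remainder has none.\<close>
    have "h \<otimes> ?f1 = \<zero>"
    proof -
      have "h \<otimes> f = x \<otimes> (a \<otimes> w)" using w(3) xy(1,2) f(1) unfolding xy(3)[symmetric] by (simp add: m_assoc)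
      moreover have "h \<otimes> ?f2 = x \<otimes> (y \<otimes> z) \<otimes> w" using xy(1,2) w(1) z(1) unfolding xy(3)[symmetric] by (simp add: m_assoc)
      ultimately show ?thesis using z xy ac w f f2c(1) by (simp add: a_minus_def r_distr r_minus r_neg m_assoc)
    qed
    moreover have "(g \<oplus> h) \<otimes> ?f1 = ?f1" "?f1 \<otimes> (g \<oplus> h) = ?f1"
      using f G2 f2c(1) g xy(9) by (simp_all add: a_minus_def r_minus l_minus r_distr[of f] l_distr[of f])
    ultimately obtain M where "has_type R I p ?f1 M" using caseA[of ?f1] f1 f2c by blast
    from has_type.add[OF this add.hyps(2) f2t f1(1,2)] show ?thesis using f1(4) by auto
  qed
qed

lemma idem_has_type:
  assumes "f \<in> carrier R" "f \<otimes> f = f"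
  shows "\<exists>M. has_type R I p f M"
  using one_type typed_below assms by (metis l_one r_one)

text \<open>The choice of a pivot: a nonzero row \<open>l\<close> has a nonzero entry at some
  summand of \<open>k\<close>, which must have label \<open>t\<close>; this summand, written
  \<open>x \<otimes> y\<close>, is split off from \<open>k\<close>.\<close>

lemma nonzero_row:
  assumes "has_type R I p k N" "t \<in> I" "l \<in> carrier R" "p t \<otimes> l = l" "l \<otimes> k = l" "l \<noteq> \<zero>"
  shows "\<exists>k' N' x y. k = k' \<oplus> x \<otimes> y \<and> N = add_mset t N' \<and> has_type R I p k' N' \<and> x \<in> carrier R \<and> y \<in> carrier R
    \<and> y \<otimes> x = p t \<and> x \<otimes> p t = x \<and> k' \<otimes> x = \<zero> \<and> y \<otimes> k' = \<zero> \<and> p t \<otimes> y = y \<and> l \<otimes> x \<noteq> \<zero>"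
  using assms
proof (induction)
  case zero
  then show ?case by simp
next
  case (add k N s h)
  have k: "k \<in> carrier R" "k \<otimes> k = k" using has_type_idem add by auto
  obtain x y where xy: "x \<in> carrier R" "y \<in> carrier R" "x \<otimes> y = h" "y \<otimes> x = p s"
    "h \<otimes> x = x" "x \<otimes> p s = x" "p s \<otimes> y = y" "y \<otimes> h = y"
    "h \<in> carrier R" "p s \<in> carrier R" "h \<otimes> h = h" "p s \<otimes> p s = p s"
    using idem_eqvE[OF add.hyps(3)] by blast
  have kx: "k \<otimes> x = \<zero>" "y \<otimes> k = \<zero>"
    using orth_prod[of k x k h] orth_prod[of y k h k] k xy add.hyps by auto
  note pt = p_closed[OF \<open>t \<in> I\<close>]
  note l = \<open>l \<in> carrier R\<close> \<open>p t \<otimes> l = l\<close>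
  show ?case
  proof (cases "l \<otimes> h = \<zero>")
    case False
    have lx: "l \<otimes> x \<noteq> \<zero>"
    proof
      assume "l \<otimes> x = \<zero>"
      then have "(l \<otimes> x) \<otimes> y = \<zero>" using xy by simp
      then have "l \<otimes> h = \<zero>" using l(1) xy(1,2,3) by (simp add: m_assoc)
      then show False using False by simp
    qed
    have "s = t"
    proof (rule ccontr)
      assume "s \<noteq> t"
      then have "p t \<otimes> (l \<otimes> x) \<otimes> p s = \<zero>" using p_orth[of t s "l \<otimes> x"] add.hyps add.prems l xy by auto
      moreover have "p t \<otimes> (l \<otimes> x) \<otimes> p s = l \<otimes> x" 
      proof -
        have "p t \<otimes> (l \<otimes> x) \<otimes> p s = (p t \<otimes> l) \<otimes> (x \<otimes> p s)" using l(1) xy(1,10) pt by (simp add: m_assoc)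
        then show ?thesis using l xy by simp
      qed
      ultimately show False using lx by simp
    qed
    then show ?thesis using add.hyps xy lx kx by blast
  next
    case True
    have "l \<otimes> k = l" using add.prems(4) True l k xy by (simp add: r_distr)
    then obtain k' N' u v where K: "k = k' \<oplus> u \<otimes> v" "N = add_mset t N'" "has_type R I p k' N'"
      "u \<in> carrier R" "v \<in> carrier R" "v \<otimes> u = p t" "u \<otimes> p t = u" "k' \<otimes> u = \<zero>" "v \<otimes> k' = \<zero>" "p t \<otimes> v = v" "l \<otimes> u \<noteq> \<zero>"
      using add.IH add.prems by blast
    have k': "k' \<in> carrier R" "k' \<otimes> k' = k'" using has_type_idem[OF K(3)] by auto
    have uv: "u \<otimes> v \<in> carrier R" "(u \<otimes> v) \<otimes> (u \<otimes> v) = u \<otimes> v" "u \<otimes> v \<otimes> u = u"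
        "k' \<otimes> (u \<otimes> v) = \<zero>" "u \<otimes> v \<otimes> k' = \<zero>" "v \<otimes> (u \<otimes> v) = v"
    proof -
      show 1: "u \<otimes> v \<otimes> u = u" using K by (simp add: m_assoc)
      show "(u \<otimes> v) \<otimes> (u \<otimes> v) = u \<otimes> v" using 1 K(4,5) by (simp add: m_assoc[symmetric])
      show "k' \<otimes> (u \<otimes> v) = \<zero>" using K k' by (simp add: m_assoc[symmetric])
      show "u \<otimes> v \<otimes> k' = \<zero>" using K k' by (simp add: m_assoc)
      show "v \<otimes> (u \<otimes> v) = v" using K by (simp add: m_assoc[symmetric])
    qed (use K in simp)
    have o: "k' \<otimes> h = \<zero>" "h \<otimes> k' = \<zero>" "u \<otimes> v \<otimes> h = \<zero>" "h \<otimes> (u \<otimes> v) = \<zero>"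
      using orth_summand[of k' "u \<otimes> v" h] k' uv xy K add.hyps by auto
    have hu: "h \<otimes> u = \<zero>" using orth_prod[of h u h "u \<otimes> v"] xy(9,11) K uv o by auto
    have vh: "v \<otimes> h = \<zero>" using orth_prod[of v h "u \<otimes> v" h] xy(9,11) K uv o by auto
    have 1: "has_type R I p (k' \<oplus> h) (add_mset s N')" using has_type.add[OF K(3) add.hyps(2,3)] o by auto
    have 2: "k \<oplus> h = (k' \<oplus> h) \<oplus> u \<otimes> v" using K k' xy by (simp add: a_ac)
    have 3: "(k' \<oplus> h) \<otimes> u = \<zero>" "v \<otimes> (k' \<oplus> h) = \<zero>"
      using K k' xy(9) hu vh by (simp_all add: l_distr r_distr)
    show ?thesis
      by (rule exI[of _ "k' \<oplus> h"], rule exI[of _ "add_mset s N'"], rule exI[of _ u], rule exI[of _ v])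
        (use 1 2 3 K in auto)
  qed
qed

text \<open>A homogeneous linear system with more unknowns than equations has a nonzero solution:
  \<open>\<theta>\<close> is a matrix with rows counted by \<open>M\<close> and columns by
  \<open>N\<close>, and only label \<open>t\<close> matters. The induction removes one row by
  elimination without division, since corners are domains but not fields.\<close>

lemma kernel_vector:
  assumes "has_type R I p f M" "has_type R I p k N" "t \<in> I" "count M t < count N t"
    "\<theta> \<in> carrier R" "f \<otimes> \<theta> = \<theta>" "\<theta> \<otimes> k = \<theta>"
  shows "\<exists>v\<in>carrier R. v \<noteq> \<zero> \<and> k \<otimes> v = v \<and> v \<otimes> p t = v \<and> \<theta> \<otimes> v = \<zero>"
  using assms
proof (induction arbitrary: k N \<theta>)
  case zero
  then have "t \<in># N" by simp
  then obtain N' where N': "N = add_mset t N'" by (metis insert_DiffM)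
  obtain k' g where k: "k = k' \<oplus> g" "has_type R I p k' N'" "idem_eqv R g (p t)" "k' \<otimes> g = \<zero>" "g \<otimes> k' = \<zero>"
    using has_type_extract[OF zero.prems(1) N'] by blast
  obtain x y where xy: "x \<in> carrier R" "y \<in> carrier R" "x \<otimes> y = g" "y \<otimes> x = p t"
    "g \<otimes> x = x" "x \<otimes> p t = x" "p t \<otimes> y = y" "y \<otimes> g = y"
    "g \<in> carrier R" "p t \<in> carrier R" "g \<otimes> g = g" "p t \<otimes> p t = p t"
    using idem_eqvE[OF k(3)] by blast
  have k': "k' \<in> carrier R" "k' \<otimes> k' = k'" using has_type_idem[OF k(2)] by auto
  have kx: "k' \<otimes> x = \<zero>" using orth_prod[of k' x k' g] k' xy k by auto
  have "k \<otimes> x = x" using k(1) kx xy k' by (simp add: l_distr)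
  moreover have "x \<noteq> \<zero>" using xy(2,4) p_nonzero[OF zero.prems(2)] by auto
  moreover have "\<theta> \<otimes> x = \<zero>" using zero.prems xy by (metis l_null)
  ultimately show ?case using xy by blast
next
  case (add f M s h)
  have f: "f \<in> carrier R" "f \<otimes> f = f" using has_type_idem add by auto
  have k: "k \<in> carrier R" "k \<otimes> k = k" using has_type_idem add by auto
  obtain x y where xy: "x \<in> carrier R" "y \<in> carrier R" "x \<otimes> y = h" "y \<otimes> x = p s"
    "h \<otimes> x = x" "x \<otimes> p s = x" "p s \<otimes> y = y" "y \<otimes> h = y"
    "h \<in> carrier R" "p s \<in> carrier R" "h \<otimes> h = h" "p s \<otimes> p s = p s"
    using idem_eqvE[OF add.hyps(3)] by blast
  note pt = p_closed[OF \<open>t \<in> I\<close>]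
  note th = \<open>\<theta> \<in> carrier R\<close>
  define l where "l = y \<otimes> \<theta>"
  define \<theta>' where "\<theta>' = f \<otimes> \<theta>"
  have l: "l \<in> carrier R" "p s \<otimes> l = l" "l \<otimes> k = l"
    using th xy add.prems(6) k unfolding l_def by (simp_all add: m_assoc) (simp add: m_assoc[symmetric])
  have t': "\<theta>' \<in> carrier R" "f \<otimes> \<theta>' = \<theta>'" "\<theta>' \<otimes> k = \<theta>'"
    using th f add.prems(6) k unfolding \<theta>'_def by (simp_all add: m_assoc) (simp add: m_assoc[symmetric])
  have th_eq: "\<theta> = \<theta>' \<oplus> x \<otimes> l"
  proof -
    have "\<theta> = f \<otimes> \<theta> \<oplus> h \<otimes> \<theta>" using add.prems(5) f xy th by (simp add: l_distr)
    then show ?thesis unfolding \<theta>'_def l_def using xy(1,2,3) th by (simp add: m_assoc[symmetric])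
  qed
  have th_v: "\<theta> \<otimes> v = \<zero>" if v: "v \<in> carrier R" "\<theta>' \<otimes> v = \<zero>" "l \<otimes> v = \<zero>" for v
    using th_eq v t' xy l by (simp add: l_distr m_assoc)
  show ?case
  \<comment> \<open>If the label of the removed row differs from \<open>t\<close>, or the row is
    zero, it imposes no condition on a column ending in \<open>p t\<close>.\<close>
  proof (cases "s = t \<and> l \<noteq> \<zero>")
    case False
    have "count M t < count N t" using add.prems(3) by (auto split: if_splits)
    then obtain v where v: "v \<in> carrier R" "v \<noteq> \<zero>" "k \<otimes> v = v" "v \<otimes> p t = v" "\<theta>' \<otimes> v = \<zero>"
      using add.IH[OF add.prems(1,2) _ t'] by blast
    have "l \<otimes> v = \<zero>"
    proof (cases "s = t")
      case True
      then show ?thesis using False v by auto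
    next
      case False
      have "l \<otimes> v = p s \<otimes> (l \<otimes> v) \<otimes> p t"
      proof -
        have "p s \<otimes> (l \<otimes> v) \<otimes> p t = (p s \<otimes> l) \<otimes> (v \<otimes> p t)" using l(1) v(1) xy(10) pt by (simp add: m_assoc)
        then show ?thesis using l v by simp
      qed
      also have "\<dots> = \<zero>" using p_orth[of s t "l \<otimes> v"] False add.hyps add.prems l v by auto
      finally show ?thesis .
    qed
    then show ?thesis using v th_v by blast
  next
    case True
    then have l0: "l \<noteq> \<zero>" "p t \<otimes> l = l" using l by auto
    obtain k' N' u w where K: "k = k' \<oplus> u \<otimes> w" "N = add_mset t N'" "has_type R I p k' N'"
      "u \<in> carrier R" "w \<in> carrier R" "w \<otimes> u = p t" "u \<otimes> p t = u" "k' \<otimes> u = \<zero>" "w \<otimes> k' = \<zero>" "p t \<otimes> w = w" "l \<otimes> u \<noteq> \<zero>"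
      using nonzero_row[OF add.prems(1,2) l(1) l0(2) l(3) l0(1)] by blast
    have k': "k' \<in> carrier R" "k' \<otimes> k' = k'" using has_type_idem[OF K(3)] by auto
    have kk: "k \<otimes> k' = k'" "k \<otimes> u = u"
    proof -
      have "u \<otimes> w \<otimes> k' = \<zero>" using K k' by (simp add: m_assoc)
      then show "k \<otimes> k' = k'" using K k' by (simp add: l_distr)
      have "u \<otimes> w \<otimes> u = u" using K by (simp add: m_assoc)
      then show "k \<otimes> u = u" using K k' by (simp add: l_distr)
    qed
    have lu: "p t \<otimes> (l \<otimes> u) = l \<otimes> u" "(l \<otimes> u) \<otimes> p t = l \<otimes> u"
      using l l0 K pt by (simp_all add: m_assoc) (simp add: m_assoc[symmetric])
    obtain z where z: "z \<in> carrier R" "\<And>b. b \<in> carrier R \<Longrightarrow> z \<otimes> b = b \<otimes> z" "l \<otimes> u = z \<otimes> p t"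
      using p_central[of t "l \<otimes> u"] lu add.prems l K by auto
    \<comment> \<open>Elimination with the pivot \<open>l \<otimes> u = z \<otimes> p t\<close>: a
      column \<open>v\<close> goes to \<open>z \<otimes> v\<close> minus
      \<open>u \<otimes> l \<otimes> v\<close>. This is annihilated by \<open>l\<close>, and its
      \<open>k'\<close> part is \<open>z \<otimes> v\<close>.\<close>
    define \<psi> where "\<psi> = z \<otimes> k' \<ominus> u \<otimes> l \<otimes> k'"
    have psi: "\<psi> \<in> carrier R" "\<psi> \<otimes> k' = \<psi>" "k \<otimes> \<psi> = \<psi>" "l \<otimes> \<psi> = \<zero>" "k' \<otimes> \<psi> = z \<otimes> k'"
    proof -
      show "\<psi> \<in> carrier R" using z k' K l unfolding \<psi>_def by simp
      show "\<psi> \<otimes> k' = \<psi>" using z(1) k' K l unfolding \<psi>_def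
        by (simp add: a_minus_def l_distr l_minus m_assoc)
      have "k \<otimes> (z \<otimes> k') = z \<otimes> (k \<otimes> k')" using z(2)[OF k(1)] z(1) k k' by (simp add: m_assoc[symmetric])
      moreover have "k \<otimes> (u \<otimes> l \<otimes> k') = (k \<otimes> u) \<otimes> l \<otimes> k'" using k K(4) l k' by (simp add: m_assoc)
      ultimately show "k \<otimes> \<psi> = \<psi>" using kk z(1) k k' K(4) l unfolding \<psi>_def
        by (simp add: a_minus_def r_distr r_minus)
      have "l \<otimes> (z \<otimes> k') = z \<otimes> (l \<otimes> k')" using z(2)[OF l(1)] z(1) l k' by (simp add: m_assoc[symmetric])
      moreover have "l \<otimes> (u \<otimes> l \<otimes> k') = z \<otimes> (l \<otimes> k')"
      proof -
        have "l \<otimes> (u \<otimes> l \<otimes> k') = (l \<otimes> u) \<otimes> (l \<otimes> k')" using l K(4) k' by (simp add: m_assoc)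
        also have "\<dots> = z \<otimes> ((p t \<otimes> l) \<otimes> k')" using z l k' pt by (simp add: m_assoc)
        finally show ?thesis using l0 by simp
      qed
      ultimately show "l \<otimes> \<psi> = \<zero>" using z(1) k' K(4) l unfolding \<psi>_def
        by (simp add: a_minus_def r_distr r_minus r_neg)
      have "k' \<otimes> (z \<otimes> k') = z \<otimes> (k' \<otimes> k')" using z(2)[OF k'(1)] z(1) k'(1) by (metis m_assoc)
      moreover have "k' \<otimes> (u \<otimes> l \<otimes> k') = (k' \<otimes> u) \<otimes> l \<otimes> k'" using k' K(4) l by (simp add: m_assoc)
      ultimately show "k' \<otimes> \<psi> = z \<otimes> k'" using z(1) k' K l unfolding \<psi>_def
        by (simp add: a_minus_def r_distr r_minus)
    qed
    have "\<exists>v\<in>carrier R. v \<noteq> \<zero> \<and> k' \<otimes> v = v \<and> v \<otimes> p t = v \<and> (\<theta>' \<otimes> \<psi>) \<otimes> v = \<zero>"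
    proof (rule add.IH[OF K(3) add.prems(2)])
      show "count M t < count N' t" using add.prems(3) K(2) True by auto
      show "f \<otimes> (\<theta>' \<otimes> \<psi>) = \<theta>' \<otimes> \<psi>" using t' f psi by (simp add: m_assoc[symmetric])
      show "\<theta>' \<otimes> \<psi> \<otimes> k' = \<theta>' \<otimes> \<psi>" using t' k' psi by (simp add: m_assoc)
    qed (use t' psi in auto)
    then obtain v where v: "v \<in> carrier R" "v \<noteq> \<zero>" "k' \<otimes> v = v" "v \<otimes> p t = v" "\<theta>' \<otimes> \<psi> \<otimes> v = \<zero>" by blast
    \<comment> \<open>If \<open>z \<otimes> v\<close> were zero, the nonzero pivot would annihilate
      every corner entry of \<open>v\<close>; as the corner is a domain, all entries and hence
      \<open>v\<close> would vanish.\<close>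
    have zv: "z \<otimes> v \<noteq> \<zero>"
    proof
      assume zv0: "z \<otimes> v = \<zero>"
      have "v = \<zero>"
      proof (rule column_zero[OF K(3) add.prems(2) v(1,4,3)])
        fix b assume b: "b \<in> carrier R"
        let ?c = "p t \<otimes> b \<otimes> v"
        have "(l \<otimes> u) \<otimes> ?c = z \<otimes> ((p t \<otimes> p t) \<otimes> b \<otimes> v)" unfolding z(3) using z(1) b v(1) pt by (simp add: m_assoc)
        also have "\<dots> = (z \<otimes> (p t \<otimes> b)) \<otimes> v" using p_idem[OF add.prems(2)] z(1) b v(1) pt by (simp add: m_assoc)
        also have "\<dots> = (p t \<otimes> b) \<otimes> (z \<otimes> v)" using z(2)[of "p t \<otimes> b"] z(1) b v(1) pt by (simp add: m_assoc)
        finally have "(l \<otimes> u) \<otimes> ?c = \<zero>" using zv0 b pt by simp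
        moreover have "p t \<otimes> ?c = ?c" using p_idem[OF add.prems(2)] b v(1) pt by (simp add: m_assoc[symmetric])
        moreover have "?c \<otimes> p t = ?c" using v b pt by (simp add: m_assoc)
        ultimately show "?c = \<zero>" using p_domain[OF add.prems(2) _ _ lu, of ?c] K(11) l(1) K(4) b v(1) pt by auto
      qed
      then show False using v by simp
    qed
    have "k' \<otimes> (\<psi> \<otimes> v) = z \<otimes> v" using psi k' v z(1) by (simp add: m_assoc[symmetric]) (simp add: m_assoc)
    then have "\<psi> \<otimes> v \<noteq> \<zero>" using zv k' by auto
    moreover have "k \<otimes> (\<psi> \<otimes> v) = \<psi> \<otimes> v" using psi k v by (simp add: m_assoc[symmetric])
    moreover have "\<psi> \<otimes> v \<otimes> p t = \<psi> \<otimes> v" using psi v pt by (simp add: m_assoc)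
    moreover have "\<theta> \<otimes> (\<psi> \<otimes> v) = \<zero>"
    proof (rule th_v)
      show "\<theta>' \<otimes> (\<psi> \<otimes> v) = \<zero>" using v t' psi by (simp add: m_assoc)
      show "l \<otimes> (\<psi> \<otimes> v) = \<zero>" using v l psi by (simp add: m_assoc[symmetric])
    qed (use psi v in auto)
    ultimately show ?thesis using psi v by blast
  qed
qed

text \<open>The idempotent \<open>f\<close> acts as the identity on its columns. Read as a matrix
  with rows of type \<open>M\<close> and columns of type \<open>N\<close>, it has no kernel, so
  \<open>kernel_vector\<close> bounds each count of \<open>N\<close> by that of
  \<open>M\<close>.\<close>

lemma has_type_unique:
  assumes "has_type R I p f M" "has_type R I p f N"
  shows "M = N"
proof -
  have le: "count N t \<le> count M t" if M: "has_type R I p f M" and N: "has_type R I p f N" for M N t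
  proof (rule ccontr)
    assume "\<not> ?thesis"
    then have lt: "count M t < count N t" by simp
    then have "t \<in> I" using has_type_subset[OF N] by (metis count_eq_zero_iff not_less_zero subsetD)
    then obtain v where "v \<in> carrier R" "v \<noteq> \<zero>" "f \<otimes> v = v" "f \<otimes> v = \<zero>"
      using kernel_vector[OF M N _ lt, of f] has_type_idem[OF M] by blast
    then show False by simp
  qed
  show ?thesis using le[OF assms] le[OF assms(2,1)] by (intro multiset_eqI) (simp add: le_antisym)
qed

end

section \<open>Matrix rings\<close>

lemma (in abelian_monoid) finsum_swap:
  assumes "finite A" "finite B" "\<And>i j. i \<in> A \<Longrightarrow> j \<in> B \<Longrightarrow> f i j \<in> carrier G"
  shows "(\<Oplus>i\<in>A. \<Oplus>j\<in>B. f i j) = (\<Oplus>j\<in>B. \<Oplus>i\<in>A. f i j)"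
  using assms(1,3)
proof (induction rule: finite_induct)
  case empty
  then show ?case by (simp add: finsum_zero)
next
  case (insert a A)
  have "(\<Oplus>i\<in>insert a A. \<Oplus>j\<in>B. f i j) = (\<Oplus>j\<in>B. f a j) \<oplus> (\<Oplus>i\<in>A. \<Oplus>j\<in>B. f i j)"
    using insert by (intro finsum_insert) (auto intro!: finsum_closed)
  also have "\<dots> = (\<Oplus>j\<in>B. f a j) \<oplus> (\<Oplus>j\<in>B. \<Oplus>i\<in>A. f i j)" using insert by simp
  also have "\<dots> = (\<Oplus>j\<in>B. f a j \<oplus> (\<Oplus>i\<in>A. f i j))"
    using insert by (intro finsum_addf[symmetric]) (auto intro!: finsum_closed)
  also have "\<dots> = (\<Oplus>j\<in>B. \<Oplus>i\<in>insert a A. f i j)"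
    using insert by (intro finsum_cong' refl finsum_insert[symmetric]) (auto intro!: finsum_closed)
  finally show ?case .
qed

lemma (in abelian_monoid) finsum_blocks:
  fixes k n :: nat
  assumes "\<And>q. q < k * n \<Longrightarrow> g q \<in> carrier G"
  shows "(\<Oplus>q\<in>{..<k * n}. g q) = (\<Oplus>L\<in>{..<k}. \<Oplus>l\<in>{..<n}. g (L * n + l))"
  using assms
proof (induction k)
  case 0
  then show ?case by simp
next
  case (Suc k)
  have lt: "L * n + l < Suc k * n" if "L \<le> k" "l < n" for L l
  proof -
    have "L * n + l < L * n + n" using that by simp
    also have "\<dots> \<le> Suc k * n" using mult_le_mono1[of "Suc L" "Suc k" n] that by simp
    finally show ?thesis .
  qed
  have 1: "{..<Suc k * n} = {..<k * n} \<union> (\<lambda>l. k * n + l) ` {..<n}"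
  proof -
    have "q \<in> (\<lambda>l. k * n + l) ` {..<n}" if "q < n + k * n" "\<not> q < k * n" for q
      by (rule image_eqI[of _ _ "q - k * n"]) (use that in auto)
    then show ?thesis by auto
  qed
  have "(\<Oplus>q\<in>{..<Suc k * n}. g q) = (\<Oplus>q\<in>{..<k * n}. g q) \<oplus> (\<Oplus>q\<in>(\<lambda>l. k * n + l) ` {..<n}. g q)"
    unfolding 1 using Suc.prems by (intro finsum_Un_disjoint) auto
  also have "(\<Oplus>q\<in>(\<lambda>l. k * n + l) ` {..<n}. g q) = (\<Oplus>l\<in>{..<n}. g (k * n + l))"
    using Suc.prems by (intro finsum_reindex) (auto simp: inj_on_def)
  also have "(\<Oplus>q\<in>{..<k * n}. g q) = (\<Oplus>L\<in>{..<k}. \<Oplus>l\<in>{..<n}. g (L * n + l))"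
    using Suc by auto
  also have "\<dots> \<oplus> (\<Oplus>l\<in>{..<n}. g (k * n + l)) = (\<Oplus>L\<in>insert k {..<k}. \<Oplus>l\<in>{..<n}. g (L * n + l))"
    using Suc.prems lt by (subst finsum_insert) (auto intro!: finsum_closed a_comm)
  also have "insert k {..<k} = {..<Suc k}" by auto
  finally show ?case .
qed

lemma (in ring) finsum_delta:
  assumes "finite A" "i \<in> A" "x \<in> carrier R"
  shows "(\<Oplus>j\<in>A. if j = i then x else \<zero>) = x"
  using finsum_singleton[OF assms(2,1), of "\<lambda>_. x"] assms(3) by (auto cong: if_cong simp: eq_commute)

lemma finsum_hom:
  assumes "ring R" "ring S" "h \<in> ring_hom R S" "finite A" "f \<in> A \<rightarrow> carrier R"
  shows "h (finsum R f A) = finsum S (\<lambda>a. h (f a)) A"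
proof -
  interpret R: ring R by fact
  interpret S: ring S by fact
  interpret h: ring_hom_ring R S h by (rule ring_hom_ringI2) (use assms in auto)
  show ?thesis using assms(4,5)
  proof (induction rule: finite_induct)
    case (insert a A)
    then have f: "f \<in> A \<rightarrow> carrier R" "f a \<in> carrier R" by auto
    then have "h (finsum R f (insert a A)) = h (f a) \<oplus>\<^bsub>S\<^esub> h (finsum R f A)"
      using insert by (simp add: R.finsum_insert)
    also have "\<dots> = h (f a) \<oplus>\<^bsub>S\<^esub> finsum S (\<lambda>a. h (f a)) A" using insert f by simp
    also have "\<dots> = finsum S (\<lambda>a. h (f a)) (insert a A)"
      using insert f ring_hom_closed[OF assms(3)] by (subst S.finsum_insert) (auto simp: Pi_iff)
    finally show ?case .
  qed simp
qed

lemma matrix_ring_carrier: "carrier (matrix_ring n R) = ({..<n} \<times> {..<n}) \<rightarrow>\<^sub>E carrier R"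
  by (simp add: matrix_ring_def)

lemma matrix_closed: "\<lbrakk>x \<in> carrier (matrix_ring n R); i < n; j < n\<rbrakk> \<Longrightarrow> x (i, j) \<in> carrier R"
  unfolding matrix_ring_carrier by (auto simp: PiE_iff)

lemma matrix_eqI:
  assumes "x \<in> carrier (matrix_ring n R)" "y \<in> carrier (matrix_ring n S)"
    "\<And>i j. i < n \<Longrightarrow> j < n \<Longrightarrow> x (i, j) = y (i, j)"
  shows "x = y"
  using assms unfolding matrix_ring_carrier by (intro PiE_ext[of x _ _ y]) auto

lemma matrix_memI:
  assumes "\<And>i j. i < n \<Longrightarrow> j < n \<Longrightarrow> f i j \<in> carrier R"
  shows "(\<lambda>(i, j)\<in>{..<n} \<times> {..<n}. f i j) \<in> carrier (matrix_ring n R)"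
  unfolding matrix_ring_carrier using assms by auto

lemma matrix_mult_entry: "i < n \<Longrightarrow> j < n \<Longrightarrow>
  (x \<otimes>\<^bsub>matrix_ring n R\<^esub> y) (i, j) = (\<Oplus>\<^bsub>R\<^esub>k\<in>{..<n}. x (i, k) \<otimes>\<^bsub>R\<^esub> y (k, j))"
  by (simp add: matrix_ring_def)

lemma matrix_add_entry: "i < n \<Longrightarrow> j < n \<Longrightarrow> (x \<oplus>\<^bsub>matrix_ring n R\<^esub> y) (i, j) = x (i, j) \<oplus>\<^bsub>R\<^esub> y (i, j)"
  by (simp add: matrix_ring_def)

lemma matrix_zero_entry: "i < n \<Longrightarrow> j < n \<Longrightarrow> \<zero>\<^bsub>matrix_ring n R\<^esub> (i, j) = \<zero>\<^bsub>R\<^esub>"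
  by (simp add: matrix_ring_def)

lemma matrix_one_entry: "i < n \<Longrightarrow> j < n \<Longrightarrow> \<one>\<^bsub>matrix_ring n R\<^esub> (i, j) = (if i = j then \<one>\<^bsub>R\<^esub> else \<zero>\<^bsub>R\<^esub>)"
  by (simp add: matrix_ring_def)

lemmas matrix_entry = matrix_mult_entry matrix_add_entry matrix_zero_entry matrix_one_entry

definition elem_mat :: "nat \<Rightarrow> ('a, 'm) ring_scheme \<Rightarrow> nat \<Rightarrow> nat \<Rightarrow> 'a \<Rightarrow> nat \<times> nat \<Rightarrow> 'a" where
  "elem_mat n R a b r = (\<lambda>(i, j)\<in>{..<n} \<times> {..<n}. if i = a \<and> j = b then r else \<zero>\<^bsub>R\<^esub>)"

lemma elem_mat_entry: "i < n \<Longrightarrow> j < n \<Longrightarrow> elem_mat n R a b r (i, j) = (if i = a \<and> j = b then r else \<zero>\<^bsub>R\<^esub>)"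
  by (simp add: elem_mat_def)

context ring begin

lemma matrix_mult_closed:
  assumes "x \<in> carrier (matrix_ring n R)" "y \<in> carrier (matrix_ring n R)"
  shows "x \<otimes>\<^bsub>matrix_ring n R\<^esub> y \<in> carrier (matrix_ring n R)"
  using matrix_closed[OF assms(1)] matrix_closed[OF assms(2)]
  by (auto simp: matrix_ring_def intro!: finsum_closed)

lemma matrix_add_closed:
  assumes "x \<in> carrier (matrix_ring n R)" "y \<in> carrier (matrix_ring n R)"
  shows "x \<oplus>\<^bsub>matrix_ring n R\<^esub> y \<in> carrier (matrix_ring n R)"
  using matrix_closed[OF assms(1)] matrix_closed[OF assms(2)] by (auto simp: matrix_ring_def)

lemma matrix_one_closed: "\<one>\<^bsub>matrix_ring n R\<^esub> \<in> carrier (matrix_ring n R)"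
  and matrix_zero_closed: "\<zero>\<^bsub>matrix_ring n R\<^esub> \<in> carrier (matrix_ring n R)"
  by (auto simp: matrix_ring_def)

lemma elem_mat_closed: "r \<in> carrier R \<Longrightarrow> elem_mat n R a b r \<in> carrier (matrix_ring n R)"
  by (auto simp: matrix_ring_def elem_mat_def)

lemma matrix_ring_ring: "ring (matrix_ring n R)"
proof -
  let ?M = "matrix_ring n R"
  note cl = matrix_mult_closed matrix_add_closed matrix_one_closed matrix_zero_closed
  note ent = matrix_entry matrix_closed
  have assoc: "x \<otimes>\<^bsub>?M\<^esub> y \<otimes>\<^bsub>?M\<^esub> z = x \<otimes>\<^bsub>?M\<^esub> (y \<otimes>\<^bsub>?M\<^esub> z)"
    if c: "x \<in> carrier ?M" "y \<in> carrier ?M" "z \<in> carrier ?M" for x y z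
  proof (rule matrix_eqI[of _ n R _ R])
    note cx = matrix_closed[OF c(1)] matrix_closed[OF c(2)] matrix_closed[OF c(3)]
    fix i j assume ij: "i < n" "j < n"
    have "(x \<otimes>\<^bsub>?M\<^esub> y \<otimes>\<^bsub>?M\<^esub> z) (i, j) = (\<Oplus>k\<in>{..<n}. (\<Oplus>l\<in>{..<n}. x (i, l) \<otimes> y (l, k)) \<otimes> z (k, j))"
      using ij by (auto simp: matrix_mult_entry cx Pi_iff intro!: finsum_cong')
    also have "\<dots> = (\<Oplus>k\<in>{..<n}. \<Oplus>l\<in>{..<n}. x (i, l) \<otimes> y (l, k) \<otimes> z (k, j))"
      using ij by (intro finsum_cong' finsum_ldistr) (auto simp: cx Pi_iff)
    also have "\<dots> = (\<Oplus>l\<in>{..<n}. \<Oplus>k\<in>{..<n}. x (i, l) \<otimes> y (l, k) \<otimes> z (k, j))"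
      using ij by (intro finsum_swap) (auto simp: cx Pi_iff)
    also have "\<dots> = (\<Oplus>l\<in>{..<n}. \<Oplus>k\<in>{..<n}. x (i, l) \<otimes> (y (l, k) \<otimes> z (k, j)))"
      using ij by (intro finsum_cong' m_assoc) (auto simp: cx Pi_iff)
    also have "\<dots> = (\<Oplus>l\<in>{..<n}. x (i, l) \<otimes> (\<Oplus>k\<in>{..<n}. y (l, k) \<otimes> z (k, j)))"
      using ij by (intro finsum_cong' finsum_rdistr[symmetric]) (auto simp: cx Pi_iff)
    also have "\<dots> = (x \<otimes>\<^bsub>?M\<^esub> (y \<otimes>\<^bsub>?M\<^esub> z)) (i, j)"
      using ij by (auto simp: matrix_mult_entry cx Pi_iff intro!: finsum_cong')
    finally show "(x \<otimes>\<^bsub>?M\<^esub> y \<otimes>\<^bsub>?M\<^esub> z) (i, j) = (x \<otimes>\<^bsub>?M\<^esub> (y \<otimes>\<^bsub>?M\<^esub> z)) (i, j)" .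
  qed (use c cl in auto)
  have abel: "abelian_group ?M"
  proof (rule abelian_groupI)
    fix x assume x: "x \<in> carrier ?M"
    let ?y = "\<lambda>(i, j)\<in>{..<n} \<times> {..<n}. \<ominus> x (i, j)"
    have y: "?y \<in> carrier ?M" using x by (intro matrix_memI) (auto simp: matrix_closed)
    have "?y \<oplus>\<^bsub>?M\<^esub> x = \<zero>\<^bsub>?M\<^esub>"
      by (rule matrix_eqI[of _ n R _ R]) (use x y cl in \<open>auto simp: ent l_neg\<close>)
    then show "\<exists>y\<in>carrier ?M. y \<oplus>\<^bsub>?M\<^esub> x = \<zero>\<^bsub>?M\<^esub>" using y by blast
  next
    fix x y z assume c: "x \<in> carrier ?M" "y \<in> carrier ?M" "z \<in> carrier ?M"
    show "x \<oplus>\<^bsub>?M\<^esub> y \<oplus>\<^bsub>?M\<^esub> z = x \<oplus>\<^bsub>?M\<^esub> (y \<oplus>\<^bsub>?M\<^esub> z)"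
      by (rule matrix_eqI[of _ n R _ R]) (use c cl in \<open>auto simp: ent a_assoc\<close>)
    show "x \<oplus>\<^bsub>?M\<^esub> y = y \<oplus>\<^bsub>?M\<^esub> x"
      by (rule matrix_eqI[of _ n R _ R]) (use c cl in \<open>auto simp: ent a_comm\<close>)
    show "\<zero>\<^bsub>?M\<^esub> \<oplus>\<^bsub>?M\<^esub> x = x"
      by (rule matrix_eqI[of _ n R _ R]) (use c cl in \<open>auto simp: ent\<close>)
  qed (use cl in auto)
  have del1: "(\<Oplus>k\<in>{..<n}. (if i = k then \<one> else \<zero>) \<otimes> f k) = f i"
    if "i < n" "f \<in> {..<n} \<rightarrow> carrier R" for i f
  proof -
    have "(\<Oplus>k\<in>{..<n}. (if i = k then \<one> else \<zero>) \<otimes> f k) = (\<Oplus>k\<in>{..<n}. if k = i then f i else \<zero>)"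
      using that by (intro finsum_cong') (auto simp: Pi_iff)
    then show ?thesis using finsum_delta[of "{..<n}" i "f i"] that by (simp add: Pi_iff)
  qed
  have del2: "(\<Oplus>k\<in>{..<n}. f k \<otimes> (if k = i then \<one> else \<zero>)) = f i"
    if "i < n" "f \<in> {..<n} \<rightarrow> carrier R" for i f
  proof -
    have "(\<Oplus>k\<in>{..<n}. f k \<otimes> (if k = i then \<one> else \<zero>)) = (\<Oplus>k\<in>{..<n}. if k = i then f i else \<zero>)"
      using that by (intro finsum_cong') (auto simp: Pi_iff)
    then show ?thesis using finsum_delta[of "{..<n}" i "f i"] that by (simp add: Pi_iff)
  qed
  have one: "\<one>\<^bsub>?M\<^esub> \<otimes>\<^bsub>?M\<^esub> x = x" "x \<otimes>\<^bsub>?M\<^esub> \<one>\<^bsub>?M\<^esub> = x" if c: "x \<in> carrier ?M" for x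
  proof -
    show "\<one>\<^bsub>?M\<^esub> \<otimes>\<^bsub>?M\<^esub> x = x"
    proof (rule matrix_eqI[of _ n R _ R])
      fix i j assume ij: "i < n" "j < n"
      have "(\<one>\<^bsub>?M\<^esub> \<otimes>\<^bsub>?M\<^esub> x) (i, j) = (\<Oplus>k\<in>{..<n}. (if i = k then \<one> else \<zero>) \<otimes> x (k, j))"
        using ij c unfolding matrix_mult_entry[OF ij]
        by (intro finsum_cong') (auto simp: matrix_one_entry matrix_closed)
      then show "(\<one>\<^bsub>?M\<^esub> \<otimes>\<^bsub>?M\<^esub> x) (i, j) = x (i, j)" using del1[of i "\<lambda>k. x (k, j)"] ij matrix_closed[OF c] by auto
    qed (use c cl in auto)
    show "x \<otimes>\<^bsub>?M\<^esub> \<one>\<^bsub>?M\<^esub> = x"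
    proof (rule matrix_eqI[of _ n R _ R])
      fix i j assume ij: "i < n" "j < n"
      have "(x \<otimes>\<^bsub>?M\<^esub> \<one>\<^bsub>?M\<^esub>) (i, j) = (\<Oplus>k\<in>{..<n}. x (i, k) \<otimes> (if k = j then \<one> else \<zero>))"
        using ij c unfolding matrix_mult_entry[OF ij]
        by (intro finsum_cong') (auto simp: matrix_one_entry matrix_closed)
      then show "(x \<otimes>\<^bsub>?M\<^esub> \<one>\<^bsub>?M\<^esub>) (i, j) = x (i, j)" using del2[of j "\<lambda>k. x (i, k)"] ij matrix_closed[OF c] by auto
    qed (use c cl in auto)
  qed
  show ?thesis
  proof (rule ringI[OF abel])
    show "monoid ?M" by (rule monoidI) (use cl assoc one in auto)
  next
    fix x y z assume c: "x \<in> carrier ?M" "y \<in> carrier ?M" "z \<in> carrier ?M"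
    show "(x \<oplus>\<^bsub>?M\<^esub> y) \<otimes>\<^bsub>?M\<^esub> z = x \<otimes>\<^bsub>?M\<^esub> z \<oplus>\<^bsub>?M\<^esub> y \<otimes>\<^bsub>?M\<^esub> z"
    proof (rule matrix_eqI[of _ n R _ R])
      fix i j assume ij: "i < n" "j < n"
      have "((x \<oplus>\<^bsub>?M\<^esub> y) \<otimes>\<^bsub>?M\<^esub> z) (i, j) = (\<Oplus>k\<in>{..<n}. x (i, k) \<otimes> z (k, j) \<oplus> y (i, k) \<otimes> z (k, j))"
        using ij c unfolding matrix_mult_entry[OF ij]
        by (intro finsum_cong') (auto simp: matrix_add_entry l_distr matrix_closed)
      also have "\<dots> = (x \<otimes>\<^bsub>?M\<^esub> z \<oplus>\<^bsub>?M\<^esub> y \<otimes>\<^bsub>?M\<^esub> z) (i, j)"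
        using ij c unfolding matrix_mult_entry[OF ij] matrix_add_entry[OF ij]
        by (intro finsum_addf) (auto simp: matrix_closed)
      finally show "((x \<oplus>\<^bsub>?M\<^esub> y) \<otimes>\<^bsub>?M\<^esub> z) (i, j) = (x \<otimes>\<^bsub>?M\<^esub> z \<oplus>\<^bsub>?M\<^esub> y \<otimes>\<^bsub>?M\<^esub> z) (i, j)" .
    qed (use c cl in auto)
    show "z \<otimes>\<^bsub>?M\<^esub> (x \<oplus>\<^bsub>?M\<^esub> y) = z \<otimes>\<^bsub>?M\<^esub> x \<oplus>\<^bsub>?M\<^esub> z \<otimes>\<^bsub>?M\<^esub> y"
    proof (rule matrix_eqI[of _ n R _ R])
      fix i j assume ij: "i < n" "j < n"
      have "(z \<otimes>\<^bsub>?M\<^esub> (x \<oplus>\<^bsub>?M\<^esub> y)) (i, j) = (\<Oplus>k\<in>{..<n}. z (i, k) \<otimes> x (k, j) \<oplus> z (i, k) \<otimes> y (k, j))"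
        using ij c unfolding matrix_mult_entry[OF ij]
        by (intro finsum_cong') (auto simp: matrix_add_entry r_distr matrix_closed)
      also have "\<dots> = (z \<otimes>\<^bsub>?M\<^esub> x \<oplus>\<^bsub>?M\<^esub> z \<otimes>\<^bsub>?M\<^esub> y) (i, j)"
        using ij c unfolding matrix_mult_entry[OF ij] matrix_add_entry[OF ij]
        by (intro finsum_addf) (auto simp: matrix_closed)
      finally show "(z \<otimes>\<^bsub>?M\<^esub> (x \<oplus>\<^bsub>?M\<^esub> y)) (i, j) = (z \<otimes>\<^bsub>?M\<^esub> x \<oplus>\<^bsub>?M\<^esub> z \<otimes>\<^bsub>?M\<^esub> y) (i, j)" .
    qed (use c cl in auto)
  qed
qed

lemma matrix_elem_left:
  assumes "r \<in> carrier R" "x \<in> carrier (matrix_ring n R)" "i < n" "j < n" "b < n"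
  shows "(elem_mat n R a b r \<otimes>\<^bsub>matrix_ring n R\<^esub> x) (i, j) = (if i = a then r \<otimes> x (b, j) else \<zero>)"
proof -
  have "(elem_mat n R a b r \<otimes>\<^bsub>matrix_ring n R\<^esub> x) (i, j)
      = (\<Oplus>k\<in>{..<n}. if k = b then (if i = a then r \<otimes> x (b, j) else \<zero>) else \<zero>)"
    unfolding matrix_mult_entry[OF assms(3,4)]
    using assms matrix_closed[OF assms(2)] by (intro finsum_cong') (auto simp: elem_mat_entry)
  then show ?thesis using finsum_delta[of "{..<n}" b "if i = a then r \<otimes> x (b, j) else \<zero>"] assms
      matrix_closed[OF assms(2)] by auto
qed

lemma matrix_elem_right:
  assumes "r \<in> carrier R" "x \<in> carrier (matrix_ring n R)" "i < n" "j < n" "a < n"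
  shows "(x \<otimes>\<^bsub>matrix_ring n R\<^esub> elem_mat n R a b r) (i, j) = (if j = b then x (i, a) \<otimes> r else \<zero>)"
proof -
  have "(x \<otimes>\<^bsub>matrix_ring n R\<^esub> elem_mat n R a b r) (i, j)
      = (\<Oplus>k\<in>{..<n}. if k = a then (if j = b then x (i, a) \<otimes> r else \<zero>) else \<zero>)"
    unfolding matrix_mult_entry[OF assms(3,4)]
    using assms matrix_closed[OF assms(2)] by (intro finsum_cong') (auto simp: elem_mat_entry)
  then show ?thesis using finsum_delta[of "{..<n}" a "if j = b then x (i, a) \<otimes> r else \<zero>"] assms
      matrix_closed[OF assms(2)] by auto
qed

lemma elem_mat_mult:
  assumes "r \<in> carrier R" "s \<in> carrier R" "b < n" "c < n"
  shows "elem_mat n R a b r \<otimes>\<^bsub>matrix_ring n R\<^esub> elem_mat n R c d s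
    = (if b = c then elem_mat n R a d (r \<otimes> s) else \<zero>\<^bsub>matrix_ring n R\<^esub>)"
  by (rule matrix_eqI[of _ n R _ R])
    (use assms in \<open>auto simp: matrix_elem_left elem_mat_closed elem_mat_entry matrix_zero_entry
      intro!: matrix_mult_closed matrix_zero_closed\<close>)

lemma elem_mat_add:
  assumes "r \<in> carrier R" "s \<in> carrier R"
  shows "elem_mat n R a b (r \<oplus> s) = elem_mat n R a b r \<oplus>\<^bsub>matrix_ring n R\<^esub> elem_mat n R a b s"
  by (rule matrix_eqI[of _ n R _ R])
    (use assms in \<open>auto simp: elem_mat_closed elem_mat_entry matrix_add_entry intro!: matrix_add_closed\<close>)

lemma elem_mat_zero: "elem_mat n R a b \<zero> = \<zero>\<^bsub>matrix_ring n R\<^esub>"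
  by (rule matrix_eqI[of _ n R _ R])
    (auto simp: elem_mat_closed elem_mat_entry matrix_zero_entry intro!: matrix_zero_closed)

lemma elem_mat_sandwich:
  assumes "r \<in> carrier R" "s \<in> carrier R" "x \<in> carrier (matrix_ring n R)" "b < n" "c < n"
  shows "elem_mat n R a b r \<otimes>\<^bsub>matrix_ring n R\<^esub> x \<otimes>\<^bsub>matrix_ring n R\<^esub> elem_mat n R c d s
     = elem_mat n R a d (r \<otimes> x (b, c) \<otimes> s)"
  by (rule matrix_eqI[of _ n R _ R])
    (use assms matrix_closed[OF assms(3)] in \<open>auto simp: matrix_elem_right matrix_elem_left elem_mat_closed elem_mat_entry
      matrix_mult_closed intro!: matrix_mult_closed elem_mat_closed\<close>)

text \<open>The embedding of \<open>R\<close> as the corner at position (0, 0) is multiplicative and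
  additive but not unital.\<close>

lemma has_type_elem_mat:
  assumes "has_type R I p f M" "0 < n"
  shows "has_type (matrix_ring n R) I (\<lambda>t. elem_mat n R 0 0 (p t)) (elem_mat n R 0 0 f) M"
  by (rule has_type_hom[OF assms(1) ring_axioms])
    (use assms(2) in \<open>auto simp: elem_mat_closed elem_mat_mult elem_mat_add elem_mat_zero\<close>)

lemma elem_mat_eqv:
  assumes "a < n" "b < n"
  shows "idem_eqv (matrix_ring n R) (elem_mat n R a a \<one>) (elem_mat n R b b \<one>)"
  unfolding idem_eqv_def using assms
  by (intro bexI[of _ "elem_mat n R a b \<one>"] bexI[of _ "elem_mat n R b a \<one>"]) (auto simp: elem_mat_mult elem_mat_closed)

text \<open>The ring stays fixed while the diagonal grows, so that the computation of the type of
  the unit can be an induction.\<close>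

lemma has_type_partial_identity:
  assumes "has_type (matrix_ring n R) I p (elem_mat n R 0 0 \<one>) M" "m \<le> n" "0 < n"
  shows "has_type (matrix_ring n R) I p (\<lambda>(i, j)\<in>{..<n} \<times> {..<n}. if i = j \<and> i < m then \<one> else \<zero>) (repeat_mset m M)"
  using assms(2)
proof (induction m)
  case 0
  have 0: "(\<lambda>(i, j)\<in>{..<n} \<times> {..<n}. if i = j \<and> i < (0::nat) then \<one> else \<zero>) = \<zero>\<^bsub>matrix_ring n R\<^esub>"
    by (rule matrix_eqI[of _ n R _ R]) (auto simp: matrix_zero_entry matrix_zero_closed intro!: matrix_memI)
  show ?case unfolding 0 using has_type.zero[of "matrix_ring n R" I p] by simp
next
  case (Suc m)
  interpret M: ring "matrix_ring n R" by (rule matrix_ring_ring)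
  let ?D = "\<lambda>m. \<lambda>(i, j)\<in>{..<n} \<times> {..<n}. if i = j \<and> i < (m::nat) then \<one> else \<zero>"
  let ?e = "elem_mat n R m m \<one>"
  have D: "?D m \<in> carrier (matrix_ring n R)" for m by (rule matrix_memI) auto
  have e: "?e \<in> carrier (matrix_ring n R)" by (simp add: elem_mat_closed)
  have 1: "has_type (matrix_ring n R) I p ?e M"
    using M.has_type_eqv[OF assms(1) elem_mat_eqv] Suc.prems assms(3) by auto
  have 2: "?D m \<otimes>\<^bsub>matrix_ring n R\<^esub> ?e = \<zero>\<^bsub>matrix_ring n R\<^esub>"
    by (rule matrix_eqI[of _ n R _ R]) (use D e Suc.prems in \<open>auto simp: matrix_elem_right matrix_zero_entry\<close>)
  have 3: "?e \<otimes>\<^bsub>matrix_ring n R\<^esub> ?D m = \<zero>\<^bsub>matrix_ring n R\<^esub>"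
    by (rule matrix_eqI[of _ n R _ R]) (use D e Suc.prems in \<open>auto simp: matrix_elem_left matrix_zero_entry\<close>)
  have 4: "?D (Suc m) = ?D m \<oplus>\<^bsub>matrix_ring n R\<^esub> ?e"
    by (rule matrix_eqI[of _ n R _ R]) (use D[of "Suc m"] D[of m] e in \<open>auto simp: matrix_add_entry elem_mat_entry\<close>)
  from M.has_type_sum[OF 1 Suc.IH 2 3] Suc.prems show ?case unfolding 4 by (simp add: union_commute)
qed

lemma has_type_matrix_one:
  assumes "has_type (matrix_ring n R) I p (elem_mat n R 0 0 \<one>) M" "0 < n"
  shows "has_type (matrix_ring n R) I p \<one>\<^bsub>matrix_ring n R\<^esub> (repeat_mset n M)"
proof -
  have "(\<lambda>(i, j)\<in>{..<n} \<times> {..<n}. if i = j \<and> i < n then \<one> else \<zero>) = \<one>\<^bsub>matrix_ring n R\<^esub>"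
    by (rule matrix_eqI[of _ n R _ R]) (auto simp: matrix_one_entry matrix_one_closed intro!: matrix_memI)
  then show ?thesis using has_type_partial_identity[OF assms(1) order_refl assms(2)] by simp
qed

lemma matrix_finsum_entry:
  assumes "finite S" "f \<in> S \<rightarrow> carrier (matrix_ring n R)" "i < n" "j < n"
  shows "finsum (matrix_ring n R) f S (i, j) = (\<Oplus>s\<in>S. f s (i, j))"
proof -
  interpret M: ring "matrix_ring n R" by (rule matrix_ring_ring)
  show ?thesis using assms(1,2)
  proof (induction rule: finite_induct)
    case empty
    then show ?case using assms(3,4) by (simp add: matrix_zero_entry)
  next
    case (insert a S)
    then show ?case using assms(3,4)
      by (subst M.finsum_insert, auto simp: matrix_add_entry Pi_iff)
        (subst finsum_insert, auto simp: Pi_iff matrix_closed)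
  qed
qed

lemma matrix_reshape: "matrix_ring (k * n) R \<simeq> matrix_ring k (matrix_ring n R)"
\<comment> \<open>For \<open>n = 0\<close> there is no division by \<open>n\<close> to define the
  inverse, but both rings have a single element.\<close>
proof (cases "n = 0")
  case True
  interpret M: ring "matrix_ring n R" by (rule matrix_ring_ring)
  have c: "carrier (matrix_ring (k * n) R) = {\<lambda>x. undefined}" "carrier (matrix_ring n R) = {\<lambda>x. undefined}"
    using True by (simp_all add: matrix_ring_carrier)
  have "\<zero>\<^bsub>matrix_ring k (matrix_ring n R)\<^esub> \<in> carrier (matrix_ring k (matrix_ring n R))"
    by (rule M.matrix_zero_closed)
  then have c3: "carrier (matrix_ring k (matrix_ring n R)) = {\<zero>\<^bsub>matrix_ring k (matrix_ring n R)\<^esub>}"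
    unfolding matrix_ring_carrier[of k] c by auto
  have x: "x = \<zero>\<^bsub>matrix_ring k (matrix_ring n R)\<^esub>" if "x \<in> carrier (matrix_ring k (matrix_ring n R))" for x
    using that c3 by auto
  have "(\<lambda>_. \<zero>\<^bsub>matrix_ring k (matrix_ring n R)\<^esub>) \<in> ring_iso (matrix_ring (k * n) R) (matrix_ring k (matrix_ring n R))"
  proof (rule ring_iso_memI)
    show "bij_betw (\<lambda>_. \<zero>\<^bsub>matrix_ring k (matrix_ring n R)\<^esub>) (carrier (matrix_ring (k * n) R)) (carrier (matrix_ring k (matrix_ring n R)))"
      unfolding c3 c by (simp add: bij_betw_def)
  qed (metis x M.matrix_zero_closed M.matrix_mult_closed M.matrix_add_closed M.matrix_one_closed)+
  then show ?thesis unfolding is_ring_iso_def by blast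
next
  case False
  interpret M: ring "matrix_ring n R" by (rule matrix_ring_ring)
  interpret MM: ring "matrix_ring k (matrix_ring n R)" by (rule M.matrix_ring_ring)
  interpret N: ring "matrix_ring (k * n) R" by (rule matrix_ring_ring)
  define \<phi> where "\<phi> U = (\<lambda>(I, J)\<in>{..<k} \<times> {..<k}. \<lambda>(i, j)\<in>{..<n} \<times> {..<n}. U (I * n + i, J * n + j))" for U :: "nat \<times> nat \<Rightarrow> 'a"
  define \<psi> where "\<psi> V = (\<lambda>(a, b)\<in>{..<k * n} \<times> {..<k * n}. V (a div n, b div n) (a mod n, b mod n))" for V :: "nat \<times> nat \<Rightarrow> nat \<times> nat \<Rightarrow> 'a"
  have lt: "L * n + l < k * n" if "L < k" "l < n" for L l
  proof -
    have "L * n + l < L * n + n" using that by simp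
    also have "\<dots> \<le> k * n" using mult_le_mono1[of "Suc L" k n] that by simp
    finally show ?thesis .
  qed
  have dv: "a div n < k" "a mod n < n" if "a < k * n" for a
    using that False by (simp_all add: less_mult_imp_div_less)
  have phi_in: "(\<lambda>(i, j)\<in>{..<n} \<times> {..<n}. U (I * n + i, J * n + j)) \<in> carrier (matrix_ring n R)"
    if "U \<in> carrier (matrix_ring (k * n) R)" "I < k" "J < k" for U I J
    by (rule matrix_memI) (use that lt in \<open>simp add: matrix_closed\<close>)
  have phi_c: "\<phi> U \<in> carrier (matrix_ring k (matrix_ring n R))" if "U \<in> carrier (matrix_ring (k * n) R)" for U
    unfolding \<phi>_def by (rule matrix_memI) (rule phi_in[OF that])
  have psi_c: "\<psi> V \<in> carrier (matrix_ring (k * n) R)" if "V \<in> carrier (matrix_ring k (matrix_ring n R))" for V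
    unfolding \<psi>_def by (rule matrix_memI, rule matrix_closed, rule matrix_closed) (use that dv in auto)
  have ent: "\<phi> U (I, J) (i, j) = U (I * n + i, J * n + j)" if "I < k" "J < k" "i < n" "j < n" for U I J i j
    using that unfolding \<phi>_def by simp
  have eqI: "V = W" if V: "V \<in> carrier (matrix_ring k (matrix_ring n R))" and W: "W \<in> carrier (matrix_ring k (matrix_ring n R))"
    and e: "\<And>I J i j. \<lbrakk>I < k; J < k; i < n; j < n\<rbrakk> \<Longrightarrow> V (I, J) (i, j) = W (I, J) (i, j)" for V W
    by (rule matrix_eqI[OF V W], rule matrix_eqI[of _ n R _ R]) (use V W e in \<open>simp_all add: matrix_closed\<close>)
  have "\<phi> \<in> ring_iso (matrix_ring (k * n) R) (matrix_ring k (matrix_ring n R))"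
  proof (rule ring_iso_memI)
    show "bij_betw \<phi> (carrier (matrix_ring (k * n) R)) (carrier (matrix_ring k (matrix_ring n R)))"
    proof (rule bij_betw_byWitness[where f' = \<psi>])
      show "\<forall>U\<in>carrier (matrix_ring (k * n) R). \<psi> (\<phi> U) = U"
      proof
        fix U assume U: "U \<in> carrier (matrix_ring (k * n) R)"
        show "\<psi> (\<phi> U) = U"
          by (rule matrix_eqI[OF psi_c[OF phi_c[OF U]] U]) (use dv in \<open>auto simp: \<psi>_def ent\<close>)
      qed
      show "\<forall>V\<in>carrier (matrix_ring k (matrix_ring n R)). \<phi> (\<psi> V) = V"
      proof
        fix V assume V: "V \<in> carrier (matrix_ring k (matrix_ring n R))"
        show "\<phi> (\<psi> V) = V"
          by (rule eqI[OF phi_c[OF psi_c[OF V]] V]) (use lt False in \<open>auto simp: \<psi>_def ent\<close>)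
      qed
    qed (use phi_c psi_c in auto)
  next
    fix U V assume U: "U \<in> carrier (matrix_ring (k * n) R)" and V: "V \<in> carrier (matrix_ring (k * n) R)"
    show "\<phi> (U \<oplus>\<^bsub>matrix_ring (k * n) R\<^esub> V) = \<phi> U \<oplus>\<^bsub>matrix_ring k (matrix_ring n R)\<^esub> \<phi> V"
      by (rule eqI) (use phi_c U V lt in \<open>auto simp: ent matrix_add_entry\<close>)
    show "\<phi> (U \<otimes>\<^bsub>matrix_ring (k * n) R\<^esub> V) = \<phi> U \<otimes>\<^bsub>matrix_ring k (matrix_ring n R)\<^esub> \<phi> V"
    proof (rule eqI)
      fix I J i j assume ij: "I < k" "J < k" "i < n" "j < n"
      have cl: "U (I * n + i, q) \<otimes> V (q, J * n + j) \<in> carrier R" if "q < k * n" for q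
        using ij lt U V that by (simp add: matrix_closed)
      have "\<phi> (U \<otimes>\<^bsub>matrix_ring (k * n) R\<^esub> V) (I, J) (i, j)
          = (\<Oplus>q\<in>{..<k * n}. U (I * n + i, q) \<otimes> V (q, J * n + j))"
        using ij lt by (simp add: ent matrix_mult_entry)
      also have "\<dots> = (\<Oplus>L\<in>{..<k}. \<Oplus>l\<in>{..<n}. U (I * n + i, L * n + l) \<otimes> V (L * n + l, J * n + j))"
        using cl by (rule finsum_blocks)
      also have "\<dots> = (\<Oplus>L\<in>{..<k}. (\<phi> U (I, L) \<otimes>\<^bsub>matrix_ring n R\<^esub> \<phi> V (L, J)) (i, j))"
        using ij lt cl by (intro finsum_cong' refl) (auto simp: matrix_mult_entry ent Pi_iff intro!: finsum_closed finsum_cong')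
      also have "\<dots> = (\<phi> U \<otimes>\<^bsub>matrix_ring k (matrix_ring n R)\<^esub> \<phi> V) (I, J) (i, j)"
        unfolding matrix_mult_entry[OF ij(1,2)]
        by (rule matrix_finsum_entry[symmetric]) (use ij phi_c[OF U] phi_c[OF V] in \<open>auto simp: matrix_closed\<close>)
      finally show "\<phi> (U \<otimes>\<^bsub>matrix_ring (k * n) R\<^esub> V) (I, J) (i, j)
          = (\<phi> U \<otimes>\<^bsub>matrix_ring k (matrix_ring n R)\<^esub> \<phi> V) (I, J) (i, j)" .
    qed (use phi_c U V in auto)
  next
    show "\<phi> \<one>\<^bsub>matrix_ring (k * n) R\<^esub> = \<one>\<^bsub>matrix_ring k (matrix_ring n R)\<^esub>"
    proof (rule eqI)
      fix I J i j assume ij: "I < k" "J < k" "i < n" "j < n"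
      have "I * n + i = J * n + j \<longleftrightarrow> I = J \<and> i = j"
        using ij by (metis False div_mult_self3 div_less add.right_neutral mod_mult_self3 mod_less)
      then show "\<phi> \<one>\<^bsub>matrix_ring (k * n) R\<^esub> (I, J) (i, j) = \<one>\<^bsub>matrix_ring k (matrix_ring n R)\<^esub> (I, J) (i, j)"
        using ij lt by (simp add: ent matrix_one_entry matrix_zero_entry)
    qed (use phi_c in auto)
  qed (use phi_c in auto)
  then show ?thesis unfolding is_ring_iso_def by blast
qed

end

lemma matrix_ring_cong_iso:
  assumes "ring R" "ring S" "R \<simeq> S"
  shows "matrix_ring n R \<simeq> matrix_ring n S"
proof -
  interpret R: ring R by fact
  interpret S: ring S by fact
  obtain h where h: "h \<in> ring_iso R S" using assms(3) unfolding is_ring_iso_def by blast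
  then have hh: "h \<in> ring_hom R S" and b: "bij_betw h (carrier R) (carrier S)" unfolding ring_iso_def by auto
  define g where "g = inv_into (carrier R) h"
  have g: "g \<in> ring_iso S R" unfolding g_def using ring_iso_set_sym[OF assms(1) h] by simp
  have gc: "g y \<in> carrier R" "h (g y) = y" if "y \<in> carrier S" for y
    using that b unfolding g_def by (auto simp: bij_betw_inv_into_right inv_into_into bij_betw_def)
  have gh: "g (h x) = x" if "x \<in> carrier R" for x
    using that b unfolding g_def by (simp add: bij_betw_inv_into_left)
  note hc = ring_hom_closed[OF hh]
  define \<phi> where "\<phi> U = (\<lambda>(i, j)\<in>{..<n} \<times> {..<n}. h (U (i, j)))" for U :: "nat \<times> nat \<Rightarrow> 'a"
  define \<psi> where "\<psi> U = (\<lambda>(i, j)\<in>{..<n} \<times> {..<n}. g (U (i, j)))" for U :: "nat \<times> nat \<Rightarrow> 'c"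
  have phi_c: "\<phi> U \<in> carrier (matrix_ring n S)" if "U \<in> carrier (matrix_ring n R)" for U
    unfolding \<phi>_def using that by (intro matrix_memI hc) (simp add: matrix_closed)
  have psi_c: "\<psi> U \<in> carrier (matrix_ring n R)" if "U \<in> carrier (matrix_ring n S)" for U
    unfolding \<psi>_def using that by (intro matrix_memI gc) (simp add: matrix_closed)
  interpret MR: ring "matrix_ring n R" by (rule R.matrix_ring_ring)
  interpret MS: ring "matrix_ring n S" by (rule S.matrix_ring_ring)
  have "\<phi> \<in> ring_iso (matrix_ring n R) (matrix_ring n S)"
  proof (rule ring_iso_memI)
    show "bij_betw \<phi> (carrier (matrix_ring n R)) (carrier (matrix_ring n S))"
    proof (rule bij_betw_byWitness[where f' = \<psi>])
      show "\<forall>U\<in>carrier (matrix_ring n R). \<psi> (\<phi> U) = U"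
      proof
        fix U assume U: "U \<in> carrier (matrix_ring n R)"
        show "\<psi> (\<phi> U) = U"
          by (rule matrix_eqI[OF psi_c[OF phi_c[OF U]] U]) (use U in \<open>simp add: \<psi>_def \<phi>_def gh matrix_closed\<close>)
      qed
      show "\<forall>U\<in>carrier (matrix_ring n S). \<phi> (\<psi> U) = U"
      proof
        fix U assume U: "U \<in> carrier (matrix_ring n S)"
        show "\<phi> (\<psi> U) = U"
          by (rule matrix_eqI[OF phi_c[OF psi_c[OF U]] U]) (use U in \<open>simp add: \<psi>_def \<phi>_def gc matrix_closed\<close>)
      qed
    qed (use phi_c psi_c in auto)
  next
    fix U V assume U: "U \<in> carrier (matrix_ring n R)" and V: "V \<in> carrier (matrix_ring n R)"
    show "\<phi> (U \<oplus>\<^bsub>matrix_ring n R\<^esub> V) = \<phi> U \<oplus>\<^bsub>matrix_ring n S\<^esub> \<phi> V"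
      by (rule matrix_eqI[of _ n S _ S])
        (use U V phi_c in \<open>auto simp: matrix_add_entry \<phi>_def matrix_closed ring_hom_add[OF hh] 
          intro!: MS.a_closed\<close>)
    show "\<phi> (U \<otimes>\<^bsub>matrix_ring n R\<^esub> V) = \<phi> U \<otimes>\<^bsub>matrix_ring n S\<^esub> \<phi> V"
    proof (rule matrix_eqI[of _ n S _ S])
      fix i j assume ij: "i < n" "j < n"
      have cl: "U (i, k) \<in> carrier R" "V (k, j) \<in> carrier R" if "k < n" for k
        using U V ij that by (simp_all add: matrix_closed)
      have "\<phi> (U \<otimes>\<^bsub>matrix_ring n R\<^esub> V) (i, j) = h (\<Oplus>\<^bsub>R\<^esub>k\<in>{..<n}. U (i, k) \<otimes>\<^bsub>R\<^esub> V (k, j))"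
        using ij by (simp add: \<phi>_def matrix_mult_entry)
      also have "\<dots> = (\<Oplus>\<^bsub>S\<^esub>k\<in>{..<n}. h (U (i, k) \<otimes>\<^bsub>R\<^esub> V (k, j)))"
        by (rule finsum_hom[OF assms(1,2) hh]) (use cl in auto)
      also have "\<dots> = (\<phi> U \<otimes>\<^bsub>matrix_ring n S\<^esub> \<phi> V) (i, j)"
        unfolding matrix_mult_entry[OF ij]
        by (rule S.finsum_cong') (use ij cl in \<open>auto simp: \<phi>_def ring_hom_mult[OF hh] intro!: S.m_closed hc\<close>)
      finally show "\<phi> (U \<otimes>\<^bsub>matrix_ring n R\<^esub> V) (i, j) = (\<phi> U \<otimes>\<^bsub>matrix_ring n S\<^esub> \<phi> V) (i, j)" .
    qed (use U V phi_c in auto)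
  next
    have "h \<zero>\<^bsub>R\<^esub> = \<zero>\<^bsub>S\<^esub>" by (rule ring_hom_zero[OF hh assms(1,2)])
    then show "\<phi> \<one>\<^bsub>matrix_ring n R\<^esub> = \<one>\<^bsub>matrix_ring n S\<^esub>"
      by (intro matrix_eqI[of _ n S _ S])
        (use phi_c in \<open>auto simp: \<phi>_def matrix_one_entry ring_hom_one[OF hh]\<close>)
  qed (use phi_c in auto)
  then show ?thesis unfolding is_ring_iso_def by blast
qed

section \<open>Cancellation in locally framed rings\<close>

text \<open>The corner of the matrix ring at \<open>elem_mat n R 0 0 (p t)\<close> is a copy of the
  corner of \<open>R\<close> at \<open>p t\<close>. Hence the corner axioms are transferred along
  the entry at (0, 0).\<close>

lemma matricial_frame_matrix:
  fixes R (structure)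
  assumes "matricial_frame R I p" "0 < n"
  shows "matricial_frame (matrix_ring n R) I (\<lambda>t. elem_mat n R 0 0 (p t))"
proof -
  interpret matricial_frame R I p by fact
  interpret M: ring "matrix_ring n R" by (rule matrix_ring_ring)
  let ?M = "matrix_ring n R" and ?e = "elem_mat n R 0 0"
  have sw: "?e r \<otimes>\<^bsub>?M\<^esub> x \<otimes>\<^bsub>?M\<^esub> ?e s = ?e (r \<otimes> x (0, 0) \<otimes> s)"
    if "r \<in> carrier R" "s \<in> carrier R" "x \<in> carrier ?M" for r s x
    using elem_mat_sandwich[OF that] assms(2) by simp
  have e00: "?e r (0, 0) = r" for r using assms(2) by (simp add: elem_mat_entry)
  have em: "?e r \<otimes>\<^bsub>?M\<^esub> ?e s = ?e (r \<otimes> s)" if "r \<in> carrier R" "s \<in> carrier R" for r s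
    using that assms(2) by (simp add: elem_mat_mult)
  note ec = elem_mat_closed
  \<comment> \<open>Elements of the corner are determined by their entry at (0, 0).\<close>
  have cor: "x = ?e (x (0, 0)) \<and> p t \<otimes> x (0, 0) = x (0, 0) \<and> x (0, 0) \<otimes> p t = x (0, 0) \<and> x (0, 0) \<in> carrier R"
    if t: "t \<in> I" and x: "x \<in> carrier ?M" and l: "?e (p t) \<otimes>\<^bsub>?M\<^esub> x = x" and r: "x \<otimes>\<^bsub>?M\<^esub> ?e (p t) = x" for t x
  proof -
    have x00: "x (0, 0) \<in> carrier R" using x assms(2) by (simp add: matrix_closed)
    have eq: "x = ?e (p t \<otimes> x (0, 0) \<otimes> p t)" using sw[OF p_closed[OF t] p_closed[OF t] x] l r by simp
    then have e: "x (0, 0) = p t \<otimes> x (0, 0) \<otimes> p t" using e00 by metis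
    have "p t \<otimes> (p t \<otimes> x (0, 0) \<otimes> p t) = p t \<otimes> x (0, 0) \<otimes> p t"
      using p_closed[OF t] x00 p_idem[OF t] by (simp add: m_assoc[symmetric])
    moreover have "(p t \<otimes> x (0, 0) \<otimes> p t) \<otimes> p t = p t \<otimes> x (0, 0) \<otimes> p t"
      using p_closed[OF t] x00 p_idem[OF t] by (simp add: m_assoc)
    ultimately show ?thesis using e eq x00 by simp
  qed
  show ?thesis
  proof (unfold_locales)
    fix t assume t: "t \<in> I"
    show "?e (p t) \<in> carrier ?M" using p_closed[OF t] by (rule ec)
    show "?e (p t) \<otimes>\<^bsub>?M\<^esub> ?e (p t) = ?e (p t)" using p_closed[OF t] p_idem[OF t] em by simp
    show "?e (p t) \<noteq> \<zero>\<^bsub>?M\<^esub>"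
      using e00[of "p t"] p_nonzero[OF t] matrix_zero_entry[of 0 n 0 R] assms(2) by auto
  next
    fix s t x assume a: "s \<in> I" "t \<in> I" "s \<noteq> t" "x \<in> carrier ?M"
    show "?e (p s) \<otimes>\<^bsub>?M\<^esub> x \<otimes>\<^bsub>?M\<^esub> ?e (p t) = \<zero>\<^bsub>?M\<^esub>"
      using sw[of "p s" "p t" x] a p_closed p_orth[of s t "x (0, 0)"] matrix_closed[of x n R 0 0] assms(2)
      by (simp add: elem_mat_zero)
  next
    fix t x assume a: "t \<in> I" "x \<in> carrier ?M"
    have x00: "x (0, 0) \<in> carrier R" using a assms(2) by (simp add: matrix_closed)
    obtain z where z: "z \<in> carrier R" "\<And>b. b \<in> carrier R \<Longrightarrow> z \<otimes> b = b \<otimes> z" "p t \<otimes> x (0, 0) \<otimes> p t = z \<otimes> p t"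
      using p_central[OF a(1) x00] by blast
    \<comment> \<open>The scalar matrix of \<open>z\<close> is central in the whole matrix ring, as
      \<open>p_central\<close> requires; \<open>elem_mat\<close> of \<open>z\<close> would be
      central in the corner only.\<close>
    let ?z = "\<lambda>(i, j)\<in>{..<n} \<times> {..<n}. if i = j then z else \<zero>"
    have zc: "?z \<in> carrier ?M" by (rule matrix_memI) (use z in simp)
    have zl: "(?z \<otimes>\<^bsub>?M\<^esub> b) (i, j) = z \<otimes> b (i, j)" and zr: "(b \<otimes>\<^bsub>?M\<^esub> ?z) (i, j) = b (i, j) \<otimes> z"
      if b: "b \<in> carrier ?M" and ij: "i < n" "j < n" for b i j
    proof -
      have "(?z \<otimes>\<^bsub>?M\<^esub> b) (i, j) = (\<Oplus>k\<in>{..<n}. if k = i then z \<otimes> b (i, j) else \<zero>)"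
        unfolding matrix_mult_entry[OF ij] by (rule finsum_cong') (use b ij z in \<open>auto simp: matrix_closed\<close>)
      then show "(?z \<otimes>\<^bsub>?M\<^esub> b) (i, j) = z \<otimes> b (i, j)"
        using finsum_delta[of "{..<n}" i "z \<otimes> b (i, j)"] b ij z by (simp add: matrix_closed)
      have "(b \<otimes>\<^bsub>?M\<^esub> ?z) (i, j) = (\<Oplus>k\<in>{..<n}. if k = j then b (i, j) \<otimes> z else \<zero>)"
        unfolding matrix_mult_entry[OF ij] by (rule finsum_cong') (use b ij z in \<open>auto simp: matrix_closed\<close>)
      then show "(b \<otimes>\<^bsub>?M\<^esub> ?z) (i, j) = b (i, j) \<otimes> z"
        using finsum_delta[of "{..<n}" j "b (i, j) \<otimes> z"] b ij z by (simp add: matrix_closed)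
    qed
    show "\<exists>z\<in>carrier ?M. (\<forall>b\<in>carrier ?M. z \<otimes>\<^bsub>?M\<^esub> b = b \<otimes>\<^bsub>?M\<^esub> z) \<and>
      ?e (p t) \<otimes>\<^bsub>?M\<^esub> x \<otimes>\<^bsub>?M\<^esub> ?e (p t) = z \<otimes>\<^bsub>?M\<^esub> ?e (p t)"
    proof (intro bexI[OF _ zc] conjI ballI)
      fix b assume b: "b \<in> carrier ?M"
      show "?z \<otimes>\<^bsub>?M\<^esub> b = b \<otimes>\<^bsub>?M\<^esub> ?z"
        by (rule matrix_eqI[of _ n R _ R]) (use b zc z zl zr in \<open>simp_all add: matrix_closed\<close>)
    next
      have "?e (p t) \<otimes>\<^bsub>?M\<^esub> x \<otimes>\<^bsub>?M\<^esub> ?e (p t) = ?e (z \<otimes> p t)" using sw p_closed a z by simp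
      also have "\<dots> = ?z \<otimes>\<^bsub>?M\<^esub> ?e (p t)"
        by (rule matrix_eqI[of _ n R _ R])
          (use zc z zl p_closed[OF a(1)] in \<open>simp_all add: elem_mat_closed elem_mat_entry\<close>)
      finally show "?e (p t) \<otimes>\<^bsub>?M\<^esub> x \<otimes>\<^bsub>?M\<^esub> ?e (p t) = ?z \<otimes>\<^bsub>?M\<^esub> ?e (p t)" .
    qed
  next
    fix t c d assume t: "t \<in> I" and a: "c \<in> carrier ?M" "d \<in> carrier ?M" "?e (p t) \<otimes>\<^bsub>?M\<^esub> c = c" "c \<otimes>\<^bsub>?M\<^esub> ?e (p t) = c"
      "?e (p t) \<otimes>\<^bsub>?M\<^esub> d = d" "d \<otimes>\<^bsub>?M\<^esub> ?e (p t) = d" and cd: "c \<otimes>\<^bsub>?M\<^esub> d = \<zero>\<^bsub>?M\<^esub>"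
    note c = cor[OF t a(1,3,4)] and d = cor[OF t a(2,5,6)]
    have "?e (c (0, 0) \<otimes> d (0, 0)) = \<zero>\<^bsub>?M\<^esub>" using em c d cd by metis
    then have "c (0, 0) \<otimes> d (0, 0) = \<zero>" using e00 matrix_zero_entry[of 0 n 0 R] assms(2) by metis
    then have "c (0, 0) = \<zero> \<or> d (0, 0) = \<zero>" using p_domain[OF t] c d by blast
    then show "c = \<zero>\<^bsub>?M\<^esub> \<or> d = \<zero>\<^bsub>?M\<^esub>" using c d elem_mat_zero by metis
  next
    fix t J assume t: "t \<in> I" and J: "J \<subseteq> carrier ?M" "\<zero>\<^bsub>?M\<^esub> \<in> J"
      "\<And>x. x \<in> J \<Longrightarrow> ?e (p t) \<otimes>\<^bsub>?M\<^esub> x = x \<and> x \<otimes>\<^bsub>?M\<^esub> ?e (p t) = x"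
      "\<And>x y. \<lbrakk>x \<in> J; y \<in> J\<rbrakk> \<Longrightarrow> x \<oplus>\<^bsub>?M\<^esub> y \<in> J"
      "\<And>x b. \<lbrakk>x \<in> J; b \<in> carrier ?M\<rbrakk> \<Longrightarrow> x \<otimes>\<^bsub>?M\<^esub> b \<otimes>\<^bsub>?M\<^esub> ?e (p t) \<in> J"
    have jc: "x = ?e (x (0, 0))" "p t \<otimes> x (0, 0) = x (0, 0)" "x (0, 0) \<otimes> p t = x (0, 0)" "x (0, 0) \<in> carrier R"
      if x: "x \<in> J" for x
      using cor[OF t] J(1,3) x by blast+
    define J0 where "J0 = (\<lambda>x. x (0, 0)) ` J"
    have m: "x (0, 0) \<in> J0" if "x \<in> J" for x using that unfolding J0_def by blast
    have "\<exists>a\<in>J0. \<forall>x\<in>J0. \<exists>b\<in>carrier R. p t \<otimes> b = b \<and> b \<otimes> p t = b \<and> x = a \<otimes> b"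
    proof (rule p_principal[OF t])
      show "J0 \<subseteq> carrier R" unfolding J0_def using jc(4) by blast
      show "\<zero> \<in> J0" using m[OF J(2)] assms(2) by (simp add: matrix_zero_entry)
    next
      fix x assume "x \<in> J0" then show "p t \<otimes> x = x \<and> x \<otimes> p t = x" unfolding J0_def using jc(2,3) by auto
    next
      fix x y assume "x \<in> J0" "y \<in> J0"
      then obtain x' y' where xy: "x' \<in> J" "x = x' (0, 0)" "y' \<in> J" "y = y' (0, 0)" unfolding J0_def by blast
      then show "x \<oplus> y \<in> J0" using m[OF J(4)[OF xy(1,3)]] assms(2) by (simp add: matrix_add_entry)
    next
      fix x b assume b: "x \<in> J0" "b \<in> carrier R"
      then obtain x' where x: "x' \<in> J" "x = x' (0, 0)" unfolding J0_def by blast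
      have 1: "?e x \<otimes>\<^bsub>?M\<^esub> ?e b \<otimes>\<^bsub>?M\<^esub> ?e (p t) \<in> J" using J(5)[OF x(1) ec[OF b(2)]] jc(1)[OF x(1)] x(2) by metis
      have 2: "?e x \<otimes>\<^bsub>?M\<^esub> ?e b \<otimes>\<^bsub>?M\<^esub> ?e (p t) = ?e (x \<otimes> b \<otimes> p t)"
        using em jc(4)[OF x(1)] x(2) b(2) p_closed[OF t] by simp
      show "x \<otimes> b \<otimes> p t \<in> J0" using m[OF 1] unfolding 2 e00 .
    qed
    then obtain a where a: "a \<in> J" and g: "\<And>x. x \<in> J0 \<Longrightarrow> \<exists>b\<in>carrier R. p t \<otimes> b = b \<and> b \<otimes> p t = b \<and> x = a (0, 0) \<otimes> b"
      unfolding J0_def by blast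
    show "\<exists>a\<in>J. \<forall>x\<in>J. \<exists>b\<in>carrier ?M. ?e (p t) \<otimes>\<^bsub>?M\<^esub> b = b \<and> b \<otimes>\<^bsub>?M\<^esub> ?e (p t) = b \<and> x = a \<otimes>\<^bsub>?M\<^esub> b"
    proof (intro bexI[OF _ a] ballI)
      fix x assume x: "x \<in> J"
      obtain b where b: "b \<in> carrier R" "p t \<otimes> b = b" "b \<otimes> p t = b" "x (0, 0) = a (0, 0) \<otimes> b" using g[OF m[OF x]] by blast
      have "x = ?e (a (0, 0)) \<otimes>\<^bsub>?M\<^esub> ?e b" using em jc(1)[OF x] jc(4)[OF a] b by simp
      then have "x = a \<otimes>\<^bsub>?M\<^esub> ?e b" using jc(1)[OF a] by simp
      then show "\<exists>b\<in>carrier ?M. ?e (p t) \<otimes>\<^bsub>?M\<^esub> b = b \<and> b \<otimes>\<^bsub>?M\<^esub> ?e (p t) = b \<and> x = a \<otimes>\<^bsub>?M\<^esub> b"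
        using em b p_closed[OF t] ec by metis
    qed
  next
    obtain M where "has_type R I p \<one> M" using one_type by blast
    from has_type_matrix_one[OF has_type_elem_mat[OF this assms(2)] assms(2)]
    show "\<exists>M. has_type ?M I (\<lambda>t. ?e (p t)) \<one>\<^bsub>?M\<^esub> M" by blast
  qed
qed

text \<open>A relation on records, because a matrix ring over a ring with restricted carrier is not
  literally a carrier update of the larger matrix ring: \<open>finsum\<close> depends on the
  carrier, so the multiplications need agree only on the smaller one.\<close>

definition subring_of :: "('a, 'm) ring_scheme \<Rightarrow> ('a, 'n) ring_scheme \<Rightarrow> bool" where
  "subring_of S T \<longleftrightarrow> ring S \<and> ring T \<and> carrier S \<subseteq> carrier T \<and> \<one>\<^bsub>S\<^esub> = \<one>\<^bsub>T\<^esub> \<and> \<zero>\<^bsub>S\<^esub> = \<zero>\<^bsub>T\<^esub> \<and>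
     (\<forall>x\<in>carrier S. \<forall>y\<in>carrier S. x \<otimes>\<^bsub>S\<^esub> y = x \<otimes>\<^bsub>T\<^esub> y \<and> x \<oplus>\<^bsub>S\<^esub> y = x \<oplus>\<^bsub>T\<^esub> y)"

lemma subring_ofD:
  assumes "subring_of S T"
  shows "ring S" "ring T" "x \<in> carrier S \<Longrightarrow> x \<in> carrier T" "\<one>\<^bsub>S\<^esub> = \<one>\<^bsub>T\<^esub>" "\<zero>\<^bsub>S\<^esub> = \<zero>\<^bsub>T\<^esub>"
    "\<lbrakk>x \<in> carrier S; y \<in> carrier S\<rbrakk> \<Longrightarrow> x \<otimes>\<^bsub>S\<^esub> y = x \<otimes>\<^bsub>T\<^esub> y"
    "\<lbrakk>x \<in> carrier S; y \<in> carrier S\<rbrakk> \<Longrightarrow> x \<oplus>\<^bsub>S\<^esub> y = x \<oplus>\<^bsub>T\<^esub> y"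
  using assms unfolding subring_of_def by auto

lemma subring_of_subring:
  assumes "subring B R" "ring R"
  shows "subring_of (R\<lparr>carrier := B\<rparr>) R"
  unfolding subring_of_def using assms ring.subring_is_ring[OF assms(2,1)] subringE(1)[OF assms(1)] by auto

lemma subring_of_matrix:
  assumes "subring_of S T"
  shows "subring_of (matrix_ring n S) (matrix_ring n T)"
proof -
  interpret S: ring S by (rule subring_ofD[OF assms])
  interpret T: ring T by (rule subring_ofD[OF assms])
  have hom: "id \<in> ring_hom S T" using subring_ofD[OF assms] by (intro ring_hom_memI) auto
  have c: "carrier (matrix_ring n S) \<subseteq> carrier (matrix_ring n T)"
    unfolding matrix_ring_carrier using subring_ofD(3)[OF assms] by auto
  show ?thesis unfolding subring_of_def
  proof (intro conjI ballI)
    show "\<one>\<^bsub>matrix_ring n S\<^esub> = \<one>\<^bsub>matrix_ring n T\<^esub>" "\<zero>\<^bsub>matrix_ring n S\<^esub> = \<zero>\<^bsub>matrix_ring n T\<^esub>"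
      using subring_ofD[OF assms] by (auto simp: matrix_ring_def)
    fix x y assume x: "x \<in> carrier (matrix_ring n S)" and y: "y \<in> carrier (matrix_ring n S)"
    show "x \<oplus>\<^bsub>matrix_ring n S\<^esub> y = x \<oplus>\<^bsub>matrix_ring n T\<^esub> y"
      by (rule matrix_eqI[of _ n S _ T])
        (use x y c subring_ofD(7)[OF assms] in \<open>auto simp: matrix_add_entry matrix_closed intro!: S.matrix_add_closed T.matrix_add_closed\<close>)
    show "x \<otimes>\<^bsub>matrix_ring n S\<^esub> y = x \<otimes>\<^bsub>matrix_ring n T\<^esub> y"
    proof (rule matrix_eqI[of _ n S _ T])
      fix i j assume ij: "i < n" "j < n"
      have "id (finsum S (\<lambda>k. x (i, k) \<otimes>\<^bsub>S\<^esub> y (k, j)) {..<n}) = finsum T (\<lambda>k. id (x (i, k) \<otimes>\<^bsub>S\<^esub> y (k, j))) {..<n}"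
        by (rule finsum_hom[OF S.ring_axioms T.ring_axioms hom]) (use ij x y in \<open>auto simp: matrix_closed\<close>)
      also have "\<dots> = finsum T (\<lambda>k. x (i, k) \<otimes>\<^bsub>T\<^esub> y (k, j)) {..<n}"
        by (rule T.finsum_cong')
          (use ij x y subring_ofD(3,6)[OF assms] in \<open>auto simp: matrix_closed Pi_iff intro!: T.m_closed\<close>)
      finally show "(x \<otimes>\<^bsub>matrix_ring n S\<^esub> y) (i, j) = (x \<otimes>\<^bsub>matrix_ring n T\<^esub> y) (i, j)"
        using ij by (simp add: matrix_mult_entry)
    qed (use x y c in \<open>auto intro!: S.matrix_mult_closed T.matrix_mult_closed\<close>)
  qed (use c S.matrix_ring_ring T.matrix_ring_ring in auto)
qed

lemma has_type_subring:
  assumes "has_type S I p f M" "subring_of S T"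
  shows "has_type T I p f M"
  using has_type_hom[OF assms(1) subring_ofD(1)[OF assms(2)], of "\<lambda>x. x" T] subring_ofD[OF assms(2)] by simp

lemma idem_eqv_subring:
  assumes "idem_eqv S e f" "subring_of S T"
  shows "idem_eqv T e f"
proof -
  interpret S: ring S by (rule subring_ofD[OF assms(2)])
  have "e \<in> carrier S" "f \<in> carrier S" using S.idem_eqvE[OF assms(1)] by metis+
  then show ?thesis
    using idem_eqv_hom[OF assms(1), of "\<lambda>x. x" T] subring_ofD[OF assms(2)] by simp
qed

text \<open>A derivation of \<open>has_type\<close> involves finitely many equivalences, each
  witnessed by two elements. A subring containing all the witnesses repeats the derivation.\<close>

lemma has_type_finite_support:
  fixes T :: "('a, 'm) ring_scheme"
  assumes "has_type T I p f M" "ring T"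
  shows "\<exists>A. finite A \<and> A \<subseteq> carrier T \<and> (\<forall>S. subring_of (S :: ('a, 'm) ring_scheme) T \<and> A \<subseteq> carrier S \<longrightarrow> has_type S I p f M)"
  using assms(1)
proof induction
  case zero
  show ?case by (rule exI[of _ "{}"]) (use has_type.zero subring_ofD(5) in \<open>metis empty_subsetI finite.emptyI\<close>)
next
  case (add f M t g)
  interpret T: ring T by fact
  obtain A where A: "finite A" "A \<subseteq> carrier T" "\<And>S::('a, 'm) ring_scheme. subring_of S T \<Longrightarrow> A \<subseteq> carrier S \<Longrightarrow> has_type S I p f M"
    using add.IH by blast
  obtain x y where xy: "x \<in> carrier T" "y \<in> carrier T" "x \<otimes>\<^bsub>T\<^esub> y = g" "y \<otimes>\<^bsub>T\<^esub> x = p t"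
    "g \<otimes>\<^bsub>T\<^esub> x = x" "x \<otimes>\<^bsub>T\<^esub> p t = x" "p t \<otimes>\<^bsub>T\<^esub> y = y" "y \<otimes>\<^bsub>T\<^esub> g = y"
    using T.idem_eqvE[OF add.hyps(3)] by metis
  show ?case
  proof (intro exI[of _ "A \<union> {x, y}"] conjI allI impI)
    fix S :: "('a, 'm) ring_scheme" assume S: "subring_of S T \<and> A \<union> {x, y} \<subseteq> carrier S"
    interpret S: ring S using subring_ofD(1) S by blast
    have f: "has_type S I p f M" using A(3) S by auto
    have s: "x \<in> carrier S" "y \<in> carrier S" "f \<in> carrier S" using S S.has_type_idem[OF f] by auto
    note agree = subring_ofD[of S T]
    have g: "g = x \<otimes>\<^bsub>S\<^esub> y" "p t = y \<otimes>\<^bsub>S\<^esub> x" using xy s agree(6) S by auto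
    then have gp: "g \<in> carrier S" "p t \<in> carrier S" using s by auto
    have "idem_eqv S g (p t)"
      by (rule S.idem_eqvI[of x y]) (use s g xy gp agree(6) S in auto)
    moreover have "f \<otimes>\<^bsub>S\<^esub> g = \<zero>\<^bsub>S\<^esub>" "g \<otimes>\<^bsub>S\<^esub> f = \<zero>\<^bsub>S\<^esub>" using add.hyps s gp agree(5,6) S by auto
    ultimately have "has_type S I p (f \<oplus>\<^bsub>S\<^esub> g) (add_mset t M)" using has_type.add[OF f add.hyps(2)] by blast
    then show "has_type S I p (f \<oplus>\<^bsub>T\<^esub> g) (add_mset t M)" using agree(7) S s gp by auto
  qed (use A xy in auto)
qed

text \<open>The part of being ultramatricial on which cancellation rests, in a form that passes to
  matrix rings. Index sets are taken in \<open>nat\<close>, since a formula cannot quantify over the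
  type of the indices.\<close>

definition locally_framed :: "('a, 'm) ring_scheme \<Rightarrow> bool" where
  "locally_framed T \<longleftrightarrow> ring T \<and> (\<forall>A. finite A \<and> A \<subseteq> carrier T \<longrightarrow>
     (\<exists>S (I :: nat set) p. subring_of (S :: ('a, 'm) ring_scheme) T \<and> A \<subseteq> carrier S \<and> matricial_frame S I p))"

text \<open>Finitely many matrices have finitely many entries, and these lie in one framed
  subring.\<close>

lemma locally_framed_matrix:
  fixes T :: "('a, 'm) ring_scheme"
  assumes "locally_framed T" "0 < n"
  shows "locally_framed (matrix_ring n T)"
  unfolding locally_framed_def
proof (intro conjI allI impI)
  interpret T: ring T using assms unfolding locally_framed_def by blast
  show "ring (matrix_ring n T)" by (rule T.matrix_ring_ring)
  fix A assume A: "finite A \<and> A \<subseteq> carrier (matrix_ring n T)"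
  let ?A = "\<Union>x\<in>A. x ` ({..<n} \<times> {..<n})"
  have "finite ?A" "?A \<subseteq> carrier T" using A by (auto simp: matrix_closed)
  then obtain S and I :: "nat set" and p where S: "subring_of (S :: ('a, 'm) ring_scheme) T" "?A \<subseteq> carrier S" "matricial_frame S I p"
    using assms(1) unfolding locally_framed_def by meson
  have "A \<subseteq> carrier (matrix_ring n S)"
  proof
    fix x assume x: "x \<in> A"
    then have "x \<in> carrier (matrix_ring n T)" using A by blast
    then show "x \<in> carrier (matrix_ring n S)" using S(2) x unfolding matrix_ring_carrier PiE_iff by blast
  qed
  then show "\<exists>S (I :: nat set) p. subring_of (S :: (nat \<times> nat \<Rightarrow> 'a) ring) (matrix_ring n T) \<and> A \<subseteq> carrier S \<and> matricial_frame S I p"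
    using subring_of_matrix[OF S(1)] matricial_frame_matrix[OF S(3) assms(2)] by blast
qed

lemma sum_mset_replicate_repeat: "sum_mset (replicate_mset k N) = repeat_mset k (N :: 'b multiset)"
  by (induction k) auto

text \<open>A type over \<open>unit\<close> counts copies of one idempotent. Both decompositions of
  the unit live in a common framed subring, where the types \<open>M\<close> of \<open>e\<close> and
  \<open>N\<close> of \<open>f\<close> satisfy \<open>repeat_mset k M = repeat_mset k N\<close>;
  multisets allow division by \<open>k\<close>.\<close>

lemma multiple_cancel:
  fixes T :: "('a, 'm) ring_scheme"
  assumes "locally_framed T" "0 < k"
    "has_type T UNIV (\<lambda>_::unit. e) \<one>\<^bsub>T\<^esub> (replicate_mset k ())"
    "has_type T UNIV (\<lambda>_::unit. f) \<one>\<^bsub>T\<^esub> (replicate_mset k ())"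
  shows "idem_eqv T e f"
proof -
  interpret T: ring T using assms unfolding locally_framed_def by blast
  obtain A where A: "finite A" "A \<subseteq> carrier T"
    "\<And>S :: ('a, 'm) ring_scheme. subring_of S T \<Longrightarrow> A \<subseteq> carrier S \<Longrightarrow> has_type S UNIV (\<lambda>_::unit. e) \<one>\<^bsub>T\<^esub> (replicate_mset k ())"
    using has_type_finite_support[OF assms(3) T.ring_axioms] by meson
  obtain B where B: "finite B" "B \<subseteq> carrier T"
    "\<And>S :: ('a, 'm) ring_scheme. subring_of S T \<Longrightarrow> B \<subseteq> carrier S \<Longrightarrow> has_type S UNIV (\<lambda>_::unit. f) \<one>\<^bsub>T\<^esub> (replicate_mset k ())"
    using has_type_finite_support[OF assms(4) T.ring_axioms] by meson
  obtain S and I :: "nat set" and p where S: "subring_of (S :: ('a, 'm) ring_scheme) T" "A \<union> B \<subseteq> carrier S" "matricial_frame S I p"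
    using assms(1) A(1,2) B(1,2) unfolding locally_framed_def by (meson finite_UnI Un_least)
  interpret S: matricial_frame S I p by fact
  have e1: "has_type S UNIV (\<lambda>_::unit. e) \<one>\<^bsub>S\<^esub> (replicate_mset k ())"
    using A(3)[OF S(1)] S(2) subring_ofD(4)[OF S(1)] by simp
  have f1: "has_type S UNIV (\<lambda>_::unit. f) \<one>\<^bsub>S\<^esub> (replicate_mset k ())"
    using B(3)[OF S(1)] S(2) subring_ofD(4)[OF S(1)] by simp
  \<comment> \<open>Since \<open>k\<close> is positive at least one copy occurs, which places the
    idempotent itself in the subring.\<close>
  have idem: "g \<in> carrier S \<and> g \<otimes>\<^bsub>S\<^esub> g = g"
    if g: "has_type S UNIV (\<lambda>_::unit. g) \<one>\<^bsub>S\<^esub> (replicate_mset k ())" for g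
  proof -
    obtain k' where k': "k = Suc k'" using assms(2) gr0_implies_Suc by blast
    obtain h where "idem_eqv S h g" using S.has_type_extract[OF g[unfolded k' replicate_mset_Suc] refl] by blast
    then show ?thesis using S.idem_eqvE by metis
  qed
  obtain M where M: "has_type S I p e M" using S.idem_has_type idem[OF e1] by blast
  obtain N where N: "has_type S I p f N" using S.idem_has_type idem[OF f1] by blast
  have "has_type S I p \<one>\<^bsub>S\<^esub> (repeat_mset k M)" "has_type S I p \<one>\<^bsub>S\<^esub> (repeat_mset k N)"
    using S.has_type_comp[OF e1, of I p "\<lambda>_. M"] S.has_type_comp[OF f1, of I p "\<lambda>_. N"] M N
    by (simp_all add: sum_mset_replicate_repeat)
  then have "repeat_mset k M = repeat_mset k N" by (rule S.has_type_unique)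
  then have "M = N" using assms(2) by (metis multiset_eqI count_repeat_mset nat_mult_eq_cancel1)
  then have "idem_eqv S e f" using S.same_type_eqv M N by blast
  then show ?thesis by (rule idem_eqv_subring[OF _ S(1)])
qed

declare ring_iso_trans [trans]

text \<open>Reshaping turns the hypothesis into an isomorphism between the rings of \<open>k\<close>
  by \<open>k\<close> matrices over \<open>?R\<close> and \<open>?S\<close>. The unit of the target
  is then a sum of \<open>k\<close> copies of the image of the corner unit of \<open>?R\<close>, and
  also of \<open>k\<close> copies of the corner unit of \<open>?S\<close>. By
  \<open>multiple_cancel\<close> the two idempotents are equivalent, so their corners, which are
  \<open>?R\<close> and \<open>?S\<close>, are isomorphic.\<close>

lemma matrix_ring_cancel:
  assumes "locally_framed A" "0 < n" "0 < m" "0 < k" "matrix_ring (n * k) A \<simeq> matrix_ring (m * k) A"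
  shows "matrix_ring n A \<simeq> matrix_ring m A"
proof -
  interpret A: ring A using assms unfolding locally_framed_def by blast
  let ?R = "matrix_ring n A" and ?S = "matrix_ring m A"
  let ?MR = "matrix_ring k ?R" and ?MS = "matrix_ring k ?S"
  interpret R: ring ?R by (rule A.matrix_ring_ring)
  interpret S: ring ?S by (rule A.matrix_ring_ring)
  interpret MR: ring ?MR by (rule R.matrix_ring_ring)
  interpret MS: ring ?MS by (rule S.matrix_ring_ring)
  interpret N: ring "matrix_ring (k * n) A" by (rule A.matrix_ring_ring)
  have "?MR \<simeq> matrix_ring (k * n) A"
    using ring_iso_sym[OF N.ring_axioms A.matrix_reshape] by (simp add: mult.commute)
  also have "matrix_ring (k * n) A \<simeq> matrix_ring (k * m) A" using assms(5) by (simp add: mult.commute)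
  also have "matrix_ring (k * m) A \<simeq> ?MS" by (rule A.matrix_reshape)
  finally obtain \<phi> where phi: "\<phi> \<in> ring_iso ?MR ?MS" unfolding is_ring_iso_def by blast
  then have hom: "\<phi> \<in> ring_hom ?MR ?MS" and bij: "bij_betw \<phi> (carrier ?MR) (carrier ?MS)"
    unfolding ring_iso_def by auto
  define \<psi> where "\<psi> = inv_into (carrier ?MR) \<phi>"
  have psi: "\<psi> \<in> ring_iso ?MS ?MR" unfolding \<psi>_def by (rule ring_iso_set_sym[OF MR.ring_axioms phi])
  then have hom': "\<psi> \<in> ring_hom ?MS ?MR" unfolding ring_iso_def by auto
  have inv: "\<psi> (\<phi> x) = x" if "x \<in> carrier ?MR" for x
    using that bij unfolding \<psi>_def by (simp add: bij_betw_inv_into_left)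
  have inv': "\<phi> (\<psi> y) = y" if "y \<in> carrier ?MS" for y
    using that bij unfolding \<psi>_def by (simp add: bij_betw_inv_into_right)
  let ?e = "elem_mat k ?R 0 0" and ?f = "elem_mat k ?S 0 0"
  let ?E = "\<phi> (?e \<one>\<^bsub>?R\<^esub>)" and ?F = "?f \<one>\<^bsub>?S\<^esub>"
  have F: "has_type ?MS UNIV (\<lambda>_::unit. ?F) \<one>\<^bsub>?MS\<^esub> (replicate_mset k ())"
    using S.has_type_matrix_one[OF MS.has_type_single[where p = "\<lambda>_::unit. ?F" and t = "()", OF UNIV_I S.elem_mat_eqv]] assms(4)
    by (simp add: repeat_mset_replicate_mset)
  have E': "has_type ?MR UNIV (\<lambda>_::unit. ?e \<one>\<^bsub>?R\<^esub>) \<one>\<^bsub>?MR\<^esub> (replicate_mset k ())"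
    using R.has_type_matrix_one[OF MR.has_type_single[where p = "\<lambda>_::unit. ?e \<one>\<^bsub>?R\<^esub>" and t = "()", OF UNIV_I R.elem_mat_eqv]] assms(4)
    by (simp add: repeat_mset_replicate_mset)
  have "has_type ?MS UNIV (\<lambda>_::unit. ?E) (\<phi> \<one>\<^bsub>?MR\<^esub>) (replicate_mset k ())"
    by (rule has_type_hom[OF E' MR.ring_axioms])
      (use hom ring_hom_zero[OF hom MR.ring_axioms MS.ring_axioms] in
        \<open>auto simp: ring_hom_closed ring_hom_mult ring_hom_add\<close>)
  then have E: "has_type ?MS UNIV (\<lambda>_::unit. ?E) \<one>\<^bsub>?MS\<^esub> (replicate_mset k ())" using ring_hom_one[OF hom] by simp
  have lf: "locally_framed ?MS" by (rule locally_framed_matrix[OF locally_framed_matrix[OF assms(1,3)] assms(4)])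
  obtain x y where xy: "x \<in> carrier ?MS" "y \<in> carrier ?MS" "x \<otimes>\<^bsub>?MS\<^esub> y = ?E" "y \<otimes>\<^bsub>?MS\<^esub> x = ?F"
    "?E \<otimes>\<^bsub>?MS\<^esub> x = x" "x \<otimes>\<^bsub>?MS\<^esub> ?F = x" "?F \<otimes>\<^bsub>?MS\<^esub> y = y" "y \<otimes>\<^bsub>?MS\<^esub> ?E = y"
    using multiple_cancel[OF lf assms(4) E F] unfolding idem_eqv_def by blast
  have e00: "?e r (0, 0) = r" for r using assms(4) by (simp add: elem_mat_entry)
  have f00: "?f r (0, 0) = r" for r using assms(4) by (simp add: elem_mat_entry)
  have em: "?e r \<otimes>\<^bsub>?MR\<^esub> ?e s = ?e (r \<otimes>\<^bsub>?R\<^esub> s)" if "r \<in> carrier ?R" "s \<in> carrier ?R" for r s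
    using that assms(4) by (simp add: R.elem_mat_mult)
  have fm: "?f r \<otimes>\<^bsub>?MS\<^esub> ?f s = ?f (r \<otimes>\<^bsub>?S\<^esub> s)" if "r \<in> carrier ?S" "s \<in> carrier ?S" for r s
    using that assms(4) by (simp add: S.elem_mat_mult)
  have ecor: "z = ?e (z (0, 0))" if "z \<in> carrier ?MR" "?e \<one>\<^bsub>?R\<^esub> \<otimes>\<^bsub>?MR\<^esub> z \<otimes>\<^bsub>?MR\<^esub> ?e \<one>\<^bsub>?R\<^esub> = z" for z
    using R.elem_mat_sandwich[of "\<one>\<^bsub>?R\<^esub>" "\<one>\<^bsub>?R\<^esub>" z k 0 0 0 0] that assms(4) matrix_closed[OF that(1)] by simp
  have fcor: "z = ?f (z (0, 0))" if "z \<in> carrier ?MS" "?F \<otimes>\<^bsub>?MS\<^esub> z \<otimes>\<^bsub>?MS\<^esub> ?F = z" for z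
    using S.elem_mat_sandwich[of "\<one>\<^bsub>?S\<^esub>" "\<one>\<^bsub>?S\<^esub>" z k 0 0 0 0] that assms(4) matrix_closed[OF that(1)] by simp
  have Ec: "?E \<in> carrier ?MS" "?F \<in> carrier ?MS" using ring_hom_closed[OF hom] by (auto simp: R.elem_mat_closed S.elem_mat_closed)
  \<comment> \<open>Conjugation by the equivalence carries the corner of \<open>?E\<close> to the
    corner of \<open>?F\<close>; \<open>H\<close> is the inverse conjugation, pulled back by
    \<open>\<psi>\<close>.\<close>
  define G where "G r = y \<otimes>\<^bsub>?MS\<^esub> \<phi> (?e r) \<otimes>\<^bsub>?MS\<^esub> x" for r
  define H where "H s = \<psi> (x \<otimes>\<^bsub>?MS\<^esub> ?f s \<otimes>\<^bsub>?MS\<^esub> y)" for s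
  have pc: "\<phi> (?e r) \<in> carrier ?MS" if "r \<in> carrier ?R" for r using ring_hom_closed[OF hom] that by (simp add: R.elem_mat_closed)
  have Gc: "G r \<in> carrier ?MS" if "r \<in> carrier ?R" for r using pc[OF that] xy unfolding G_def by simp
  have fc: "?f s \<in> carrier ?MS" if "s \<in> carrier ?S" for s using that by (simp add: S.elem_mat_closed)
  have Hc: "H s \<in> carrier ?MR" if "s \<in> carrier ?S" for s using fc[OF that] xy ring_hom_closed[OF hom'] unfolding H_def by simp
  have Eph: "?E \<otimes>\<^bsub>?MS\<^esub> \<phi> (?e r) = \<phi> (?e r)" "\<phi> (?e r) \<otimes>\<^bsub>?MS\<^esub> ?E = \<phi> (?e r)" if r: "r \<in> carrier ?R" for r
    using ring_hom_mult[OF hom, of "?e \<one>\<^bsub>?R\<^esub>" "?e r"] ring_hom_mult[OF hom, of "?e r" "?e \<one>\<^bsub>?R\<^esub>"] em r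
    by (simp_all add: R.elem_mat_closed)
  have Ff: "?F \<otimes>\<^bsub>?MS\<^esub> ?f s = ?f s" "?f s \<otimes>\<^bsub>?MS\<^esub> ?F = ?f s" if s: "s \<in> carrier ?S" for s
    using fm s by simp_all
  have Gcor: "G r = ?f (G r (0, 0))" if r: "r \<in> carrier ?R" for r
  proof (rule fcor[OF Gc[OF r]])
    have "?F \<otimes>\<^bsub>?MS\<^esub> G r = (?F \<otimes>\<^bsub>?MS\<^esub> y) \<otimes>\<^bsub>?MS\<^esub> \<phi> (?e r) \<otimes>\<^bsub>?MS\<^esub> x"
      using xy(1,2) pc[OF r] Ec unfolding G_def by (simp add: MS.m_assoc)
    then have 1: "?F \<otimes>\<^bsub>?MS\<^esub> G r = G r" unfolding xy(7) G_def .
    have "G r \<otimes>\<^bsub>?MS\<^esub> ?F = y \<otimes>\<^bsub>?MS\<^esub> \<phi> (?e r) \<otimes>\<^bsub>?MS\<^esub> (x \<otimes>\<^bsub>?MS\<^esub> ?F)"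
      using xy(1,2) pc[OF r] Ec unfolding G_def by (simp add: MS.m_assoc)
    then have "G r \<otimes>\<^bsub>?MS\<^esub> ?F = G r" unfolding xy(6) G_def .
    then show "?F \<otimes>\<^bsub>?MS\<^esub> G r \<otimes>\<^bsub>?MS\<^esub> ?F = G r" unfolding 1 .
  qed
  have xGy: "x \<otimes>\<^bsub>?MS\<^esub> G r \<otimes>\<^bsub>?MS\<^esub> y = \<phi> (?e r)" if r: "r \<in> carrier ?R" for r
  proof -
    have "x \<otimes>\<^bsub>?MS\<^esub> G r \<otimes>\<^bsub>?MS\<^esub> y = (x \<otimes>\<^bsub>?MS\<^esub> y) \<otimes>\<^bsub>?MS\<^esub> \<phi> (?e r) \<otimes>\<^bsub>?MS\<^esub> (x \<otimes>\<^bsub>?MS\<^esub> y)"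
      using xy(1,2) pc[OF r] unfolding G_def by (simp add: MS.m_assoc)
    then show ?thesis unfolding xy(3) Eph[OF r] .
  qed
  have Hcor: "H s = ?e (H s (0, 0))" if s: "s \<in> carrier ?S" for s
  proof (rule ecor[OF Hc[OF s]])
    let ?z = "x \<otimes>\<^bsub>?MS\<^esub> ?f s \<otimes>\<^bsub>?MS\<^esub> y"
    have z: "?z \<in> carrier ?MS" using xy fc[OF s] by simp
    have "?E \<otimes>\<^bsub>?MS\<^esub> ?z = (?E \<otimes>\<^bsub>?MS\<^esub> x) \<otimes>\<^bsub>?MS\<^esub> ?f s \<otimes>\<^bsub>?MS\<^esub> y"
      using xy(1,2) fc[OF s] Ec by (simp add: MS.m_assoc)
    then have 1: "?E \<otimes>\<^bsub>?MS\<^esub> ?z = ?z" unfolding xy(5) .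
    have "?z \<otimes>\<^bsub>?MS\<^esub> ?E = x \<otimes>\<^bsub>?MS\<^esub> ?f s \<otimes>\<^bsub>?MS\<^esub> (y \<otimes>\<^bsub>?MS\<^esub> ?E)"
      using xy(1,2) fc[OF s] Ec by (simp add: MS.m_assoc)
    then have 2: "?E \<otimes>\<^bsub>?MS\<^esub> ?z \<otimes>\<^bsub>?MS\<^esub> ?E = ?z" unfolding 1 xy(8) .
    have "\<psi> ?E = ?e \<one>\<^bsub>?R\<^esub>" by (rule inv) (simp add: R.elem_mat_closed)
    then show "?e \<one>\<^bsub>?R\<^esub> \<otimes>\<^bsub>?MR\<^esub> H s \<otimes>\<^bsub>?MR\<^esub> ?e \<one>\<^bsub>?R\<^esub> = H s"
      using arg_cong[OF 2, of \<psi>] ring_hom_mult[OF hom'] Ec z unfolding H_def by simp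
  qed
  have "(\<lambda>r. G r (0, 0)) \<in> ring_iso ?R ?S"
  proof (rule ring_iso_memI)
    show "bij_betw (\<lambda>r. G r (0, 0)) (carrier ?R) (carrier ?S)"
    proof (rule bij_betw_byWitness[where f' = "\<lambda>s. H s (0, 0)"])
      show "\<forall>r\<in>carrier ?R. H (G r (0, 0)) (0, 0) = r"
      proof
        fix r assume r: "r \<in> carrier ?R"
        have "H (G r (0, 0)) = \<psi> (\<phi> (?e r))" unfolding H_def Gcor[OF r, symmetric] xGy[OF r] ..
        also have "\<dots> = ?e r" using inv r by (simp add: R.elem_mat_closed)
        finally show "H (G r (0, 0)) (0, 0) = r" using e00 by simp
      qed
      show "\<forall>s\<in>carrier ?S. G (H s (0, 0)) (0, 0) = s"
      proof
        fix s assume s: "s \<in> carrier ?S"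
        have z: "x \<otimes>\<^bsub>?MS\<^esub> ?f s \<otimes>\<^bsub>?MS\<^esub> y \<in> carrier ?MS" using xy fc[OF s] by simp
        have "G (H s (0, 0)) = y \<otimes>\<^bsub>?MS\<^esub> \<phi> (H s) \<otimes>\<^bsub>?MS\<^esub> x" unfolding G_def Hcor[OF s, symmetric] ..
        also have "\<phi> (H s) = x \<otimes>\<^bsub>?MS\<^esub> ?f s \<otimes>\<^bsub>?MS\<^esub> y" unfolding H_def using inv' z by simp
        also have "y \<otimes>\<^bsub>?MS\<^esub> (x \<otimes>\<^bsub>?MS\<^esub> ?f s \<otimes>\<^bsub>?MS\<^esub> y) \<otimes>\<^bsub>?MS\<^esub> x
          = (y \<otimes>\<^bsub>?MS\<^esub> x) \<otimes>\<^bsub>?MS\<^esub> ?f s \<otimes>\<^bsub>?MS\<^esub> (y \<otimes>\<^bsub>?MS\<^esub> x)"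
          using xy(1,2) fc[OF s] by (simp add: MS.m_assoc)
        also have "\<dots> = ?f s" unfolding xy(4) Ff[OF s] ..
        finally show "G (H s (0, 0)) (0, 0) = s" using f00 by simp
      qed
      show "(\<lambda>r. G r (0, 0)) ` carrier ?R \<subseteq> carrier ?S" using Gc assms(4) matrix_closed[of _ k ?S] by blast
      show "(\<lambda>s. H s (0, 0)) ` carrier ?S \<subseteq> carrier ?R" using Hc assms(4) matrix_closed[of _ k ?R] by blast
    qed
  next
    fix r s assume r: "r \<in> carrier ?R" and s: "s \<in> carrier ?R"
    show "G r (0, 0) \<in> carrier ?S" using Gc[OF r] assms(4) matrix_closed[of _ k ?S] by blast
    have g00: "G r (0, 0) \<in> carrier ?S" "G s (0, 0) \<in> carrier ?S" using Gc r s assms(4) matrix_closed[of _ k ?S] by blast+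
    have "G r \<otimes>\<^bsub>?MS\<^esub> G s = y \<otimes>\<^bsub>?MS\<^esub> \<phi> (?e r) \<otimes>\<^bsub>?MS\<^esub> (x \<otimes>\<^bsub>?MS\<^esub> G s)"
      using xy(1,2) pc[OF r] Gc[OF s] unfolding G_def[of r] by (simp add: MS.m_assoc)
    also have "x \<otimes>\<^bsub>?MS\<^esub> G s = \<phi> (?e s) \<otimes>\<^bsub>?MS\<^esub> x"
    proof -
      have "x \<otimes>\<^bsub>?MS\<^esub> G s = (x \<otimes>\<^bsub>?MS\<^esub> y) \<otimes>\<^bsub>?MS\<^esub> \<phi> (?e s) \<otimes>\<^bsub>?MS\<^esub> x"
        using xy(1,2) pc[OF s] unfolding G_def by (simp add: MS.m_assoc)
      then show ?thesis unfolding xy(3) Eph[OF s] .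
    qed
    also have "y \<otimes>\<^bsub>?MS\<^esub> \<phi> (?e r) \<otimes>\<^bsub>?MS\<^esub> (\<phi> (?e s) \<otimes>\<^bsub>?MS\<^esub> x) = y \<otimes>\<^bsub>?MS\<^esub> (\<phi> (?e r) \<otimes>\<^bsub>?MS\<^esub> \<phi> (?e s)) \<otimes>\<^bsub>?MS\<^esub> x"
      using xy(1,2) pc[OF r] pc[OF s] by (simp add: MS.m_assoc)
    also have "\<phi> (?e r) \<otimes>\<^bsub>?MS\<^esub> \<phi> (?e s) = \<phi> (?e (r \<otimes>\<^bsub>?R\<^esub> s))"
      using ring_hom_mult[OF hom, of "?e r" "?e s"] em r s by (simp add: R.elem_mat_closed)
    finally have "G (r \<otimes>\<^bsub>?R\<^esub> s) = ?f (G r (0, 0)) \<otimes>\<^bsub>?MS\<^esub> ?f (G s (0, 0))"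
      using Gcor[OF r] Gcor[OF s] unfolding G_def[of "r \<otimes>\<^bsub>?R\<^esub> s"] by simp
    then show "G (r \<otimes>\<^bsub>?R\<^esub> s) (0, 0) = G r (0, 0) \<otimes>\<^bsub>?S\<^esub> G s (0, 0)" using fm g00 f00 by simp
    have "\<phi> (?e (r \<oplus>\<^bsub>?R\<^esub> s)) = \<phi> (?e r) \<oplus>\<^bsub>?MS\<^esub> \<phi> (?e s)"
      using ring_hom_add[OF hom, of "?e r" "?e s"] r s by (simp add: R.elem_mat_closed R.elem_mat_add)
    then have "G (r \<oplus>\<^bsub>?R\<^esub> s) = G r \<oplus>\<^bsub>?MS\<^esub> G s"
      using xy(1,2) pc[OF r] pc[OF s] unfolding G_def by (simp add: MS.r_distr MS.l_distr)
    then show "G (r \<oplus>\<^bsub>?R\<^esub> s) (0, 0) = G r (0, 0) \<oplus>\<^bsub>?S\<^esub> G s (0, 0)" using assms(4) by (simp add: matrix_add_entry)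
  next
    have "G \<one>\<^bsub>?R\<^esub> = y \<otimes>\<^bsub>?MS\<^esub> x" unfolding G_def xy(8) ..
    then show "G \<one>\<^bsub>?R\<^esub> (0, 0) = \<one>\<^bsub>?S\<^esub>" using xy(4) f00 by simp
  qed
  then show ?thesis unfolding is_ring_iso_def by blast
qed

lemma matrix_ring_multiple:
  assumes "ring A" "matrix_ring n A \<simeq> matrix_ring m A"
  shows "matrix_ring (n * k) A \<simeq> matrix_ring (m * k) A"
proof -
  interpret A: ring A by fact
  have "matrix_ring (k * n) A \<simeq> matrix_ring k (matrix_ring n A)" by (rule A.matrix_reshape)
  also have "matrix_ring k (matrix_ring n A) \<simeq> matrix_ring k (matrix_ring m A)"
    by (rule matrix_ring_cong_iso[OF A.matrix_ring_ring A.matrix_ring_ring assms(2)])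
  also have "matrix_ring k (matrix_ring m A) \<simeq> matrix_ring (k * m) A"
    by (rule ring_iso_sym[OF A.matrix_ring_ring A.matrix_reshape])
  finally show ?thesis by (simp add: mult.commute)
qed

section \<open>Products of matrix algebras\<close>

lemma matrix_algebra_simps:
  "carrier (matrix_algebra n F) = carrier (matrix_ring n F)"
  "monoid.mult (matrix_algebra n F) = monoid.mult (matrix_ring n F)"
  "one (matrix_algebra n F) = one (matrix_ring n F)"
  "ring.zero (matrix_algebra n F) = ring.zero (matrix_ring n F)"
  "ring.add (matrix_algebra n F) = ring.add (matrix_ring n F)"
  "a \<odot>\<^bsub>matrix_algebra n F\<^esub> x = (\<lambda>p \<in> {..<n} \<times> {..<n}. a \<otimes>\<^bsub>F\<^esub> x p)"
  by (simp_all add: matrix_algebra_def ring.extend_def)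

abbreviation matrix_product :: "('a, 'm) ring_scheme \<Rightarrow> 'i set \<Rightarrow> ('i \<Rightarrow> nat) \<Rightarrow> ('a, 'i \<Rightarrow> nat \<times> nat \<Rightarrow> 'a) module" where
  "matrix_product F I d \<equiv> product_algebra I (\<lambda>i. matrix_algebra (d i) F)"

lemma matrix_product_simps:
  "carrier (matrix_product F I d) = (\<Pi>\<^sub>E i\<in>I. carrier (matrix_ring (d i) F))"
  "l \<in> I \<Longrightarrow> (x \<otimes>\<^bsub>matrix_product F I d\<^esub> y) l = x l \<otimes>\<^bsub>matrix_ring (d l) F\<^esub> y l"
  "l \<in> I \<Longrightarrow> (x \<oplus>\<^bsub>matrix_product F I d\<^esub> y) l = x l \<oplus>\<^bsub>matrix_ring (d l) F\<^esub> y l"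
  "l \<in> I \<Longrightarrow> \<one>\<^bsub>matrix_product F I d\<^esub> l = \<one>\<^bsub>matrix_ring (d l) F\<^esub>"
  "l \<in> I \<Longrightarrow> \<zero>\<^bsub>matrix_product F I d\<^esub> l = \<zero>\<^bsub>matrix_ring (d l) F\<^esub>"
  "l \<in> I \<Longrightarrow> (a \<odot>\<^bsub>matrix_product F I d\<^esub> x) l = (\<lambda>p \<in> {..<d l} \<times> {..<d l}. a \<otimes>\<^bsub>F\<^esub> x l p)"
  by (simp_all add: product_algebra_def matrix_algebra_simps)

lemma matrix_product_component: "x \<in> carrier (matrix_product F I d) \<Longrightarrow> l \<in> I \<Longrightarrow> x l \<in> carrier (matrix_ring (d l) F)"
  unfolding matrix_product_simps by (auto simp: PiE_iff)

lemma matrix_product_eqI: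
  assumes "x \<in> carrier (matrix_product F I d)" "y \<in> carrier (matrix_product F I d)" "\<And>l. l \<in> I \<Longrightarrow> x l = y l"
  shows "x = y"
  using assms unfolding matrix_product_simps by (intro PiE_ext[of x _ _ y]) auto

lemma matrix_product_memI:
  assumes "\<And>l. l \<in> I \<Longrightarrow> f l \<in> carrier (matrix_ring (d l) F)"
  shows "(\<lambda>l\<in>I. f l) \<in> carrier (matrix_product F I d)"
  unfolding matrix_product_simps using assms by auto

lemma (in ring) matrix_null:
  assumes "x \<in> carrier (matrix_ring n R)"
  shows "\<zero>\<^bsub>matrix_ring n R\<^esub> \<otimes>\<^bsub>matrix_ring n R\<^esub> x = \<zero>\<^bsub>matrix_ring n R\<^esub>"
    "x \<otimes>\<^bsub>matrix_ring n R\<^esub> \<zero>\<^bsub>matrix_ring n R\<^esub> = \<zero>\<^bsub>matrix_ring n R\<^esub>"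
    "\<zero>\<^bsub>matrix_ring n R\<^esub> \<oplus>\<^bsub>matrix_ring n R\<^esub> x = x"
    "x \<oplus>\<^bsub>matrix_ring n R\<^esub> \<zero>\<^bsub>matrix_ring n R\<^esub> = x"
proof -
  interpret M: ring "matrix_ring n R" by (rule matrix_ring_ring)
  show "\<zero>\<^bsub>matrix_ring n R\<^esub> \<otimes>\<^bsub>matrix_ring n R\<^esub> x = \<zero>\<^bsub>matrix_ring n R\<^esub>"
    "x \<otimes>\<^bsub>matrix_ring n R\<^esub> \<zero>\<^bsub>matrix_ring n R\<^esub> = \<zero>\<^bsub>matrix_ring n R\<^esub>"
    "\<zero>\<^bsub>matrix_ring n R\<^esub> \<oplus>\<^bsub>matrix_ring n R\<^esub> x = x"
    "x \<oplus>\<^bsub>matrix_ring n R\<^esub> \<zero>\<^bsub>matrix_ring n R\<^esub> = x"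
    using assms by simp_all
qed

lemma (in ring) matrix_product_closed:
  assumes "x \<in> carrier (matrix_product R I d)" "y \<in> carrier (matrix_product R I d)"
  shows "x \<otimes>\<^bsub>matrix_product R I d\<^esub> y \<in> carrier (matrix_product R I d)"
    "x \<oplus>\<^bsub>matrix_product R I d\<^esub> y \<in> carrier (matrix_product R I d)"
  using assms by (auto simp: product_algebra_def matrix_algebra_simps PiE_iff matrix_mult_closed matrix_add_closed)

lemma (in ring) matrix_product_one_zero_closed:
  "\<one>\<^bsub>matrix_product R I d\<^esub> \<in> carrier (matrix_product R I d)"
  "\<zero>\<^bsub>matrix_product R I d\<^esub> \<in> carrier (matrix_product R I d)"
  by (auto simp: product_algebra_def matrix_algebra_simps PiE_iff matrix_one_closed matrix_zero_closed)

definition block_unit :: "('a, 'm) ring_scheme \<Rightarrow> 'i set \<Rightarrow> ('i \<Rightarrow> nat) \<Rightarrow> 'i \<Rightarrow> nat \<Rightarrow> nat \<Rightarrow> 'a \<Rightarrow> 'i \<Rightarrow> nat \<times> nat \<Rightarrow> 'a" where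
  "block_unit F I d l a b z = (\<lambda>i\<in>I. if i = l then elem_mat (d i) F a b z else \<zero>\<^bsub>matrix_ring (d i) F\<^esub>)"

definition block_diag :: "('a, 'm) ring_scheme \<Rightarrow> 'i set \<Rightarrow> ('i \<Rightarrow> nat) \<Rightarrow> ('i \<times> nat) set \<Rightarrow> 'i \<Rightarrow> nat \<times> nat \<Rightarrow> 'a" where
  "block_diag F I d S = (\<lambda>l\<in>I. \<lambda>(i, j)\<in>{..<d l} \<times> {..<d l}. if i = j \<and> (l, i) \<in> S then \<one>\<^bsub>F\<^esub> else \<zero>\<^bsub>F\<^esub>)"

text \<open>An isomorphism of rings directed from the product to \<open>R\<close>, so that the frame
  of \<open>R\<close> can be written as the image of matrix units.\<close>

locale matricial_rep = F: principal_domain F + R: ring R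
  for F :: "('a, 'm) ring_scheme" and R :: "('b, 'k) ring_scheme" +
  fixes I :: "'i set" and d :: "'i \<Rightarrow> nat" and \<Psi> :: "('i \<Rightarrow> nat \<times> nat \<Rightarrow> 'a) \<Rightarrow> 'b"
  assumes finite_I: "finite I"
    and d_pos: "l \<in> I \<Longrightarrow> 0 < d l"
    and rep_closed: "x \<in> carrier (matrix_product F I d) \<Longrightarrow> \<Psi> x \<in> carrier R"
    and rep_mult: "\<lbrakk>x \<in> carrier (matrix_product F I d); y \<in> carrier (matrix_product F I d)\<rbrakk> \<Longrightarrow>
      \<Psi> (x \<otimes>\<^bsub>matrix_product F I d\<^esub> y) = \<Psi> x \<otimes>\<^bsub>R\<^esub> \<Psi> y"
    and rep_add: "\<lbrakk>x \<in> carrier (matrix_product F I d); y \<in> carrier (matrix_product F I d)\<rbrakk> \<Longrightarrow>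
      \<Psi> (x \<oplus>\<^bsub>matrix_product F I d\<^esub> y) = \<Psi> x \<oplus>\<^bsub>R\<^esub> \<Psi> y"
    and rep_one: "\<Psi> \<one>\<^bsub>matrix_product F I d\<^esub> = \<one>\<^bsub>R\<^esub>"
    and rep_inj: "inj_on \<Psi> (carrier (matrix_product F I d))"
    and rep_surj: "\<Psi> ` carrier (matrix_product F I d) = carrier R"
begin

abbreviation "P \<equiv> matrix_product F I d"
abbreviation "U \<equiv> block_unit F I d"
abbreviation "Dg \<equiv> block_diag F I d"

lemmas P_eqI = matrix_product_eqI[where F = F and I = I and d = d]

lemma U_closed: "z \<in> carrier F \<Longrightarrow> U l a b z \<in> carrier P"
  unfolding block_unit_def by (rule matrix_product_memI) (auto simp: F.elem_mat_closed F.matrix_zero_closed)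

lemma Dg_closed: "Dg S \<in> carrier P"
  unfolding block_diag_def by (rule matrix_product_memI, rule matrix_memI) auto

lemma rep_zero: "\<Psi> \<zero>\<^bsub>P\<^esub> = \<zero>\<^bsub>R\<^esub>"
proof -
  have z: "\<zero>\<^bsub>P\<^esub> \<in> carrier P" by (rule F.matrix_product_one_zero_closed)
  have "\<zero>\<^bsub>P\<^esub> \<oplus>\<^bsub>P\<^esub> \<zero>\<^bsub>P\<^esub> = \<zero>\<^bsub>P\<^esub>"
  proof (rule P_eqI[OF F.matrix_product_closed(2)[OF z z] z])
    fix l assume l: "l \<in> I"
    show "(\<zero>\<^bsub>P\<^esub> \<oplus>\<^bsub>P\<^esub> \<zero>\<^bsub>P\<^esub>) l = \<zero>\<^bsub>P\<^esub> l" using l by (simp add: matrix_product_simps F.matrix_null F.matrix_zero_closed)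
  qed
  then have "\<Psi> \<zero>\<^bsub>P\<^esub> \<oplus>\<^bsub>R\<^esub> \<Psi> \<zero>\<^bsub>P\<^esub> = \<Psi> \<zero>\<^bsub>P\<^esub>" using rep_add[OF z z] by simp
  then show ?thesis using rep_closed[OF z] by (metis R.add.l_cancel_one)
qed

lemma U_mult:
  assumes "z \<in> carrier F" "w \<in> carrier F" "b < d l" "c < d l'"
  shows "U l a b z \<otimes>\<^bsub>P\<^esub> U l' c e w = (if l = l' \<and> b = c then U l a e (z \<otimes>\<^bsub>F\<^esub> w) else \<zero>\<^bsub>P\<^esub>)"
proof (rule P_eqI)
  fix i assume i: "i \<in> I"
  show "(U l a b z \<otimes>\<^bsub>P\<^esub> U l' c e w) i = (if l = l' \<and> b = c then U l a e (z \<otimes>\<^bsub>F\<^esub> w) else \<zero>\<^bsub>P\<^esub>) i"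
    using i assms by (auto simp: matrix_product_simps block_unit_def F.elem_mat_mult F.elem_mat_closed F.matrix_null F.matrix_zero_closed)
qed (use assms in \<open>auto simp: U_closed F.matrix_product_closed F.matrix_product_one_zero_closed\<close>)

lemma U_add:
  assumes "z \<in> carrier F" "w \<in> carrier F"
  shows "U l a b z \<oplus>\<^bsub>P\<^esub> U l a b w = U l a b (z \<oplus>\<^bsub>F\<^esub> w)"
proof (rule P_eqI)
  fix i assume i: "i \<in> I"
  show "(U l a b z \<oplus>\<^bsub>P\<^esub> U l a b w) i = U l a b (z \<oplus>\<^bsub>F\<^esub> w) i"
    using i assms by (auto simp: matrix_product_simps block_unit_def F.elem_mat_add F.matrix_null F.matrix_zero_closed)
qed (use assms in \<open>auto simp: U_closed F.matrix_product_closed\<close>)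

lemma U_zero: "U l a b \<zero>\<^bsub>F\<^esub> = \<zero>\<^bsub>P\<^esub>"
  by (rule P_eqI[OF U_closed[OF F.zero_closed] F.matrix_product_one_zero_closed(2)])
    (simp add: matrix_product_simps block_unit_def F.elem_mat_zero)

lemma U_sandwich:
  assumes "x \<in> carrier P" "l \<in> I" "l' \<in> I" "b < d l" "c < d l'" "z \<in> carrier F" "w \<in> carrier F"
  shows "U l a b z \<otimes>\<^bsub>P\<^esub> x \<otimes>\<^bsub>P\<^esub> U l' c e w = (if l = l' then U l a e (z \<otimes>\<^bsub>F\<^esub> x l (b, c) \<otimes>\<^bsub>F\<^esub> w) else \<zero>\<^bsub>P\<^esub>)"
proof (rule P_eqI)
  have xl: "x l \<in> carrier (matrix_ring (d l) F)" by (rule matrix_product_component[OF assms(1,2)])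
  show "U l a b z \<otimes>\<^bsub>P\<^esub> x \<otimes>\<^bsub>P\<^esub> U l' c e w \<in> carrier P"
    by (intro F.matrix_product_closed U_closed assms)
  have "x l (b, c) \<in> carrier F" if "l = l'" using matrix_closed[OF xl] assms that by simp
  then show "(if l = l' then U l a e (z \<otimes>\<^bsub>F\<^esub> x l (b, c) \<otimes>\<^bsub>F\<^esub> w) else \<zero>\<^bsub>P\<^esub>) \<in> carrier P"
    using assms by (simp add: F.matrix_product_one_zero_closed(2) U_closed)
  fix i assume i: "i \<in> I"
  have xi: "x i \<in> carrier (matrix_ring (d i) F)" by (rule matrix_product_component[OF assms(1) i])
  note s = matrix_product_simps(2,5) block_unit_def F.elem_mat_closed F.matrix_mult_closed F.matrix_null F.matrix_zero_closed
  show "(U l a b z \<otimes>\<^bsub>P\<^esub> x \<otimes>\<^bsub>P\<^esub> U l' c e w) i = (if l = l' then U l a e (z \<otimes>\<^bsub>F\<^esub> x l (b, c) \<otimes>\<^bsub>F\<^esub> w) else \<zero>\<^bsub>P\<^esub>) i"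
  proof (cases "i = l")
    case True
    show ?thesis
    proof (cases "l = l'")
      case True
      then show ?thesis using i xi assms \<open>i = l\<close> by (simp add: s F.elem_mat_sandwich)
    next
      case False
      then show ?thesis using i xi assms \<open>i = l\<close> by (simp add: s)
    qed
  next
    case False
    then show ?thesis using i xi assms by (auto simp: s)
  qed
qed

lemma rep_U_inj:
  assumes "l \<in> I" "z \<in> carrier F" "w \<in> carrier F" "\<Psi> (U l 0 0 z) = \<Psi> (U l 0 0 w)"
  shows "z = w"
proof -
  have "U l 0 0 z = U l 0 0 w" using inj_onD[OF rep_inj, of "U l 0 0 z" "U l 0 0 w"] assms U_closed by simp
  then have "U l 0 0 z l (0, 0) = U l 0 0 w l (0, 0)" by simp
  then show ?thesis using assms(1) d_pos[OF assms(1)] by (simp add: block_unit_def elem_mat_entry)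
qed

lemma rep_U_eqv:
  assumes "l \<in> I" "a < d l" "b < d l"
  shows "idem_eqv R (\<Psi> (U l a a \<one>\<^bsub>F\<^esub>)) (\<Psi> (U l b b \<one>\<^bsub>F\<^esub>))"
proof -
  have m: "\<Psi> (U l i j \<one>\<^bsub>F\<^esub>) \<otimes>\<^bsub>R\<^esub> \<Psi> (U l j k \<one>\<^bsub>F\<^esub>) = \<Psi> (U l i k \<one>\<^bsub>F\<^esub>)" if j: "j < d l" for i j k
    unfolding rep_mult[OF U_closed[OF F.one_closed] U_closed[OF F.one_closed], symmetric]
    using U_mult[OF F.one_closed F.one_closed j j] by simp
  show ?thesis
    by (rule R.idem_eqvI[of "\<Psi> (U l a b \<one>\<^bsub>F\<^esub>)" "\<Psi> (U l b a \<one>\<^bsub>F\<^esub>)"])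
      (simp_all add: m assms rep_closed U_closed)
qed

text \<open>Each diagonal position of the block \<open>l\<close> carries a matrix unit equivalent to
  the first one of that block, so the type counts positions block by block.\<close>

lemma has_type_Dg:
  assumes "finite S" "S \<subseteq> Sigma I (\<lambda>l. {..<d l})"
  shows "has_type R I (\<lambda>l. \<Psi> (U l 0 0 \<one>\<^bsub>F\<^esub>)) (\<Psi> (Dg S)) (image_mset fst (mset_set S))"
  using assms
proof (induction rule: finite_induct)
  case empty
  have "Dg {} = \<zero>\<^bsub>P\<^esub>"
  proof (rule P_eqI[OF Dg_closed F.matrix_product_one_zero_closed(2)])
    fix l assume l: "l \<in> I"
    show "Dg {} l = \<zero>\<^bsub>P\<^esub> l" unfolding matrix_product_simps(5)[OF l]
      by (rule matrix_eqI[OF matrix_product_component[OF Dg_closed l] F.matrix_zero_closed])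
        (use l in \<open>simp add: block_diag_def matrix_zero_entry\<close>)
  qed
  then show ?case using rep_zero has_type.zero[of R I] by simp
next
  case (insert s S)
  obtain l a where s: "s = (l, a)" by (cases s)
  have la: "l \<in> I" "a < d l" using insert.prems s by auto
  have IH: "has_type R I (\<lambda>l. \<Psi> (U l 0 0 \<one>\<^bsub>F\<^esub>)) (\<Psi> (Dg S)) (image_mset fst (mset_set S))"
    using insert by auto
  let ?u = "U l a a \<one>\<^bsub>F\<^esub>"
  have c: "Dg S \<in> carrier P" "?u \<in> carrier P" by (simp_all add: Dg_closed U_closed)
  have comp: "Dg S i \<in> carrier (matrix_ring (d i) F)" "elem_mat (d i) F a a \<one>\<^bsub>F\<^esub> \<in> carrier (matrix_ring (d i) F)" if "i \<in> I" for i
    using that by (auto intro: matrix_product_component Dg_closed F.elem_mat_closed)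
  have 1: "Dg S \<otimes>\<^bsub>P\<^esub> ?u = \<zero>\<^bsub>P\<^esub>"
  proof (rule P_eqI[OF F.matrix_product_closed(1)[OF c] F.matrix_product_one_zero_closed(2)])
    fix i assume i: "i \<in> I"
      show "(Dg S \<otimes>\<^bsub>P\<^esub> ?u) i = \<zero>\<^bsub>P\<^esub> i"
    proof (cases "i = l")
      case True
      have "Dg S i \<otimes>\<^bsub>matrix_ring (d i) F\<^esub> elem_mat (d i) F a a \<one>\<^bsub>F\<^esub> = \<zero>\<^bsub>matrix_ring (d i) F\<^esub>"
        by (rule matrix_eqI[OF F.matrix_mult_closed[OF comp(1)[OF i] comp(2)[OF i]] F.matrix_zero_closed])
          (use i True la comp insert.hyps s in \<open>auto simp: F.matrix_elem_right matrix_zero_entry block_diag_def\<close>)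
      then show ?thesis using i True by (simp add: matrix_product_simps block_unit_def)
    next
      case False
      then show ?thesis using i comp by (simp add: matrix_product_simps block_unit_def F.matrix_null F.matrix_zero_closed)
    qed
  qed
  have 2: "?u \<otimes>\<^bsub>P\<^esub> Dg S = \<zero>\<^bsub>P\<^esub>"
  proof (rule P_eqI[OF F.matrix_product_closed(1)[OF c(2,1)] F.matrix_product_one_zero_closed(2)])
    fix i assume i: "i \<in> I"
      show "(?u \<otimes>\<^bsub>P\<^esub> Dg S) i = \<zero>\<^bsub>P\<^esub> i"
    proof (cases "i = l")
      case True
      have "elem_mat (d i) F a a \<one>\<^bsub>F\<^esub> \<otimes>\<^bsub>matrix_ring (d i) F\<^esub> Dg S i = \<zero>\<^bsub>matrix_ring (d i) F\<^esub>"
        by (rule matrix_eqI[OF F.matrix_mult_closed[OF comp(2)[OF i] comp(1)[OF i]] F.matrix_zero_closed])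
          (use i True la comp insert.hyps s in \<open>auto simp: F.matrix_elem_left matrix_zero_entry block_diag_def\<close>)
      then show ?thesis using i True by (simp add: matrix_product_simps block_unit_def)
    next
      case False
      then show ?thesis using i comp by (simp add: matrix_product_simps block_unit_def F.matrix_null F.matrix_zero_closed)
    qed
  qed
  have 3: "Dg (insert s S) = Dg S \<oplus>\<^bsub>P\<^esub> ?u"
  proof (rule P_eqI[OF Dg_closed F.matrix_product_closed(2)[OF c]])
    fix i assume i: "i \<in> I"
      show "Dg (insert s S) i = (Dg S \<oplus>\<^bsub>P\<^esub> ?u) i"
    proof (cases "i = l")
      case True
      have "Dg (insert s S) i = Dg S i \<oplus>\<^bsub>matrix_ring (d i) F\<^esub> elem_mat (d i) F a a \<one>\<^bsub>F\<^esub>"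
        by (rule matrix_eqI[OF matrix_product_component[OF Dg_closed i] F.matrix_add_closed[OF comp(1)[OF i] comp(2)[OF i]]])
          (use i True la comp insert.hyps s in \<open>auto simp: matrix_add_entry elem_mat_entry block_diag_def\<close>)
      then show ?thesis using i True by (simp add: matrix_product_simps block_unit_def)
    next
      case False
      have "Dg (insert s S) i = Dg S i"
        by (rule matrix_eqI[OF matrix_product_component[OF Dg_closed i] comp(1)[OF i]])
          (use i False s in \<open>auto simp: block_diag_def\<close>)
      then show ?thesis using i comp False by (simp add: matrix_product_simps block_unit_def F.matrix_null F.matrix_zero_closed)
    qed
  qed
  have o: "\<Psi> (Dg S) \<otimes>\<^bsub>R\<^esub> \<Psi> ?u = \<zero>\<^bsub>R\<^esub>" "\<Psi> ?u \<otimes>\<^bsub>R\<^esub> \<Psi> (Dg S) = \<zero>\<^bsub>R\<^esub>"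
    using rep_mult[OF c] rep_mult[OF c(2,1)] 1 2 rep_zero by simp_all
  have e: "idem_eqv R (\<Psi> ?u) (\<Psi> (U l 0 0 \<one>\<^bsub>F\<^esub>))" using rep_U_eqv la d_pos by blast
  have "has_type R I (\<lambda>l. \<Psi> (U l 0 0 \<one>\<^bsub>F\<^esub>)) (\<Psi> (Dg S) \<oplus>\<^bsub>R\<^esub> \<Psi> ?u) (add_mset l (image_mset fst (mset_set S)))"
    by (rule has_type.add[OF IH la(1) e o])
  then show ?case using 3 rep_add[OF c] insert.hyps s by simp
qed

lemma Dg_all: "Dg (Sigma I (\<lambda>l. {..<d l})) = \<one>\<^bsub>P\<^esub>"
proof (rule P_eqI[OF Dg_closed F.matrix_product_one_zero_closed(1)])
  fix i assume i: "i \<in> I"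
  show "Dg (Sigma I (\<lambda>l. {..<d l})) i = \<one>\<^bsub>P\<^esub> i"
    unfolding matrix_product_simps(4)[OF i]
    by (rule matrix_eqI[OF matrix_product_component[OF Dg_closed i] F.matrix_one_closed])
      (use i in \<open>auto simp: block_diag_def matrix_one_entry\<close>)
qed

lemma finite_Sigma: "finite (Sigma I (\<lambda>l. {..<d l}))"
  using finite_I by auto

text \<open>Repeating one scalar along the diagonals of all blocks gives a central element, by
  commutativity of \<open>F\<close>. It is the central witness needed for
  \<open>p_central\<close>.\<close>

lemma scalar_central:
  assumes "z \<in> carrier F"
  defines "s \<equiv> (\<lambda>l\<in>I. \<lambda>(i, j)\<in>{..<d l} \<times> {..<d l}. if i = j then z else \<zero>\<^bsub>F\<^esub>)"
  shows "s \<in> carrier P" "x \<in> carrier P \<Longrightarrow> s \<otimes>\<^bsub>P\<^esub> x = x \<otimes>\<^bsub>P\<^esub> s" "l \<in> I \<Longrightarrow> s \<otimes>\<^bsub>P\<^esub> U l 0 0 \<one>\<^bsub>F\<^esub> = U l 0 0 z"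
proof -
  show sc: "s \<in> carrier P" unfolding s_def by (rule matrix_product_memI, rule matrix_memI) (use assms(1) in auto)
  have ent: "(s \<otimes>\<^bsub>P\<^esub> x) l (i, j) = z \<otimes>\<^bsub>F\<^esub> x l (i, j)" "(x \<otimes>\<^bsub>P\<^esub> s) l (i, j) = z \<otimes>\<^bsub>F\<^esub> x l (i, j)"
    if x: "x \<in> carrier P" and l: "l \<in> I" and ij: "i < d l" "j < d l" for x l i j
  proof -
    have xl: "x l \<in> carrier (matrix_ring (d l) F)" by (rule matrix_product_component[OF x l])
    have sl: "s l (i, j) = (if i = j then z else \<zero>\<^bsub>F\<^esub>)" if "i < d l" "j < d l" for i j
      using l that unfolding s_def by simp
    have "(s \<otimes>\<^bsub>P\<^esub> x) l (i, j) = (\<Oplus>\<^bsub>F\<^esub>k\<in>{..<d l}. if k = i then z \<otimes>\<^bsub>F\<^esub> x l (i, j) else \<zero>\<^bsub>F\<^esub>)"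
      unfolding matrix_product_simps(2)[OF l] matrix_mult_entry[OF ij]
      by (rule F.finsum_cong') (use ij xl assms(1) in \<open>auto simp: sl matrix_closed\<close>)
    then show "(s \<otimes>\<^bsub>P\<^esub> x) l (i, j) = z \<otimes>\<^bsub>F\<^esub> x l (i, j)"
      using F.finsum_delta[of "{..<d l}" i "z \<otimes>\<^bsub>F\<^esub> x l (i, j)"] ij xl assms(1) by (simp add: matrix_closed)
    have "(x \<otimes>\<^bsub>P\<^esub> s) l (i, j) = (\<Oplus>\<^bsub>F\<^esub>k\<in>{..<d l}. if k = j then z \<otimes>\<^bsub>F\<^esub> x l (i, j) else \<zero>\<^bsub>F\<^esub>)"
      unfolding matrix_product_simps(2)[OF l] matrix_mult_entry[OF ij]
      by (rule F.finsum_cong') (use ij xl assms(1) in \<open>auto simp: sl matrix_closed F.m_comm\<close>)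
    then show "(x \<otimes>\<^bsub>P\<^esub> s) l (i, j) = z \<otimes>\<^bsub>F\<^esub> x l (i, j)"
      using F.finsum_delta[of "{..<d l}" j "z \<otimes>\<^bsub>F\<^esub> x l (i, j)"] ij xl assms(1) by (simp add: matrix_closed)
  qed
  have eqI: "x = y" if x: "x \<in> carrier P" and y: "y \<in> carrier P"
    and e: "\<And>l i j. \<lbrakk>l \<in> I; i < d l; j < d l\<rbrakk> \<Longrightarrow> x l (i, j) = y l (i, j)" for x y
  proof (rule P_eqI[OF x y])
    fix l assume l: "l \<in> I"
    show "x l = y l"
      by (rule matrix_eqI[OF matrix_product_component[OF x l] matrix_product_component[OF y l]]) (rule e[OF l])
  qed
  show "s \<otimes>\<^bsub>P\<^esub> x = x \<otimes>\<^bsub>P\<^esub> s" if x: "x \<in> carrier P"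
    by (rule eqI[OF F.matrix_product_closed(1)[OF sc x] F.matrix_product_closed(1)[OF x sc]])
      (simp only: ent[OF x])
  show "s \<otimes>\<^bsub>P\<^esub> U l 0 0 \<one>\<^bsub>F\<^esub> = U l 0 0 z" if l: "l \<in> I"
  proof (rule eqI[OF F.matrix_product_closed(1)[OF sc U_closed[OF F.one_closed]] U_closed[OF assms(1)]])
    fix m i j assume mij: "m \<in> I" "i < d m" "j < d m"
    show "(s \<otimes>\<^bsub>P\<^esub> U l 0 0 \<one>\<^bsub>F\<^esub>) m (i, j) = U l 0 0 z m (i, j)"
      unfolding ent(1)[OF U_closed[OF F.one_closed] mij]
      using mij assms(1) by (auto simp: block_unit_def elem_mat_entry matrix_zero_entry)
  qed
qed

text \<open>Multiplying by the first diagonal unit of the block \<open>t\<close> on both sides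
  leaves only the entry at (0, 0).\<close>

lemma corner_element:
  assumes "t \<in> I" "c \<in> carrier R" "\<Psi> (U t 0 0 \<one>\<^bsub>F\<^esub>) \<otimes>\<^bsub>R\<^esub> c = c" "c \<otimes>\<^bsub>R\<^esub> \<Psi> (U t 0 0 \<one>\<^bsub>F\<^esub>) = c"
  shows "\<exists>z\<in>carrier F. c = \<Psi> (U t 0 0 z)"
proof -
  obtain x where x: "x \<in> carrier P" "c = \<Psi> x" using assms(2) rep_surj by auto
  have "c = \<Psi> (U t 0 0 \<one>\<^bsub>F\<^esub> \<otimes>\<^bsub>P\<^esub> x \<otimes>\<^bsub>P\<^esub> U t 0 0 \<one>\<^bsub>F\<^esub>)"
    using x assms by (simp add: rep_mult U_closed F.matrix_product_closed)
  moreover have "x t (0, 0) \<in> carrier F"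
    using matrix_closed[OF matrix_product_component[OF x(1) assms(1)]] d_pos[OF assms(1)] by blast
  ultimately show ?thesis using U_sandwich[of x t t 0 0 "\<one>\<^bsub>F\<^esub>" "\<one>\<^bsub>F\<^esub>"] x assms(1) d_pos[OF assms(1)] by auto
qed

text \<open>The corner at the first diagonal unit of a block is a copy of \<open>F\<close>, so the
  corner axioms become the domain and principal ideal properties of \<open>F\<close>.\<close>

lemma is_matricial_frame: "matricial_frame R I (\<lambda>l. \<Psi> (U l 0 0 \<one>\<^bsub>F\<^esub>))"
proof -
  let ?p = "\<lambda>l. \<Psi> (U l 0 0 \<one>\<^bsub>F\<^esub>)"
  have UU: "\<Psi> (U l 0 0 z) \<otimes>\<^bsub>R\<^esub> \<Psi> (U l 0 0 w) = \<Psi> (U l 0 0 (z \<otimes>\<^bsub>F\<^esub> w))"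
    if "z \<in> carrier F" "w \<in> carrier F" "l \<in> I" for z w l
    using that d_pos[OF that(3)] by (simp add: rep_mult[symmetric] U_closed U_mult)
  have UA: "\<Psi> (U l 0 0 z) \<oplus>\<^bsub>R\<^esub> \<Psi> (U l 0 0 w) = \<Psi> (U l 0 0 (z \<oplus>\<^bsub>F\<^esub> w))"
    if "z \<in> carrier F" "w \<in> carrier F" "l \<in> I" for z w l
    using that d_pos[OF that(3)] by (simp add: rep_add[symmetric] U_closed U_add)
  have uc: "\<Psi> (U l 0 0 z) \<in> carrier R" if "z \<in> carrier F" for l z using that by (simp add: rep_closed U_closed)
  have u0: "\<Psi> (U l 0 0 \<zero>\<^bsub>F\<^esub>) = \<zero>\<^bsub>R\<^esub>" for l by (simp add: U_zero rep_zero)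
  have u_eq0: "z = \<zero>\<^bsub>F\<^esub>" if "l \<in> I" "z \<in> carrier F" "\<Psi> (U l 0 0 z) = \<zero>\<^bsub>R\<^esub>" for l z
    using rep_U_inj[OF that(1,2) F.zero_closed] that u0 by simp
  show ?thesis
  proof (unfold_locales)
    fix t assume t: "t \<in> I"
    show "?p t \<in> carrier R" by (simp add: uc)
    show "?p t \<otimes>\<^bsub>R\<^esub> ?p t = ?p t" using UU t by simp
    show "?p t \<noteq> \<zero>\<^bsub>R\<^esub>" using u_eq0[OF t F.one_closed] F.one_not_zero by blast
  next
    fix s t x assume a: "s \<in> I" "t \<in> I" "s \<noteq> t" "x \<in> carrier R"
    obtain y where y: "y \<in> carrier P" "x = \<Psi> y" using a rep_surj by auto
    have "?p s \<otimes>\<^bsub>R\<^esub> x \<otimes>\<^bsub>R\<^esub> ?p t = \<Psi> (U s 0 0 \<one>\<^bsub>F\<^esub> \<otimes>\<^bsub>P\<^esub> y \<otimes>\<^bsub>P\<^esub> U t 0 0 \<one>\<^bsub>F\<^esub>)"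
      using y by (simp add: rep_mult U_closed F.matrix_product_closed)
    then show "?p s \<otimes>\<^bsub>R\<^esub> x \<otimes>\<^bsub>R\<^esub> ?p t = \<zero>\<^bsub>R\<^esub>"
      using U_sandwich[OF y(1) a(1,2)] a d_pos rep_zero by simp
  next
    fix t x assume a: "t \<in> I" "x \<in> carrier R"
    have "?p t \<otimes>\<^bsub>R\<^esub> (?p t \<otimes>\<^bsub>R\<^esub> x \<otimes>\<^bsub>R\<^esub> ?p t) = ?p t \<otimes>\<^bsub>R\<^esub> x \<otimes>\<^bsub>R\<^esub> ?p t"
      "(?p t \<otimes>\<^bsub>R\<^esub> x \<otimes>\<^bsub>R\<^esub> ?p t) \<otimes>\<^bsub>R\<^esub> ?p t = ?p t \<otimes>\<^bsub>R\<^esub> x \<otimes>\<^bsub>R\<^esub> ?p t"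
      using a uc UU[OF F.one_closed F.one_closed a(1)] by (simp_all add: R.m_assoc) (simp add: R.m_assoc[symmetric])
    then obtain z where z: "z \<in> carrier F" "?p t \<otimes>\<^bsub>R\<^esub> x \<otimes>\<^bsub>R\<^esub> ?p t = \<Psi> (U t 0 0 z)"
      using corner_element[OF a(1)] a uc by (metis F.one_closed R.m_closed)
    let ?s = "\<lambda>l\<in>I. \<lambda>(i, j)\<in>{..<d l} \<times> {..<d l}. if i = j then z else \<zero>\<^bsub>F\<^esub>"
    note s = scalar_central[OF z(1)]
    show "\<exists>z\<in>carrier R. (\<forall>b\<in>carrier R. z \<otimes>\<^bsub>R\<^esub> b = b \<otimes>\<^bsub>R\<^esub> z) \<and> ?p t \<otimes>\<^bsub>R\<^esub> x \<otimes>\<^bsub>R\<^esub> ?p t = z \<otimes>\<^bsub>R\<^esub> ?p t"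
    proof (intro bexI[of _ "\<Psi> ?s"] conjI ballI)
      fix b assume "b \<in> carrier R"
      then obtain y where y: "y \<in> carrier P" "b = \<Psi> y" using rep_surj by auto
      show "\<Psi> ?s \<otimes>\<^bsub>R\<^esub> b = b \<otimes>\<^bsub>R\<^esub> \<Psi> ?s" using rep_mult[OF s(1) y(1)] rep_mult[OF y(1) s(1)] s(2)[OF y(1)] y(2) by simp
    next
      show "?p t \<otimes>\<^bsub>R\<^esub> x \<otimes>\<^bsub>R\<^esub> ?p t = \<Psi> ?s \<otimes>\<^bsub>R\<^esub> ?p t"
        unfolding z(2) s(3)[OF a(1), symmetric] by (rule rep_mult[OF s(1) U_closed[OF F.one_closed]])
    qed (simp add: rep_closed s(1))
  next
    fix t c e assume a: "t \<in> I" "c \<in> carrier R" "e \<in> carrier R" "?p t \<otimes>\<^bsub>R\<^esub> c = c" "c \<otimes>\<^bsub>R\<^esub> ?p t = c"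
      "?p t \<otimes>\<^bsub>R\<^esub> e = e" "e \<otimes>\<^bsub>R\<^esub> ?p t = e" "c \<otimes>\<^bsub>R\<^esub> e = \<zero>\<^bsub>R\<^esub>"
    obtain z where z: "z \<in> carrier F" "c = \<Psi> (U t 0 0 z)" using corner_element[OF a(1,2,4,5)] by blast
    obtain w where w: "w \<in> carrier F" "e = \<Psi> (U t 0 0 w)" using corner_element[OF a(1,3,6,7)] by blast
    have "z \<otimes>\<^bsub>F\<^esub> w = \<zero>\<^bsub>F\<^esub>" using u_eq0[OF a(1)] UU[OF z(1) w(1) a(1)] z w a(8) by simp
    then have "z = \<zero>\<^bsub>F\<^esub> \<or> w = \<zero>\<^bsub>F\<^esub>" using F.integral z w by blast
    then show "c = \<zero>\<^bsub>R\<^esub> \<or> e = \<zero>\<^bsub>R\<^esub>" using z w u0 by auto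
  next
    fix t J assume t: "t \<in> I" and J: "J \<subseteq> carrier R" "\<zero>\<^bsub>R\<^esub> \<in> J" "\<And>x. x \<in> J \<Longrightarrow> ?p t \<otimes>\<^bsub>R\<^esub> x = x \<and> x \<otimes>\<^bsub>R\<^esub> ?p t = x"
      "\<And>x y. \<lbrakk>x \<in> J; y \<in> J\<rbrakk> \<Longrightarrow> x \<oplus>\<^bsub>R\<^esub> y \<in> J" "\<And>x b. \<lbrakk>x \<in> J; b \<in> carrier R\<rbrakk> \<Longrightarrow> x \<otimes>\<^bsub>R\<^esub> b \<otimes>\<^bsub>R\<^esub> ?p t \<in> J"
    \<comment> \<open>The right ideal of the corner, pulled back to an ideal of \<open>F\<close>,
      where a generator exists.\<close>
    define J0 where "J0 = {z \<in> carrier F. \<Psi> (U t 0 0 z) \<in> J}"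
    have mul: "z \<otimes>\<^bsub>F\<^esub> w \<in> J0" if zJ: "z \<in> J0" and w: "w \<in> carrier F" for z w
    proof -
      have z: "z \<in> carrier F" "\<Psi> (U t 0 0 z) \<in> J" using zJ unfolding J0_def by auto
      have "\<Psi> (U t 0 0 z) \<otimes>\<^bsub>R\<^esub> \<Psi> (U t 0 0 w) \<otimes>\<^bsub>R\<^esub> ?p t \<in> J" using J(5)[OF z(2) uc[OF w]] .
      then show ?thesis unfolding J0_def using UU t z w by simp
    qed
    have "ideal J0 F"
    proof (rule idealI[OF F.ring_axioms])
      show "subgroup J0 (add_monoid F)"
      proof (rule F.add.subgroupI)
        show "J0 \<subseteq> carrier F" unfolding J0_def by auto
        show "J0 \<noteq> {}" unfolding J0_def using J(2) u0 by auto
      next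
        fix a assume a: "a \<in> J0"
        then have ac: "a \<in> carrier F" unfolding J0_def by auto
        have "\<ominus>\<^bsub>F\<^esub> a = a \<otimes>\<^bsub>F\<^esub> (\<ominus>\<^bsub>F\<^esub> \<one>\<^bsub>F\<^esub>)" using ac by (simp add: F.r_minus)
        then show "\<ominus>\<^bsub>F\<^esub> a \<in> J0" using mul[OF a, of "\<ominus>\<^bsub>F\<^esub> \<one>\<^bsub>F\<^esub>"] by simp
      next
        fix a b assume "a \<in> J0" "b \<in> J0"
        then show "a \<oplus>\<^bsub>F\<^esub> b \<in> J0" unfolding J0_def using J(4)[of "\<Psi> (U t 0 0 a)" "\<Psi> (U t 0 0 b)"] UA[of a b t] t by simp
      qed
    next
      fix a x assume a: "a \<in> J0" "x \<in> carrier F"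
      then have ac: "a \<in> carrier F" unfolding J0_def by auto
      show "a \<otimes>\<^bsub>F\<^esub> x \<in> J0" using mul a by blast
      then show "x \<otimes>\<^bsub>F\<^esub> a \<in> J0" using a ac by (simp add: F.m_comm)
    qed
    then obtain a where a: "a \<in> carrier F" "J0 = PIdl\<^bsub>F\<^esub> a" using F.exists_gen by blast
    have aJ: "a \<in> J0" unfolding a(2) using F.cgenideal_self[OF a(1)] .
    show "\<exists>a\<in>J. \<forall>x\<in>J. \<exists>b\<in>carrier R. ?p t \<otimes>\<^bsub>R\<^esub> b = b \<and> b \<otimes>\<^bsub>R\<^esub> ?p t = b \<and> x = a \<otimes>\<^bsub>R\<^esub> b"
    proof (rule bexI[of _ "\<Psi> (U t 0 0 a)"], rule ballI)
      show "\<Psi> (U t 0 0 a) \<in> J" using aJ unfolding J0_def by auto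
      fix x assume x: "x \<in> J"
      then obtain z where z: "z \<in> carrier F" "x = \<Psi> (U t 0 0 z)" using corner_element[OF t, of x] J(1,3) by blast
      then have "z \<in> J0" using x unfolding J0_def by auto
      then obtain b where b: "b \<in> carrier F" "z = b \<otimes>\<^bsub>F\<^esub> a" unfolding a(2) cgenideal_def by auto
      show "\<exists>b\<in>carrier R. ?p t \<otimes>\<^bsub>R\<^esub> b = b \<and> b \<otimes>\<^bsub>R\<^esub> ?p t = b \<and> x = \<Psi> (U t 0 0 a) \<otimes>\<^bsub>R\<^esub> b"
        by (rule bexI[of _ "\<Psi> (U t 0 0 b)"]) (use UU t a b z uc in \<open>auto simp: F.m_comm\<close>)
    qed
  next
    show "\<exists>M. has_type R I ?p \<one>\<^bsub>R\<^esub> M"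
      using has_type_Dg[OF finite_Sigma subset_refl] unfolding Dg_all rep_one by blast
  qed
qed

end

lemma ultramatricial_locally_framed:
  fixes F :: "('a, 'm) ring_scheme" and A :: "('a, 'b) module"
  assumes "principal_domain F" "ultramatricial F A"
  shows "locally_framed A"
proof -
  interpret F: principal_domain F by fact
  have A: "assoc_algebra F A" using assms(2) unfolding ultramatricial_def by (rule conjunct1)
  obtain \<B> where B': "countable \<B> \<and> \<B> \<noteq> {} \<and>
      (\<forall>B \<in> \<B>. \<forall>C \<in> \<B>. \<exists>D \<in> \<B>. B \<subseteq> D \<and> C \<subseteq> D) \<and>
      (\<forall>B \<in> \<B>. unital_subalgebra B F A \<and> matricial F (A\<lparr>carrier := B\<rparr>)) \<and> carrier A = \<Union>\<B>"
    using conjunct2[OF assms(2)[unfolded ultramatricial_def]] by (elim exE)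
  note B1 = B'[THEN conjunct2, THEN conjunct1] and B2 = B'[THEN conjunct2, THEN conjunct2, THEN conjunct1]
    and B3 = B'[THEN conjunct2, THEN conjunct2, THEN conjunct2, THEN conjunct1]
    and B4 = B'[THEN conjunct2, THEN conjunct2, THEN conjunct2, THEN conjunct2]
  have rA: "ring A" using A unfolding assoc_algebra_def by (elim conjE)
  interpret A: ring A by (rule rA)
  show ?thesis unfolding locally_framed_def
  proof (intro conjI allI impI)
    fix K assume "finite K \<and> K \<subseteq> carrier A"
    then have "finite K" "K \<subseteq> \<Union>\<B>" unfolding B4 by simp_all
    \<comment> \<open>Directedness puts a finite set into a single member of the family.
      Nonemptiness of the family settles the empty set.\<close>
    then have "\<exists>C\<in>\<B>. K \<subseteq> C"
    proof (induction rule: finite_induct)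
      case empty
      then show ?case using B1 by blast
    next
      case (insert x K)
      then obtain C D where "C \<in> \<B>" "K \<subseteq> C" "D \<in> \<B>" "x \<in> D" by auto
      then show ?case using bspec[OF bspec[OF B2, of C], of D] by blast
    qed
    then obtain C where C: "C \<in> \<B>" "K \<subseteq> C" by blast
    let ?S = "A\<lparr>carrier := C\<rparr>"
    have sub: "subring C A" "matricial F ?S" using bspec[OF B3 C(1)] unfolding unital_subalgebra_def by simp_all
    have S: "subring_of ?S A" by (rule subring_of_subring[OF sub(1) rA])
    interpret S: ring ?S by (rule subring_ofD(1)[OF S])
    obtain r :: nat and d h where d: "\<And>i. i < r \<Longrightarrow> 0 < d i" and h: "h \<in> ring_iso ?S (matrix_product F {..<r} d)"
      using sub(2) unfolding matricial_def algebra_isomorphic_def by blast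
    define \<Psi> where "\<Psi> = inv_into (carrier ?S) h"
    have "\<Psi> \<in> ring_iso (matrix_product F {..<r} d) ?S" unfolding \<Psi>_def by (rule ring_iso_set_sym[OF S.ring_axioms h])
    then have "\<Psi> \<in> ring_hom (matrix_product F {..<r} d) ?S" "bij_betw \<Psi> (carrier (matrix_product F {..<r} d)) (carrier ?S)"
      unfolding ring_iso_def by auto
    note psi = this
    interpret matricial_rep F ?S "{..<r}" d \<Psi>
      by unfold_locales (use psi d in \<open>auto simp: ring_hom_closed[OF psi(1)] ring_hom_mult[OF psi(1)]
        ring_hom_add[OF psi(1)] ring_hom_one[OF psi(1)] bij_betw_def\<close>)
    have "subring_of ?S A \<and> K \<subseteq> carrier ?S \<and> matricial_frame ?S {..<r} (\<lambda>l. \<Psi> (block_unit F {..<r} d l 0 0 \<one>\<^bsub>F\<^esub>))"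
      using S C(2) is_matricial_frame by simp
    then show "\<exists>S (I :: nat set) p. subring_of (S :: ('a, 'b) module) A \<and> K \<subseteq> carrier S \<and> matricial_frame S I p"
      by (intro exI[of _ ?S] exI[of _ "{..<r}"] exI[of _ "\<lambda>l. \<Psi> (block_unit F {..<r} d l 0 0 \<one>\<^bsub>F\<^esub>)"])
  qed (rule rA)
qed

section \<open>Kernel algebras\<close>

text \<open>Families, indexed by \<open>C\<close>, of infinite row-finite matrices.\<close>
definition kernel_algebra :: "'c set \<Rightarrow> ('a, 'm) ring_scheme \<Rightarrow> ('a, 'c \<times> nat \<times> nat \<Rightarrow> 'a) module" where
  "kernel_algebra C F =
     \<lparr>carrier = {k. (\<forall>\<xi> a b. k (\<xi>, a, b) \<in> carrier F) \<and> (\<forall>\<xi> a. \<exists>N. \<forall>b\<ge>N. k (\<xi>, a, b) = \<zero>\<^bsub>F\<^esub>) \<and>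
        (\<forall>\<xi> a b. \<xi> \<notin> C \<longrightarrow> k (\<xi>, a, b) = \<zero>\<^bsub>F\<^esub>)},
      monoid.mult = (\<lambda>k l. \<lambda>(\<xi>, a, c). \<Oplus>\<^bsub>F\<^esub>b\<in>{b. k (\<xi>, a, b) \<noteq> \<zero>\<^bsub>F\<^esub>}. k (\<xi>, a, b) \<otimes>\<^bsub>F\<^esub> l (\<xi>, b, c)),
      one = (\<lambda>(\<xi>, a, b). if \<xi> \<in> C \<and> a = b then \<one>\<^bsub>F\<^esub> else \<zero>\<^bsub>F\<^esub>),
      ring.zero = (\<lambda>_. \<zero>\<^bsub>F\<^esub>),
      ring.add = (\<lambda>k l. \<lambda>x. k x \<oplus>\<^bsub>F\<^esub> l x),
      smult = (\<lambda>z k. \<lambda>x. z \<otimes>\<^bsub>F\<^esub> k x)\<rparr>"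

lemma kernel_simps:
  "k \<in> carrier (kernel_algebra C F) \<longleftrightarrow> (\<forall>\<xi> a b. k (\<xi>, a, b) \<in> carrier F) \<and> (\<forall>\<xi> a. \<exists>N. \<forall>b\<ge>N. k (\<xi>, a, b) = \<zero>\<^bsub>F\<^esub>) \<and>
        (\<forall>\<xi> a b. \<xi> \<notin> C \<longrightarrow> k (\<xi>, a, b) = \<zero>\<^bsub>F\<^esub>)"
  "(k \<oplus>\<^bsub>kernel_algebra C F\<^esub> l) x = k x \<oplus>\<^bsub>F\<^esub> l x"
  "\<zero>\<^bsub>kernel_algebra C F\<^esub> x = \<zero>\<^bsub>F\<^esub>"
  "\<one>\<^bsub>kernel_algebra C F\<^esub> (\<xi>, a, b) = (if \<xi> \<in> C \<and> a = b then \<one>\<^bsub>F\<^esub> else \<zero>\<^bsub>F\<^esub>)"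
  "(z \<odot>\<^bsub>kernel_algebra C F\<^esub> k) x = z \<otimes>\<^bsub>F\<^esub> k x"
  by (simp_all add: kernel_algebra_def)

lemma kernel_eqI: "(\<And>\<xi> a b. k (\<xi>, a, b) = l (\<xi>, a, b)) \<Longrightarrow> k = l" for k l :: "'c \<times> nat \<times> nat \<Rightarrow> 'a"
  by (intro ext) auto

lemma kernel_closed: "k \<in> carrier (kernel_algebra C F) \<Longrightarrow> k x \<in> carrier F"
  by (cases x) (auto simp: kernel_simps)

lemma kernel_bound:
  assumes "k \<in> carrier (kernel_algebra C F)"
  obtains N where "\<And>b. b \<ge> N \<Longrightarrow> k (\<xi>, a, b) = \<zero>\<^bsub>F\<^esub>"
  using assms unfolding kernel_simps by blast

lemma kernel_outside: "k \<in> carrier (kernel_algebra C F) \<Longrightarrow> \<xi> \<notin> C \<Longrightarrow> k (\<xi>, a, b) = \<zero>\<^bsub>F\<^esub>"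
  by (simp add: kernel_simps)

context ring begin

text \<open>The defining sum runs over the support of a row. Any common bound may replace it, so
  that sums coming from different factors can be compared over the same range.\<close>

lemma kernel_mult:
  assumes k: "k \<in> carrier (kernel_algebra C R)" and l: "l \<in> carrier (kernel_algebra C R)"
    and N: "\<And>b. b \<ge> N \<Longrightarrow> k (\<xi>, a, b) = \<zero>"
  shows "(k \<otimes>\<^bsub>kernel_algebra C R\<^esub> l) (\<xi>, a, c) = (\<Oplus>b\<in>{..<N}. k (\<xi>, a, b) \<otimes> l (\<xi>, b, c))"
proof -
  have kc: "k x \<in> carrier R" "l x \<in> carrier R" for x by (rule kernel_closed, rule k, rule kernel_closed, rule l)
  have "(k \<otimes>\<^bsub>kernel_algebra C R\<^esub> l) (\<xi>, a, c) = (\<Oplus>b\<in>{b. k (\<xi>, a, b) \<noteq> \<zero>}. k (\<xi>, a, b) \<otimes> l (\<xi>, b, c))"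
    by (simp add: kernel_algebra_def)
  also have "\<dots> = (\<Oplus>b\<in>{..<N}. k (\<xi>, a, b) \<otimes> l (\<xi>, b, c))"
  proof (rule add.finprod_mono_neutral_cong_left)
    show "{b. k (\<xi>, a, b) \<noteq> \<zero>} \<subseteq> {..<N}" using N by (auto simp: not_le[symmetric])
  qed (use kc in auto)
  finally show ?thesis .
qed

lemma kernel_mult_closed:
  assumes k: "k \<in> carrier (kernel_algebra C R)" and l: "l \<in> carrier (kernel_algebra C R)"
  shows "k \<otimes>\<^bsub>kernel_algebra C R\<^esub> l \<in> carrier (kernel_algebra C R)"
proof -
  have kc: "k x \<in> carrier R" "l x \<in> carrier R" for x by (rule kernel_closed, rule k, rule kernel_closed, rule l)
  have "(k \<otimes>\<^bsub>kernel_algebra C R\<^esub> l) (\<xi>, a, c) \<in> carrier R" for \<xi> a c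
    by (auto simp: kernel_algebra_def intro!: finsum_closed m_closed kc)
  moreover have "\<exists>M. \<forall>c\<ge>M. (k \<otimes>\<^bsub>kernel_algebra C R\<^esub> l) (\<xi>, a, c) = \<zero>" for \<xi> a
  proof -
    obtain N where N: "\<And>b. b \<ge> N \<Longrightarrow> k (\<xi>, a, b) = \<zero>" using kernel_bound[OF k] by metis
    have "\<forall>b. \<exists>M. \<forall>c\<ge>M. l (\<xi>, b, c) = \<zero>" using l unfolding kernel_simps by blast
    then obtain M where M: "\<And>b c. c \<ge> M b \<Longrightarrow> l (\<xi>, b, c) = \<zero>" by metis
    have "(k \<otimes>\<^bsub>kernel_algebra C R\<^esub> l) (\<xi>, a, c) = \<zero>" if c: "c \<ge> Max (insert 0 (M ` {..<N}))" for c
    proof -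
      have "l (\<xi>, b, c) = \<zero>" if b: "b < N" for b using M[of b c] c b by auto
      then have "(\<Oplus>b\<in>{..<N}. k (\<xi>, a, b) \<otimes> l (\<xi>, b, c)) = (\<Oplus>b\<in>{..<N}. \<zero>)"
        by (intro finsum_cong') (auto simp: kc)
      then show ?thesis using kernel_mult[OF k l N] by (simp add: finsum_zero)
    qed
    then show ?thesis by blast
  qed
  moreover have "(k \<otimes>\<^bsub>kernel_algebra C R\<^esub> l) (\<xi>, a, c) = \<zero>" if "\<xi> \<notin> C" for \<xi> a c
    using kernel_mult[OF k l, of 0 \<xi> a c] kernel_outside[OF k that] by simp
  ultimately show ?thesis unfolding kernel_simps by blast
qed

lemma kernel_add_closed:
  assumes k: "k \<in> carrier (kernel_algebra C R)" and l: "l \<in> carrier (kernel_algebra C R)"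
  shows "k \<oplus>\<^bsub>kernel_algebra C R\<^esub> l \<in> carrier (kernel_algebra C R)"
proof -
  have kc: "k x \<in> carrier R" "l x \<in> carrier R" for x by (rule kernel_closed, rule k, rule kernel_closed, rule l)
  have "\<exists>N. \<forall>b\<ge>N. k (\<xi>, a, b) \<oplus> l (\<xi>, a, b) = \<zero>" for \<xi> a
  proof -
    obtain N where N: "\<And>b. b \<ge> N \<Longrightarrow> k (\<xi>, a, b) = \<zero>" using kernel_bound[OF k] by metis
    obtain M where M: "\<And>b. b \<ge> M \<Longrightarrow> l (\<xi>, a, b) = \<zero>" using kernel_bound[OF l] by metis
    show ?thesis by (rule exI[of _ "max N M"]) (simp add: N M)
  qed
  then show ?thesis using kernel_outside[OF k] kernel_outside[OF l] kc unfolding kernel_simps by auto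
qed

lemma kernel_smult_closed:
  assumes k: "k \<in> carrier (kernel_algebra C R)" and z: "z \<in> carrier R"
  shows "z \<odot>\<^bsub>kernel_algebra C R\<^esub> k \<in> carrier (kernel_algebra C R)"
proof -
  have "\<exists>N. \<forall>b\<ge>N. z \<otimes> k (\<xi>, a, b) = \<zero>" for \<xi> a
  proof -
    obtain N where N: "\<And>b. b \<ge> N \<Longrightarrow> k (\<xi>, a, b) = \<zero>" using kernel_bound[OF k] by metis
    show ?thesis by (rule exI[of _ "N"]) (simp add: N z)
  qed
  then show ?thesis using kernel_outside[OF k] kernel_closed[OF k] z unfolding kernel_simps by auto
qed

lemma kernel_one_closed: "\<one>\<^bsub>kernel_algebra C R\<^esub> \<in> carrier (kernel_algebra C R)"
proof -
  have "\<exists>N. \<forall>b\<ge>N. \<one>\<^bsub>kernel_algebra C R\<^esub> (\<xi>, a, b) = \<zero>" for \<xi> a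
    by (rule exI[of _ "Suc a"]) (simp add: kernel_simps)
  then show ?thesis unfolding kernel_simps(1) by (auto simp: kernel_simps)
qed

lemma kernel_zero_closed: "\<zero>\<^bsub>kernel_algebra C R\<^esub> \<in> carrier (kernel_algebra C R)"
  by (simp add: kernel_simps)

lemma kernel_ring: "ring (kernel_algebra C R)"
proof -
  let ?A = "kernel_algebra C R"
  note cl = kernel_mult_closed kernel_add_closed kernel_one_closed kernel_zero_closed
  have assoc: "k \<otimes>\<^bsub>?A\<^esub> l \<otimes>\<^bsub>?A\<^esub> m = k \<otimes>\<^bsub>?A\<^esub> (l \<otimes>\<^bsub>?A\<^esub> m)"
    if c: "k \<in> carrier ?A" "l \<in> carrier ?A" "m \<in> carrier ?A" for k l m
  proof (rule kernel_eqI)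
    fix \<xi> a e
    have kc: "k x \<in> carrier R" "l x \<in> carrier R" "m x \<in> carrier R" for x by (rule kernel_closed, rule c)+
    obtain N where N: "\<And>b. b \<ge> N \<Longrightarrow> k (\<xi>, a, b) = \<zero>" using kernel_bound[OF c(1)] by metis
    have "\<forall>b. \<exists>M. \<forall>c\<ge>M. l (\<xi>, b, c) = \<zero>" using c(2) unfolding kernel_simps by blast
    then obtain M0 where M0: "\<And>b c. c \<ge> M0 b \<Longrightarrow> l (\<xi>, b, c) = \<zero>" by metis
    obtain M1 where M1: "\<And>c. c \<ge> M1 \<Longrightarrow> (k \<otimes>\<^bsub>?A\<^esub> l) (\<xi>, a, c) = \<zero>"
      using kernel_bound[OF cl(1)[OF c(1,2)]] by metis
    \<comment> \<open>One bound for the rows of \<open>l\<close> met by the row of \<open>k\<close>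
      and for the row of the product, so that both bracketings become sums over the same
      rectangle.\<close>
    define M where "M = Max (insert M1 (M0 ` {..<N}))"
    have M: "l (\<xi>, b, c) = \<zero>" if "b < N" "c \<ge> M" for b c using M0[of b c] that unfolding M_def by auto
    have Mkl: "(k \<otimes>\<^bsub>?A\<^esub> l) (\<xi>, a, c) = \<zero>" if "c \<ge> M" for c using M1[of c] that unfolding M_def by auto
    have "(k \<otimes>\<^bsub>?A\<^esub> l \<otimes>\<^bsub>?A\<^esub> m) (\<xi>, a, e)
      = (\<Oplus>c\<in>{..<M}. (\<Oplus>b\<in>{..<N}. k (\<xi>, a, b) \<otimes> l (\<xi>, b, c)) \<otimes> m (\<xi>, c, e))"
      using kernel_mult[OF cl(1)[OF c(1,2)] c(3) Mkl] kernel_mult[OF c(1,2) N] by simp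
    also have "\<dots> = (\<Oplus>c\<in>{..<M}. \<Oplus>b\<in>{..<N}. k (\<xi>, a, b) \<otimes> l (\<xi>, b, c) \<otimes> m (\<xi>, c, e))"
      by (intro finsum_cong' finsum_ldistr) (auto simp: kc Pi_iff)
    also have "\<dots> = (\<Oplus>b\<in>{..<N}. \<Oplus>c\<in>{..<M}. k (\<xi>, a, b) \<otimes> l (\<xi>, b, c) \<otimes> m (\<xi>, c, e))"
      by (intro finsum_swap) (auto simp: kc)
    also have "\<dots> = (\<Oplus>b\<in>{..<N}. \<Oplus>c\<in>{..<M}. k (\<xi>, a, b) \<otimes> (l (\<xi>, b, c) \<otimes> m (\<xi>, c, e)))"
      by (intro finsum_cong' m_assoc) (auto simp: kc Pi_iff)
    also have "\<dots> = (\<Oplus>b\<in>{..<N}. k (\<xi>, a, b) \<otimes> (\<Oplus>c\<in>{..<M}. l (\<xi>, b, c) \<otimes> m (\<xi>, c, e)))"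
      by (intro finsum_cong' finsum_rdistr[symmetric]) (auto simp: kc Pi_iff)
    also have "\<dots> = (\<Oplus>b\<in>{..<N}. k (\<xi>, a, b) \<otimes> (l \<otimes>\<^bsub>?A\<^esub> m) (\<xi>, b, e))"
      using kernel_mult[OF c(2,3) M] by (intro finsum_cong') (auto simp: kc Pi_iff)
    also have "\<dots> = (k \<otimes>\<^bsub>?A\<^esub> (l \<otimes>\<^bsub>?A\<^esub> m)) (\<xi>, a, e)"
      using kernel_mult[OF c(1) cl(1)[OF c(2,3)] N] by simp
    finally show "(k \<otimes>\<^bsub>?A\<^esub> l \<otimes>\<^bsub>?A\<^esub> m) (\<xi>, a, e) = (k \<otimes>\<^bsub>?A\<^esub> (l \<otimes>\<^bsub>?A\<^esub> m)) (\<xi>, a, e)" .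
  qed
  have abel: "abelian_group ?A"
  proof (rule abelian_groupI)
    fix k assume k: "k \<in> carrier ?A"
    have kc: "k x \<in> carrier R" for x by (rule kernel_closed[OF k])
    have "(\<ominus> \<one>) \<odot>\<^bsub>?A\<^esub> k \<oplus>\<^bsub>?A\<^esub> k = \<zero>\<^bsub>?A\<^esub>"
      by (rule kernel_eqI) (simp add: kernel_simps kc l_minus l_neg)
    then show "\<exists>y\<in>carrier ?A. y \<oplus>\<^bsub>?A\<^esub> k = \<zero>\<^bsub>?A\<^esub>" using kernel_smult_closed[OF k] by blast
  next
    fix k l m assume c: "k \<in> carrier ?A" "l \<in> carrier ?A" "m \<in> carrier ?A"
    have kc: "k x \<in> carrier R" "l x \<in> carrier R" "m x \<in> carrier R" for x by (rule kernel_closed, rule c)+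
    show "k \<oplus>\<^bsub>?A\<^esub> l \<oplus>\<^bsub>?A\<^esub> m = k \<oplus>\<^bsub>?A\<^esub> (l \<oplus>\<^bsub>?A\<^esub> m)" by (rule kernel_eqI) (simp add: kernel_simps kc a_assoc)
    show "k \<oplus>\<^bsub>?A\<^esub> l = l \<oplus>\<^bsub>?A\<^esub> k" by (rule kernel_eqI) (simp add: kernel_simps kc a_comm)
    show "\<zero>\<^bsub>?A\<^esub> \<oplus>\<^bsub>?A\<^esub> k = k" by (rule kernel_eqI) (simp add: kernel_simps kc)
  qed (auto intro: cl)
  have one: "\<one>\<^bsub>?A\<^esub> \<otimes>\<^bsub>?A\<^esub> k = k" "k \<otimes>\<^bsub>?A\<^esub> \<one>\<^bsub>?A\<^esub> = k" if k: "k \<in> carrier ?A" for k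
  proof -
    have kc: "k x \<in> carrier R" for x by (rule kernel_closed[OF k])
    show "\<one>\<^bsub>?A\<^esub> \<otimes>\<^bsub>?A\<^esub> k = k"
    proof (rule kernel_eqI)
      fix \<xi> a c
      have "(\<one>\<^bsub>?A\<^esub> \<otimes>\<^bsub>?A\<^esub> k) (\<xi>, a, c) = (\<Oplus>b\<in>{..<Suc a}. \<one>\<^bsub>?A\<^esub> (\<xi>, a, b) \<otimes> k (\<xi>, b, c))"
        by (rule kernel_mult[OF cl(3) k]) (simp add: kernel_simps)
      also have "\<dots> = (\<Oplus>b\<in>{..<Suc a}. if b = a then k (\<xi>, a, c) else \<zero>)"
        by (rule finsum_cong') (auto simp: kernel_simps kc kernel_outside[OF k])
      also have "\<dots> = k (\<xi>, a, c)" by (rule finsum_delta) (auto simp: kc)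
      finally show "(\<one>\<^bsub>?A\<^esub> \<otimes>\<^bsub>?A\<^esub> k) (\<xi>, a, c) = k (\<xi>, a, c)" .
    qed
    show "k \<otimes>\<^bsub>?A\<^esub> \<one>\<^bsub>?A\<^esub> = k"
    proof (rule kernel_eqI)
      fix \<xi> a c
      obtain N0 where N0: "\<And>b. b \<ge> N0 \<Longrightarrow> k (\<xi>, a, b) = \<zero>" using kernel_bound[OF k] by metis
      have "(k \<otimes>\<^bsub>?A\<^esub> \<one>\<^bsub>?A\<^esub>) (\<xi>, a, c) = (\<Oplus>b\<in>{..<max N0 (Suc c)}. k (\<xi>, a, b) \<otimes> \<one>\<^bsub>?A\<^esub> (\<xi>, b, c))"
        by (rule kernel_mult[OF k cl(3)]) (simp add: N0)
      also have "\<dots> = (\<Oplus>b\<in>{..<max N0 (Suc c)}. if b = c then k (\<xi>, a, c) else \<zero>)"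
        by (rule finsum_cong') (auto simp: kernel_simps kc kernel_outside[OF k])
      also have "\<dots> = k (\<xi>, a, c)" by (rule finsum_delta) (auto simp: kc)
      finally show "(k \<otimes>\<^bsub>?A\<^esub> \<one>\<^bsub>?A\<^esub>) (\<xi>, a, c) = k (\<xi>, a, c)" .
    qed
  qed
  show ?thesis
  proof (rule ringI[OF abel])
    show "monoid ?A" by (rule monoidI) (auto intro: cl assoc one)
  next
    fix k l m assume c: "k \<in> carrier ?A" "l \<in> carrier ?A" "m \<in> carrier ?A"
    have kc: "k x \<in> carrier R" "l x \<in> carrier R" "m x \<in> carrier R" for x by (rule kernel_closed, rule c)+
    show "(k \<oplus>\<^bsub>?A\<^esub> l) \<otimes>\<^bsub>?A\<^esub> m = k \<otimes>\<^bsub>?A\<^esub> m \<oplus>\<^bsub>?A\<^esub> l \<otimes>\<^bsub>?A\<^esub> m"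
    proof (rule kernel_eqI)
      fix \<xi> a e
      obtain N0 where N0: "\<And>b. b \<ge> N0 \<Longrightarrow> k (\<xi>, a, b) = \<zero>" using kernel_bound[OF c(1)] by metis
      obtain N1 where N1: "\<And>b. b \<ge> N1 \<Longrightarrow> l (\<xi>, a, b) = \<zero>" using kernel_bound[OF c(2)] by metis
      let ?N = "max N0 N1"
      have "((k \<oplus>\<^bsub>?A\<^esub> l) \<otimes>\<^bsub>?A\<^esub> m) (\<xi>, a, e) = (\<Oplus>b\<in>{..<?N}. (k \<oplus>\<^bsub>?A\<^esub> l) (\<xi>, a, b) \<otimes> m (\<xi>, b, e))"
        by (rule kernel_mult[OF cl(2)[OF c(1,2)] c(3)]) (simp add: N0 N1 kernel_simps)
      also have "\<dots> = (\<Oplus>b\<in>{..<?N}. k (\<xi>, a, b) \<otimes> m (\<xi>, b, e) \<oplus> l (\<xi>, a, b) \<otimes> m (\<xi>, b, e))"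
        by (rule finsum_cong') (auto simp: kernel_simps kc l_distr)
      also have "\<dots> = (\<Oplus>b\<in>{..<?N}. k (\<xi>, a, b) \<otimes> m (\<xi>, b, e)) \<oplus> (\<Oplus>b\<in>{..<?N}. l (\<xi>, a, b) \<otimes> m (\<xi>, b, e))"
        by (rule finsum_addf) (auto simp: kc)
      also have "\<dots> = (k \<otimes>\<^bsub>?A\<^esub> m \<oplus>\<^bsub>?A\<^esub> l \<otimes>\<^bsub>?A\<^esub> m) (\<xi>, a, e)"
        using kernel_mult[OF c(1,3), of ?N] kernel_mult[OF c(2,3), of ?N] by (simp add: N0 N1 kernel_simps)
      finally show "((k \<oplus>\<^bsub>?A\<^esub> l) \<otimes>\<^bsub>?A\<^esub> m) (\<xi>, a, e) = (k \<otimes>\<^bsub>?A\<^esub> m \<oplus>\<^bsub>?A\<^esub> l \<otimes>\<^bsub>?A\<^esub> m) (\<xi>, a, e)" .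
    qed
    show "m \<otimes>\<^bsub>?A\<^esub> (k \<oplus>\<^bsub>?A\<^esub> l) = m \<otimes>\<^bsub>?A\<^esub> k \<oplus>\<^bsub>?A\<^esub> m \<otimes>\<^bsub>?A\<^esub> l"
    proof (rule kernel_eqI)
      fix \<xi> a e
      obtain N where N: "\<And>b. b \<ge> N \<Longrightarrow> m (\<xi>, a, b) = \<zero>" using kernel_bound[OF c(3)] by metis
      have "(m \<otimes>\<^bsub>?A\<^esub> (k \<oplus>\<^bsub>?A\<^esub> l)) (\<xi>, a, e) = (\<Oplus>b\<in>{..<N}. m (\<xi>, a, b) \<otimes> (k \<oplus>\<^bsub>?A\<^esub> l) (\<xi>, b, e))"
        by (rule kernel_mult[OF c(3) cl(2)[OF c(1,2)] N])
      also have "\<dots> = (\<Oplus>b\<in>{..<N}. m (\<xi>, a, b) \<otimes> k (\<xi>, b, e) \<oplus> m (\<xi>, a, b) \<otimes> l (\<xi>, b, e))"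
        by (rule finsum_cong') (auto simp: kernel_simps kc r_distr)
      also have "\<dots> = (\<Oplus>b\<in>{..<N}. m (\<xi>, a, b) \<otimes> k (\<xi>, b, e)) \<oplus> (\<Oplus>b\<in>{..<N}. m (\<xi>, a, b) \<otimes> l (\<xi>, b, e))"
        by (rule finsum_addf) (auto simp: kc)
      also have "\<dots> = (m \<otimes>\<^bsub>?A\<^esub> k \<oplus>\<^bsub>?A\<^esub> m \<otimes>\<^bsub>?A\<^esub> l) (\<xi>, a, e)"
        using kernel_mult[OF c(3,1) N] kernel_mult[OF c(3,2) N] by (simp add: kernel_simps)
      finally show "(m \<otimes>\<^bsub>?A\<^esub> (k \<oplus>\<^bsub>?A\<^esub> l)) (\<xi>, a, e) = (m \<otimes>\<^bsub>?A\<^esub> k \<oplus>\<^bsub>?A\<^esub> m \<otimes>\<^bsub>?A\<^esub> l) (\<xi>, a, e)" .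
    qed
  qed
qed

end

lemma (in cring) kernel_assoc_algebra: "assoc_algebra R (kernel_algebra C R)"
proof -
  let ?A = "kernel_algebra C R"
  interpret A: ring ?A by (rule kernel_ring)
  show ?thesis
  proof (unfold_locales)
    fix a x assume a: "a \<in> carrier R" and x: "x \<in> carrier ?A"
    show "a \<odot>\<^bsub>?A\<^esub> x \<in> carrier ?A" by (rule kernel_smult_closed[OF x a])
  next
    fix x assume x: "x \<in> carrier ?A"
    show "\<one> \<odot>\<^bsub>?A\<^esub> x = x" by (rule kernel_eqI) (simp add: kernel_simps kernel_closed[OF x])
  next
    fix a b x assume a: "a \<in> carrier R" and b: "b \<in> carrier R" and x: "x \<in> carrier ?A"
    have xc: "x p \<in> carrier R" for p by (rule kernel_closed[OF x])
    show "(a \<oplus> b) \<odot>\<^bsub>?A\<^esub> x = a \<odot>\<^bsub>?A\<^esub> x \<oplus>\<^bsub>?A\<^esub> b \<odot>\<^bsub>?A\<^esub> x" by (rule kernel_eqI) (simp add: kernel_simps xc a b l_distr)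
    show "(a \<otimes> b) \<odot>\<^bsub>?A\<^esub> x = a \<odot>\<^bsub>?A\<^esub> (b \<odot>\<^bsub>?A\<^esub> x)" by (rule kernel_eqI) (simp add: kernel_simps xc a b m_assoc)
  next
    fix a x y assume a: "a \<in> carrier R" and x: "x \<in> carrier ?A" and y: "y \<in> carrier ?A"
    have xc: "x p \<in> carrier R" "y p \<in> carrier R" for p by (rule kernel_closed, rule x, rule kernel_closed, rule y)
    show "a \<odot>\<^bsub>?A\<^esub> (x \<oplus>\<^bsub>?A\<^esub> y) = a \<odot>\<^bsub>?A\<^esub> x \<oplus>\<^bsub>?A\<^esub> a \<odot>\<^bsub>?A\<^esub> y" by (rule kernel_eqI) (simp add: kernel_simps xc a r_distr)
    have *: "((a \<odot>\<^bsub>?A\<^esub> x) \<otimes>\<^bsub>?A\<^esub> y) (\<xi>, i, j) = (a \<odot>\<^bsub>?A\<^esub> (x \<otimes>\<^bsub>?A\<^esub> y)) (\<xi>, i, j) \<and>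
        (x \<otimes>\<^bsub>?A\<^esub> (a \<odot>\<^bsub>?A\<^esub> y)) (\<xi>, i, j) = (a \<odot>\<^bsub>?A\<^esub> (x \<otimes>\<^bsub>?A\<^esub> y)) (\<xi>, i, j)" for \<xi> i j
    proof -
      obtain N where N: "\<And>b. b \<ge> N \<Longrightarrow> x (\<xi>, i, b) = \<zero>" using kernel_bound[OF x] by metis
      have aN: "(a \<odot>\<^bsub>?A\<^esub> x) (\<xi>, i, b) = \<zero>" if "b \<ge> N" for b using N[OF that] a by (simp add: kernel_simps)
      have r: "(a \<odot>\<^bsub>?A\<^esub> (x \<otimes>\<^bsub>?A\<^esub> y)) (\<xi>, i, j) = (\<Oplus>b\<in>{..<N}. a \<otimes> (x (\<xi>, i, b) \<otimes> y (\<xi>, b, j)))"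
        unfolding kernel_simps by (subst kernel_mult[where N = N, OF x y], rule N, assumption, rule finsum_rdistr) (auto simp: xc a)
      have "((a \<odot>\<^bsub>?A\<^esub> x) \<otimes>\<^bsub>?A\<^esub> y) (\<xi>, i, j) = (\<Oplus>b\<in>{..<N}. a \<otimes> (x (\<xi>, i, b) \<otimes> y (\<xi>, b, j)))"
        by (subst kernel_mult[where N = N, OF kernel_smult_closed[OF x a] y], rule aN, assumption, rule finsum_cong') (auto simp: kernel_simps xc a m_assoc)
      moreover have "(x \<otimes>\<^bsub>?A\<^esub> (a \<odot>\<^bsub>?A\<^esub> y)) (\<xi>, i, j) = (\<Oplus>b\<in>{..<N}. a \<otimes> (x (\<xi>, i, b) \<otimes> y (\<xi>, b, j)))"
        by (subst kernel_mult[where N = N, OF x kernel_smult_closed[OF y a]], rule N, assumption, rule finsum_cong') (auto simp: kernel_simps xc a m_lcomm)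
      ultimately show ?thesis using r by simp
    qed
    show "(a \<odot>\<^bsub>?A\<^esub> x) \<otimes>\<^bsub>?A\<^esub> y = a \<odot>\<^bsub>?A\<^esub> (x \<otimes>\<^bsub>?A\<^esub> y)" by (rule kernel_eqI) (use * in blast)
    show "x \<otimes>\<^bsub>?A\<^esub> (a \<odot>\<^bsub>?A\<^esub> y) = a \<odot>\<^bsub>?A\<^esub> (x \<otimes>\<^bsub>?A\<^esub> y)" by (rule kernel_eqI) (use * in blast)
  qed
qed

text \<open>Each coordinate \<open>\<xi>\<close> cuts the naturals into intervals of length \<open>s \<xi>\<close>; a blockwise kernel
  vanishes off these intervals and looks the same on all intervals with the same label.\<close>
definition blockwise :: "'c set \<Rightarrow> ('a, 'm) ring_scheme \<Rightarrow> ('c \<Rightarrow> nat) \<Rightarrow> ('c \<Rightarrow> nat \<Rightarrow> 'l) \<Rightarrow> ('c \<times> nat \<times> nat \<Rightarrow> 'a) \<Rightarrow> bool" where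
  "blockwise C F s g k \<longleftrightarrow>
     (\<forall>\<xi>\<in>C. \<forall>a b. a div s \<xi> \<noteq> b div s \<xi> \<longrightarrow> k (\<xi>, a, b) = \<zero>\<^bsub>F\<^esub>) \<and>
     (\<forall>\<xi>\<in>C. \<forall>\<eta>\<in>C. \<forall>u v r t. g \<xi> u = g \<eta> v \<longrightarrow> r < s \<xi> \<longrightarrow> t < s \<xi> \<longrightarrow>
        k (\<xi>, u * s \<xi> + r, u * s \<xi> + t) = k (\<eta>, v * s \<eta> + r, v * s \<eta> + t))"

text \<open>A coarse interval is a union of \<open>q \<xi>\<close> fine ones. If equally labelled
  coarse intervals show the same sequence of fine labels, a kernel that is constant on fine labels
  is constant on coarse ones.\<close>

lemma blockwise_refine:
  assumes bw: "blockwise C F s g k"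
    and s: "\<And>\<xi>. \<xi> \<in> C \<Longrightarrow> s' \<xi> = q \<xi> * s \<xi>" "\<And>\<xi>. \<xi> \<in> C \<Longrightarrow> 0 < s \<xi>"
    and g: "\<And>\<xi> \<eta> u v. \<lbrakk>\<xi> \<in> C; \<eta> \<in> C; g' \<xi> u = g' \<eta> v\<rbrakk> \<Longrightarrow>
      s \<xi> = s \<eta> \<and> q \<xi> = q \<eta> \<and> (\<forall>c<q \<xi>. g \<xi> (u * q \<xi> + c) = g \<eta> (v * q \<eta> + c))"
  shows "blockwise C F s' g' k"
  unfolding blockwise_def
proof (intro conjI ballI allI impI)
  fix \<xi> a b assume \<xi>: "\<xi> \<in> C" and ne: "a div s' \<xi> \<noteq> b div s' \<xi>"
  then have "a div s \<xi> \<noteq> b div s \<xi>" using s(1)[OF \<xi>] by (metis div_mult2_eq mult.commute)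
  then show "k (\<xi>, a, b) = \<zero>\<^bsub>F\<^esub>" using bw \<xi> unfolding blockwise_def by blast
next
  fix \<xi> \<eta> u v r t assume \<xi>: "\<xi> \<in> C" and \<eta>: "\<eta> \<in> C" and e: "g' \<xi> u = g' \<eta> v" and r: "r < s' \<xi>" and t: "t < s' \<xi>"
  note gg = g[OF \<xi> \<eta> e]
  have pos: "0 < s \<xi>" by (rule s(2)[OF \<xi>])
  have split: "w * s' \<zeta> + x = (w * q \<zeta> + x div s \<zeta>) * s \<zeta> + x mod s \<zeta>" if "\<zeta> \<in> C" for w \<zeta> x
    unfolding s(1)[OF that] by (simp add: algebra_simps)
  have d: "(w * q \<zeta> + x div s \<zeta>) * s \<zeta> + x mod s \<zeta> = w * s' \<zeta> + x" if "\<zeta> \<in> C" for w \<zeta> x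
    using split[OF that] by simp
  have dv: "((w * q \<zeta> + x div s \<zeta>) * s \<zeta> + x mod s \<zeta>) div s \<zeta> = w * q \<zeta> + x div s \<zeta>" if "\<zeta> \<in> C" for w \<zeta> x
    using s(2)[OF that] by (simp add: div_mult_self3)
  have rq: "r div s \<xi> < q \<xi>" using r s(1)[OF \<xi>] pos by (simp add: less_mult_imp_div_less)
  show "k (\<xi>, u * s' \<xi> + r, u * s' \<xi> + t) = k (\<eta>, v * s' \<eta> + r, v * s' \<eta> + t)"
  \<comment> \<open>Two positions of a coarse interval lie either in the same fine interval, where
    the fine labels decide, or in different ones, where the kernel vanishes.\<close>
  proof (cases "r div s \<xi> = t div s \<xi>")
    case True
    have "g \<xi> (u * q \<xi> + r div s \<xi>) = g \<eta> (v * q \<eta> + r div s \<xi>)" using gg rq by blast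
    then have "k (\<xi>, (u * q \<xi> + r div s \<xi>) * s \<xi> + r mod s \<xi>, (u * q \<xi> + r div s \<xi>) * s \<xi> + t mod s \<xi>)
       = k (\<eta>, (v * q \<eta> + r div s \<xi>) * s \<eta> + r mod s \<xi>, (v * q \<eta> + r div s \<xi>) * s \<eta> + t mod s \<xi>)"
      using bw \<xi> \<eta> pos unfolding blockwise_def by (meson mod_less_divisor)
    then show ?thesis using d[OF \<xi>, of u r] d[OF \<xi>, of u t] d[OF \<eta>, of v r] d[OF \<eta>, of v t] True gg by simp
  next
    case False
    have "(u * s' \<xi> + r) div s \<xi> \<noteq> (u * s' \<xi> + t) div s \<xi>"
      using dv[OF \<xi>, of u r] dv[OF \<xi>, of u t] False unfolding d[OF \<xi>] by simp
    moreover have "(v * s' \<eta> + r) div s \<eta> \<noteq> (v * s' \<eta> + t) div s \<eta>"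
      using dv[OF \<eta>, of v r] dv[OF \<eta>, of v t] False gg unfolding d[OF \<eta>] by simp
    ultimately show ?thesis using bw \<xi> \<eta> unfolding blockwise_def by metis
  qed
qed

text \<open>The size of an interval is determined by its label through \<open>d_g\<close>, and
  \<open>g_onto\<close> lets every factor of the product occur somewhere, which makes
  \<open>\<Psi>\<close> injective.\<close>

locale interval_blocks = F: principal_domain F
  for F :: "('a, 'm) ring_scheme" +
  fixes C :: "'c set" and s :: "'c \<Rightarrow> nat" and g :: "'c \<Rightarrow> nat \<Rightarrow> 'l" and L :: "'l set" and d :: "'l \<Rightarrow> nat"
  assumes finite_L: "finite L"
    and s_pos: "\<xi> \<in> C \<Longrightarrow> 0 < s \<xi>"
    and g_in: "\<xi> \<in> C \<Longrightarrow> g \<xi> u \<in> L"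
    and d_g: "\<xi> \<in> C \<Longrightarrow> d (g \<xi> u) = s \<xi>"
    and g_onto: "l \<in> L \<Longrightarrow> \<exists>\<xi>\<in>C. \<exists>u. g \<xi> u = l"
begin

abbreviation "A \<equiv> kernel_algebra C F"
abbreviation "Q \<equiv> matrix_product F L d"
abbreviation "level \<equiv> {k \<in> carrier A. blockwise C F s g k}"

text \<open>The matrix of the factor \<open>l\<close> is copied along the diagonal to every interval
  with label \<open>l\<close>.\<close>

definition "\<Psi> M = (\<lambda>(\<xi>, a, b). if \<xi> \<in> C \<and> a div s \<xi> = b div s \<xi> then M (g \<xi> (a div s \<xi>)) (a mod s \<xi>, b mod s \<xi>) else \<zero>\<^bsub>F\<^esub>)"
  for M :: "'l \<Rightarrow> nat \<times> nat \<Rightarrow> 'a"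

lemma psi_apply: "\<Psi> M (\<xi>, a, b) = (if \<xi> \<in> C \<and> a div s \<xi> = b div s \<xi> then M (g \<xi> (a div s \<xi>)) (a mod s \<xi>, b mod s \<xi>) else \<zero>\<^bsub>F\<^esub>)"
  by (simp add: \<Psi>_def)

lemma psi_entry:
  assumes "\<xi> \<in> C" "i < s \<xi>" "j < s \<xi>"
  shows "\<Psi> M (\<xi>, u * s \<xi> + i, u * s \<xi> + j) = M (g \<xi> u) (i, j)"
  using assms by (simp add: psi_apply)

lemma entry_closed:
  assumes "M \<in> carrier Q" "\<xi> \<in> C" "i < s \<xi>" "j < s \<xi>"
  shows "M (g \<xi> u) (i, j) \<in> carrier F"
  by (rule matrix_closed[OF matrix_product_component[OF assms(1) g_in[OF assms(2)]]]) (use assms d_g in auto)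

lemma psi_closed: 
  assumes M: "M \<in> carrier Q" 
  shows "\<Psi> M \<in> carrier A"
proof -
  have 1: "\<Psi> M (\<xi>, a, b) \<in> carrier F" for \<xi> a b
    using entry_closed[OF M] s_pos by (simp add: psi_apply)
  have 2: "\<exists>N. \<forall>b\<ge>N. \<Psi> M (\<xi>, a, b) = \<zero>\<^bsub>F\<^esub>" for \<xi> a
  proof (cases "\<xi> \<in> C")
    case True
    show ?thesis
    proof (intro exI[of _ "Suc (a div s \<xi>) * s \<xi>"] allI impI)
      fix b assume b: "Suc (a div s \<xi>) * s \<xi> \<le> b"
      have "Suc (a div s \<xi>) \<le> b div s \<xi>" using div_le_mono[OF b, of "s \<xi>"] s_pos[OF True] by (simp only: nonzero_mult_div_cancel_right)
      then show "\<Psi> M (\<xi>, a, b) = \<zero>\<^bsub>F\<^esub>" by (simp add: psi_apply)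
    qed
  qed (simp add: psi_apply)
  show ?thesis unfolding kernel_simps(1) using 1 2 by (simp add: psi_apply)
qed

lemma psi_blockwise: "blockwise C F s g (\<Psi> M)"
  unfolding blockwise_def
proof (intro conjI ballI allI impI)
  fix \<xi> a b assume "\<xi> \<in> C" "a div s \<xi> \<noteq> b div s \<xi>"
  then show "\<Psi> M (\<xi>, a, b) = \<zero>\<^bsub>F\<^esub>" by (simp add: psi_apply)
next
  fix \<xi> \<eta> u v r t assume a: "\<xi> \<in> C" "\<eta> \<in> C" "g \<xi> u = g \<eta> v" "r < s \<xi>" "t < s \<xi>"
  have "s \<xi> = s \<eta>" using d_g a by metis
  then show "\<Psi> M (\<xi>, u * s \<xi> + r, u * s \<xi> + t) = \<Psi> M (\<eta>, v * s \<eta> + r, v * s \<eta> + t)"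
    using a psi_entry[of \<xi> r t M u] psi_entry[of \<eta> r t M v] by simp
qed

lemma psi_surj:
  assumes "k \<in> level"
  shows "\<exists>M\<in>carrier Q. \<Psi> M = k"
proof -
  have k: "k \<in> carrier A" "blockwise C F s g k" using assms by auto
  \<comment> \<open>One interval is chosen for each label; the block of \<open>k\<close> on it
    represents the blocks on all intervals with that label.\<close>
  have "\<forall>l. \<exists>\<xi> u. l \<in> L \<longrightarrow> \<xi> \<in> C \<and> g \<xi> u = l" using g_onto by blast
  then obtain X0 u where Xu: "\<And>l. l \<in> L \<Longrightarrow> X0 l \<in> C \<and> g (X0 l) (u l) = l" by metis
  define M where "M = (\<lambda>l\<in>L. \<lambda>(i, j)\<in>{..<d l} \<times> {..<d l}. k (X0 l, u l * d l + i, u l * d l + j))"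
  have "M \<in> carrier Q" unfolding M_def
    by (rule matrix_product_memI, rule matrix_memI) (rule kernel_closed[OF k(1)])
  moreover have "\<Psi> M = k"
  proof (rule kernel_eqI)
    fix \<xi> a b
    show "\<Psi> M (\<xi>, a, b) = k (\<xi>, a, b)"
    proof (cases "\<xi> \<in> C \<and> a div s \<xi> = b div s \<xi>")
      case False
      have "k (\<xi>, a, b) = \<zero>\<^bsub>F\<^esub>"
      proof (cases "\<xi> \<in> C")
        case True
        then show ?thesis using False k(2) unfolding blockwise_def by blast
      next
        case False
        then show ?thesis by (rule kernel_outside[OF k(1)])
      qed
      then show ?thesis using False unfolding psi_apply by auto
    next
      case True
      define w where "w = a div s \<xi>"
      let ?l = "g \<xi> w"
      have xi: "\<xi> \<in> C" and bw: "b div s \<xi> = w" using True unfolding w_def by auto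
      have l: "?l \<in> L" using g_in xi by blast
      have dl: "d ?l = s \<xi>" "s (X0 ?l) = s \<xi>" using d_g[OF xi] d_g[of "X0 ?l" "u ?l"] Xu[OF l] by auto
      have lt: "a mod s \<xi> < s \<xi>" "b mod s \<xi> < s \<xi>" using s_pos[OF xi] by auto
      have "\<Psi> M (\<xi>, a, b) = M ?l (a mod s \<xi>, b mod s \<xi>)" using True unfolding psi_apply w_def by simp
      also have "\<dots> = k (X0 ?l, u ?l * s (X0 ?l) + a mod s \<xi>, u ?l * s (X0 ?l) + b mod s \<xi>)"
        using l dl lt unfolding M_def by simp
      also have "\<dots> = k (\<xi>, w * s \<xi> + a mod s \<xi>, w * s \<xi> + b mod s \<xi>)"
      proof -
        have "g \<xi> w = g (X0 ?l) (u ?l)" using Xu[OF l] by simp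
        then show ?thesis using k(2) xi Xu[OF l] lt unfolding blockwise_def by metis
      qed
      also have "\<dots> = k (\<xi>, a, b)" unfolding w_def using bw by (metis div_mult_mod_eq w_def)
      finally show ?thesis .
    qed
  qed
  ultimately show ?thesis by blast
qed

lemma psi_image: "\<Psi> ` carrier Q = level"
  using psi_surj psi_closed psi_blockwise by blast

lemma psi_inj: "inj_on \<Psi> (carrier Q)"
proof (rule inj_onI)
  fix M N assume M: "M \<in> carrier Q" and N: "N \<in> carrier Q" and e: "\<Psi> M = \<Psi> N"
  show "M = N"
  proof (rule matrix_product_eqI[OF M N])
    fix l assume l: "l \<in> L"
    obtain \<xi> u where xu: "\<xi> \<in> C" "g \<xi> u = l" using g_onto[OF l] by blast
    have dl: "d l = s \<xi>" using d_g xu by auto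
    show "M l = N l"
    proof (rule matrix_eqI[OF matrix_product_component[OF M l] matrix_product_component[OF N l]])
      fix i j assume "i < d l" "j < d l"
      then show "M l (i, j) = N l (i, j)" using psi_entry[OF xu(1), of i j _ u] e xu dl by metis
    qed
  qed
qed

lemma psi_mult:
  assumes M: "M \<in> carrier Q" and N: "N \<in> carrier Q"
  shows "\<Psi> (M \<otimes>\<^bsub>Q\<^esub> N) = \<Psi> M \<otimes>\<^bsub>A\<^esub> \<Psi> N"
proof (rule kernel_eqI)
  fix \<xi> a c
  note kc = kernel_closed[OF psi_closed[OF M]] kernel_closed[OF psi_closed[OF N]]
  have lhs: "(\<Psi> M \<otimes>\<^bsub>A\<^esub> \<Psi> N) (\<xi>, a, c) = (\<Oplus>\<^bsub>F\<^esub>b\<in>{b. \<Psi> M (\<xi>, a, b) \<noteq> \<zero>\<^bsub>F\<^esub>}. \<Psi> M (\<xi>, a, b) \<otimes>\<^bsub>F\<^esub> \<Psi> N (\<xi>, b, c))"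
    by (simp add: kernel_algebra_def)
  show "\<Psi> (M \<otimes>\<^bsub>Q\<^esub> N) (\<xi>, a, c) = (\<Psi> M \<otimes>\<^bsub>A\<^esub> \<Psi> N) (\<xi>, a, c)"
  proof (cases "\<xi> \<in> C")
    case False
    then show ?thesis unfolding lhs by (simp add: psi_apply)
  next
    case xi: True
    define u where "u = a div s \<xi>"
    let ?B = "(\<lambda>j. u * s \<xi> + j) ` {..<s \<xi>}"
    \<comment> \<open>A row of a block diagonal kernel is supported in its own interval, so the
      product is computed there.\<close>
    have sub: "{b. \<Psi> M (\<xi>, a, b) \<noteq> \<zero>\<^bsub>F\<^esub>} \<subseteq> ?B"
    proof
      fix b assume "b \<in> {b. \<Psi> M (\<xi>, a, b) \<noteq> \<zero>\<^bsub>F\<^esub>}"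
      then have "b div s \<xi> = u" unfolding u_def by (auto simp: psi_apply split: if_splits)
      then show "b \<in> ?B" using s_pos[OF xi] by (intro image_eqI[of _ _ "b mod s \<xi>"]) auto
    qed
    have au: "a = u * s \<xi> + a mod s \<xi>" unfolding u_def by simp
    have am: "a mod s \<xi> < s \<xi>" "c mod s \<xi> < s \<xi>" using s_pos[OF xi] by auto
    have "(\<Psi> M \<otimes>\<^bsub>A\<^esub> \<Psi> N) (\<xi>, a, c) = (\<Oplus>\<^bsub>F\<^esub>b\<in>?B. \<Psi> M (\<xi>, a, b) \<otimes>\<^bsub>F\<^esub> \<Psi> N (\<xi>, b, c))"
      unfolding lhs by (rule F.add.finprod_mono_neutral_cong_left) (use sub kc in auto)
    also have "\<dots> = (\<Oplus>\<^bsub>F\<^esub>j\<in>{..<s \<xi>}. \<Psi> M (\<xi>, a, u * s \<xi> + j) \<otimes>\<^bsub>F\<^esub> \<Psi> N (\<xi>, u * s \<xi> + j, c))"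
      by (rule F.finsum_reindex) (use kc in \<open>auto simp: inj_on_def\<close>)
    also have "\<dots> = \<Psi> (M \<otimes>\<^bsub>Q\<^esub> N) (\<xi>, a, c)"
    proof (cases "c div s \<xi> = u")
      case True
      then have cu: "c = u * s \<xi> + c mod s \<xi>" by (metis div_mult_mod_eq)
      have "(\<Oplus>\<^bsub>F\<^esub>j\<in>{..<s \<xi>}. \<Psi> M (\<xi>, a, u * s \<xi> + j) \<otimes>\<^bsub>F\<^esub> \<Psi> N (\<xi>, u * s \<xi> + j, c))
        = (\<Oplus>\<^bsub>F\<^esub>j\<in>{..<s \<xi>}. M (g \<xi> u) (a mod s \<xi>, j) \<otimes>\<^bsub>F\<^esub> N (g \<xi> u) (j, c mod s \<xi>))"
      proof (rule F.finsum_cong')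
        fix j assume "j \<in> {..<s \<xi>}"
        then have j: "j < s \<xi>" by simp
        have "\<Psi> M (\<xi>, a, u * s \<xi> + j) = M (g \<xi> u) (a mod s \<xi>, j)"
          using psi_entry[OF xi am(1) j, of M u] unfolding au[symmetric] .
        moreover have "\<Psi> N (\<xi>, u * s \<xi> + j, c) = N (g \<xi> u) (j, c mod s \<xi>)"
          using psi_entry[OF xi j am(2), of N u] unfolding cu[symmetric] .
        ultimately show "\<Psi> M (\<xi>, a, u * s \<xi> + j) \<otimes>\<^bsub>F\<^esub> \<Psi> N (\<xi>, u * s \<xi> + j, c)
          = M (g \<xi> u) (a mod s \<xi>, j) \<otimes>\<^bsub>F\<^esub> N (g \<xi> u) (j, c mod s \<xi>)" by simp
      qed (use entry_closed[OF M xi am(1)] entry_closed[OF N xi _ am(2)] in auto)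
      also have "\<dots> = (M (g \<xi> u) \<otimes>\<^bsub>matrix_ring (d (g \<xi> u)) F\<^esub> N (g \<xi> u)) (a mod s \<xi>, c mod s \<xi>)"
        using am d_g[OF xi] by (simp add: matrix_mult_entry)
      also have "\<dots> = \<Psi> (M \<otimes>\<^bsub>Q\<^esub> N) (\<xi>, a, c)"
        unfolding matrix_product_simps(2)[OF g_in[OF xi], symmetric] psi_apply using xi True by (simp add: u_def)
      finally show ?thesis .
    next
      case False
      have "\<Psi> N (\<xi>, u * s \<xi> + j, c) = \<zero>\<^bsub>F\<^esub>" if "j < s \<xi>" for j
        using False that unfolding psi_apply by simp
      then have "(\<Oplus>\<^bsub>F\<^esub>j\<in>{..<s \<xi>}. \<Psi> M (\<xi>, a, u * s \<xi> + j) \<otimes>\<^bsub>F\<^esub> \<Psi> N (\<xi>, u * s \<xi> + j, c)) = (\<Oplus>\<^bsub>F\<^esub>j\<in>{..<s \<xi>}. \<zero>\<^bsub>F\<^esub>)"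
        by (intro F.finsum_cong') (use kc in auto)
      then show ?thesis using False unfolding psi_apply u_def by (auto simp: F.finsum_zero)
    qed
    finally show ?thesis ..
  qed
qed

lemma psi_add:
  assumes M: "M \<in> carrier Q" and N: "N \<in> carrier Q"
  shows "\<Psi> (M \<oplus>\<^bsub>Q\<^esub> N) = \<Psi> M \<oplus>\<^bsub>A\<^esub> \<Psi> N"
proof (rule kernel_eqI)
  fix \<xi> a c
  show "\<Psi> (M \<oplus>\<^bsub>Q\<^esub> N) (\<xi>, a, c) = (\<Psi> M \<oplus>\<^bsub>A\<^esub> \<Psi> N) (\<xi>, a, c)"
    using g_in[of \<xi>] d_g[of \<xi>] s_pos[of \<xi>]
    by (simp add: kernel_simps psi_apply matrix_product_simps matrix_add_entry)
qed

lemma psi_one: "\<Psi> \<one>\<^bsub>Q\<^esub> = \<one>\<^bsub>A\<^esub>"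
proof (rule kernel_eqI)
  fix \<xi> a c
  have "a div s \<xi> = c div s \<xi> \<Longrightarrow> (a mod s \<xi> = c mod s \<xi>) = (a = c)" by (metis div_mult_mod_eq)
  then show "\<Psi> \<one>\<^bsub>Q\<^esub> (\<xi>, a, c) = \<one>\<^bsub>A\<^esub> (\<xi>, a, c)"
    using g_in[of \<xi>] d_g[of \<xi>] s_pos[of \<xi>]
    by (auto simp: kernel_simps psi_apply matrix_product_simps matrix_one_entry)
qed

lemma psi_smult:
  assumes M: "M \<in> carrier Q" and z: "z \<in> carrier F"
  shows "\<Psi> (z \<odot>\<^bsub>Q\<^esub> M) = z \<odot>\<^bsub>A\<^esub> \<Psi> M"
proof (rule kernel_eqI)
  fix \<xi> a c
  show "\<Psi> (z \<odot>\<^bsub>Q\<^esub> M) (\<xi>, a, c) = (z \<odot>\<^bsub>A\<^esub> \<Psi> M) (\<xi>, a, c)"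
    using g_in[of \<xi>] d_g[of \<xi>] s_pos[of \<xi>] z
    by (simp add: kernel_simps psi_apply matrix_product_simps)
qed

lemma Q_smult_closed:
  assumes M: "M \<in> carrier Q" and z: "z \<in> carrier F"
  shows "z \<odot>\<^bsub>Q\<^esub> M \<in> carrier Q"
  using matrix_closed[OF matrix_product_component[OF M]] z
  by (simp add: product_algebra_def matrix_algebra_simps matrix_ring_carrier PiE_iff extensional_def)

lemma level_memI: "M \<in> carrier Q \<Longrightarrow> \<Psi> M \<in> level"
  using psi_closed psi_blockwise by simp

lemma levelD: "k \<in> level \<Longrightarrow> k \<in> carrier A"
  by simp

lemma level_smult:
  assumes k: "k \<in> level" and z: "z \<in> carrier F"
  shows "z \<odot>\<^bsub>A\<^esub> k \<in> level"
proof -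
  obtain M where M: "M \<in> carrier Q" "\<Psi> M = k" using psi_surj[OF k] by blast
  show ?thesis unfolding M(2)[symmetric] psi_smult[OF M(1) z, symmetric]
    by (rule level_memI[OF Q_smult_closed[OF M(1) z]])
qed

lemma level_unital_subalgebra: "unital_subalgebra level F A"
  unfolding unital_subalgebra_def
proof (rule conjI)
  show "\<forall>z\<in>carrier F. \<forall>k\<in>level. z \<odot>\<^bsub>A\<^esub> k \<in> level" by (rule ballI, rule ballI, rule level_smult)
  interpret A: ring A by (rule F.kernel_ring)
  show "subring level A"
  proof (rule A.subringI)
    show "level \<subseteq> carrier A" by (rule Collect_restrict)
    show "\<one>\<^bsub>A\<^esub> \<in> level" unfolding psi_one[symmetric] by (rule level_memI[OF F.matrix_product_one_zero_closed(1)])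
  next
    fix k assume k: "k \<in> level"
    then have kA: "k \<in> carrier A" by (rule levelD)
    have mA: "(\<ominus>\<^bsub>F\<^esub> \<one>\<^bsub>F\<^esub>) \<odot>\<^bsub>A\<^esub> k \<in> level" using level_smult[OF k] by simp
    have "(\<ominus>\<^bsub>F\<^esub> \<one>\<^bsub>F\<^esub>) \<odot>\<^bsub>A\<^esub> k \<oplus>\<^bsub>A\<^esub> k = \<zero>\<^bsub>A\<^esub>"
      by (rule kernel_eqI) (simp add: kernel_simps kernel_closed[OF kA] F.l_minus F.l_neg)
    then have "\<ominus>\<^bsub>A\<^esub> k = (\<ominus>\<^bsub>F\<^esub> \<one>\<^bsub>F\<^esub>) \<odot>\<^bsub>A\<^esub> k"
      by (rule A.minus_equality[OF _ kA levelD[OF mA]])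
    then show "\<ominus>\<^bsub>A\<^esub> k \<in> level" using mA by (simp only:)
  next
    fix k l assume k: "k \<in> level" and l: "l \<in> level"
    obtain M where M: "M \<in> carrier Q" "\<Psi> M = k" using psi_surj[OF k] by blast
    obtain N where N: "N \<in> carrier Q" "\<Psi> N = l" using psi_surj[OF l] by blast
    show "k \<otimes>\<^bsub>A\<^esub> l \<in> level" unfolding M(2)[symmetric] N(2)[symmetric] psi_mult[OF M(1) N(1), symmetric]
      by (rule level_memI[OF F.matrix_product_closed(1)[OF M(1) N(1)]])
    show "k \<oplus>\<^bsub>A\<^esub> l \<in> level" unfolding M(2)[symmetric] N(2)[symmetric] psi_add[OF M(1) N(1), symmetric]
      by (rule level_memI[OF F.matrix_product_closed(2)[OF M(1) N(1)]])
  qed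
qed

lemma level_subring: "subring level A"
  using level_unital_subalgebra unfolding unital_subalgebra_def by (rule conjunct1)

lemma level_rep: "matricial_rep F (A\<lparr>carrier := level\<rparr>) L d \<Psi>"
proof -
  interpret A: ring A by (rule F.kernel_ring)
  interpret B: ring "A\<lparr>carrier := level\<rparr>" by (rule A.subring_is_ring[OF level_subring])
  show ?thesis
  proof (unfold_locales)
    show "finite L" by (rule finite_L)
    show "0 < d l" if "l \<in> L" for l using g_onto[OF that] d_g s_pos by metis
    show "inj_on \<Psi> (carrier Q)" by (rule psi_inj)
    show "\<Psi> ` carrier Q = carrier (A\<lparr>carrier := level\<rparr>)" using psi_image by simp
  qed (simp_all add: psi_closed psi_blockwise psi_mult psi_add psi_one)
qed

lemma level_iso: "algebra_isomorphic F (A\<lparr>carrier := level\<rparr>) Q"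
proof -
  define h where "h = inv_into (carrier Q) \<Psi>"
  have h1: "h (\<Psi> M) = M" if "M \<in> carrier Q" for M unfolding h_def using psi_inj that by simp
  have ex: "\<exists>M\<in>carrier Q. k = \<Psi> M" if "k \<in> level" for k using that psi_image by blast
  have "h \<in> ring_iso (A\<lparr>carrier := level\<rparr>) Q"
  proof (rule ring_iso_memI)
    show "bij_betw h (carrier (A\<lparr>carrier := level\<rparr>)) (carrier Q)"
      unfolding h_def using bij_betw_inv_into[OF bij_betw_imageI[OF psi_inj psi_image]] by simp
  next
    fix k assume k: "k \<in> carrier (A\<lparr>carrier := level\<rparr>)"
    then obtain M where M: "M \<in> carrier Q" "k = \<Psi> M" using ex[of k] by auto
    then show "h k \<in> carrier Q" using h1 by simp
    fix l assume l: "l \<in> carrier (A\<lparr>carrier := level\<rparr>)"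
    then obtain N where N: "N \<in> carrier Q" "l = \<Psi> N" using ex[of l] by auto
    show "h (k \<otimes>\<^bsub>A\<lparr>carrier := level\<rparr>\<^esub> l) = h k \<otimes>\<^bsub>Q\<^esub> h l"
      using M N h1 psi_mult[OF M(1) N(1), symmetric] F.matrix_product_closed(1)[OF M(1) N(1)] by simp
    show "h (k \<oplus>\<^bsub>A\<lparr>carrier := level\<rparr>\<^esub> l) = h k \<oplus>\<^bsub>Q\<^esub> h l"
      using M N h1 psi_add[OF M(1) N(1), symmetric] F.matrix_product_closed(2)[OF M(1) N(1)] by simp
  next
    show "h \<one>\<^bsub>A\<lparr>carrier := level\<rparr>\<^esub> = \<one>\<^bsub>Q\<^esub>"
      using h1[OF F.matrix_product_one_zero_closed(1)] psi_one by simp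
  qed
  moreover have "h (z \<odot>\<^bsub>A\<lparr>carrier := level\<rparr>\<^esub> k) = z \<odot>\<^bsub>Q\<^esub> h k" if z: "z \<in> carrier F" and k: "k \<in> carrier (A\<lparr>carrier := level\<rparr>)" for z k
  proof -
    obtain M where M: "M \<in> carrier Q" "k = \<Psi> M" using k ex[of k] by auto
    then show ?thesis using h1 psi_smult[OF M(1) z, symmetric] Q_smult_closed[OF M(1) z] by simp
  qed
  ultimately show ?thesis unfolding algebra_isomorphic_def by blast
qed

end

text \<open>Only the partition of the intervals induced by the labels matters, so the labels may be
  taken to be initial natural numbers.\<close>
lemma (in interval_blocks) level_matricial: "matricial F (A\<lparr>carrier := level\<rparr>)"
proof -
  obtain e where e: "bij_betw e {..<card L} L" using ex_bij_betw_nat_finite[OF finite_L] by (auto simp: atLeast0LessThan)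
  define c where "c = inv_into {..<card L} e"
  have ce: "e (c l) = l" "c l < card L" if "l \<in> L" for l
    using that e bij_betwE[OF bij_betw_inv_into[OF e]] unfolding c_def by (auto simp: bij_betw_inv_into_right)
  have ec: "c (e i) = i" "e i \<in> L" if "i < card L" for i
    using that e unfolding c_def by (auto simp: bij_betw_inv_into_left bij_betwE)
  interpret N: interval_blocks F C s "\<lambda>\<xi> u. c (g \<xi> u)" "{..<card L}" "\<lambda>i. d (e i)"
  proof unfold_locales
    show "0 < s \<xi>" if "\<xi> \<in> C" for \<xi> using that by (rule s_pos)
    show "c (g \<xi> u) \<in> {..<card L}" if "\<xi> \<in> C" for \<xi> u using ce g_in that by auto
    show "d (e (c (g \<xi> u))) = s \<xi>" if "\<xi> \<in> C" for \<xi> u using ce g_in d_g that by auto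
    show "\<exists>\<xi>\<in>C. \<exists>u. c (g \<xi> u) = l" if "l \<in> {..<card L}" for l
    proof -
      have l: "l < card L" using that by simp
      obtain \<xi> u where "\<xi> \<in> C" "g \<xi> u = e l" using g_onto[OF ec(2)[OF l]] by blast
      then have "c (g \<xi> u) = l" "\<xi> \<in> C" using ec(1)[OF l] by simp_all
      then show ?thesis by blast
    qed
  qed auto
  have "c (g \<xi> u) = c (g \<eta> v) \<longleftrightarrow> g \<xi> u = g \<eta> v" if "\<xi> \<in> C" "\<eta> \<in> C" for \<xi> \<eta> u v
    using arg_cong[of "c (g \<xi> u)" "c (g \<eta> v)" e] unfolding ce(1)[OF g_in[OF that(1)]] ce(1)[OF g_in[OF that(2)]] by auto
  then have "blockwise C F s (\<lambda>\<xi> u. c (g \<xi> u)) k = blockwise C F s g k" for k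
    unfolding blockwise_def by (intro conj_cong refl ball_cong) simp
  then have "{k \<in> carrier A. blockwise C F s (\<lambda>\<xi> u. c (g \<xi> u)) k} = level" by (simp only:)
  then have "algebra_isomorphic F (A\<lparr>carrier := level\<rparr>) (matrix_product F {..<card L} (\<lambda>i. d (e i)))"
    using N.level_iso by (simp only:)
  moreover have "0 < d (e i)" if i: "i < card L" for i
  proof -
    obtain \<xi> u where x: "\<xi> \<in> C" "g \<xi> u = e i" using g_onto[OF ec(2)[OF i]] by blast
    show ?thesis using d_g[OF x(1), of u] s_pos[OF x(1)] x(2) by simp
  qed
  ultimately show ?thesis
    unfolding matricial_def by (intro exI[of _ "card L"] exI[of _ "\<lambda>i. d (e i)"] conjI allI impI)
qed

section \<open>The tower of a subgroup of the positive rationals\<close>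

text \<open>Factorials make every integer divide all sufficiently late factors. The shift by 3 keeps
  the factor at least 3, so that a subdivision contains a third subinterval, labelled
  \<open>True\<close>.\<close>

definition fac :: "nat \<Rightarrow> nat" where "fac i = fact (i + 3)"

definition facs :: "nat \<Rightarrow> nat \<Rightarrow> nat" where "facs i j = (\<Prod>l\<in>{i..<j}. fac l)"

abbreviation size0 :: "nat \<Rightarrow> nat" where "size0 j \<equiv> facs 0 j"

lemma fac_gt: "i < fac i" "3 \<le> fac i"
proof -
  have "i + 3 \<le> fac i" unfolding fac_def by (rule fact_ge_self)
  then show "i < fac i" "3 \<le> fac i" by auto
qed

lemma fac_pos: "0 < fac i" using fac_gt(2)[of i] by linarith

lemma dvd_fac: "\<lbrakk>0 < q; q \<le> i + 3\<rbrakk> \<Longrightarrow> q dvd fac i"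
  unfolding fac_def by (rule dvd_fact) auto

lemma facs_pos: "0 < facs i j"
  unfolding facs_def using fac_pos by (simp add: prod_pos)

lemma facs_refl: "facs i i = 1"
  by (simp add: facs_def)

lemma facs_Suc: "i \<le> j \<Longrightarrow> facs i (Suc j) = facs i j * fac j"
  by (simp add: facs_def)

lemma facs_trans: "i \<le> j \<Longrightarrow> j \<le> k \<Longrightarrow> facs i k = facs i j * facs j k"
  unfolding facs_def by (simp add: prod.atLeastLessThan_concat)

text \<open>The last factor is divisible by \<open>q\<close> and the product of the earlier ones by
  \<open>facs 0 i\<close>.\<close>

lemma facs_dvd_eventually:
  assumes "0 < q"
  shows "q * facs 0 i dvd facs 0 (Suc (max i q))"
proof -
  let ?m = "max i q"
  have "facs 0 (Suc ?m) = facs 0 ?m * fac ?m" by (simp add: facs_Suc)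
  moreover have "facs 0 i dvd facs 0 ?m" using facs_trans[of 0 i ?m] by simp
  moreover have "q dvd fac ?m" using assms by (intro dvd_fac) auto
  ultimately show ?thesis by (simp add: mult_dvd_mono mult.commute)
qed

text \<open>Inside an interval of level \<open>i + 1\<close>, the first subinterval of level \<open>i\<close> inherits the label,
  the second is labelled \<open>False\<close> and the remaining ones are labelled \<open>True\<close>.\<close>
function label :: "nat \<Rightarrow> nat \<Rightarrow> bool" where
  "label i b = (if b = 0 then False else if b mod fac i = 0 then label (Suc i) (b div fac i) else b mod fac i \<noteq> 1)"
  by auto
termination
proof (relation "measure snd")
  fix i b :: nat assume "b \<noteq> 0"
  then show "((Suc i, b div fac i), i, b) \<in> measure snd" using fac_gt(2)[of i] by simp
qed simp

declare label.simps [simp del]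

lemma label_step:
  assumes "c < fac i"
  shows "label i (b * fac i + c) = (if c = 0 then label (Suc i) b else c \<noteq> 1)"
proof (cases "b * fac i + c = 0")
  \<comment> \<open>At the origin the inheritance of labels never ends; the default
    \<open>False\<close> is the same at every level, so the rule holds there too.\<close>
  case True
  then have "b = 0" "c = 0" using fac_pos[of i] by auto
  then show ?thesis using label.simps[of i 0] label.simps[of "Suc i" 0] by simp
next
  case False
  have "(b * fac i + c) mod fac i = c" "c = 0 \<Longrightarrow> (b * fac i + c) div fac i = b" using assms by auto
  then show ?thesis using False label.simps[of i "b * fac i + c"] by auto
qed

text \<open>The pattern of labels of level \<open>i\<close> inside an interval of level
  \<open>j\<close> depends only on the label of that interval. This consistency makes the levels
  increase.\<close>

lemma label_facs:
  assumes "i \<le> j" "label j u = label j v" "c < facs i j"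
  shows "label i (u * facs i j + c) = label i (v * facs i j + c)"
  using assms
proof (induction j arbitrary: u v c rule: dec_induct)
  case base
  then show ?case by (simp add: facs_refl)
next
  case (step j)
  let ?r = "facs i j"
  have r: "facs i (Suc j) = ?r * fac j" using step.hyps by (simp add: facs_Suc)
  have pos: "0 < ?r" by (rule facs_pos)
  have d: "c div ?r < fac j" using step.prems(2) unfolding r by (simp add: less_mult_imp_div_less mult.commute)
  have e: "w * facs i (Suc j) + c = (w * fac j + c div ?r) * ?r + c mod ?r" for w
    unfolding r by (simp add: algebra_simps)
  have "label j (u * fac j + c div ?r) = label j (v * fac j + c div ?r)"
    unfolding label_step[OF d] using step.prems(1) by simp
  then show ?case unfolding e using pos by (intro step.IH) auto
qed

lemma pos_rat_group: "group pos_rat_group"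
  by (rule groupI) (auto simp: pos_rat_group_def mult.assoc intro!: exI[of _ "inverse _"] bexI[of _ "inverse _"])

lemma inv_pos_rat_group: "0 < h \<Longrightarrow> inv\<^bsub>pos_rat_group\<^esub> h = inverse h"
  by (rule group.inv_equality[OF pos_rat_group]) (auto simp: pos_rat_group_def)

locale tower = F: principal_domain F
  for F :: "('a, 'm) ring_scheme" +
  fixes H :: "rat set"
  assumes H: "subgroup H pos_rat_group"
begin

lemma H_pos: "h \<in> H \<Longrightarrow> 0 < h"
  using subgroup.subset[OF H] by (auto simp: pos_rat_group_def)

lemma H_one: "1 \<in> H"
  using subgroup.one_closed[OF H] by (simp add: pos_rat_group_def)

lemma H_mult: "h \<in> H \<Longrightarrow> h' \<in> H \<Longrightarrow> h * h' \<in> H"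
  using subgroup.m_closed[OF H] by (simp add: pos_rat_group_def)

lemma H_inverse: "h \<in> H \<Longrightarrow> inverse h \<in> H"
  using subgroup.m_inv_closed[OF H] inv_pos_rat_group[OF H_pos] by fastforce

text \<open>Multiplication by elements of \<open>H\<close> permutes the first component. The factor
  \<open>UNIV\<close> makes the set infinite even for \<open>H = {1}\<close>, so coordinates waiting
  in the common block remain at every level.\<close>

definition C :: "(rat \<times> nat) set" where "C = H \<times> UNIV"

text \<open>The coordinates with blocks of their own at level \<open>i\<close>. The bound on
  \<open>to_nat\<close> makes the set finite; the bound on the denominator of \<open>h\<close> makes
  \<open>h\<close> times \<open>size0 i\<close> an integer.\<close>

definition S :: "nat \<Rightarrow> (rat \<times> nat) set" where
  "S i = {\<xi> \<in> C. to_nat \<xi> < i \<and> nat (snd (quotient_of (fst \<xi>))) \<le> i}"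

text \<open>On \<open>S i\<close> the product is an integer, and there the floor only changes its
  type.\<close>

definition csize :: "nat \<Rightarrow> rat \<times> nat \<Rightarrow> nat" where
  "csize i \<xi> = nat \<lfloor>fst \<xi> * of_nat (size0 i)\<rfloor>"

lemma C_pos: "\<xi> \<in> C \<Longrightarrow> 0 < fst \<xi>"
  using H_pos by (auto simp: C_def)

lemma S_sub: "S i \<subseteq> C"
  by (auto simp: S_def)

lemma S_mono: "i \<le> j \<Longrightarrow> S i \<subseteq> S j"
  by (auto simp: S_def)

lemma finite_S: "finite (S i)"
proof (rule inj_on_finite[of to_nat _ "{..<i}"])
  show "inj_on to_nat (S i)" by (simp add: inj_on_def)
qed (auto simp: S_def)

lemma infinite_C: "infinite C"
  using H_one by (auto simp: C_def finite_cartesian_product_iff)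

lemma in_S: "\<xi> \<in> C \<Longrightarrow> \<exists>i. \<xi> \<in> S i"
  by (rule exI[of _ "Suc (max (to_nat \<xi>) (nat (snd (quotient_of (fst \<xi>)))))"]) (auto simp: S_def)

text \<open>A denominator of at most \<open>j = Suc i\<close> already divides the last factor
  \<open>fac i\<close>. Hence the earlier product \<open>size0 i\<close> survives as a divisor of
  the block size, as is needed when a coordinate leaves the common block.\<close>

lemma csize_decomp:
  assumes "\<xi> \<in> S j" "Suc i = j"
  shows "\<exists>w>0. csize j \<xi> = size0 i * w \<and> (of_nat (csize j \<xi>) :: rat) = fst \<xi> * of_nat (size0 j)"
proof -
  obtain a b where ab: "quotient_of (fst \<xi>) = (a, b)" by (cases "quotient_of (fst \<xi>)")
  have b: "0 < b" using quotient_of_denom_pos[OF ab] .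
  have h: "fst \<xi> = of_int a / of_int b" using quotient_of_div[OF ab] .
  have pos: "0 < fst \<xi>" using C_pos S_sub assms by blast
  then have a: "0 < a" using b unfolding h by (simp add: zero_less_divide_iff)
  have "nat b \<le> j" using assms(1) ab by (simp add: S_def)
  then have "nat b dvd fac i" using b assms(2) by (intro dvd_fac) auto
  then obtain c where c: "fac i = nat b * c" by auto
  have cpos: "0 < c" using fac_pos[of i] c by (cases c) auto
  have e: "fst \<xi> * of_nat (size0 j) = (of_nat (size0 i * (nat a * c)) :: rat)"
  proof -
    have "size0 j = size0 i * (nat b * c)" using facs_Suc[of 0 i] assms(2) c by auto
    moreover have "(of_nat (nat b) :: rat) = of_int b" "(of_nat (nat a) :: rat) = of_int a" using a b by auto
    ultimately show ?thesis using b unfolding h by (simp add: field_simps)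
  qed
  then have "csize j \<xi> = size0 i * (nat a * c)" unfolding csize_def by (simp only: floor_of_nat nat_int)
  then show ?thesis using e a cpos by (intro exI[of _ "nat a * c"]) auto
qed

lemma S_0: "\<xi> \<in> S j \<Longrightarrow> \<exists>i. Suc i = j"
  by (cases j) (auto simp: S_def)

lemma csize_eq: "\<xi> \<in> S j \<Longrightarrow> (of_nat (csize j \<xi>) :: rat) = fst \<xi> * of_nat (size0 j)"
  using csize_decomp S_0 by blast

lemma csize_pos: "\<xi> \<in> S j \<Longrightarrow> 0 < csize j \<xi>"
  using csize_decomp S_0 facs_pos by (metis nat_0_less_mult_iff)

lemma csize_dvd: "\<lbrakk>\<xi> \<in> S j; i < j\<rbrakk> \<Longrightarrow> size0 i dvd csize j \<xi>"
proof -
  assume x: "\<xi> \<in> S j" "i < j"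
  obtain k where k: "Suc k = j" using S_0[OF x(1)] by blast
  obtain w where "csize j \<xi> = size0 k * w" using csize_decomp[OF x(1) k] by blast
  moreover have "size0 i dvd size0 k" using facs_trans[of 0 i k] x k by simp
  ultimately show ?thesis by simp
qed

text \<open>The coordinates outside \<open>S i\<close>, on which \<open>csize i\<close> may be rounded, share the label \<open>None\<close>
  and hence a single block.\<close>
definition sz :: "nat \<Rightarrow> nat \<Rightarrow> rat \<times> nat \<Rightarrow> nat" where
  "sz n i \<xi> = n * (if \<xi> \<in> S i then csize i \<xi> else size0 i)"

definition lab :: "nat \<Rightarrow> rat \<times> nat \<Rightarrow> nat \<Rightarrow> ((rat \<times> nat) \<times> bool) option" where
  "lab i \<xi> u = (if \<xi> \<in> S i then Some (\<xi>, label i u) else None)"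

definition labs :: "nat \<Rightarrow> ((rat \<times> nat) \<times> bool) option set" where
  "labs i = insert None (Some ` (S i \<times> UNIV))"

definition dim :: "nat \<Rightarrow> nat \<Rightarrow> ((rat \<times> nat) \<times> bool) option \<Rightarrow> nat" where
  "dim n i l = n * (case l of None \<Rightarrow> size0 i | Some x \<Rightarrow> csize i (fst x))"

abbreviation "KA \<equiv> kernel_algebra C F"

definition lvl :: "nat \<Rightarrow> nat \<Rightarrow> ((rat \<times> nat) \<times> nat \<times> nat \<Rightarrow> 'a) set" where
  "lvl n i = {k \<in> carrier KA. blockwise C F (sz n i) (lab i) k}"

text \<open>Kernels with block sizes multiplied by \<open>n\<close>. By \<open>matrix_alg\<close>
  this is the ring of \<open>n\<close> by \<open>n\<close> matrices over \<open>alg 1\<close>;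
  realising all of them inside one kernel algebra makes different \<open>n\<close>
  comparable.\<close>

definition alg :: "nat \<Rightarrow> ('a, (rat \<times> nat) \<times> nat \<times> nat \<Rightarrow> 'a) module" where
  "alg n = KA\<lparr>carrier := \<Union>i. lvl n i\<rparr>"

lemma sz_pos: "0 < n \<Longrightarrow> 0 < sz n i \<xi>"
  using csize_pos facs_pos by (simp add: sz_def)

lemma blocks:
  assumes "0 < n"
  shows "interval_blocks F C (sz n i) (lab i) (labs i) (dim n i)"
proof unfold_locales
  show "finite (labs i)" using finite_S by (simp add: labs_def)
  show "0 < sz n i \<xi>" for \<xi> using sz_pos[OF assms] .
  show "lab i \<xi> u \<in> labs i" for \<xi> u by (auto simp: lab_def labs_def)
  show "dim n i (lab i \<xi> u) = sz n i \<xi>" for \<xi> u by (auto simp: lab_def dim_def sz_def)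
  show "\<exists>\<xi>\<in>C. \<exists>u. lab i \<xi> u = l" if l: "l \<in> labs i" for l
  proof (cases l)
    case None
    \<comment> \<open>The common label needs a coordinate outside the finite set \<open>S i\<close>;
      infinity of \<open>C\<close> provides it.\<close>
    obtain \<xi> where "\<xi> \<in> C" "\<xi> \<notin> S i" using infinite_C finite_S[of i] by (metis finite_subset subsetI)
    then show ?thesis using None by (auto simp: lab_def)
  next
    case (Some x)
    then obtain \<xi> e where x: "x = (\<xi>, e)" "\<xi> \<in> S i" using l by (auto simp: labs_def)
    \<comment> \<open>The intervals numbered 0 and 2 show that both labels occur.\<close>
    have "label i 0 = False" using label.simps[of i 0] by simp
    moreover have "label i 2 = True"
    proof -
      have "label i (0 * fac i + 2) = (2 \<noteq> (1::nat))" using label_step[of 2 i 0] fac_gt(2)[of i] by simp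
      then show ?thesis by (simp only: mult_zero_left add_0) simp
    qed
    ultimately have "\<exists>u. label i u = e" by (cases e) blast+
    then show ?thesis using x Some S_sub by (auto simp: lab_def intro!: bexI[of _ \<xi>])
  qed
qed

text \<open>Covers both the inclusion of a level in the next one, with \<open>\<sigma>\<close> the
  identity, and the change of coordinates behind \<open>alg_iso\<close>. If \<open>\<xi>\<close> has
  its own block at level \<open>j\<close> and \<open>\<sigma> \<xi>\<close> has one at level
  \<open>i\<close>, the sizes match by the equation for \<open>\<sigma>\<close>. If
  \<open>\<sigma> \<xi>\<close> is still in the common block, all its intervals have the same label,
  so divisibility of the sizes suffices.\<close>

lemma lvl_transfer:
  assumes n: "0 < n" and m: "0 < m" and k: "k \<in> lvl n i" and ij: "i \<le> j"
    and \<sigma>: "\<And>\<xi>. \<sigma> \<xi> \<in> C \<longleftrightarrow> \<xi> \<in> C" "\<And>\<xi>. \<xi> \<in> C \<Longrightarrow> of_nat n * fst (\<sigma> \<xi>) = of_nat m * fst \<xi>"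
    and Sj: "\<And>\<xi>. \<xi> \<in> C \<Longrightarrow> \<sigma> \<xi> \<in> S i \<Longrightarrow> \<xi> \<in> S j"
    and dvd: "n * size0 i dvd m * size0 j" "\<And>\<xi>. \<xi> \<in> S j \<Longrightarrow> \<sigma> \<xi> \<notin> S i \<Longrightarrow> n * size0 i dvd m * csize j \<xi>"
  shows "(\<lambda>(\<xi>, a, b). k (\<sigma> \<xi>, a, b)) \<in> lvl m j"
proof -
  let ?k = "\<lambda>(\<xi>, a, b). k (\<sigma> \<xi>, a, b)"
  have kA: "k \<in> carrier KA" and bw: "blockwise C F (sz n i) (lab i) k" using k by (auto simp: lvl_def)
  have "?k \<in> carrier KA"
    unfolding kernel_simps(1)
  proof (intro conjI allI impI)
    fix \<xi> a
    show "?k (\<xi>, a, b) \<in> carrier F" for b using kernel_closed[OF kA] by (simp only: prod.case)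
    obtain N where "\<And>b. b \<ge> N \<Longrightarrow> k (\<sigma> \<xi>, a, b) = \<zero>\<^bsub>F\<^esub>" using kernel_bound[OF kA, of "\<sigma> \<xi>" a] by blast
    then show "\<exists>N. \<forall>b\<ge>N. ?k (\<xi>, a, b) = \<zero>\<^bsub>F\<^esub>" by (simp only: prod.case) blast
    show "?k (\<xi>, a, b) = \<zero>\<^bsub>F\<^esub>" if "\<xi> \<notin> C" for b
      unfolding prod.case by (rule kernel_outside[OF kA]) (use that \<sigma>(1) in blast)
  qed
  moreover have "blockwise C F (sz m j) (lab j) ?k"
  proof (rule blockwise_refine[where s = "\<lambda>\<xi>. sz n i (\<sigma> \<xi>)" and g = "\<lambda>\<xi>. lab i (\<sigma> \<xi>)" and q = "\<lambda>\<xi>. sz m j \<xi> div sz n i (\<sigma> \<xi>)"])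
    show "blockwise C F (\<lambda>\<xi>. sz n i (\<sigma> \<xi>)) (\<lambda>\<xi>. lab i (\<sigma> \<xi>)) ?k"
      using bw \<sigma>(1) unfolding blockwise_def by simp
    show "0 < sz n i (\<sigma> \<xi>)" for \<xi> by (rule sz_pos[OF n])
    \<comment> \<open>The factors \<open>n\<close> and \<open>m\<close> are absorbed by
      \<open>\<sigma>\<close>, so exactly \<open>facs i j\<close> old intervals fit into a new
      one.\<close>
    have both: "sz m j \<xi> = facs i j * sz n i (\<sigma> \<xi>)" if x: "\<xi> \<in> S j" "\<sigma> \<xi> \<in> S i" for \<xi>
    proof -
      have "(of_nat (sz m j \<xi>) :: rat) = of_nat m * fst \<xi> * of_nat (size0 j)"
        using x csize_eq[OF x(1)] by (simp add: sz_def)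
      also have "\<dots> = of_nat n * fst (\<sigma> \<xi>) * of_nat (size0 j)" using \<sigma>(2) x S_sub by (metis subsetD)
      also have "size0 j = size0 i * facs i j" using facs_trans[of 0 i j] ij by simp
      also have "of_nat n * fst (\<sigma> \<xi>) * of_nat (size0 i * facs i j) = (of_nat (facs i j * sz n i (\<sigma> \<xi>)) :: rat)"
        using x csize_eq[OF x(2)] by (simp add: sz_def)
      finally show ?thesis by (simp only: of_nat_eq_iff)
    qed
    have div: "sz n i (\<sigma> \<xi>) dvd sz m j \<xi>" if x: "\<xi> \<in> C" for \<xi>
    proof (cases "\<sigma> \<xi> \<in> S i")
      case True
      then show ?thesis using both Sj[OF x] by auto
    next
      case False
      then show ?thesis using dvd by (auto simp: sz_def)
    qed
    show "sz m j \<xi> = sz m j \<xi> div sz n i (\<sigma> \<xi>) * sz n i (\<sigma> \<xi>)" if "\<xi> \<in> C" for \<xi> using div[OF that] by simp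
    fix \<xi> \<eta> u v assume x: "\<xi> \<in> C" and y: "\<eta> \<in> C" and e: "lab j \<xi> u = lab j \<eta> v"
    show "sz n i (\<sigma> \<xi>) = sz n i (\<sigma> \<eta>) \<and> sz m j \<xi> div sz n i (\<sigma> \<xi>) = sz m j \<eta> div sz n i (\<sigma> \<eta>) \<and>
      (\<forall>c<sz m j \<xi> div sz n i (\<sigma> \<xi>). lab i (\<sigma> \<xi>) (u * (sz m j \<xi> div sz n i (\<sigma> \<xi>)) + c)
         = lab i (\<sigma> \<eta>) (v * (sz m j \<eta> div sz n i (\<sigma> \<eta>)) + c))"
    proof (cases "\<xi> \<in> S j")
      case True
      then have \<eta>: "\<eta> = \<xi>" "label j u = label j v" using e by (auto simp: lab_def split: if_splits)
      show ?thesis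
      proof (cases "\<sigma> \<xi> \<in> S i")
        case s: True
        have q: "sz m j \<xi> div sz n i (\<sigma> \<xi>) = facs i j" using both[OF True s] sz_pos[OF n] by simp
        show ?thesis unfolding \<eta>(1) q using label_facs[OF ij \<eta>(2)] by (simp add: lab_def)
      next
        case False
        then show ?thesis unfolding \<eta>(1) by (simp add: lab_def)
      qed
    next
      case False
      then have \<eta>: "\<eta> \<notin> S j" using e by (auto simp: lab_def split: if_splits)
      have "\<sigma> \<xi> \<notin> S i" "\<sigma> \<eta> \<notin> S i" using Sj x y False \<eta> by blast+
      then show ?thesis using False \<eta> by (simp add: sz_def lab_def)
    qed
  qed
  ultimately show ?thesis by (simp add: lvl_def)
qed

lemma lvl_Suc:
  assumes "0 < n"
  shows "lvl n i \<subseteq> lvl n (Suc i)"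
proof
  fix k assume k: "k \<in> lvl n i"
  have "(\<lambda>(\<xi>, a, b). k (id \<xi>, a, b)) \<in> lvl n (Suc i)"
  proof (rule lvl_transfer[OF assms assms k, of "Suc i" id])
    show "n * size0 i dvd n * size0 (Suc i)" by (simp add: facs_Suc)
    show "n * size0 i dvd n * csize (Suc i) \<xi>" if "\<xi> \<in> S (Suc i)" for \<xi> using csize_dvd[OF that, of i] by simp
    show "\<xi> \<in> S (Suc i)" if "id \<xi> \<in> S i" for \<xi> using that S_mono[of i "Suc i"] by auto
  qed auto
  then show "k \<in> lvl n (Suc i)" by (simp add: case_prod_unfold)
qed

lemma lvl_mono: "0 < n \<Longrightarrow> i \<le> j \<Longrightarrow> lvl n i \<subseteq> lvl n j"
  using lift_Suc_mono_le[of "lvl n"] lvl_Suc by blast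

lemma lvl_subalgebra: "0 < n \<Longrightarrow> unital_subalgebra (lvl n i) F KA"
  unfolding lvl_def by (rule interval_blocks.level_unital_subalgebra[OF blocks])

lemma lvl_subring: "0 < n \<Longrightarrow> subring (lvl n i) KA"
  using lvl_subalgebra unfolding unital_subalgebra_def by (rule conjunct1)

lemma KA_ring: "ring KA"
  by (rule F.kernel_ring)

lemma alg_subring:
  assumes "0 < n"
  shows "subring (\<Union>i. lvl n i) KA"
proof -
  interpret K: ring KA by (rule KA_ring)
  have common: "\<exists>i. k \<in> lvl n i \<and> l \<in> lvl n i" if "k \<in> (\<Union>i. lvl n i)" "l \<in> (\<Union>i. lvl n i)" for k l
  proof -
    obtain i j where "k \<in> lvl n i" "l \<in> lvl n j" using \<open>k \<in> (\<Union>i. lvl n i)\<close> \<open>l \<in> (\<Union>i. lvl n i)\<close> by blast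
    then show ?thesis using lvl_mono[OF assms, of i "max i j"] lvl_mono[OF assms, of j "max i j"] by auto
  qed
  show ?thesis
  proof (rule K.subringI)
    show "(\<Union>i. lvl n i) \<subseteq> carrier KA" by (auto simp: lvl_def)
    show "\<one>\<^bsub>KA\<^esub> \<in> (\<Union>i. lvl n i)" using subringE(3)[OF lvl_subring[OF assms]] by blast
  next
    fix k assume "k \<in> (\<Union>i. lvl n i)"
    then show "\<ominus>\<^bsub>KA\<^esub> k \<in> (\<Union>i. lvl n i)" using subringE(5)[OF lvl_subring[OF assms]] by blast
  next
    fix k l assume kl: "k \<in> (\<Union>i. lvl n i)" "l \<in> (\<Union>i. lvl n i)"
    then obtain i where i: "k \<in> lvl n i" "l \<in> lvl n i" using common by blast
    show "k \<otimes>\<^bsub>KA\<^esub> l \<in> (\<Union>i. lvl n i)" using subringE(6)[OF lvl_subring[OF assms] i] by blast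
    show "k \<oplus>\<^bsub>KA\<^esub> l \<in> (\<Union>i. lvl n i)" using subringE(7)[OF lvl_subring[OF assms] i] by blast
  qed
qed

lemma alg_simps:
  "carrier (alg n) = (\<Union>i. lvl n i)" "monoid.mult (alg n) = monoid.mult KA" "ring.add (alg n) = ring.add KA"
  "one (alg n) = one KA" "ring.zero (alg n) = ring.zero KA" "smult (alg n) = smult KA"
  "(alg n)\<lparr>carrier := B\<rparr> = KA\<lparr>carrier := B\<rparr>"
  by (simp_all add: alg_def)

lemma alg_ring: "0 < n \<Longrightarrow> ring (alg n)"
  unfolding alg_def by (rule ring.subring_is_ring[OF KA_ring alg_subring])

lemma alg_carrier: "k \<in> carrier (alg n) \<Longrightarrow> k \<in> carrier KA"
  by (auto simp: alg_simps lvl_def)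

lemma alg_assoc_algebra:
  assumes "0 < n"
  shows "assoc_algebra F (alg n)"
proof -
  interpret K: assoc_algebra F KA by (rule F.kernel_assoc_algebra)
  interpret A: ring "alg n" by (rule alg_ring[OF assms])
  note c = alg_carrier
  show ?thesis
  proof unfold_locales
    fix a x assume a: "a \<in> carrier F" and x: "x \<in> carrier (alg n)"
    then show "a \<odot>\<^bsub>alg n\<^esub> x \<in> carrier (alg n)"
      using lvl_subalgebra[OF assms] unfolding unital_subalgebra_def alg_simps by blast
  qed (auto simp: alg_simps(2-6) c K.smult_l_distr K.smult_r_distr K.smult_assoc1 K.smult_mult_left K.smult_mult_right)
qed

lemma lvl_subring_of:
  assumes "0 < n"
  shows "subring_of (KA\<lparr>carrier := lvl n i\<rparr>) (alg n)"
  unfolding subring_of_def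
  using ring.subring_is_ring[OF KA_ring lvl_subring[OF assms]] alg_ring[OF assms] by (auto simp: alg_simps)

lemma alg_ultramatricial: "ultramatricial F (alg 1)"
  unfolding ultramatricial_def
proof (intro conjI exI[of _ "range (lvl 1)"] ballI)
  show "assoc_algebra F (alg 1)" by (rule alg_assoc_algebra) simp
  show "countable (range (lvl 1))" by simp
  show "range (lvl 1) \<noteq> {}" by simp
  show "carrier (alg 1) = \<Union> (range (lvl 1))" by (simp add: alg_simps)
next
  fix B D assume "B \<in> range (lvl 1)" "D \<in> range (lvl 1)"
  then obtain i j where "B = lvl 1 i" "D = lvl 1 j" by blast
  then show "\<exists>E\<in>range (lvl 1). B \<subseteq> E \<and> D \<subseteq> E"
    using lvl_mono[of 1 i "max i j"] lvl_mono[of 1 j "max i j"] by auto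
next
  fix B assume "B \<in> range (lvl 1)"
  then obtain i where B: "B = lvl 1 i" by blast
  have s: "subring B (alg 1)"
  proof -
    interpret A: ring "alg 1" by (rule alg_ring) simp
    have sub: "subring B KA" unfolding B by (rule lvl_subring) simp
    interpret K: ring KA by (rule KA_ring)
    show ?thesis
      by (rule A.ring_incl_imp_subring)
        (use B K.subring_is_ring[OF sub] in \<open>auto simp: alg_simps\<close>)
  qed
  show "unital_subalgebra B F (alg 1)"
    using lvl_subalgebra[of 1 i] s unfolding unital_subalgebra_def alg_simps B by simp
  show "matricial F ((alg 1)\<lparr>carrier := B\<rparr>)"
    unfolding alg_simps B lvl_def by (rule interval_blocks.level_matricial[OF blocks]) simp
qed

text \<open>Multiplying first components by \<open>of_nat m / of_nat n\<close>, an element of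
  \<open>H\<close>, permutes the coordinates and turns the block size \<open>n\<close> times
  \<open>h\<close> into \<open>m\<close> times \<open>h\<close>. It maps levels into possibly later
  levels, so the isomorphism exists only between the unions.\<close>

lemma alg_iso:
  assumes n: "0 < n" and m: "0 < m" and h: "of_nat n / of_nat m \<in> H"
  shows "alg n \<simeq> alg m"
proof -
  define \<sigma> where "\<sigma> r \<xi> = (fst \<xi> * r, snd \<xi>)" for r :: rat and \<xi> :: "rat \<times> nat"
  define T where "T r k = (\<lambda>(\<xi>, a, b). k (\<sigma> r \<xi>, a, b))" for r and k :: "(rat \<times> nat) \<times> nat \<times> nat \<Rightarrow> 'a"
  have \<sigma>C: "\<sigma> (of_nat m / of_nat n) \<xi> \<in> C \<longleftrightarrow> \<xi> \<in> C"
    if n: "0 < n" and m: "0 < m" and h: "of_nat m / of_nat n \<in> H" for n m :: nat and \<xi>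
  proof
    let ?r = "of_nat m / of_nat n :: rat"
    assume "\<sigma> ?r \<xi> \<in> C"
    then have "fst \<xi> * ?r \<in> H" by (simp only: \<sigma>_def C_def mem_Times_iff fst_conv)
    then have "fst \<xi> * ?r * inverse ?r \<in> H" by (rule H_mult[OF _ H_inverse[OF h]])
    moreover have "fst \<xi> * ?r * inverse ?r = fst \<xi>" using n m by simp
    ultimately have "fst \<xi> \<in> H" by (simp only:)
    then show "\<xi> \<in> C" by (simp only: C_def mem_Times_iff UNIV_I)
  next
    assume "\<xi> \<in> C"
    then show "\<sigma> (of_nat m / of_nat n) \<xi> \<in> C" using H_mult[OF _ h] by (simp only: \<sigma>_def C_def mem_Times_iff fst_conv snd_conv UNIV_I simp_thms)
  qed
  have tr: "T (of_nat m / of_nat n) k \<in> carrier (alg m)"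
    if k: "k \<in> carrier (alg n)" and n: "0 < n" and m: "0 < m" and h: "of_nat m / of_nat n \<in> H" for n m :: nat and k
  proof -
    let ?r = "of_nat m / of_nat n :: rat"
    obtain i where i: "k \<in> lvl n i" using k by (auto simp: alg_simps)
    note C = \<sigma>C[OF n m h]
    \<comment> \<open>Injectivity makes the preimage of the finite set \<open>S i\<close> finite, so
      that one later set \<open>S j0\<close> contains it.\<close>
    have inj: "inj (\<sigma> ?r)" using n m by (auto simp: \<sigma>_def inj_def prod_eq_iff)
    have "finite {\<xi> \<in> C. \<sigma> ?r \<xi> \<in> S i}"
      by (rule finite_subset[OF _ finite_vimageI[OF finite_S inj]]) auto
    moreover have "\<exists>j. {\<xi> \<in> C. \<sigma> ?r \<xi> \<in> S i} \<subseteq> S j"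
    proof -
      have "\<exists>j. X0 \<subseteq> S j" if "finite X0" "X0 \<subseteq> C" for X0
        using that
      proof (induction rule: finite_induct)
        case (insert x X0)
        then obtain j j' where "X0 \<subseteq> S j" "x \<in> S j'" using in_S[of x] by blast
        then have "insert x X0 \<subseteq> S (max j j')" using S_mono[of j "max j j'"] S_mono[of j' "max j j'"] by auto
        then show ?case by blast
      qed simp
      then show ?thesis using calculation by blast
    qed
    then obtain j0 where j0: "{\<xi> \<in> C. \<sigma> ?r \<xi> \<in> S i} \<subseteq> S j0" by blast
    define j1 where "j1 = Suc (max i n)"
    \<comment> \<open>Late enough to contain the preimage of \<open>S i\<close>, and strictly beyond
      \<open>j1\<close> because \<open>csize_dvd\<close> yields divisibility only by sizes of
      earlier levels.\<close>
    define j where "j = Suc (max j0 j1)"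
    have dv: "n * size0 i dvd size0 j1" unfolding j1_def by (rule facs_dvd_eventually[OF n])
    have "T ?r k \<in> lvl m j"
      unfolding T_def
    proof (rule lvl_transfer[OF n m i _ C])
      show "i \<le> j" unfolding j_def j1_def by auto
      show "of_nat n * fst (\<sigma> ?r \<xi>) = of_nat m * fst \<xi>" for \<xi> using n by (simp add: \<sigma>_def)
      show "\<xi> \<in> S j" if "\<xi> \<in> C" "\<sigma> ?r \<xi> \<in> S i" for \<xi>
      proof (rule subsetD[OF S_mono])
        show "j0 \<le> j" unfolding j_def by auto
        show "\<xi> \<in> S j0" by (rule subsetD[OF j0]) (rule CollectI, rule conjI, fact, fact)
      qed
      have "size0 j1 dvd size0 j" using facs_trans[of 0 j1 j] unfolding j_def by simp
      then show "n * size0 i dvd m * size0 j" by (intro dvd_mult dvd_trans[OF dv])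
      show "n * size0 i dvd m * csize j \<xi>" if "\<xi> \<in> S j" for \<xi>
      proof (intro dvd_mult dvd_trans[OF dv] csize_dvd[OF that])
        show "j1 < j" unfolding j_def by auto
      qed
    qed
    then show ?thesis by (auto simp: alg_simps)
  qed
  have h': "of_nat m / of_nat n \<in> H" using H_inverse[OF h] by simp
  have inv: "T (of_nat n / of_nat m) (T (of_nat m / of_nat n) k) = k" if "0 < n" "0 < m" for n m :: nat and k
    using that by (auto simp: T_def \<sigma>_def fun_eq_iff)
  let ?r = "of_nat m / of_nat n :: rat"
  have "T ?r \<in> ring_iso (alg n) (alg m)"
  proof (rule ring_iso_memI)
    show "bij_betw (T ?r) (carrier (alg n)) (carrier (alg m))"
      by (rule bij_betw_byWitness[where f' = "T (of_nat n / of_nat m)"])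
        (use tr[OF _ n m h'] tr[OF _ m n h] inv n m in auto)
  next
    fix k l assume k: "k \<in> carrier (alg n)" and l: "l \<in> carrier (alg n)"
    show "T ?r k \<in> carrier (alg m)" by (rule tr[OF k n m h'])
    show "T ?r (k \<oplus>\<^bsub>alg n\<^esub> l) = T ?r k \<oplus>\<^bsub>alg m\<^esub> T ?r l"
      by (rule kernel_eqI) (simp add: alg_simps kernel_simps T_def)
    show "T ?r (k \<otimes>\<^bsub>alg n\<^esub> l) = T ?r k \<otimes>\<^bsub>alg m\<^esub> T ?r l"
      by (rule kernel_eqI) (simp add: alg_simps kernel_algebra_def T_def)
  next
    have "\<sigma> ?r \<xi> \<in> C \<longleftrightarrow> \<xi> \<in> C" for \<xi> by (rule \<sigma>C[OF n m h'])
    then show "T ?r \<one>\<^bsub>alg n\<^esub> = \<one>\<^bsub>alg m\<^esub>"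
      by (intro kernel_eqI) (simp add: alg_simps kernel_simps T_def)
  qed
  then show ?thesis unfolding is_ring_iso_def by blast
qed

end

text \<open>Positions are written as \<open>n * y + r\<close>, so that dividing by
  \<open>n * s \<xi>\<close> amounts to dividing \<open>y\<close> by \<open>s \<xi>\<close>.
  Interleaving by residues thus respects the intervals: the condition on the large kernel splits
  into conditions on its residue kernels.\<close>

lemma blockwise_residues:
  assumes n: "0 < n"
  shows "blockwise C F (\<lambda>\<xi>. n * s \<xi>) g k \<longleftrightarrow>
    (\<forall>r<n. \<forall>t<n. blockwise C F s g (\<lambda>(\<xi>, y, z). k (\<xi>, n * y + r, n * z + t)))" (is "?L \<longleftrightarrow> ?R")
proof
  assume L: ?L
  show ?R
    unfolding blockwise_def prod.case
  proof (intro conjI allI impI ballI)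
    fix r t \<xi> a b assume r: "r < n" "t < n" and \<xi>: "\<xi> \<in> C" and ne: "a div s \<xi> \<noteq> b div s \<xi>"
    have "(n * a + r) div (n * s \<xi>) = a div s \<xi>" "(n * b + t) div (n * s \<xi>) = b div s \<xi>"
      using r n by (simp_all add: div_mult2_eq)
    then show "k (\<xi>, n * a + r, n * b + t) = \<zero>\<^bsub>F\<^esub>" using L \<xi> ne unfolding blockwise_def by metis
  next
    fix r t \<xi> \<eta> u v x y assume r: "r < n" "t < n" and \<xi>: "\<xi> \<in> C" "\<eta> \<in> C" and e: "g \<xi> u = g \<eta> v" and x: "x < s \<xi>" "y < s \<xi>"
    have lt: "n * x + r < n * s \<xi>" if "x < s \<xi>" "r < n" for x r
    proof -
      have "n * x + r < n * Suc x" using that by simp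
      also have "n * Suc x \<le> n * s \<xi>" using that by (intro mult_le_mono) auto
      finally show ?thesis .
    qed
    have e1: "n * (w * q + x) + r = w * (n * q) + (n * x + r)" for w q x r :: nat by (simp add: algebra_simps)
    show "k (\<xi>, n * (u * s \<xi> + x) + r, n * (u * s \<xi> + y) + t) = k (\<eta>, n * (v * s \<eta> + x) + r, n * (v * s \<eta> + y) + t)"
      unfolding e1 using L \<xi> e lt[OF x(1) r(1)] lt[OF x(2) r(2)] unfolding blockwise_def by blast
  qed
next
  assume R: ?R
  show ?L
    unfolding blockwise_def
  proof (intro conjI allI impI ballI)
    fix \<xi> a b assume \<xi>: "\<xi> \<in> C" and ne: "a div (n * s \<xi>) \<noteq> b div (n * s \<xi>)"
    have "blockwise C F s g (\<lambda>(\<xi>, y, z). k (\<xi>, n * y + a mod n, n * z + b mod n))" using R n by simp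
    moreover have "a div n div s \<xi> \<noteq> b div n div s \<xi>" using ne by (simp add: div_mult2_eq)
    ultimately have "(\<lambda>(\<xi>, y, z). k (\<xi>, n * y + a mod n, n * z + b mod n)) (\<xi>, a div n, b div n) = \<zero>\<^bsub>F\<^esub>"
      using \<xi> unfolding blockwise_def by blast
    then show "k (\<xi>, a, b) = \<zero>\<^bsub>F\<^esub>" by simp
  next
    fix \<xi> \<eta> u v x y assume \<xi>: "\<xi> \<in> C" "\<eta> \<in> C" and e: "g \<xi> u = g \<eta> v" and x: "x < n * s \<xi>" "y < n * s \<xi>"
    have "blockwise C F s g (\<lambda>(\<xi>, a, z). k (\<xi>, n * a + x mod n, n * z + y mod n))" using R n by simp
    moreover have "x div n < s \<xi>" "y div n < s \<xi>" using x by (simp_all add: less_mult_imp_div_less mult.commute)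
    ultimately have "(\<lambda>(\<xi>, a, z). k (\<xi>, n * a + x mod n, n * z + y mod n)) (\<xi>, u * s \<xi> + x div n, u * s \<xi> + y div n)
       = (\<lambda>(\<xi>, a, z). k (\<xi>, n * a + x mod n, n * z + y mod n)) (\<eta>, v * s \<eta> + x div n, v * s \<eta> + y div n)"
      using \<xi> e unfolding blockwise_def by blast
    moreover have "n * (w * q + x div n) + x mod n = w * (n * q) + x" for w q x
      by (simp add: algebra_simps)
    ultimately show "k (\<xi>, u * (n * s \<xi>) + x, u * (n * s \<xi>) + y) = k (\<eta>, v * (n * s \<eta>) + x, v * (n * s \<eta>) + y)"
      by (simp only: prod.case)
  qed
qed

section \<open>Matrix rings over the algebra of the tower\<close>

context tower begin

lemma sz_multiple: "sz n i = (\<lambda>\<xi>. n * sz 1 i \<xi>)"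
  by (simp add: sz_def fun_eq_iff)

lemma kernel_finsum_entry:
  assumes "finite B" "f \<in> B \<rightarrow> carrier (alg 1)"
  shows "finsum (alg 1) f B x = (\<Oplus>\<^bsub>F\<^esub>s\<in>B. f s x)"
proof -
  interpret A: ring "alg 1" by (rule alg_ring) simp
  show ?thesis
    using assms
  proof (induction rule: finite_induct)
    case empty
    show ?case unfolding A.finsum_empty F.finsum_empty alg_simps kernel_simps ..
  next
    case (insert s B)
    have "f t x \<in> carrier F" if "t \<in> insert s B" for t
      by (rule kernel_closed[OF alg_carrier]) (use insert.prems that in blast)
    then show ?case using insert by (simp del: One_nat_def add: alg_simps(3) kernel_simps Pi_iff)
  qed
qed

text \<open>The entry at \<open>(r, t)\<close> of the matrix belonging to a kernel collects the rows
  congruent to \<open>r\<close> and the columns congruent to \<open>t\<close> modulo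
  \<open>n\<close>. The sum over positions in a product of kernels then splits into a sum over
  residues, which is the matrix product.\<close>

lemma matrix_alg: 
  assumes n: "0 < n"
  shows "matrix_ring n (alg 1) \<simeq> alg n"
proof -
  define f where "f k = (\<lambda>(r, t)\<in>{..<n} \<times> {..<n}. \<lambda>(\<xi>, y, z). k (\<xi>, n * y + r, n * z + t))"
    for k :: "(rat \<times> nat) \<times> nat \<times> nat \<Rightarrow> 'a"
  define h where "h M = (\<lambda>(\<xi>, a, b). M (a mod n, b mod n) (\<xi>, a div n, b div n))"
    for M :: "nat \<times> nat \<Rightarrow> (rat \<times> nat) \<times> nat \<times> nat \<Rightarrow> 'a"
  interpret A: ring "alg 1" by (rule alg_ring) simp
  interpret An: ring "alg n" by (rule alg_ring[OF n])
  let ?M = "matrix_ring n (alg 1)"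
  have fent: "f k (r, t) (\<xi>, y, z) = k (\<xi>, n * y + r, n * z + t)" if "r < n" "t < n" for k r t \<xi> y z
    using that by (simp add: f_def)
  have fent': "f k (r, t) = (\<lambda>(\<xi>, y, z). k (\<xi>, n * y + r, n * z + t))" if "r < n" "t < n" for k r t
    using that by (simp add: f_def)
  have flvl: "f k (r, t) \<in> lvl 1 i" if k: "k \<in> lvl n i" and r: "r < n" "t < n" for k i r t
  proof -
    have kA: "k \<in> carrier KA" and bw: "blockwise C F (sz n i) (lab i) k" using k by (auto simp: lvl_def)
    have "f k (r, t) \<in> carrier KA"
      unfolding kernel_simps(1) fent[OF r]
    proof (intro conjI allI impI)
      fix \<xi> a
      show "k (\<xi>, n * a + r, n * b + t) \<in> carrier F" for b by (rule kernel_closed[OF kA])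
      obtain N where N: "\<And>b. b \<ge> N \<Longrightarrow> k (\<xi>, n * a + r, b) = \<zero>\<^bsub>F\<^esub>" using kernel_bound[OF kA, of \<xi> "n * a + r"] by blast
      have "k (\<xi>, n * a + r, n * b + t) = \<zero>\<^bsub>F\<^esub>" if "N \<le> b" for b
        by (rule N) (use n that in \<open>metis trans_le_add1 mult_le_mono1 One_nat_def Suc_leI mult_1 order_trans\<close>)
      then show "\<exists>N. \<forall>b\<ge>N. k (\<xi>, n * a + r, n * b + t) = \<zero>\<^bsub>F\<^esub>" by blast
      show "k (\<xi>, n * a + r, n * b + t) = \<zero>\<^bsub>F\<^esub>" if "\<xi> \<notin> C" for b by (rule kernel_outside[OF kA that])
    qed
    moreover have "blockwise C F (sz 1 i) (lab i) (f k (r, t))"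
      using bw r unfolding sz_multiple[of n] blockwise_residues[OF n] fent'[OF r] by blast
    ultimately show ?thesis unfolding lvl_def by blast
  qed
  have fc: "f k \<in> carrier ?M" if k: "k \<in> carrier (alg n)" for k
  proof -
    obtain i where i: "k \<in> lvl n i" using k by (auto simp: alg_simps)
    have "(\<lambda>(r, t)\<in>{..<n} \<times> {..<n}. f k (r, t)) \<in> carrier ?M"
      by (rule matrix_memI) (use flvl[OF i] in \<open>auto simp: alg_simps\<close>)
    moreover have "(\<lambda>(r, t)\<in>{..<n} \<times> {..<n}. f k (r, t)) = f k" by (auto simp: f_def fun_eq_iff restrict_def)
    ultimately show ?thesis by simp
  qed
  have hent: "h M (\<xi>, n * y + r, n * z + t) = M (r, t) (\<xi>, y, z)" if "r < n" "t < n" for M \<xi> y z r t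
    using that by (simp add: h_def)
  have hc: "h M \<in> carrier (alg n)" if M: "M \<in> carrier ?M" for M
  proof -
    have ent: "M (r, t) \<in> carrier (alg 1)" if "r < n" "t < n" for r t using matrix_closed[OF M that] .
    then have "\<forall>r t. \<exists>i. r < n \<longrightarrow> t < n \<longrightarrow> M (r, t) \<in> lvl 1 i" unfolding alg_simps by blast
    then obtain i where i: "\<And>r t. r < n \<Longrightarrow> t < n \<Longrightarrow> M (r, t) \<in> lvl 1 (i r t)" by metis
    \<comment> \<open>The finitely many entries of a matrix lie in a common level.\<close>
    define j where "j = Max ((\<lambda>(r, t). i r t) ` ({..<n} \<times> {..<n}))"
    have j: "M (r, t) \<in> lvl 1 j" if rt: "r < n" "t < n" for r t
    proof -
      have "i r t \<le> j" unfolding j_def by (rule Max_ge) (use rt in auto)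
      then show ?thesis using i[OF rt] lvl_mono[of 1 "i r t" j] by auto
    qed
    have Mc: "M (r, t) \<in> carrier KA" if "r < n" "t < n" for r t using ent[OF that] by (rule alg_carrier)
    have mod: "a mod n < n" for a using n by simp
    have "h M \<in> carrier KA"
      unfolding kernel_simps(1) h_def prod.case
    proof (intro conjI allI impI)
      fix \<xi> a
      show "M (a mod n, b mod n) (\<xi>, a div n, b div n) \<in> carrier F" for b
        by (rule kernel_closed[OF Mc[OF mod mod]])
      have "\<forall>t. \<exists>N. t < n \<longrightarrow> (\<forall>b\<ge>N. M (a mod n, t) (\<xi>, a div n, b) = \<zero>\<^bsub>F\<^esub>)"
        using kernel_bound[OF Mc[OF mod], where \<xi> = \<xi> and a = "a div n"] by metis
      then obtain N where N: "\<And>t b. t < n \<Longrightarrow> b \<ge> N t \<Longrightarrow> M (a mod n, t) (\<xi>, a div n, b) = \<zero>\<^bsub>F\<^esub>" by metis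
      have "M (a mod n, b mod n) (\<xi>, a div n, b div n) = \<zero>\<^bsub>F\<^esub>" if b: "n * Max (N ` {..<n}) \<le> b" for b
      proof (rule N[OF mod])
        have "N (b mod n) \<le> Max (N ` {..<n})" by (rule Max_ge) (use n in auto)
        also have "\<dots> \<le> b div n" using b n by (simp add: less_eq_div_iff_mult_less_eq mult.commute)
        finally show "N (b mod n) \<le> b div n" .
      qed
      then show "\<exists>N. \<forall>b\<ge>N. M (a mod n, b mod n) (\<xi>, a div n, b div n) = \<zero>\<^bsub>F\<^esub>" by blast
      show "M (a mod n, b mod n) (\<xi>, a div n, b div n) = \<zero>\<^bsub>F\<^esub>" if "\<xi> \<notin> C" for b
        by (rule kernel_outside[OF Mc[OF mod mod] that])
    qed
    moreover have "blockwise C F (sz n j) (lab j) (h M)"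
      unfolding sz_multiple[of n] blockwise_residues[OF n]
    proof (intro allI impI)
      fix r t assume rt: "r < n" "t < n"
      have "(\<lambda>(\<xi>, y, z). h M (\<xi>, n * y + r, n * z + t)) = M (r, t)"
        by (rule kernel_eqI) (simp only: prod.case hent[OF rt])
      then show "blockwise C F (sz 1 j) (lab j) (\<lambda>(\<xi>, y, z). h M (\<xi>, n * y + r, n * z + t))"
        using j[OF rt] unfolding lvl_def by simp
    qed
    ultimately show ?thesis unfolding alg_simps lvl_def by blast
  qed
  have hf: "h (f k) = k" for k
    by (rule kernel_eqI) (simp add: h_def f_def n)
  have fh: "f (h M) = M" if M: "M \<in> carrier ?M" for M
  proof (rule matrix_eqI[OF fc[OF hc[OF M]] M])
    fix r t assume rt: "r < n" "t < n"
    show "f (h M) (r, t) = M (r, t)" by (rule kernel_eqI) (simp only: fent[OF rt] hent[OF rt])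
  qed
  have "f \<in> ring_iso (alg n) ?M"
  proof (rule ring_iso_memI)
    show "bij_betw f (carrier (alg n)) (carrier ?M)"
      by (rule bij_betw_byWitness[where f' = h]) (use hf fh fc hc in auto)
  next
    fix k assume k: "k \<in> carrier (alg n)"
    show "f k \<in> carrier ?M" by (rule fc[OF k])
    fix l assume l: "l \<in> carrier (alg n)"
    have kA: "k \<in> carrier KA" "l \<in> carrier KA" using k l by (auto intro: alg_carrier)
    note kc = kernel_closed[OF kA(1)] kernel_closed[OF kA(2)]
    have ent: "f k (r, t) \<in> carrier (alg 1)" "f l (r, t) \<in> carrier (alg 1)" if "r < n" "t < n" for r t
      using matrix_closed[OF fc[OF k] that] matrix_closed[OF fc[OF l] that] .
    show "f (k \<oplus>\<^bsub>alg n\<^esub> l) = f k \<oplus>\<^bsub>?M\<^esub> f l"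
    proof (rule matrix_eqI[OF fc[OF An.a_closed[OF k l]] A.matrix_add_closed[OF fc[OF k] fc[OF l]]])
      fix r t assume rt: "r < n" "t < n"
      show "f (k \<oplus>\<^bsub>alg n\<^esub> l) (r, t) = (f k \<oplus>\<^bsub>?M\<^esub> f l) (r, t)"
        by (rule kernel_eqI) (simp only: matrix_add_entry[OF rt] fent[OF rt] alg_simps(3) kernel_simps(2))
    qed
    show "f (k \<otimes>\<^bsub>alg n\<^esub> l) = f k \<otimes>\<^bsub>?M\<^esub> f l"
    proof (rule matrix_eqI[OF fc[OF An.m_closed[OF k l]] A.matrix_mult_closed[OF fc[OF k] fc[OF l]]])
      fix r t assume rt: "r < n" "t < n"
      show "f (k \<otimes>\<^bsub>alg n\<^esub> l) (r, t) = (f k \<otimes>\<^bsub>?M\<^esub> f l) (r, t)"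
      proof (rule kernel_eqI)
        fix \<xi> y z
        obtain N where N: "\<And>b. b \<ge> N \<Longrightarrow> k (\<xi>, n * y + r, b) = \<zero>\<^bsub>F\<^esub>" using kernel_bound[OF kA(1), of \<xi> "n * y + r"] by blast
        \<comment> \<open>The bound is enlarged to a multiple of \<open>n\<close>, so that the range
          splits into full blocks of residues.\<close>
        have N1: "k (\<xi>, n * y + r, b) = \<zero>\<^bsub>F\<^esub>" if "N * n \<le> b" for b
          by (rule N) (use n that in \<open>metis mult_le_mono2 One_nat_def Suc_leI mult_1_right order_trans\<close>)
        have N2: "k (\<xi>, n * y + r, n * b + q) = \<zero>\<^bsub>F\<^esub>" if "N \<le> b" for b q
          by (rule N1) (use that in \<open>simp add: mult.commute trans_le_add1\<close>)
        have prod: "(f k (r, q) \<otimes>\<^bsub>alg 1\<^esub> f l (q, t)) (\<xi>, y, z)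
          = (\<Oplus>\<^bsub>F\<^esub>b\<in>{..<N}. k (\<xi>, n * y + r, n * b + q) \<otimes>\<^bsub>F\<^esub> l (\<xi>, n * b + q, n * z + t))" if q: "q < n" for q
        proof -
          have "(f k (r, q) \<otimes>\<^bsub>KA\<^esub> f l (q, t)) (\<xi>, y, z)
            = (\<Oplus>\<^bsub>F\<^esub>b\<in>{..<N}. f k (r, q) (\<xi>, y, b) \<otimes>\<^bsub>F\<^esub> f l (q, t) (\<xi>, b, z))"
            by (rule F.kernel_mult[OF alg_carrier[OF ent(1)[OF rt(1) q]] alg_carrier[OF ent(2)[OF q rt(2)]]])
              (simp only: fent[OF rt(1) q] N2)
          then show ?thesis by (simp only: alg_simps fent[OF rt(1) q] fent[OF q rt(2)])
        qed
        have "f (k \<otimes>\<^bsub>alg n\<^esub> l) (r, t) (\<xi>, y, z) = (k \<otimes>\<^bsub>KA\<^esub> l) (\<xi>, n * y + r, n * z + t)"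
          by (simp only: fent[OF rt] alg_simps)
        also have "\<dots> = (\<Oplus>\<^bsub>F\<^esub>b\<in>{..<N * n}. k (\<xi>, n * y + r, b) \<otimes>\<^bsub>F\<^esub> l (\<xi>, b, n * z + t))"
          by (rule F.kernel_mult[OF kA N1])
        also have "\<dots> = (\<Oplus>\<^bsub>F\<^esub>b\<in>{..<N}. \<Oplus>\<^bsub>F\<^esub>q\<in>{..<n}. k (\<xi>, n * y + r, b * n + q) \<otimes>\<^bsub>F\<^esub> l (\<xi>, b * n + q, n * z + t))"
          by (rule F.finsum_blocks) (rule F.m_closed[OF kc])
        also have "\<dots> = (\<Oplus>\<^bsub>F\<^esub>q\<in>{..<n}. \<Oplus>\<^bsub>F\<^esub>b\<in>{..<N}. k (\<xi>, n * y + r, b * n + q) \<otimes>\<^bsub>F\<^esub> l (\<xi>, b * n + q, n * z + t))"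
          by (rule F.finsum_swap) (auto intro: F.m_closed[OF kc])
        also have "\<dots> = (\<Oplus>\<^bsub>F\<^esub>q\<in>{..<n}. (f k (r, q) \<otimes>\<^bsub>alg 1\<^esub> f l (q, t)) (\<xi>, y, z))"
          by (rule F.finsum_cong')
            (simp_all del: One_nat_def add: prod mult.commute[of _ n] Pi_iff F.finsum_closed F.m_closed[OF kc])
        also have "\<dots> = (f k \<otimes>\<^bsub>?M\<^esub> f l) (r, t) (\<xi>, y, z)"
          unfolding matrix_mult_entry[OF rt]
          by (rule kernel_finsum_entry[symmetric]) (use A.m_closed[OF ent(1)[OF rt(1)] ent(2)[OF _ rt(2)]] in blast)+
        finally show "f (k \<otimes>\<^bsub>alg n\<^esub> l) (r, t) (\<xi>, y, z) = (f k \<otimes>\<^bsub>?M\<^esub> f l) (r, t) (\<xi>, y, z)" .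
      qed
    qed
  next
    show "f \<one>\<^bsub>alg n\<^esub> = \<one>\<^bsub>?M\<^esub>"
    proof (rule matrix_eqI[OF fc[OF An.one_closed] A.matrix_one_closed])
      fix r t assume rt: "r < n" "t < n"
      show "f \<one>\<^bsub>alg n\<^esub> (r, t) = \<one>\<^bsub>?M\<^esub> (r, t)"
      proof (rule kernel_eqI)
        fix \<xi> y z
        have "n * y + r = n * z + t \<longleftrightarrow> r = t \<and> y = z"
        proof
          assume e: "n * y + r = n * z + t"
          have "(n * y + r) mod n = r" "(n * z + t) mod n = t" "(n * y + r) div n = y" "(n * z + t) div n = z" using rt by auto
          then show "r = t \<and> y = z" using e by metis
        qed simp
        then show "f \<one>\<^bsub>alg n\<^esub> (r, t) (\<xi>, y, z) = \<one>\<^bsub>?M\<^esub> (r, t) (\<xi>, y, z)"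
          unfolding fent[OF rt] matrix_one_entry[OF rt] alg_simps kernel_simps by (auto simp: kernel_simps)
      qed
    qed
  qed
  then have "alg n \<simeq> ?M" unfolding is_ring_iso_def by blast
  then show ?thesis by (rule ring_iso_sym[OF An.ring_axioms])
qed

end

text \<open>\<open>has_type_comp\<close> asks for a decomposition at every index; restricting to
  labels that occur makes it applicable.\<close>

lemma has_type_restrict:
  assumes "has_type R I p f M" "set_mset M \<subseteq> J"
  shows "has_type R J p f M"
  using assms by induction (auto intro: has_type.intros)

lemma block_unit_diag: "block_unit F L d l 0 0 \<one>\<^bsub>F\<^esub> = block_diag F L d {(l, 0)}"
  unfolding block_unit_def block_diag_def
proof (rule restrict_ext)
  fix i assume "i \<in> L"
  show "(if i = l then elem_mat (d i) F 0 0 \<one>\<^bsub>F\<^esub> else \<zero>\<^bsub>matrix_ring (d i) F\<^esub>)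
    = (\<lambda>(a, b)\<in>{..<d i} \<times> {..<d i}. if a = b \<and> (i, a) \<in> {(l, 0)} then \<one>\<^bsub>F\<^esub> else \<zero>\<^bsub>F\<^esub>)"
    by (cases "i = l") (auto simp: elem_mat_def matrix_ring_def intro!: restrict_ext)
qed

lemma (in interval_blocks) psi_diag:
  "\<Psi> (block_diag F L d T) = (\<lambda>(\<xi>, a, b). if \<xi> \<in> C \<and> a = b \<and> (g \<xi> (a div s \<xi>), a mod s \<xi>) \<in> T then \<one>\<^bsub>F\<^esub> else \<zero>\<^bsub>F\<^esub>)"
proof (rule kernel_eqI)
  fix \<xi> a b
  have "a div s \<xi> = b div s \<xi> \<Longrightarrow> (a mod s \<xi> = b mod s \<xi>) = (a = b)" by (metis div_mult_mod_eq)
  then show "\<Psi> (block_diag F L d T) (\<xi>, a, b) = (\<lambda>(\<xi>, a, b). if \<xi> \<in> C \<and> a = b \<and> (g \<xi> (a div s \<xi>), a mod s \<xi>) \<in> T then \<one>\<^bsub>F\<^esub> else \<zero>\<^bsub>F\<^esub>) (\<xi>, a, b)"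
    using g_in[of \<xi> "a div s \<xi>"] d_g[of \<xi> "a div s \<xi>"] s_pos[of \<xi>]
    by (cases "\<xi> \<in> C"; cases "a div s \<xi> = b div s \<xi>") (auto simp: psi_apply block_diag_def)
qed

lemma count_image_fst:
  assumes "finite T"
  shows "count (image_mset fst (mset_set T)) l = card {x \<in> T. fst x = l}"
proof -
  have "count (image_mset fst (mset_set T)) l = (\<Sum>x\<in>fst -` {l} \<inter> T. count (mset_set T) x)"
    using assms by (simp add: count_image_mset)
  also have "\<dots> = (\<Sum>x\<in>fst -` {l} \<inter> T. 1)" using assms by (intro sum.cong) auto
  also have "\<dots> = card (fst -` {l} \<inter> T)" by simp
  also have "fst -` {l} \<inter> T = {x \<in> T. fst x = l}" by auto
  finally show ?thesis .
qed

section \<open>Types of diagonal idempotents in the tower\<close>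

context tower begin

text \<open>A set of diagonal positions as an idempotent. It mentions no level, so equality of
  idempotents described at different levels becomes equality of sets of positions.\<close>

definition dk :: "((rat \<times> nat) \<times> nat) set \<Rightarrow> (rat \<times> nat) \<times> nat \<times> nat \<Rightarrow> 'a" where
  "dk T = (\<lambda>(\<xi>, a, b). if \<xi> \<in> C \<and> a = b \<and> (\<xi>, a) \<in> T then \<one>\<^bsub>F\<^esub> else \<zero>\<^bsub>F\<^esub>)"

abbreviation "Lv n i \<equiv> KA\<lparr>carrier := lvl n i\<rparr>"

text \<open>The first position of every interval with label \<open>l\<close>: the minimal idempotent
  of the factor \<open>l\<close> used in the frame of level \<open>i\<close>.\<close>

definition q :: "nat \<Rightarrow> nat \<Rightarrow> ((rat \<times> nat) \<times> bool) option \<Rightarrow> (rat \<times> nat) \<times> nat \<times> nat \<Rightarrow> 'a" where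
  "q n i l = dk {(\<zeta>, a). lab i \<zeta> (a div sz n i \<zeta>) = l \<and> a mod sz n i \<zeta> = 0}"

text \<open>The unit of the coordinate \<open>\<xi>\<close>, a central idempotent.\<close>

definition Z :: "rat \<times> nat \<Rightarrow> (rat \<times> nat) \<times> nat \<times> nat \<Rightarrow> 'a" where
  "Z \<xi> = dk ({\<xi>} \<times> UNIV)"

lemma q_eq:
  assumes "0 < n"
  shows "q n i l = interval_blocks.\<Psi> F C (sz n i) (lab i) (block_unit F (labs i) (dim n i) l 0 0 \<one>\<^bsub>F\<^esub>)"
proof -
  interpret B: interval_blocks F C "sz n i" "lab i" "labs i" "dim n i" by (rule blocks[OF assms])
  show ?thesis unfolding block_unit_diag B.psi_diag q_def dk_def by (simp add: fun_eq_iff)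
qed

lemma frame:
  assumes "0 < n"
  shows "matricial_frame (Lv n i) (labs i) (q n i)"
  using matricial_rep.is_matricial_frame[OF interval_blocks.level_rep[OF blocks[OF assms]], of i]
  unfolding q_eq[OF assms] lvl_def .

lemma has_type_dk:
  assumes "0 < n" "T \<subseteq> Sigma (labs i) (\<lambda>l. {..<dim n i l})"
  shows "has_type (Lv n i) (labs i) (q n i) (dk {(\<zeta>, a). (lab i \<zeta> (a div sz n i \<zeta>), a mod sz n i \<zeta>) \<in> T}) (image_mset fst (mset_set T))"
proof -
  interpret B: interval_blocks F C "sz n i" "lab i" "labs i" "dim n i" by (rule blocks[OF assms(1)])
  interpret M: matricial_rep F "Lv n i" "labs i" "dim n i" B.\<Psi> unfolding lvl_def by (rule B.level_rep)
  have "has_type (Lv n i) (labs i) (q n i) (B.\<Psi> (block_diag F (labs i) (dim n i) T)) (image_mset fst (mset_set T))"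
    unfolding q_eq[OF assms(1)] by (rule M.has_type_Dg[OF finite_subset[OF assms(2) M.finite_Sigma] assms(2)])
  moreover have "B.\<Psi> (block_diag F (labs i) (dim n i) T) = dk {(\<zeta>, a). (lab i \<zeta> (a div sz n i \<zeta>), a mod sz n i \<zeta>) \<in> T}"
    unfolding B.psi_diag dk_def by (simp add: fun_eq_iff)
  ultimately show ?thesis by (simp only:)
qed

text \<open>The order unit of the coordinate: both of its factors at level \<open>i\<close> have
  size \<open>n * csize i \<xi>\<close>, and \<open>Z \<xi>\<close> is the unit of each of
  them.\<close>

lemma has_type_Z:
  assumes n: "0 < n" and \<xi>: "\<xi> \<in> S i"
  shows "has_type (Lv n i) (labs i) (q n i) (Z \<xi>) (repeat_mset (n * csize i \<xi>) {#Some (\<xi>, False), Some (\<xi>, True)#})"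
proof -
  let ?T = "(Some ` ({\<xi>} \<times> (UNIV :: bool set))) \<times> {..<n * csize i \<xi>}"
  have fin: "finite ?T" by (intro finite_cartesian_product finite_imageI) auto
  have "image_mset fst (mset_set ?T) = repeat_mset (n * csize i \<xi>) {#Some (\<xi>, False), Some (\<xi>, True)#}"
  proof (rule multiset_eqI)
    fix l
    have "{x \<in> ?T. fst x = l} = (if l \<in> Some ` ({\<xi>} \<times> UNIV) then {l} \<times> {..<n * csize i \<xi>} else {})" by auto
    then have "count (image_mset fst (mset_set ?T)) l = (if l \<in> Some ` ({\<xi>} \<times> UNIV) then n * csize i \<xi> else 0)"
      unfolding count_image_fst[OF fin] by (simp add: card_cartesian_product)
    moreover have "l \<in> Some ` ({\<xi>} \<times> UNIV) \<longleftrightarrow> l = Some (\<xi>, False) \<or> l = Some (\<xi>, True)" by (auto simp: UNIV_bool)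
    ultimately show "count (image_mset fst (mset_set ?T)) l = count (repeat_mset (n * csize i \<xi>) {#Some (\<xi>, False), Some (\<xi>, True)#}) l"
      by auto
  qed
  moreover have "dk {(\<zeta>, a). (lab i \<zeta> (a div sz n i \<zeta>), a mod sz n i \<zeta>) \<in> ?T} = Z \<xi>"
  proof -
    have "a mod sz n i \<xi> < n * csize i \<xi>" for a using sz_pos[OF n, of i \<xi>] \<xi> by (simp add: sz_def)
    then have "{(\<zeta>, a). (lab i \<zeta> (a div sz n i \<zeta>), a mod sz n i \<zeta>) \<in> ?T} = {\<xi>} \<times> UNIV"
      using \<xi> by (auto simp: lab_def)
    then show ?thesis unfolding Z_def by (simp only:)
  qed
  moreover have "?T \<subseteq> Sigma (labs i) (\<lambda>l. {..<dim n i l})" using \<xi> by (auto simp: labs_def dim_def)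
  ultimately show ?thesis using has_type_dk[OF n, of ?T i] by simp
qed

text \<open>Number of subintervals labelled \<open>e\<close>, not counting the inherited label.\<close>
definition reps :: "nat \<Rightarrow> bool \<Rightarrow> nat" where "reps i e = (if e then fac i - 2 else 1)"

text \<open>The transition between levels. Each interval of level \<open>i + 1\<close> at
  \<open>\<xi>\<close> contains \<open>reps i e\<close> new subintervals labelled \<open>e\<close>,
  whatever its own label is, and one more, at its beginning, if its own label is \<open>e\<close>.
  The multiplicity matrix is therefore the identity plus a matrix of rank one.\<close>

lemma has_type_q:
  assumes n: "0 < n" and \<xi>: "\<xi> \<in> S i"
  shows "has_type (Lv n (Suc i)) (labs (Suc i)) (q n (Suc i)) (q n i (Some (\<xi>, e)))
    (add_mset (Some (\<xi>, e)) (repeat_mset (reps i e) {#Some (\<xi>, False), Some (\<xi>, True)#}))"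
proof -
  have \<xi>': "\<xi> \<in> S (Suc i)" using \<xi> S_mono[of i "Suc i"] by auto
  define s where "s = sz n i \<xi>"
  have s: "0 < s" unfolding s_def by (rule sz_pos[OF n])
  have s': "sz n (Suc i) \<xi> = fac i * s"
  proof -
    have "(of_nat (csize (Suc i) \<xi>) :: rat) = of_nat (fac i * csize i \<xi>)"
      using csize_eq[OF \<xi>] csize_eq[OF \<xi>'] by (simp add: facs_Suc)
    then show ?thesis unfolding s_def sz_def using \<xi> \<xi>' by (simp only: of_nat_eq_iff) simp
  qed
  \<comment> \<open>The subintervals labelled \<open>e\<close> in an interval labelled
    \<open>e'\<close>.\<close>
  let ?D = "\<lambda>e'. {c. c < fac i \<and> (if c = 0 then e' else c \<noteq> 1) = e}"
  \<comment> \<open>The first positions of these subintervals, which have length \<open>s\<close>,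
    for each label \<open>e'\<close> of the larger interval.\<close>
  define T where "T = (\<Union>e'. {Some (\<xi>, e')} \<times> (\<lambda>c. c * s) ` ?D e')"
  have sub: "T \<subseteq> Sigma (labs (Suc i)) (\<lambda>l. {..<dim n (Suc i) l})"
  proof -
    have "c * s < n * csize (Suc i) \<xi>" if "c < fac i" for c using s' s \<xi>' that unfolding sz_def by simp
    then show ?thesis using \<xi>' unfolding T_def labs_def dim_def by (fastforce simp del: neq0_conv)
  qed
  have memT: "(l, v) \<in> T \<longleftrightarrow> (\<exists>e'. l = Some (\<xi>, e') \<and> (\<exists>c\<in>?D e'. v = c * s))" for l v
    unfolding T_def by blast
  have fin: "finite T" unfolding T_def by auto
  have D: "card (?D e') = reps i e + (if e' = e then 1 else 0)" for e'
  proof -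
    have "?D e' = (if e then {2..<fac i} else {1}) \<union> (if e' = e then {0} else {})"
      using fac_gt(2)[of i] by auto
    then show ?thesis by (auto simp: reps_def card_insert_if)
  qed
  have "image_mset fst (mset_set T) = add_mset (Some (\<xi>, e)) (repeat_mset (reps i e) {#Some (\<xi>, False), Some (\<xi>, True)#})"
  proof (rule multiset_eqI)
    fix l
    show "count (image_mset fst (mset_set T)) l = count (add_mset (Some (\<xi>, e)) (repeat_mset (reps i e) {#Some (\<xi>, False), Some (\<xi>, True)#})) l"
    proof (cases "\<exists>e'. l = Some (\<xi>, e')")
      case True
      then obtain e' where l: "l = Some (\<xi>, e')" by blast
      have "{x \<in> T. fst x = l} = {l} \<times> (\<lambda>c. c * s) ` ?D e'" unfolding T_def l by auto
      then have "count (image_mset fst (mset_set T)) l = card (?D e')"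
        unfolding count_image_fst[OF fin] using s by (simp add: card_cartesian_product card_image inj_on_def)
      then show ?thesis unfolding D l by (cases e'; cases e) simp_all
    next
      case False
      then have "{x \<in> T. fst x = l} = {}" unfolding T_def by auto
      then have "count (image_mset fst (mset_set T)) l = 0" unfolding count_image_fst[OF fin] by (simp only: card.empty)
      then show ?thesis using False by auto
    qed
  qed
  moreover have "{(\<zeta>, a). (lab (Suc i) \<zeta> (a div sz n (Suc i) \<zeta>), a mod sz n (Suc i) \<zeta>) \<in> T}
    = {(\<zeta>, a). lab i \<zeta> (a div sz n i \<zeta>) = Some (\<xi>, e) \<and> a mod sz n i \<zeta> = 0}"
  proof (rule Set.set_eqI)
    fix x :: "(rat \<times> nat) \<times> nat"
    obtain \<zeta> a where x: "x = (\<zeta>, a)" by (cases x)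
    have "(lab (Suc i) \<zeta> (a div sz n (Suc i) \<zeta>), a mod sz n (Suc i) \<zeta>) \<in> T \<longleftrightarrow>
      lab i \<zeta> (a div sz n i \<zeta>) = Some (\<xi>, e) \<and> a mod sz n i \<zeta> = 0"
    proof (cases "\<zeta> = \<xi>")
      case False
      then show ?thesis unfolding T_def lab_def by auto
    next
      case z: True
      let ?b = "a div (fac i * s)" and ?c = "a div s mod fac i"
      have c: "?c < fac i" using fac_pos by simp
      have e1: "a div s = ?b * fac i + ?c"
      proof -
        have "?b = a div s div fac i" unfolding mult.commute[of "fac i" s] by (rule div_mult2_eq)
        then show ?thesis by simp
      qed
      have e2: "a mod (fac i * s) = ?c * s + a mod s"
        unfolding mult.commute[of "fac i" s] mult.commute[of _ s] by (rule mod_mult2_eq)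
      have "(lab (Suc i) \<zeta> (a div sz n (Suc i) \<zeta>), a mod sz n (Suc i) \<zeta>) \<in> T \<longleftrightarrow>
        (\<exists>c\<in>?D (label (Suc i) ?b). ?c * s + a mod s = c * s)"
        unfolding z memT lab_def s' e2[symmetric] if_P[OF \<xi>'] by simp
      also have "\<dots> \<longleftrightarrow> a mod s = 0 \<and> ?c \<in> ?D (label (Suc i) ?b)"
      proof
        assume "\<exists>c\<in>?D (label (Suc i) ?b). ?c * s + a mod s = c * s"
        then obtain c where c: "c \<in> ?D (label (Suc i) ?b)" "?c * s + a mod s = c * s" by blast
        have "r = 0 \<and> x = y" if "x * s + r = y * s" "r < s" for x y r
        proof -
          have "(x * s + r) mod s = r" "(x * s + r) div s = x" using that(2) by simp_all
          then show ?thesis unfolding that(1) using s by simp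
        qed
        from this[OF c(2)] have "a mod s = 0" "?c = c" using s by simp_all
        then show "a mod s = 0 \<and> ?c \<in> ?D (label (Suc i) ?b)" using c(1) by (simp only: simp_thms)
      next
        assume "a mod s = 0 \<and> ?c \<in> ?D (label (Suc i) ?b)"
        then show "\<exists>c\<in>?D (label (Suc i) ?b). ?c * s + a mod s = c * s" by (intro bexI[of _ ?c]) (simp_all only: add_0_right)
      qed
      also have "?c \<in> ?D (label (Suc i) ?b) \<longleftrightarrow> label i (a div s) = e"
        unfolding mem_Collect_eq label_step[OF c, of ?b, folded e1] using c by simp
      finally show ?thesis unfolding z lab_def s_def using \<xi> by auto
    qed
    then show "(x \<in> {(\<zeta>, a). (lab (Suc i) \<zeta> (a div sz n (Suc i) \<zeta>), a mod sz n (Suc i) \<zeta>) \<in> T})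
      = (x \<in> {(\<zeta>, a). lab i \<zeta> (a div sz n i \<zeta>) = Some (\<xi>, e) \<and> a mod sz n i \<zeta> = 0})"
      unfolding x by (simp only: mem_Collect_eq prod.case)
  qed
  ultimately show ?thesis unfolding q_def[of n i] using has_type_dk[OF n sub] by (simp only:)
qed

end

section \<open>Coordinate idempotents\<close>

context ring begin

lemma central_eqv:
  assumes c: "c \<in> carrier R" "\<And>b. b \<in> carrier R \<Longrightarrow> c \<otimes> b = b \<otimes> c" and e: "idem_eqv R e f"
  shows "c \<otimes> e = e \<Longrightarrow> c \<otimes> f = f" "c \<otimes> e = \<zero> \<Longrightarrow> c \<otimes> f = \<zero>"
proof -
  obtain x y where xy: "x \<in> carrier R" "y \<in> carrier R" "x \<otimes> y = e" "y \<otimes> x = f"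
    "e \<otimes> x = x" "x \<otimes> f = x" "f \<otimes> y = y" "y \<otimes> e = y" "e \<in> carrier R" "f \<in> carrier R" "e \<otimes> e = e" "f \<otimes> f = f"
    by (rule idem_eqvE[OF e])
  have "c \<otimes> f = c \<otimes> (y \<otimes> (e \<otimes> x))" by (simp only: xy(4,5))
  also have "\<dots> = c \<otimes> y \<otimes> (e \<otimes> x)" by (simp add: m_assoc c(1) xy(1,2,9))
  also have "\<dots> = y \<otimes> c \<otimes> (e \<otimes> x)" by (simp only: c(2)[OF xy(2)])
  also have "\<dots> = y \<otimes> (c \<otimes> e \<otimes> x)" by (simp add: m_assoc c(1) xy(1,2,9))
  finally have *: "c \<otimes> f = y \<otimes> (c \<otimes> e \<otimes> x)" .
  show "c \<otimes> e = e \<Longrightarrow> c \<otimes> f = f" unfolding * using xy by simp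
  show "c \<otimes> e = \<zero> \<Longrightarrow> c \<otimes> f = \<zero>" unfolding * using xy by simp
qed

text \<open>If the central element acts in the same way, as 1 or as 0, on all labels of a type, it
  acts so on the idempotent.\<close>

lemma central_has_type:
  assumes c: "c \<in> carrier R" "\<And>b. b \<in> carrier R \<Longrightarrow> c \<otimes> b = b \<otimes> c" and f: "has_type R I p f M"
  shows "\<forall>t\<in>#M. c \<otimes> p t = p t \<Longrightarrow> c \<otimes> f = f" "\<forall>t\<in>#M. c \<otimes> p t = \<zero> \<Longrightarrow> c \<otimes> f = \<zero>"
proof -
  have "(\<forall>t\<in>#M. c \<otimes> p t = p t) \<longrightarrow> c \<otimes> f = f" "(\<forall>t\<in>#M. c \<otimes> p t = \<zero>) \<longrightarrow> c \<otimes> f = \<zero>"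
    using f
  proof (induction)
    case zero
    show "(\<forall>t\<in>#{#}. c \<otimes> p t = p t) \<longrightarrow> c \<otimes> \<zero> = \<zero>" "(\<forall>t\<in>#{#}. c \<otimes> p t = \<zero>) \<longrightarrow> c \<otimes> \<zero> = \<zero>" using c(1) by simp_all
  next
    case (add f M t g)
    have f: "f \<in> carrier R" using has_type_idem[OF add.hyps(1)] by simp
    have g: "g \<in> carrier R" using idem_eqvE[OF add.hyps(3)] by metis
    note e = central_eqv[OF c idem_eqv_sym[OF add.hyps(3)]]
    show "(\<forall>t\<in>#add_mset t M. c \<otimes> p t = p t) \<longrightarrow> c \<otimes> (f \<oplus> g) = f \<oplus> g" using add.IH e(1) c(1) f g by (simp add: r_distr)
    show "(\<forall>t\<in>#add_mset t M. c \<otimes> p t = \<zero>) \<longrightarrow> c \<otimes> (f \<oplus> g) = \<zero>" using add.IH e(2) c(1) f g by (simp add: r_distr)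
  qed
  then show "\<forall>t\<in>#M. c \<otimes> p t = p t \<Longrightarrow> c \<otimes> f = f" "\<forall>t\<in>#M. c \<otimes> p t = \<zero> \<Longrightarrow> c \<otimes> f = \<zero>" by simp_all
qed

text \<open>The converse of \<open>central_has_type\<close>. Together they carry the action of a
  central element between idempotents that share labels.\<close>

lemma central_summand:
  assumes c: "c \<in> carrier R" "\<And>b. b \<in> carrier R \<Longrightarrow> c \<otimes> b = b \<otimes> c" and f: "has_type R I p f M" and t: "t \<in># M"
  shows "c \<otimes> f = f \<Longrightarrow> c \<otimes> p t = p t" "c \<otimes> f = \<zero> \<Longrightarrow> c \<otimes> p t = \<zero>"
proof -
  obtain M' where "M = add_mset t M'" using t by (metis insert_DiffM)
  then obtain f' g where fg: "f = f' \<oplus> g" "has_type R I p f' M'" "idem_eqv R g (p t)" "f' \<otimes> g = \<zero>" "g \<otimes> f' = \<zero>"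
    using has_type_extract[OF f] by blast
  have f': "f' \<in> carrier R" using has_type_idem[OF fg(2)] by simp
  have g: "g \<in> carrier R" "g \<otimes> g = g" using idem_eqvE[OF fg(3)] by metis+
  have "f \<otimes> g = g" unfolding fg(1) using f' g fg(4) by (simp add: l_distr)
  then have "c \<otimes> g = (c \<otimes> f) \<otimes> g" using c(1) f' g fg(1) by (simp add: m_assoc)
  then have "c \<otimes> f = f \<Longrightarrow> c \<otimes> g = g" "c \<otimes> f = \<zero> \<Longrightarrow> c \<otimes> g = \<zero>" using \<open>f \<otimes> g = g\<close> g by simp_all
  then show "c \<otimes> f = f \<Longrightarrow> c \<otimes> p t = p t" "c \<otimes> f = \<zero> \<Longrightarrow> c \<otimes> p t = \<zero>"
    using central_eqv[OF c fg(3)] by blast+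
qed

end

abbreviation pair :: "(rat \<times> nat) \<Rightarrow> ((rat \<times> nat) \<times> bool) option multiset" where
  "pair \<xi> \<equiv> {#Some (\<xi>, False), Some (\<xi>, True)#}"

context tower begin

lemma Lv_ring: "0 < n \<Longrightarrow> ring (Lv n i)"
  by (rule ring.subring_is_ring[OF KA_ring lvl_subring])

lemma Z_apply: "Z \<xi> (\<zeta>, a, b) = (if \<zeta> = \<xi> \<and> \<zeta> \<in> C \<and> a = b then \<one>\<^bsub>F\<^esub> else \<zero>\<^bsub>F\<^esub>)"
  unfolding Z_def dk_def prod.case by (cases "\<zeta> = \<xi>") auto

lemma Z_lvl:
  assumes "0 < n" "\<xi> \<in> S i"
  shows "Z \<xi> \<in> lvl n i"
proof -
  have "Z \<xi> \<in> carrier (Lv n i)" by (rule conjunct1[OF ring.has_type_idem[OF Lv_ring[OF assms(1)] has_type_Z[OF assms]]])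
  then show ?thesis by simp
qed

lemma Z_closed: "\<xi> \<in> C \<Longrightarrow> 0 < n \<Longrightarrow> Z \<xi> \<in> carrier (alg n)"
proof -
  assume "\<xi> \<in> C" "0 < n"
  then obtain i where "\<xi> \<in> S i" using in_S by meson
  then show ?thesis unfolding alg_simps by (intro UN_I[of i] Z_lvl[OF \<open>0 < n\<close>]) auto
qed

lemma Z_mult:
  assumes \<xi>: "\<xi> \<in> C" and k: "k \<in> carrier KA"
  shows "(Z \<xi> \<otimes>\<^bsub>KA\<^esub> k) (\<zeta>, a, b) = (if \<zeta> = \<xi> then k (\<zeta>, a, b) else \<zero>\<^bsub>F\<^esub>)"
    "(k \<otimes>\<^bsub>KA\<^esub> Z \<xi>) (\<zeta>, a, b) = (if \<zeta> = \<xi> then k (\<zeta>, a, b) else \<zero>\<^bsub>F\<^esub>)"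
proof -
  have Z: "Z \<xi> \<in> carrier KA" using Z_closed[OF \<xi>, of 1] alg_carrier[of "Z \<xi>" 1] by simp
  note kc = kernel_closed[OF k]
  have "(Z \<xi> \<otimes>\<^bsub>KA\<^esub> k) (\<zeta>, a, b) = (\<Oplus>\<^bsub>F\<^esub>c\<in>{..<Suc a}. Z \<xi> (\<zeta>, a, c) \<otimes>\<^bsub>F\<^esub> k (\<zeta>, c, b))"
    by (rule F.kernel_mult[OF Z k]) (simp add: Z_apply)
  also have "\<dots> = (\<Oplus>\<^bsub>F\<^esub>c\<in>{..<Suc a}. if c = a then (if \<zeta> = \<xi> then k (\<zeta>, a, b) else \<zero>\<^bsub>F\<^esub>) else \<zero>\<^bsub>F\<^esub>)"
    by (rule F.finsum_cong') (use \<xi> in \<open>auto simp: Z_apply kc\<close>)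
  also have "\<dots> = (if \<zeta> = \<xi> then k (\<zeta>, a, b) else \<zero>\<^bsub>F\<^esub>)" by (rule F.finsum_delta) (auto simp: kc)
  finally show "(Z \<xi> \<otimes>\<^bsub>KA\<^esub> k) (\<zeta>, a, b) = (if \<zeta> = \<xi> then k (\<zeta>, a, b) else \<zero>\<^bsub>F\<^esub>)" .
  obtain N where N: "\<And>b. b \<ge> N \<Longrightarrow> k (\<zeta>, a, b) = \<zero>\<^bsub>F\<^esub>" using kernel_bound[OF k, of \<zeta> a] by blast
  have "(k \<otimes>\<^bsub>KA\<^esub> Z \<xi>) (\<zeta>, a, b) = (\<Oplus>\<^bsub>F\<^esub>c\<in>{..<max N (Suc b)}. k (\<zeta>, a, c) \<otimes>\<^bsub>F\<^esub> Z \<xi> (\<zeta>, c, b))"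
    by (rule F.kernel_mult[OF k Z]) (simp add: N)
  also have "\<dots> = (\<Oplus>\<^bsub>F\<^esub>c\<in>{..<max N (Suc b)}. if c = b then (if \<zeta> = \<xi> then k (\<zeta>, a, b) else \<zero>\<^bsub>F\<^esub>) else \<zero>\<^bsub>F\<^esub>)"
    by (rule F.finsum_cong') (use \<xi> in \<open>auto simp: Z_apply kc\<close>)
  also have "\<dots> = (if \<zeta> = \<xi> then k (\<zeta>, a, b) else \<zero>\<^bsub>F\<^esub>)" by (rule F.finsum_delta) (auto simp: kc)
  finally show "(k \<otimes>\<^bsub>KA\<^esub> Z \<xi>) (\<zeta>, a, b) = (if \<zeta> = \<xi> then k (\<zeta>, a, b) else \<zero>\<^bsub>F\<^esub>)" .
qed

lemma Z_central:
  assumes "\<xi> \<in> C" "k \<in> carrier KA"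
  shows "Z \<xi> \<otimes>\<^bsub>KA\<^esub> k = k \<otimes>\<^bsub>KA\<^esub> Z \<xi>"
  by (rule kernel_eqI) (simp only: Z_mult[OF assms])

lemma lvl_KA: "k \<in> lvl n i \<Longrightarrow> k \<in> carrier KA"
  by (simp add: lvl_def)

lemma q_lvl: "0 < n \<Longrightarrow> l \<in> labs i \<Longrightarrow> q n i l \<in> lvl n i"
  using matricial_frame.p_closed[OF frame] by simp

lemma q_apply: "q n i l (\<zeta>, a, b) = (if \<zeta> \<in> C \<and> a = b \<and> lab i \<zeta> (a div sz n i \<zeta>) = l \<and> a mod sz n i \<zeta> = 0 then \<one>\<^bsub>F\<^esub> else \<zero>\<^bsub>F\<^esub>)"
  by (simp add: q_def dk_def)

lemma Z_q:
  assumes n: "0 < n" and \<xi>: "\<xi> \<in> S i"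
  shows "Z \<xi> \<otimes>\<^bsub>KA\<^esub> q n i (Some (\<xi>, e)) = q n i (Some (\<xi>, e))"
    "l \<in> labs i \<Longrightarrow> l \<notin># pair \<xi> \<Longrightarrow> Z \<xi> \<otimes>\<^bsub>KA\<^esub> q n i l = \<zero>\<^bsub>KA\<^esub>"
proof -
  have C: "\<xi> \<in> C" using \<xi> S_sub by blast
  have "Some (\<xi>, e) \<in> labs i" using \<xi> by (auto simp: labs_def)
  then have k: "q n i (Some (\<xi>, e)) \<in> carrier KA" using q_lvl[OF n] lvl_KA by blast
  show "Z \<xi> \<otimes>\<^bsub>KA\<^esub> q n i (Some (\<xi>, e)) = q n i (Some (\<xi>, e))"
    by (rule kernel_eqI) (auto simp: Z_mult[OF C k] q_apply lab_def)
  assume l: "l \<in> labs i" "l \<notin># pair \<xi>"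
  then have k: "q n i l \<in> carrier KA" using q_lvl[OF n] lvl_KA by blast
  have "lab i \<xi> u \<noteq> l" for u using l(2) \<xi> by (cases "label i u") (auto simp: lab_def)
  then show "Z \<xi> \<otimes>\<^bsub>KA\<^esub> q n i l = \<zero>\<^bsub>KA\<^esub>"
    by (intro kernel_eqI) (simp add: Z_mult[OF C k] q_apply kernel_simps)
qed

text \<open>\<open>Z \<xi>\<close> annihilates the minimal idempotents of all other labels, so none
  of these occurs in the type.\<close>

lemma type_under_Z:
  assumes n: "0 < n" and \<xi>: "\<xi> \<in> S i" and f: "has_type (Lv n i) (labs i) (q n i) f M" and Zf: "Z \<xi> \<otimes>\<^bsub>KA\<^esub> f = f"
  shows "set_mset M \<subseteq> set_mset (pair \<xi>)"
proof
  fix t assume t: "t \<in># M"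
  interpret R: ring "Lv n i" by (rule Lv_ring[OF n])
  have C: "\<xi> \<in> C" using \<xi> S_sub by blast
  have tI: "t \<in> labs i" using R.has_type_subset[OF f] t by blast
  have "Z \<xi> \<otimes>\<^bsub>Lv n i\<^esub> q n i t = q n i t"
    by (rule R.central_summand(1)[OF _ _ f t]) (use Z_lvl[OF n \<xi>] Z_central[OF C lvl_KA] Zf in simp_all)
  then show "t \<in># pair \<xi>"
    using Z_q(2)[OF n \<xi> tI] matricial_frame.p_nonzero[OF frame[OF n] tI] by auto
qed

text \<open>A coordinate has no central idempotents besides 0 and its unit. The corner at the label
  \<open>False\<close> is a domain, so \<open>Y\<close> acts on its unit \<open>?p\<close> as 0 or
  1. One level later the type of \<open>?p\<close> contains both labels of \<open>\<xi>\<close>, so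
  the same holds on all of \<open>Z \<xi>\<close>.\<close>

lemma central_idem_dichotomy:
  assumes n: "0 < n" and Y: "Y \<in> carrier (alg n)" "Y \<otimes>\<^bsub>KA\<^esub> Y = Y"
    and central: "\<And>k. k \<in> carrier (alg n) \<Longrightarrow> Y \<otimes>\<^bsub>KA\<^esub> k = k \<otimes>\<^bsub>KA\<^esub> Y" and \<xi>: "\<xi> \<in> C"
  shows "Y \<otimes>\<^bsub>KA\<^esub> Z \<xi> = Z \<xi> \<or> Y \<otimes>\<^bsub>KA\<^esub> Z \<xi> = \<zero>\<^bsub>KA\<^esub>"
proof -
  obtain i1 i2 where i12: "\<xi> \<in> S i1" "Y \<in> lvl n i2" using in_S[OF \<xi>] Y(1) unfolding alg_simps by blast
  define i where "i = max i1 i2"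
  have i: "\<xi> \<in> S i" "Y \<in> lvl n i" using i12 S_mono[of i1 i] lvl_mono[OF n, of i2 i] unfolding i_def by auto
  have i': "\<xi> \<in> S (Suc i)" "Y \<in> lvl n (Suc i)" using i S_mono[of i "Suc i"] lvl_Suc[OF n, of i] by auto
  interpret R: matricial_frame "Lv n i" "labs i" "q n i" by (rule frame[OF n])
  interpret R': matricial_frame "Lv n (Suc i)" "labs (Suc i)" "q n (Suc i)" by (rule frame[OF n])
  interpret K: ring KA by (rule KA_ring)
  have com: "Y \<otimes>\<^bsub>KA\<^esub> k = k \<otimes>\<^bsub>KA\<^esub> Y" if "k \<in> lvl n j" for k j
    by (rule central) (use that in \<open>auto simp: alg_simps\<close>)
  let ?p = "q n i (Some (\<xi>, False))"
  have l: "Some (\<xi>, False) \<in> labs i" using i by (auto simp: labs_def)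
  have p: "?p \<in> carrier (Lv n i)" "?p \<otimes>\<^bsub>Lv n i\<^esub> ?p = ?p" by (rule R.p_closed[OF l], rule R.p_idem[OF l])
  have Yc: "Y \<in> carrier (Lv n i)" "Y \<otimes>\<^bsub>Lv n i\<^esub> Y = Y" "Y \<otimes>\<^bsub>Lv n i\<^esub> ?p = ?p \<otimes>\<^bsub>Lv n i\<^esub> Y" 
    using i(2) Y(2) com[OF q_lvl[OF n l]] by simp_all
  define c where "c = Y \<otimes>\<^bsub>Lv n i\<^esub> ?p"
  have c: "c \<in> carrier (Lv n i)" unfolding c_def by (rule R.m_closed[OF Yc(1) p(1)])
  have cp: "c \<otimes>\<^bsub>Lv n i\<^esub> ?p = c" "?p \<otimes>\<^bsub>Lv n i\<^esub> c = c" "c \<otimes>\<^bsub>Lv n i\<^esub> c = c"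
  proof -
    show 1: "c \<otimes>\<^bsub>Lv n i\<^esub> ?p = c" unfolding c_def R.m_assoc[OF Yc(1) p(1) p(1)] p(2) ..
    show 2: "?p \<otimes>\<^bsub>Lv n i\<^esub> c = c" unfolding c_def Yc(3) R.m_assoc[OF p(1) p(1) Yc(1), symmetric] p(2) ..
    have "c \<otimes>\<^bsub>Lv n i\<^esub> c = Y \<otimes>\<^bsub>Lv n i\<^esub> (?p \<otimes>\<^bsub>Lv n i\<^esub> c)"
      by (subst (1) c_def) (rule R.m_assoc[OF Yc(1) p(1) c])
    also have "\<dots> = Y \<otimes>\<^bsub>Lv n i\<^esub> Y \<otimes>\<^bsub>Lv n i\<^esub> ?p" unfolding 2 unfolding c_def by (rule R.m_assoc[OF Yc(1) Yc(1) p(1), symmetric])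
    also have "\<dots> = c" unfolding Yc(2) c_def ..
    finally show "c \<otimes>\<^bsub>Lv n i\<^esub> c = c" .
  qed
  \<comment> \<open>In the corner \<open>c\<close> and \<open>?p\<close> minus \<open>c\<close> are
    elements with product zero.\<close>
  have "c = \<zero>\<^bsub>Lv n i\<^esub> \<or> ?p \<ominus>\<^bsub>Lv n i\<^esub> c = \<zero>\<^bsub>Lv n i\<^esub>"
  proof (rule R.p_domain[OF l c _ cp(2,1)])
    show "?p \<ominus>\<^bsub>Lv n i\<^esub> c \<in> carrier (Lv n i)" by (rule R.minus_closed[OF p(1) c])
    show "?p \<otimes>\<^bsub>Lv n i\<^esub> (?p \<ominus>\<^bsub>Lv n i\<^esub> c) = ?p \<ominus>\<^bsub>Lv n i\<^esub> c"
      using p c cp by (simp only: R.minus_eq R.r_distr R.r_minus R.a_inv_closed)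
    show "(?p \<ominus>\<^bsub>Lv n i\<^esub> c) \<otimes>\<^bsub>Lv n i\<^esub> ?p = ?p \<ominus>\<^bsub>Lv n i\<^esub> c"
      using p c cp by (simp only: R.minus_eq R.l_distr R.l_minus R.a_inv_closed)
    have "c \<otimes>\<^bsub>Lv n i\<^esub> (?p \<ominus>\<^bsub>Lv n i\<^esub> c) = c \<ominus>\<^bsub>Lv n i\<^esub> c"
      using p c cp by (simp only: R.minus_eq R.r_distr R.r_minus R.a_inv_closed)
    also have "\<dots> = \<zero>\<^bsub>Lv n i\<^esub>" unfolding R.minus_eq by (rule R.r_neg[OF c])
    finally show "c \<otimes>\<^bsub>Lv n i\<^esub> (?p \<ominus>\<^bsub>Lv n i\<^esub> c) = \<zero>\<^bsub>Lv n i\<^esub>" .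
  qed
  then have "c = \<zero>\<^bsub>Lv n i\<^esub> \<or> c = ?p" using R.r_right_minus_eq[OF p(1) c] by metis
  then have alt: "Y \<otimes>\<^bsub>Lv n (Suc i)\<^esub> ?p = \<zero>\<^bsub>Lv n (Suc i)\<^esub> \<or> Y \<otimes>\<^bsub>Lv n (Suc i)\<^esub> ?p = ?p" unfolding c_def by simp
  note tp = has_type_q[OF n i(1), of False] and tZ = has_type_Z[OF n i'(1)]
  have Y': "Y \<in> carrier (Lv n (Suc i))" "\<And>b. b \<in> carrier (Lv n (Suc i)) \<Longrightarrow> Y \<otimes>\<^bsub>Lv n (Suc i)\<^esub> b = b \<otimes>\<^bsub>Lv n (Suc i)\<^esub> Y"
  proof -
    show "Y \<in> carrier (Lv n (Suc i))" using i'(2) by simp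
    show "Y \<otimes>\<^bsub>Lv n (Suc i)\<^esub> b = b \<otimes>\<^bsub>Lv n (Suc i)\<^esub> Y" if "b \<in> carrier (Lv n (Suc i))" for b
      using com[of b "Suc i"] that by simp
  qed
  \<comment> \<open>Every label in the type of \<open>Z \<xi>\<close> occurs in the type of
    \<open>?p\<close> at level \<open>i + 1\<close>, since \<open>reps i False\<close> is 1.\<close>
  have lab: "t \<in># add_mset (Some (\<xi>, False)) (repeat_mset (reps i False) (pair \<xi>))" if "t \<in># repeat_mset (n * csize (Suc i) \<xi>) (pair \<xi>)" for t
    using that by (auto simp: reps_def split: if_splits)
  show ?thesis
    using alt
  proof
    assume a: "Y \<otimes>\<^bsub>Lv n (Suc i)\<^esub> ?p = \<zero>\<^bsub>Lv n (Suc i)\<^esub>"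
    have "Y \<otimes>\<^bsub>Lv n (Suc i)\<^esub> Z \<xi> = \<zero>\<^bsub>Lv n (Suc i)\<^esub>"
      by (rule R'.central_has_type(2)[OF Y' tZ]) (use R'.central_summand(2)[OF Y' tp lab a] in blast)+
    then show ?thesis by simp
  next
    assume a: "Y \<otimes>\<^bsub>Lv n (Suc i)\<^esub> ?p = ?p"
    have "Y \<otimes>\<^bsub>Lv n (Suc i)\<^esub> Z \<xi> = Z \<xi>"
      by (rule R'.central_has_type(1)[OF Y' tZ]) (use R'.central_summand(1)[OF Y' tp lab a] in blast)+
    then show ?thesis by simp
  qed
qed

text \<open>The finitely many witnesses of a decomposition lie in a single level, and the levels
  increase.\<close>

lemma has_type_eventually:
  assumes n: "0 < n" and f: "has_type (alg n) I p f M"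
  shows "\<exists>i0. \<forall>i\<ge>i0. has_type (Lv n i) I p f M"
proof -
  obtain A where A: "finite A" "A \<subseteq> carrier (alg n)"
    "\<And>S'. subring_of (S' :: ('a, (rat \<times> nat) \<times> nat \<times> nat \<Rightarrow> 'a) module) (alg n) \<and> A \<subseteq> carrier S' \<Longrightarrow> has_type S' I p f M"
    using has_type_finite_support[OF f alg_ring[OF n]] by blast
  have "\<exists>i. A \<subseteq> lvl n i"
    using A(1,2)
  proof (induction rule: finite_induct)
    case (insert x A)
    then obtain i j where "A \<subseteq> lvl n i" "x \<in> lvl n j" unfolding alg_simps by blast
    then have "insert x A \<subseteq> lvl n (max i j)" using lvl_mono[OF n, of i "max i j"] lvl_mono[OF n, of j "max i j"] by auto
    then show ?case by blast
  qed simp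
  then obtain i0 where i0: "A \<subseteq> lvl n i0" by blast
  show ?thesis
  proof (intro exI allI impI)
    fix i assume "i0 \<le> i"
    then have "A \<subseteq> carrier (Lv n i)" using i0 lvl_mono[OF n, of i0 i] by auto
    then show "has_type (Lv n i) I p f M" using A(3) lvl_subring_of[OF n, of i] by blast
  qed
qed

lemma idem_has_type_eventually:
  assumes n: "0 < n" and f: "f \<in> carrier (alg n)" "f \<otimes>\<^bsub>KA\<^esub> f = f"
  shows "\<exists>i0. \<forall>i\<ge>i0. \<exists>M. has_type (Lv n i) (labs i) (q n i) f M"
proof -
  obtain i0 where i0: "f \<in> lvl n i0" using f(1) unfolding alg_simps by blast
  have "\<exists>M. has_type (Lv n i) (labs i) (q n i) f M" if "i0 \<le> i" for i
    by (rule matricial_frame.idem_has_type[OF frame[OF n]]) (use i0 lvl_mono[OF n that] f in auto)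
  then show ?thesis by blast
qed

text \<open>Both counts grow by the same amount, so their difference is preserved from level to
  level. This difference is the coefficient of \<theta> in the ordered group of the
  coordinate.\<close>

lemma has_type_step:
  assumes n: "0 < n" and \<xi>: "\<xi> \<in> S i" and f: "has_type (Lv n i) (labs i) (q n i) f M" and M: "set_mset M \<subseteq> set_mset (pair \<xi>)"
  shows "has_type (Lv n (Suc i)) (labs (Suc i)) (q n (Suc i)) f
    (M + repeat_mset (count M (Some (\<xi>, False)) + (fac i - 2) * count M (Some (\<xi>, True))) (pair \<xi>))"
proof -
  interpret R': ring "Lv n (Suc i)" by (rule Lv_ring[OF n])
  have sub: "subring_of (Lv n i) (Lv n (Suc i))"
    unfolding subring_of_def using Lv_ring[OF n] lvl_Suc[OF n, of i] by auto
  define N where "N l = add_mset l (repeat_mset (if l = Some (\<xi>, True) then fac i - 2 else 1) (pair \<xi>))" for l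
  have "has_type (Lv n (Suc i)) (set_mset M) (q n i) f M"
    by (rule has_type_restrict[OF has_type_subring[OF f sub]]) simp
  then have t: "has_type (Lv n (Suc i)) (labs (Suc i)) (q n (Suc i)) f (\<Sum>l\<in>#M. N l)"
  proof (rule R'.has_type_comp)
    fix l assume "l \<in># M"
    then obtain e where l: "l = Some (\<xi>, e)" using M by auto
    show "has_type (Lv n (Suc i)) (labs (Suc i)) (q n (Suc i)) (q n i l) (N l)"
      using has_type_q[OF n \<xi>, of e] unfolding l N_def reps_def by simp
  qed
  define r where "r = fac i - 2"
  have "(\<Sum>l\<in>#M. N l) = M + repeat_mset (count M (Some (\<xi>, False)) + r * count M (Some (\<xi>, True))) (pair \<xi>)"
    using M
  proof (induction M)
    case (add l M)
    then have "l = Some (\<xi>, False) \<or> l = Some (\<xi>, True)" by auto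
    then show ?case
    proof
      assume l: "l = Some (\<xi>, False)"
      show ?thesis by (rule multiset_eqI) (use add l in \<open>simp add: N_def\<close>)
    next
      assume l: "l = Some (\<xi>, True)"
      show ?thesis by (rule multiset_eqI) (use add l in \<open>simp add: N_def r_def[symmetric] algebra_simps\<close>)
    qed
  qed simp
  then show ?thesis using t unfolding r_def by (simp only:)
qed

end

text \<open>The quotients \<open>P i / size0 i\<close> converge to an irrational \<open>\<theta>\<close>, and \<open>b j / size0 j\<close> converges to
  \<open>\<delta> * \<theta> + q\<close> with \<open>q\<close> rational; the bounds say that the second limit is \<open>(g1 / g2) * \<theta>\<close>.\<close>
lemma quotient_recursion_unique:
  fixes P b :: "nat \<Rightarrow> int" and \<delta> g1 g2 :: int
  assumes g: "0 < g1" "0 < g2"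
    and P: "\<And>i. i0 \<le> i \<Longrightarrow> P (Suc i) = int (fac i) * P i + 1"
    and b: "\<And>j. j0 \<le> j \<Longrightarrow> b (Suc j) = int (fac j) * b j + \<delta>"
    and bounds: "\<And>i. i0 \<le> i \<Longrightarrow> \<exists>J. \<forall>j\<ge>J. g1 * P i * int (size0 j) \<le> g2 * int (size0 i) * b j \<and>
      g2 * int (size0 i) * b j \<le> g1 * (P i + 1) * int (size0 j)"
  shows "g2 * \<delta> = g1"
proof -
  define s where "s = max i0 j0"
  \<comment> \<open>\<open>P\<close> and \<open>b\<close> satisfy the same recursion up to the
    factor \<open>\<delta>\<close>, so \<open>b\<close> minus \<open>\<delta>\<close> times
    \<open>P\<close> solves the homogeneous one and is a multiple of
    \<open>facs s j\<close>.\<close>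
  define c where "c = b s - \<delta> * P s"
  \<comment> \<open>Up to a bounded error this is \<open>g2 * b j\<close> divided by
    \<open>facs i j\<close>, minus \<open>g1 * P i\<close>; the bounds in the hypothesis therefore
    keep it bounded. It also satisfies a recursion with the unbounded factor
    \<open>fac i\<close>.\<close>
  define X0 where "X0 i = (g2 * \<delta> - g1) * P i + g2 * c * int (facs s i)" for i
  define B where "B = g1 + g2 * \<bar>\<delta>\<bar>"
  have bj: "b j = \<delta> * P j + c * int (facs s j)" if "s \<le> j" for j
    using that
  proof (induction j rule: dec_induct)
    case base
    show ?case by (simp add: c_def facs_refl)
  next
    case (step j)
    then have "i0 \<le> j" "j0 \<le> j" unfolding s_def by auto
    then show ?case using step by (simp add: P b facs_Suc algebra_simps)
  qed
  have XS: "X0 (Suc i) = int (fac i) * X0 i + (g2 * \<delta> - g1)" if "s \<le> i" for i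
  proof -
    have "i0 \<le> i" using that unfolding s_def by auto
    then show ?thesis unfolding X0_def using that by (simp add: P facs_Suc algebra_simps)
  qed
  have XB: "\<bar>X0 i\<bar> \<le> B" if i: "s \<le> i" for i
  proof -
    have i0: "i0 \<le> i" using i unfolding s_def by auto
    obtain J where J: "\<And>j. J \<le> j \<Longrightarrow> g1 * P i * int (size0 j) \<le> g2 * int (size0 i) * b j \<and>
      g2 * int (size0 i) * b j \<le> g1 * (P i + 1) * int (size0 j)" using bounds[OF i0] by blast
    define j where "j = max i J"
    have ij: "i \<le> j" "J \<le> j" unfolding j_def by auto
    define f where "f = int (facs i j)"
    have f: "0 < f" unfolding f_def using facs_pos[of i j] by simp
    define K where "K = int (size0 i)"
    have K: "0 < K" unfolding K_def using facs_pos[of 0 i] by simp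
    have Kj: "int (size0 j) = K * f" unfolding K_def f_def using facs_trans[of 0 i j] ij by simp
    \<comment> \<open>The intervals from \<open>P i / size0 i\<close> to
      \<open>(P i + 1) / size0 i\<close> are nested, so \<open>P j\<close> is known up to an error
      of \<open>facs i j\<close>.\<close>
    have "P i * int (facs i j') \<le> P j' \<and> P j' + 1 \<le> (P i + 1) * int (facs i j')" if "i \<le> j'" for j'
      using that
    proof (induction j' rule: dec_induct)
      case base
      show ?case by (simp add: facs_refl)
    next
      case (step j')
      have k: "2 \<le> int (fac j')" using fac_gt(2)[of j'] by simp
      have e: "P (Suc j') = int (fac j') * P j' + 1" using P step.hyps i0 by simp
      have "P i * int (facs i j') * int (fac j') \<le> P j' * int (fac j')" using step.IH k by (intro mult_right_mono) auto
      moreover have "(P j' + 1) * int (fac j') \<le> (P i + 1) * int (facs i j') * int (fac j')" using step.IH k by (intro mult_right_mono) auto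
      ultimately have "P i * (int (facs i j') * int (fac j')) \<le> int (fac j') * P j'"
        "int (fac j') * P j' + int (fac j') \<le> (P i + 1) * (int (facs i j') * int (fac j'))"
        by (simp_all only: mult.assoc distrib_right mult_1 mult.commute[of "P j'"])
      then show ?case unfolding e facs_Suc[OF step.hyps(1)] of_nat_mult using k by linarith
    qed
    from this[OF ij(1)] obtain r where r: "P j = P i * f + r" "0 \<le> r" "r \<le> f"
      unfolding f_def[symmetric] by (metis add.commute diff_add_cancel diff_ge_0_iff_ge add_le_cancel_left distrib_right mult_1 zle_add1_eq_le less_add_one order_trans order_less_imp_le)
    have bj': "b j = \<delta> * (P i * f + r) + c * (int (facs s i) * f)"
      using bj[of j] facs_trans[of s i j] i ij r(1) unfolding f_def by simp
    have "g1 * P i * (K * f) \<le> g2 * K * b j" "g2 * K * b j \<le> g1 * (P i + 1) * (K * f)" using J[OF ij(2)] unfolding Kj K_def[symmetric] by auto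
    then have "K * (g1 * P i * f) \<le> K * (g2 * b j)" "K * (g2 * b j) \<le> K * (g1 * (P i + 1) * f)" by (simp_all add: algebra_simps)
    then have 1: "g1 * P i * f \<le> g2 * b j" "g2 * b j \<le> g1 * (P i + 1) * f" using K by simp_all
    have e: "g2 * b j - g1 * P i * f = X0 i * f + g2 * \<delta> * r" unfolding bj' X0_def by (simp add: algebra_simps)
    have dr: "\<bar>\<delta> * r\<bar> \<le> \<bar>\<delta>\<bar> * f" unfolding abs_mult using r by (intro mult_left_mono) auto
    have "\<bar>g2 * \<delta> * r\<bar> \<le> g2 * \<bar>\<delta>\<bar> * f"
      using mult_left_mono[OF dr, of g2] g by (simp add: abs_mult mult.assoc)
    then have "- (g2 * \<bar>\<delta>\<bar> * f) \<le> X0 i * f" "X0 i * f \<le> g1 * f + g2 * \<bar>\<delta>\<bar> * f"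
      using 1 e by (simp_all add: algebra_simps)
    then have "- (g2 * \<bar>\<delta>\<bar>) * f \<le> X0 i * f" "X0 i * f \<le> B * f" unfolding B_def by (simp_all add: algebra_simps)
    then have "- (g2 * \<bar>\<delta>\<bar>) \<le> X0 i" "X0 i \<le> B" using f by (simp_all only: mult_le_cancel_right_pos)
    then show ?thesis unfolding B_def using g by linarith
  qed
  have dB: "\<bar>g2 * \<delta> - g1\<bar> \<le> B"
  proof -
    have "\<bar>g2 * \<delta> - g1\<bar> \<le> \<bar>g2 * \<delta>\<bar> + \<bar>g1\<bar>" by (rule abs_triangle_ineq4)
    then show ?thesis unfolding B_def using g by (simp add: abs_mult)
  qed
  \<comment> \<open>A nonzero integer would be multiplied by \<open>fac i\<close>, which exceeds
    \<open>2 * B\<close>, and the next term would violate the bound. This is the irrationality of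
    \<theta> in integer form.\<close>
  have X0: "X0 i = 0" if i: "s \<le> i" "nat (2 * B) \<le> i" for i
  proof (rule ccontr)
    assume "X0 i \<noteq> 0"
    have "2 * B < int (fac i)" using i(2) fac_gt(1)[of i] by linarith
    moreover have "int (fac i) * 1 \<le> int (fac i) * \<bar>X0 i\<bar>" using \<open>X0 i \<noteq> 0\<close> by (intro mult_left_mono) auto
    moreover have "int (fac i) * \<bar>X0 i\<bar> = \<bar>X0 (Suc i) - (g2 * \<delta> - g1)\<bar>" using XS[OF i(1)] by (simp add: abs_mult)
    moreover have "\<bar>X0 (Suc i) - (g2 * \<delta> - g1)\<bar> \<le> \<bar>X0 (Suc i)\<bar> + \<bar>g2 * \<delta> - g1\<bar>" by (rule abs_triangle_ineq4)
    moreover have "\<bar>X0 (Suc i)\<bar> \<le> B" using XB[of "Suc i"] i(1) by simp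
    ultimately show False using dB by linarith
  qed
  define i where "i = max s (nat (2 * B))"
  have "s \<le> i" "nat (2 * B) \<le> i" unfolding i_def by auto
  then have "X0 i = 0" "X0 (Suc i) = 0" using X0[of i] X0[of "Suc i"] by auto
  then show ?thesis using XS[of i] \<open>s \<le> i\<close> by simp
qed

section \<open>Recovering the order units from the algebra\<close>

context tower begin

text \<open>A minimal idempotent \<open>p\<close> at \<open>\<xi>\<close> has normalised counts
  converging to \<theta> up to a rational factor. Its image has counts governed by a constant
  difference \<open>\<delta>\<close>, and the image of the order unit fixes the scale between the
  two coordinates. By \<open>quotient_recursion_unique\<close> the ratio of the order units is
  \<open>\<delta>\<close>, an integer.\<close>

lemma ratio:
  assumes n: "0 < n" and m: "0 < m" and \<xi>: "\<xi> \<in> C" and \<xi>': "\<xi>' \<in> C"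
    and cl: "\<And>x. x \<in> carrier (alg n) \<Longrightarrow> \<phi> x \<in> carrier (alg m)"
    and mult: "\<And>x y. x \<in> carrier (alg n) \<Longrightarrow> y \<in> carrier (alg n) \<Longrightarrow> \<phi> (x \<otimes>\<^bsub>KA\<^esub> y) = \<phi> x \<otimes>\<^bsub>KA\<^esub> \<phi> y"
    and add: "\<And>x y. x \<in> carrier (alg n) \<Longrightarrow> y \<in> carrier (alg n) \<Longrightarrow> \<phi> (x \<oplus>\<^bsub>KA\<^esub> y) = \<phi> x \<oplus>\<^bsub>KA\<^esub> \<phi> y"
    and zero: "\<phi> \<zero>\<^bsub>KA\<^esub> = \<zero>\<^bsub>KA\<^esub>" and Z: "\<phi> (Z \<xi>) = Z \<xi>'"
  shows "\<exists>c::nat. of_nat m * fst \<xi>' = (of_nat c * (of_nat n * fst \<xi>) :: rat)"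
proof -
  interpret An: ring "alg n" by (rule alg_ring[OF n])
  obtain i0 where "\<xi> \<in> S i0" using in_S[OF \<xi>] by meson
  then have Si: "\<xi> \<in> S i" if "i0 \<le> i" for i using S_mono[OF that] by (rule subsetD[rotated])
  \<comment> \<open>The explicit solution of \<open>P (Suc i) = fac i * P i + 1\<close> with value 0
    at \<open>i0\<close>. At level \<open>i\<close> the type of \<open>p\<close> is one label
    \<open>False\<close> plus \<open>P i\<close> copies of \<open>pair \<xi>\<close>.\<close>
  define P where "P i = (\<Sum>l\<in>{i0..<i}. facs (Suc l) i)" for i
  have P0: "P i0 = 0" by (simp add: P_def)
  have PS: "P (Suc i) = fac i * P i + 1" if "i0 \<le> i" for i
  proof -
    have "P (Suc i) = (\<Sum>l\<in>{i0..<i}. facs (Suc l) (Suc i)) + 1" using that by (simp add: P_def facs_refl)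
    also have "(\<Sum>l\<in>{i0..<i}. facs (Suc l) (Suc i)) = fac i * P i"
      unfolding P_def sum_distrib_left by (rule sum.cong) (auto simp: facs_Suc)
    finally show "P (Suc i) = fac i * P i + 1" .
  qed
  define E where "E i e = q n i (Some (\<xi>, e))" for i e
  define p where "p = E i0 False"
  have labs: "Some (\<xi>, e) \<in> labs i" if "i0 \<le> i" for i e using Si[OF that] by (auto simp: labs_def)
  have Elvl: "E i e \<in> lvl n i" if "i0 \<le> i" for i e unfolding E_def by (rule q_lvl[OF n labs[OF that]])
  have Eidem: "E i e \<otimes>\<^bsub>KA\<^esub> E i e = E i e" if "i0 \<le> i" for i e
    using matricial_frame.p_idem[OF frame[OF n] labs[OF that]] unfolding E_def by simp
  have Ecar: "E i e \<in> carrier (alg n)" if "i0 \<le> i" for i e using Elvl[OF that] unfolding alg_simps by blast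
  have ZE: "Z \<xi> \<otimes>\<^bsub>KA\<^esub> E i e = E i e" if "i0 \<le> i" for i e unfolding E_def by (rule Z_q(1)[OF n Si[OF that]])
  have tp: "has_type (Lv n i) (labs i) (q n i) p (add_mset (Some (\<xi>, False)) (repeat_mset (P i) (pair \<xi>)))" if "i0 \<le> i" for i
    using that
  proof (induction i rule: dec_induct)
    case base
    show ?case unfolding P0 p_def E_def
      using ring.has_type_single[OF Lv_ring[OF n] labs[of i0 False] ring.idem_eqv_refl[OF Lv_ring[OF n]], of _ i0]
        Elvl[of i0 False] Eidem[of i0 False] unfolding E_def by simp
  next
    case (step i)
    have 2: "2 \<le> fac i" using fac_gt(2)[of i] by simp
    let ?N = "add_mset (Some (\<xi>, False)) (repeat_mset (P i) (pair \<xi>))"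
    have e: "P i + (1 + P i + (fac i - 2) * P i) = P (Suc i)"
      unfolding PS[OF step.hyps(1)] using 2 by (metis add.assoc add.commute add_mult_distrib le_add_diff_inverse mult_2)
    have "has_type (Lv n (Suc i)) (labs (Suc i)) (q n (Suc i)) p
      (?N + repeat_mset (count ?N (Some (\<xi>, False)) + (fac i - 2) * count ?N (Some (\<xi>, True))) (pair \<xi>))"
      by (rule has_type_step[OF n Si[OF step.hyps(1)] step.IH]) (auto split: if_splits)
    moreover have "?N + repeat_mset (count ?N (Some (\<xi>, False)) + (fac i - 2) * count ?N (Some (\<xi>, True))) (pair \<xi>)
      = add_mset (Some (\<xi>, False)) (repeat_mset (P (Suc i)) (pair \<xi>))"
      unfolding e[symmetric] by (rule multiset_eqI) simp
    ultimately show ?case by (simp only:)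
  qed
  \<comment> \<open>Decompositions inside \<open>alg n\<close> are carried over by
    \<open>\<phi>\<close>; their images are then read off at late levels of
    \<open>alg m\<close>.\<close>
  have img: "has_type (alg m) (labs i) (\<lambda>l. \<phi> (q n i l)) (\<phi> f) M" if "has_type (Lv n i) (labs i) (q n i) f M" for i f M
    by (rule has_type_hom[OF has_type_subring[OF that lvl_subring_of[OF n]] An.ring_axioms])
      (use cl mult add zero in \<open>simp_all add: alg_simps\<close>)
  have \<phi>Z: "Z \<xi>' \<otimes>\<^bsub>KA\<^esub> \<phi> (E i e) = \<phi> (E i e)" if "i0 \<le> i" for i e
    unfolding Z[symmetric] using mult[OF Z_closed[OF \<xi> n] Ecar[OF that]] ZE[OF that] by simp
  have \<phi>c: "\<phi> (E i e) \<in> carrier (alg m)" "\<phi> (E i e) \<otimes>\<^bsub>KA\<^esub> \<phi> (E i e) = \<phi> (E i e)" if "i0 \<le> i" for i e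
    by (rule cl[OF Ecar[OF that]], rule mult[OF Ecar[OF that] Ecar[OF that], of e e, unfolded Eidem[OF that], symmetric])
  obtain j1 where "\<xi>' \<in> S j1" using in_S[OF \<xi>'] by meson
  then have Sj: "\<xi>' \<in> S j" if "j1 \<le> j" for j using S_mono[OF that] by (rule subsetD[rotated])
  obtain j2 where j2: "\<And>j. j2 \<le> j \<Longrightarrow> \<exists>M. has_type (Lv m j) (labs j) (q m j) (\<phi> p) M"
    using idem_has_type_eventually[OF m \<phi>c, of i0 False] unfolding p_def by blast
  then obtain M where M: "\<And>j. j2 \<le> j \<Longrightarrow> has_type (Lv m j) (labs j) (q m j) (\<phi> p) (M j)" by metis
  define b where "b e j = count (M j) (Some (\<xi>', e))" for e j
  define j3 where "j3 = max j1 j2"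
  have M_uniq: "M j = N" if "j2 \<le> j" "has_type (Lv m j) (labs j) (q m j) (\<phi> p) N" for j N
    by (rule matricial_frame.has_type_unique[OF frame[OF m] M[OF that(1)] that(2)])
  have Msub: "set_mset (M j) \<subseteq> set_mset (pair \<xi>')" if "j3 \<le> j" for j
  proof -
    have "j1 \<le> j" "j2 \<le> j" using that unfolding j3_def by auto
    then show ?thesis using type_under_Z[OF m Sj M] \<phi>Z[of i0 False] unfolding p_def by simp
  qed
  have bS: "b e (Suc j) = b e j + (b False j + (fac j - 2) * b True j)" if j: "j3 \<le> j" for e j
  proof -
    have jj: "j1 \<le> j" "j2 \<le> j" using j unfolding j3_def by auto
    have "M (Suc j) = M j + repeat_mset (count (M j) (Some (\<xi>', False)) + (fac j - 2) * count (M j) (Some (\<xi>', True))) (pair \<xi>')"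
      by (rule M_uniq) (use jj has_type_step[OF m Sj[OF jj(1)] M[OF jj(2)] Msub[OF j]] in simp_all)
    then show ?thesis by (cases e) (simp_all add: b_def)
  qed
  \<comment> \<open>The difference of the two counts of \<open>\<phi> p\<close>, constant by
    \<open>has_type_step\<close>. With it the recursion for the count at \<open>True\<close> becomes
    that of \<open>P\<close> with \<open>\<delta>\<close> in place of 1.\<close>
  define \<delta> where "\<delta> = int (b False j3) - int (b True j3)"
  have \<delta>: "int (b False j) = int (b True j) + \<delta>" if "j3 \<le> j" for j
    using that
  proof (induction j rule: dec_induct)
    case (step j)
    then show ?case using bS[OF step.hyps(1), of False] bS[OF step.hyps(1), of True] by simp
  qed (simp add: \<delta>_def)
  have bT: "int (b True (Suc j)) = int (fac j) * int (b True j) + \<delta>" if j: "j3 \<le> j" for j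
  proof -
    obtain r where r: "fac j = r + 2" using fac_gt(2)[of j] by (metis add.commute le_add_diff_inverse numeral_2_eq_2 Suc_le_lessD Suc_leD numeral_3_eq_3)
    show ?thesis using bS[OF j, of True] \<delta>[OF j] unfolding r by (simp add: algebra_simps)
  qed
  have bounds: "\<exists>J. \<forall>j\<ge>J. P i * (m * csize j \<xi>') \<le> n * csize i \<xi> * b True j \<and> n * csize i \<xi> * b True j \<le> (P i + 1) * (m * csize j \<xi>')"
    if i: "i0 \<le> i" for i
  proof -
    obtain J1 where J1: "\<And>j. J1 \<le> j \<Longrightarrow> \<exists>N. has_type (Lv m j) (labs j) (q m j) (\<phi> (E i False)) N"
      using idem_has_type_eventually[OF m \<phi>c[OF i]] by blast
    obtain J2 where J2: "\<And>j. J2 \<le> j \<Longrightarrow> \<exists>N. has_type (Lv m j) (labs j) (q m j) (\<phi> (E i True)) N"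
      using idem_has_type_eventually[OF m \<phi>c[OF i]] by blast
    obtain J3 where J3: "\<And>j. J3 \<le> j \<Longrightarrow> has_type (Lv m j) (labs i) (\<lambda>l. \<phi> (q n i l)) (\<phi> p) (add_mset (Some (\<xi>, False)) (repeat_mset (P i) (pair \<xi>)))"
      using has_type_eventually[OF m img[OF tp[OF i]]] by blast
    obtain J4 where J4: "\<And>j. J4 \<le> j \<Longrightarrow> has_type (Lv m j) (labs i) (\<lambda>l. \<phi> (q n i l)) (Z \<xi>') (repeat_mset (n * csize i \<xi>) (pair \<xi>))"
      using has_type_eventually[OF m img[OF has_type_Z[OF n Si[OF i]]]] unfolding Z by blast
    show ?thesis
    proof (intro exI[of _ "j3 + J1 + J2 + J3 + J4"] allI impI)
      fix j assume "j3 + J1 + J2 + J3 + J4 \<le> j"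
      then have j: "j1 \<le> j" "j2 \<le> j" "J1 \<le> j" "J2 \<le> j" "J3 \<le> j" "J4 \<le> j" unfolding j3_def by auto
      obtain N0 N1 where N: "has_type (Lv m j) (labs j) (q m j) (\<phi> (E i False)) N0" "has_type (Lv m j) (labs j) (q m j) (\<phi> (E i True)) N1"
        using J1[OF j(3)] J2[OF j(4)] by blast
      \<comment> \<open>\<open>N0\<close> and \<open>N1\<close> are the types of the images of the
        two minimal idempotents of level \<open>i\<close>; substituting them gives the types of all
        images of idempotents under \<open>Z \<xi>\<close>.\<close>
      define N where "N l = (if l = Some (\<xi>, True) then N1 else N0)" for l
      have comp: "has_type (Lv m j) (labs j) (q m j) f (\<Sum>l\<in>#A. N l)"
        if A: "has_type (Lv m j) (labs i) (\<lambda>l. \<phi> (q n i l)) f A" "set_mset A \<subseteq> set_mset (pair \<xi>)" for f A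
      proof (rule ring.has_type_comp[OF Lv_ring[OF m] has_type_restrict[OF A]])
        fix l assume "l \<in> set_mset (pair \<xi>)"
        then show "has_type (Lv m j) (labs j) (q m j) (\<phi> (q n i l)) (N l)" using N by (auto simp: N_def E_def)
      qed
      have N_False: "N (Some (\<xi>, False)) = N0" by (simp add: N_def)
      have rep: "(\<Sum>l\<in>#repeat_mset k (pair \<xi>). N l) = repeat_mset k (N0 + N1)" for k
        by (induction k) (simp_all add: N_def)
      have "has_type (Lv m j) (labs j) (q m j) (Z \<xi>') (repeat_mset (n * csize i \<xi>) (N0 + N1))"
        unfolding rep[symmetric] by (rule comp[OF J4[OF j(6)]]) (auto split: if_splits)
      then have "repeat_mset (n * csize i \<xi>) (N0 + N1) = repeat_mset (m * csize j \<xi>') (pair \<xi>')"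
        using matricial_frame.has_type_unique[OF frame[OF m] _ has_type_Z[OF m Sj[OF j(1)]]] by simp
      then have "count (repeat_mset (n * csize i \<xi>) (N0 + N1)) (Some (\<xi>', True)) = count (repeat_mset (m * csize j \<xi>') (pair \<xi>')) (Some (\<xi>', True))" by (simp only:)
      then have \<mu>: "n * csize i \<xi> * (count N0 (Some (\<xi>', True)) + count N1 (Some (\<xi>', True))) = m * csize j \<xi>'" by (simp add: distrib_left)
      have "has_type (Lv m j) (labs j) (q m j) (\<phi> p) (\<Sum>l\<in>#add_mset (Some (\<xi>, False)) (repeat_mset (P i) (pair \<xi>)). N l)"
        by (rule comp[OF J3[OF j(5)]]) (auto split: if_splits)
      \<comment> \<open>\<open>N0\<close> is at most \<open>N0 + N1\<close>, and
        \<open>n * csize i \<xi>\<close> copies of \<open>N0 + N1\<close> give the order unit at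
        \<open>\<xi>'\<close>. Hence the count of \<open>\<phi> p\<close> lies between
        \<open>P i\<close> and \<open>P i + 1\<close> copies of \<open>N0 + N1\<close>.\<close>
      then have "M j = N0 + repeat_mset (P i) (N0 + N1)"
        by (intro M_uniq[OF j(2)]) (simp only: image_mset_add_mset sum_mset.add_mset rep N_False)
      then have bj: "b True j = count N0 (Some (\<xi>', True)) + P i * (count N0 (Some (\<xi>', True)) + count N1 (Some (\<xi>', True)))"
        by (simp add: b_def distrib_left)
      have "n * csize i \<xi> * b True j = n * csize i \<xi> * count N0 (Some (\<xi>', True)) + P i * (m * csize j \<xi>')"
        unfolding bj \<mu>[symmetric] by (simp add: algebra_simps)
      moreover have "n * csize i \<xi> * count N0 (Some (\<xi>', True)) \<le> m * csize j \<xi>'" unfolding \<mu>[symmetric] by (intro mult_le_mono) auto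
      ultimately show "P i * (m * csize j \<xi>') \<le> n * csize i \<xi> * b True j \<and> n * csize i \<xi> * b True j \<le> (P i + 1) * (m * csize j \<xi>')"
        by (simp add: algebra_simps)
    qed
  qed
  have pos: "0 < fst \<xi>" "0 < fst \<xi>'" using C_pos \<xi> \<xi>' by auto
  obtain u v where uv: "quotient_of (fst \<xi>) = (u, v)" by (cases "quotient_of (fst \<xi>)")
  obtain u' v' where uv': "quotient_of (fst \<xi>') = (u', v')" by (cases "quotient_of (fst \<xi>')")
  have v: "0 < v" "0 < v'" using quotient_of_denom_pos[OF uv] quotient_of_denom_pos[OF uv'] by auto
  have h: "fst \<xi> = of_int u / of_int v" "fst \<xi>' = of_int u' / of_int v'" using quotient_of_div[OF uv] quotient_of_div[OF uv'] by auto
  have u: "0 < u" "0 < u'" using pos v unfolding h by (simp_all add: zero_less_divide_iff)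
  \<comment> \<open>Numerators of the two order units over a common denominator: \<open>g1\<close>
    to \<open>g2\<close> is as \<open>m\<close> times the first component of \<open>\<xi>'\<close>
    to \<open>n\<close> times that of \<open>\<xi>\<close>.\<close>
  define g1 where "g1 = int m * u' * v"
  define g2 where "g2 = int n * u * v'"
  have g12: "0 < g1" "0 < g2" unfolding g1_def g2_def using n m u v by simp_all
  have PS': "int (P (Suc i)) = int (fac i) * int (P i) + 1" if "i0 \<le> i" for i using PS[OF that] by simp
  have gbounds: "\<exists>J. \<forall>j\<ge>J. g1 * int (P i) * int (size0 j) \<le> g2 * int (size0 i) * int (b True j) \<and>
      g2 * int (size0 i) * int (b True j) \<le> g1 * (int (P i) + 1) * int (size0 j)" if i: "i0 \<le> i" for i
  proof -
    obtain J where J: "\<And>j. J \<le> j \<Longrightarrow> P i * (m * csize j \<xi>') \<le> n * csize i \<xi> * b True j \<and> n * csize i \<xi> * b True j \<le> (P i + 1) * (m * csize j \<xi>')"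
      using bounds[OF i] by blast
    show "\<exists>J. \<forall>j\<ge>J. g1 * int (P i) * int (size0 j) \<le> g2 * int (size0 i) * int (b True j) \<and>
      g2 * int (size0 i) * int (b True j) \<le> g1 * (int (P i) + 1) * int (size0 j)"
    proof (intro exI[of _ "max J j1"] allI impI)
      fix j assume "max J j1 \<le> j"
      then have j: "J \<le> j" "j1 \<le> j" by auto
      have "(of_int (int (csize i \<xi>) * v) :: rat) = of_int (u * int (size0 i))"
        using csize_eq[OF Si[OF i]] v unfolding h by (simp add: field_simps)
      then have c1: "int (csize i \<xi>) * v = u * int (size0 i)" by (simp only: of_int_eq_iff)
      have "(of_int (int (csize j \<xi>') * v') :: rat) = of_int (u' * int (size0 j))"
        using csize_eq[OF Sj[OF j(2)]] v unfolding h by (simp add: field_simps)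
      then have c2: "int (csize j \<xi>') * v' = u' * int (size0 j)" by (simp only: of_int_eq_iff)
      have vv: "0 < v * v'" using v by simp
      have e1: "g1 * A * int (size0 j) = A * (int m * int (csize j \<xi>')) * (v * v')" for A
      proof -
        have "g1 * A * int (size0 j) = A * int m * v * (u' * int (size0 j))" unfolding g1_def by (simp add: algebra_simps)
        then show ?thesis unfolding c2[symmetric] by (simp add: algebra_simps)
      qed
      have e2: "g2 * int (size0 i) * A = int n * int (csize i \<xi>) * A * (v * v')" for A
      proof -
        have "g2 * int (size0 i) * A = int n * A * v' * (u * int (size0 i))" unfolding g2_def by (simp add: algebra_simps)
        then show ?thesis unfolding c1[symmetric] by (simp add: algebra_simps)
      qed
      have "int (P i * (m * csize j \<xi>')) \<le> int (n * csize i \<xi> * b True j)" "int (n * csize i \<xi> * b True j) \<le> int ((P i + 1) * (m * csize j \<xi>'))"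
        using J[OF j(1)] by (simp_all only: of_nat_le_iff)
      then show "g1 * int (P i) * int (size0 j) \<le> g2 * int (size0 i) * int (b True j) \<and>
        g2 * int (size0 i) * int (b True j) \<le> g1 * (int (P i) + 1) * int (size0 j)"
        unfolding e1 e2 mult_le_cancel_right_pos[OF vv] by (simp add: algebra_simps)
    qed
  qed
  have "g2 * \<delta> = g1"
    by (rule quotient_recursion_unique[where P = "\<lambda>i. int (P i)" and b = "\<lambda>j. int (b True j)", OF g12 PS' bT gbounds])
  then have \<delta>pos: "0 < \<delta>" using g12 by (metis zero_less_mult_pos)
  have "(of_int (g2 * \<delta>) :: rat) = of_int g1" using \<open>g2 * \<delta> = g1\<close> by simp
  then have "of_nat m * fst \<xi>' = (of_int \<delta> * (of_nat n * fst \<xi>) :: rat)"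
    using v unfolding g1_def g2_def h by (simp add: field_simps)
  then show ?thesis using \<delta>pos by (intro exI[of _ "nat \<delta>"]) simp
qed

text \<open>An isomorphism sends coordinate units to central idempotents, which the dichotomy
  compares with the coordinates of the target. This pairs some \<open>\<xi>\<close> with some
  \<open>\<xi>'\<close>. Applying \<open>ratio\<close> in both directions gives two natural numbers
  that are inverse to each other, so the order units agree.\<close>

lemma alg_iso_ratio:
  assumes n: "0 < n" and m: "0 < m" and iso: "alg n \<simeq> alg m"
  shows "of_nat n / of_nat m \<in> H"
proof -
  interpret An: ring "alg n" by (rule alg_ring[OF n])
  interpret Am: ring "alg m" by (rule alg_ring[OF m])
  obtain f where f: "f \<in> ring_iso (alg n) (alg m)" using iso unfolding is_ring_iso_def by blast
  define g where "g = inv_into (carrier (alg n)) f"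
  have g: "g \<in> ring_iso (alg m) (alg n)" unfolding g_def by (rule ring_iso_set_sym[OF An.ring_axioms f])
  have bij: "bij_betw f (carrier (alg n)) (carrier (alg m))" using f by (simp add: ring_iso_def)
  have gf: "g (f x) = x" if "x \<in> carrier (alg n)" for x
    unfolding g_def using bij that by (simp add: bij_betw_inv_into_left)
  have cl: "f x \<in> carrier (alg m)" if "x \<in> carrier (alg n)" for x using ring_iso_memE(1)[OF f that] .
  have clg: "g x \<in> carrier (alg n)" if "x \<in> carrier (alg m)" for x using ring_iso_memE(1)[OF g that] .
  note Zc = Z_closed
  obtain \<xi> where \<xi>: "\<xi> \<in> C" using infinite_C by (metis ex_in_conv finite.emptyI)
  define Y where "Y = f (Z \<xi>)"
  have Zne: "Z \<xi> \<noteq> \<zero>\<^bsub>KA\<^esub>" if "\<xi> \<in> C" for \<xi>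
  proof
    assume "Z \<xi> = \<zero>\<^bsub>KA\<^esub>"
    then have "Z \<xi> (\<xi>, 0, 0) = \<zero>\<^bsub>KA\<^esub> (\<xi>, 0, 0)" by simp
    then show False using that by (simp add: Z_apply kernel_simps)
  qed
  have Zidem: "Z \<xi> \<otimes>\<^bsub>KA\<^esub> Z \<xi> = Z \<xi>" if "\<xi> \<in> C" for \<xi>
    by (rule kernel_eqI) (auto simp: Z_mult[OF that alg_carrier[OF Zc[OF that n]]] Z_apply)
  have Zcom: "Z \<xi> \<otimes>\<^bsub>KA\<^esub> k = k \<otimes>\<^bsub>KA\<^esub> Z \<xi>" if "\<xi> \<in> C" "k \<in> carrier (alg j)" for \<xi> k j
    by (rule Z_central[OF that(1) alg_carrier[OF that(2)]])
  \<comment> \<open>Stated for an arbitrary isomorphism between two of the algebras, since it serves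
    \<open>f\<close> and its inverse \<open>g\<close>.\<close>
  have dich: "\<phi> (Z \<xi>) \<otimes>\<^bsub>KA\<^esub> Z \<xi>' = Z \<xi>' \<or> \<phi> (Z \<xi>) \<otimes>\<^bsub>KA\<^esub> Z \<xi>' = \<zero>\<^bsub>KA\<^esub>"
    if \<phi>: "\<phi> \<in> ring_iso (alg i) (alg j)" and ij: "0 < i" "0 < j" and \<xi>: "\<xi> \<in> C" "\<xi>' \<in> C" for \<phi> i j \<xi> \<xi>'
  proof (rule central_idem_dichotomy[OF ij(2) ring_iso_memE(1)[OF \<phi> Zc[OF \<xi>(1) ij(1)]] _ _ \<xi>(2)])
    show "\<phi> (Z \<xi>) \<otimes>\<^bsub>KA\<^esub> \<phi> (Z \<xi>) = \<phi> (Z \<xi>)"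
      using ring_iso_memE(2)[OF \<phi> Zc[OF \<xi>(1) ij(1)] Zc[OF \<xi>(1) ij(1)]] unfolding alg_simps Zidem[OF \<xi>(1)] by (rule sym)
    fix k assume "k \<in> carrier (alg j)"
    then obtain x where x: "x \<in> carrier (alg i)" "k = \<phi> x"
      using ring_iso_memE(5)[OF \<phi>] by (auto simp: bij_betw_def)
    show "\<phi> (Z \<xi>) \<otimes>\<^bsub>KA\<^esub> k = k \<otimes>\<^bsub>KA\<^esub> \<phi> (Z \<xi>)"
      using ring_iso_memE(2)[OF \<phi> Zc[OF \<xi>(1) ij(1)] x(1)] ring_iso_memE(2)[OF \<phi> x(1) Zc[OF \<xi>(1) ij(1)]]
      unfolding alg_simps x(2) Zcom[OF \<xi>(1) x(1)] by (rule trans[OF sym])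
  qed
  have main: "\<exists>c::nat. of_nat j * fst \<xi>' = (of_nat c * (of_nat i * fst \<xi>) :: rat)"
    if \<phi>: "\<phi> \<in> ring_iso (alg i) (alg j)" and ij: "0 < i" "0 < j" and \<xi>: "\<xi> \<in> C" "\<xi>' \<in> C"
      and Z: "\<phi> (Z \<xi>) \<otimes>\<^bsub>KA\<^esub> Z \<xi>' = Z \<xi>'" for \<phi> i j \<xi> \<xi>'
  \<comment> \<open>Multiplication by \<open>Z \<xi>'\<close> projects \<open>\<phi>\<close> to one
    coordinate of the target; as \<open>Z \<xi>'\<close> is a central idempotent, the result is
    still multiplicative.\<close>
  proof (rule ratio[OF ij \<xi>, where \<phi> = "\<lambda>x. \<phi> x \<otimes>\<^bsub>KA\<^esub> Z \<xi>'"])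
    interpret Ai: ring "alg i" by (rule alg_ring[OF ij(1)])
    interpret Aj: ring "alg j" by (rule alg_ring[OF ij(2)])
    have c: "\<phi> x \<in> carrier (alg j)" if "x \<in> carrier (alg i)" for x using ring_iso_memE(1)[OF \<phi> that] .
    have Zj: "Z \<xi>' \<in> carrier (alg j)" by (rule Zc[OF \<xi>(2) ij(2)])
    show "\<phi> x \<otimes>\<^bsub>KA\<^esub> Z \<xi>' \<in> carrier (alg j)" if "x \<in> carrier (alg i)" for x
      using Aj.m_closed[OF c[OF that] Zj] unfolding alg_simps .
    show "\<phi> (Z \<xi>) \<otimes>\<^bsub>KA\<^esub> Z \<xi>' = Z \<xi>'" by (rule Z)
    show "\<phi> (x \<oplus>\<^bsub>KA\<^esub> y) \<otimes>\<^bsub>KA\<^esub> Z \<xi>' = \<phi> x \<otimes>\<^bsub>KA\<^esub> Z \<xi>' \<oplus>\<^bsub>KA\<^esub> \<phi> y \<otimes>\<^bsub>KA\<^esub> Z \<xi>'"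
      if "x \<in> carrier (alg i)" "y \<in> carrier (alg i)" for x y
      using ring_iso_memE(3)[OF \<phi> that] Aj.l_distr[OF c[OF that(1)] c[OF that(2)] Zj] unfolding alg_simps by simp
    show "\<phi> \<zero>\<^bsub>KA\<^esub> \<otimes>\<^bsub>KA\<^esub> Z \<xi>' = \<zero>\<^bsub>KA\<^esub>"
    proof -
      have "\<phi> \<zero>\<^bsub>alg i\<^esub> = \<zero>\<^bsub>alg j\<^esub>"
        by (rule ring_hom_zero[OF _ Ai.ring_axioms Aj.ring_axioms]) (use \<phi> in \<open>simp add: ring_iso_def\<close>)
      then show ?thesis using Aj.l_null[OF Zj] unfolding alg_simps by simp
    qed
    fix x y assume xy: "x \<in> carrier (alg i)" "y \<in> carrier (alg i)"
    have "\<phi> x \<otimes>\<^bsub>KA\<^esub> Z \<xi>' \<otimes>\<^bsub>KA\<^esub> (\<phi> y \<otimes>\<^bsub>KA\<^esub> Z \<xi>') = \<phi> x \<otimes>\<^bsub>KA\<^esub> (Z \<xi>' \<otimes>\<^bsub>KA\<^esub> (\<phi> y \<otimes>\<^bsub>KA\<^esub> Z \<xi>'))"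
      using Aj.m_assoc[OF c[OF xy(1)] Zj Aj.m_closed[OF c[OF xy(2)] Zj]] unfolding alg_simps .
    also have "\<dots> = \<phi> x \<otimes>\<^bsub>KA\<^esub> (\<phi> y \<otimes>\<^bsub>KA\<^esub> (Z \<xi>' \<otimes>\<^bsub>KA\<^esub> Z \<xi>'))"
      using Zcom[OF \<xi>(2) Aj.m_closed[OF c[OF xy(2)] Zj]] Aj.m_assoc[OF c[OF xy(2)] Zj Zj] unfolding alg_simps by simp
    also have "\<dots> = \<phi> x \<otimes>\<^bsub>KA\<^esub> \<phi> y \<otimes>\<^bsub>KA\<^esub> Z \<xi>'"
      unfolding Zidem[OF \<xi>(2)] using Aj.m_assoc[OF c[OF xy(1)] c[OF xy(2)] Zj] unfolding alg_simps by simp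
    finally show "\<phi> (x \<otimes>\<^bsub>KA\<^esub> y) \<otimes>\<^bsub>KA\<^esub> Z \<xi>' = \<phi> x \<otimes>\<^bsub>KA\<^esub> Z \<xi>' \<otimes>\<^bsub>KA\<^esub> (\<phi> y \<otimes>\<^bsub>KA\<^esub> Z \<xi>')"
      using ring_iso_memE(2)[OF \<phi> xy] unfolding alg_simps by simp
  qed
  have YA: "Y \<in> carrier (alg m)" unfolding Y_def by (rule cl[OF Zc[OF \<xi> n]])
  have f0: "f \<zero>\<^bsub>KA\<^esub> = \<zero>\<^bsub>KA\<^esub>" and g0: "g \<zero>\<^bsub>KA\<^esub> = \<zero>\<^bsub>KA\<^esub>"
    using ring_hom_zero[OF _ An.ring_axioms Am.ring_axioms, of f] ring_hom_zero[OF _ Am.ring_axioms An.ring_axioms, of g] f g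
    unfolding ring_iso_def alg_simps by auto
  have "Y \<noteq> \<zero>\<^bsub>KA\<^esub>" using gf[OF Zc[OF \<xi> n]] g0 Zne[OF \<xi>] unfolding Y_def by metis
  then obtain \<xi>' a b where ne: "Y (\<xi>', a, b) \<noteq> \<zero>\<^bsub>F\<^esub>" using kernel_eqI[of Y "\<zero>\<^bsub>KA\<^esub>"] unfolding kernel_simps by blast
  then have \<xi>': "\<xi>' \<in> C" using kernel_outside[OF alg_carrier[OF YA]] by blast
  have "(Y \<otimes>\<^bsub>KA\<^esub> Z \<xi>') (\<xi>', a, b) \<noteq> \<zero>\<^bsub>KA\<^esub> (\<xi>', a, b)" using ne unfolding Z_mult(2)[OF \<xi>' alg_carrier[OF YA]] kernel_simps by simp
  then have Y1: "Y \<otimes>\<^bsub>KA\<^esub> Z \<xi>' = Z \<xi>'" using dich[OF f n m \<xi> \<xi>'] unfolding Y_def by auto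
  \<comment> \<open>\<open>Z \<xi>'\<close> lies below \<open>Y\<close>, so its preimage lies below
    \<open>Z \<xi>\<close>. Being nonzero, the preimage satisfies the first alternative of the
    dichotomy, and so \<open>Z \<xi>\<close> lies below it.\<close>
  have gZ: "g (Z \<xi>') \<otimes>\<^bsub>KA\<^esub> Z \<xi> = g (Z \<xi>')"
  proof -
    have "g (Z \<xi>') = g (Y \<otimes>\<^bsub>alg m\<^esub> Z \<xi>')" unfolding alg_simps Y1 ..
    also have "\<dots> = Z \<xi> \<otimes>\<^bsub>KA\<^esub> g (Z \<xi>')"
      using ring_iso_memE(2)[OF g YA Zc[OF \<xi>' m]] gf[OF Zc[OF \<xi> n]] unfolding alg_simps Y_def by simp
    finally show ?thesis using Zcom[OF \<xi> clg[OF Zc[OF \<xi>' m]]] by simp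
  qed
  have "g (Z \<xi>') \<noteq> \<zero>\<^bsub>KA\<^esub>"
  proof
    assume "g (Z \<xi>') = \<zero>\<^bsub>KA\<^esub>"
    then have "f (g (Z \<xi>')) = \<zero>\<^bsub>KA\<^esub>" using f0 by simp
    moreover have "f (g (Z \<xi>')) = Z \<xi>'" unfolding g_def using bij Zc[OF \<xi>' m] by (simp add: bij_betw_inv_into_right)
    ultimately show False using Zne[OF \<xi>'] by simp
  qed
  then have "g (Z \<xi>') \<otimes>\<^bsub>KA\<^esub> Z \<xi> = Z \<xi>" using dich[OF g m n \<xi>' \<xi>] gZ by auto
  then obtain c c' where c: "of_nat m * fst \<xi>' = (of_nat c * (of_nat n * fst \<xi>) :: rat)" "of_nat n * fst \<xi> = (of_nat c' * (of_nat m * fst \<xi>') :: rat)"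
    using main[OF f n m \<xi> \<xi>'] Y1 main[OF g m n \<xi>' \<xi>] unfolding Y_def by blast
  have pos: "0 < fst \<xi>" "0 < fst \<xi>'" using C_pos \<xi> \<xi>' by auto
  define y where "y = of_nat m * fst \<xi>'"
  have ypos: "0 < y" unfolding y_def using pos m by simp
  \<comment> \<open>Going to \<open>\<xi>\<close> and back multiplies a positive number by
    \<open>c * c'\<close>, which must be 1.\<close>
  have "of_nat (c * c') * y = 1 * y" unfolding y_def using c by (metis mult.assoc mult.left_neutral of_nat_mult)
  then have "(of_nat (c * c') :: rat) = of_nat 1" using ypos by simp
  then have "c * c' = 1" by (simp only: of_nat_eq_iff)
  then have "of_nat m * fst \<xi>' = of_nat n * fst \<xi>" using c(1) by simp
  then have "of_nat n / of_nat m = fst \<xi>' * inverse (fst \<xi>)" using pos m by (simp add: field_simps)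
  moreover have "fst \<xi> \<in> H" "fst \<xi>' \<in> H" using \<xi> \<xi>' by (auto simp: C_def)
  ultimately show ?thesis using H_mult H_inverse by (simp del: times_divide_eq_left)
qed

lemma matrix_type_alg: "matrix_type (alg 1) = {(n, m). 0 < n \<and> 0 < m \<and> of_nat n / of_nat m \<in> H}"
proof -
  have r: "ring (matrix_ring k (alg 1))" for k by (rule ring.matrix_ring_ring[OF alg_ring]) simp
  have "matrix_ring n (alg 1) \<simeq> matrix_ring m (alg 1) \<longleftrightarrow> of_nat n / of_nat m \<in> H" if n: "0 < n" and m: "0 < m" for n m
  proof
    note sym = ring_iso_sym[OF r matrix_alg]
    assume "matrix_ring n (alg 1) \<simeq> matrix_ring m (alg 1)"
    then show "of_nat n / of_nat m \<in> H"
      by (intro alg_iso_ratio[OF n m] ring_iso_trans[OF ring_iso_trans[OF sym[OF n]] matrix_alg[OF m]])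
  next
    note sym = ring_iso_sym[OF r matrix_alg]
    assume "of_nat n / of_nat m \<in> H"
    then show "matrix_ring n (alg 1) \<simeq> matrix_ring m (alg 1)"
      by (intro ring_iso_trans[OF ring_iso_trans[OF matrix_alg[OF n] alg_iso[OF n m]] sym[OF m]])
  qed
  then show ?thesis unfolding matrix_type_def by auto
qed

end

section \<open>Transport along an injection\<close>

definition transport :: "('b \<Rightarrow> 'c) \<Rightarrow> ('a, 'b) module \<Rightarrow> ('a, 'c) module" where
  "transport f A =
     \<lparr>carrier = f ` carrier A,
      monoid.mult = (\<lambda>x y. f (inv_into UNIV f x \<otimes>\<^bsub>A\<^esub> inv_into UNIV f y)),
      one = f \<one>\<^bsub>A\<^esub>,
      ring.zero = f \<zero>\<^bsub>A\<^esub>,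
      ring.add = (\<lambda>x y. f (inv_into UNIV f x \<oplus>\<^bsub>A\<^esub> inv_into UNIV f y)),
      smult = (\<lambda>a x. f (a \<odot>\<^bsub>A\<^esub> inv_into UNIV f x))\<rparr>"

lemma transport_simps:
  assumes "inj f"
  shows "carrier (transport f A) = f ` carrier A"
    "f x \<otimes>\<^bsub>transport f A\<^esub> f y = f (x \<otimes>\<^bsub>A\<^esub> y)" "f x \<oplus>\<^bsub>transport f A\<^esub> f y = f (x \<oplus>\<^bsub>A\<^esub> y)"
    "\<one>\<^bsub>transport f A\<^esub> = f \<one>\<^bsub>A\<^esub>" "a \<odot>\<^bsub>transport f A\<^esub> f x = f (a \<odot>\<^bsub>A\<^esub> x)"
  using assms by (simp_all add: transport_def)

lemma carrier_update_simps:
  "x \<otimes>\<^bsub>R\<lparr>carrier := D\<rparr>\<^esub> y = x \<otimes>\<^bsub>R\<^esub> y" "x \<oplus>\<^bsub>R\<lparr>carrier := D\<rparr>\<^esub> y = x \<oplus>\<^bsub>R\<^esub> y"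
  "\<one>\<^bsub>R\<lparr>carrier := D\<rparr>\<^esub> = \<one>\<^bsub>R\<^esub>" "carrier (R\<lparr>carrier := D\<rparr>) = D" for R :: "('a, 'b, 'm) module_scheme"
  by simp_all

lemma transport_iso:
  assumes f: "inj f"
  shows "f \<in> ring_iso A (transport f A)"
  by (rule ring_iso_memI) (auto simp: transport_def f bij_betw_def inj_on_subset[OF f])

lemma transport_ring:
  assumes "inj f" "ring A"
  shows "ring (transport f A)"
proof -
  \<comment> \<open>The image ring furnished by the isomorphism has its zero overwritten; here the
    overwriting changes nothing.\<close>
  have "transport f A\<lparr>ring.zero := f \<zero>\<^bsub>A\<^esub>\<rparr> = transport f A" by (simp add: transport_def)
  then show ?thesis using ring.ring_iso_imp_img_ring[OF assms(2) transport_iso[OF assms(1)]] by simp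
qed

lemma transport_assoc_algebra:
  assumes f: "inj f" and A: "assoc_algebra F A"
  shows "assoc_algebra F (transport f A)"
proof -
  interpret A: assoc_algebra F A by (rule A)
  interpret T: ring "transport f A" by (rule transport_ring[OF f A.ring_axioms])
  show ?thesis
    by unfold_locales (auto simp: transport_def f A.smult_l_distr A.smult_r_distr A.smult_assoc1 A.smult_mult_left A.smult_mult_right)
qed

lemma transport_ultramatricial:
  assumes f: "inj f" and A: "ultramatricial F A"
  shows "ultramatricial F (transport f A)"
proof -
  let ?T = "transport f A"
  obtain \<B> where B0: "countable \<B> \<and> \<B> \<noteq> {} \<and>
      (\<forall>B \<in> \<B>. \<forall>C \<in> \<B>. \<exists>D \<in> \<B>. B \<subseteq> D \<and> C \<subseteq> D) \<and>
      (\<forall>B \<in> \<B>. unital_subalgebra B F A \<and> matricial F (A\<lparr>carrier := B\<rparr>)) \<and> carrier A = \<Union>\<B>"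
    using conjunct2[OF A[unfolded ultramatricial_def]] by (elim exE)
  note B = B0[THEN conjunct1] B0[THEN conjunct2, THEN conjunct1] B0[THEN conjunct2, THEN conjunct2, THEN conjunct1]
    B0[THEN conjunct2, THEN conjunct2, THEN conjunct2, THEN conjunct1] B0[THEN conjunct2, THEN conjunct2, THEN conjunct2, THEN conjunct2]
  have aA: "assoc_algebra F A" using A unfolding ultramatricial_def by (rule conjunct1)
  interpret A: assoc_algebra F A by (rule aA)
  interpret T: ring ?T by (rule transport_ring[OF f A.ring_axioms])
  interpret h: ring_hom_ring A ?T f
    by (rule ring_hom_ringI2[OF A.ring_axioms T.ring_axioms]) (use transport_iso[OF f, of A] in \<open>simp add: ring_iso_def\<close>)
  show ?thesis
    unfolding ultramatricial_def
  proof (intro conjI exI[of _ "image f ` \<B>"] ballI)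
    show "assoc_algebra F ?T" by (rule transport_assoc_algebra[OF f aA])
    show "countable (image f ` \<B>)" by (rule countable_image[OF B(1)])
    show "image f ` \<B> \<noteq> {}" using B(2) by simp
    show "carrier ?T = \<Union> (image f ` \<B>)" unfolding transport_def partial_object.simps B(5) by (rule image_Union)
  next
    fix B' C' assume "B' \<in> image f ` \<B>" "C' \<in> image f ` \<B>"
    then obtain B1 C1 where BC: "B1 \<in> \<B>" "B' = f ` B1" "C1 \<in> \<B>" "C' = f ` C1" by blast
    obtain D where "D \<in> \<B>" "B1 \<subseteq> D" "C1 \<subseteq> D" using bspec[OF bspec[OF B(3) BC(1)] BC(3)] by blast
    then show "\<exists>D\<in>image f ` \<B>. B' \<subseteq> D \<and> C' \<subseteq> D" unfolding BC by blast
  next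
    fix B' assume "B' \<in> image f ` \<B>"
    then obtain B1 where B1: "B1 \<in> \<B>" "B' = f ` B1" by blast
    have sub: "subring B1 A" "\<forall>a\<in>carrier F. \<forall>x\<in>B1. a \<odot>\<^bsub>A\<^esub> x \<in> B1"
      using conjunct1[OF bspec[OF B(4) B1(1)]] unfolding unital_subalgebra_def by (rule conjunct1, rule conjunct2)
    show "unital_subalgebra B' F ?T"
      unfolding unital_subalgebra_def B1(2)
    proof (intro conjI ballI)
      show "subring (f ` B1) ?T" by (rule h.img_is_subring[OF sub(1)])
      fix a x assume a: "a \<in> carrier F" "x \<in> f ` B1"
      from this(2) obtain u where u: "x = f u" "u \<in> B1" by (rule imageE)
      show "a \<odot>\<^bsub>?T\<^esub> x \<in> f ` B1"
        unfolding u(1) transport_simps(5)[OF f] by (rule imageI) (rule bspec[OF bspec[OF sub(2) a(1)] u(2)])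
    qed
    obtain r :: nat and d where d: "\<forall>i<r. 0 < d i" and iso: "algebra_isomorphic F (A\<lparr>carrier := B1\<rparr>) (matrix_product F {..<r} d)"
      using conjunct2[OF bspec[OF B(4) B1(1)]] unfolding matricial_def by (elim exE conjE)
    obtain h where h: "h \<in> ring_iso (A\<lparr>carrier := B1\<rparr>) (matrix_product F {..<r} d)"
      and "\<forall>a\<in>carrier F. \<forall>x\<in>carrier (A\<lparr>carrier := B1\<rparr>). h (a \<odot>\<^bsub>A\<lparr>carrier := B1\<rparr>\<^esub> x) = a \<odot>\<^bsub>matrix_product F {..<r} d\<^esub> h x"
      using iso unfolding algebra_isomorphic_def by (elim bexE)
    then have sm: "h (a \<odot>\<^bsub>A\<^esub> x) = a \<odot>\<^bsub>matrix_product F {..<r} d\<^esub> h x" if "a \<in> carrier F" "x \<in> B1" for a x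
      using that by simp
    have hb: "bij_betw h B1 (carrier (matrix_product F {..<r} d))" using h by (simp add: ring_iso_def)
    have "h \<circ> inv_into UNIV f \<in> ring_iso (?T\<lparr>carrier := f ` B1\<rparr>) (matrix_product F {..<r} d)"
    proof (rule ring_iso_memI)
      have "bij_betw (inv_into UNIV f) (f ` B1) B1" by (rule bij_betw_byWitness[where f' = f]) (auto simp: inv_f_f[OF f])
      then show "bij_betw (h \<circ> inv_into UNIV f) (carrier (?T\<lparr>carrier := f ` B1\<rparr>)) (carrier (matrix_product F {..<r} d))"
        using bij_betw_trans[OF _ hb] by simp
    next
      note ops = carrier_update_simps
      note hE = ring_iso_memE[OF h, unfolded ops] and fin = transport_simps[OF f] comp_apply inv_f_f[OF f]
      fix x assume "x \<in> carrier (?T\<lparr>carrier := f ` B1\<rparr>)"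
      then obtain u where u: "x = f u" "u \<in> B1" unfolding ops by (rule imageE)
      show "(h \<circ> inv_into UNIV f) x \<in> carrier (matrix_product F {..<r} d)" unfolding u(1) fin by (rule hE(1)[OF u(2)])
      fix y assume "y \<in> carrier (?T\<lparr>carrier := f ` B1\<rparr>)"
      then obtain v where v: "y = f v" "v \<in> B1" unfolding ops by (rule imageE)
      show "(h \<circ> inv_into UNIV f) (x \<otimes>\<^bsub>?T\<lparr>carrier := f ` B1\<rparr>\<^esub> y) = (h \<circ> inv_into UNIV f) x \<otimes>\<^bsub>matrix_product F {..<r} d\<^esub> (h \<circ> inv_into UNIV f) y"
        unfolding u(1) v(1) ops fin by (rule hE(2)[OF u(2) v(2)])
      show "(h \<circ> inv_into UNIV f) (x \<oplus>\<^bsub>?T\<lparr>carrier := f ` B1\<rparr>\<^esub> y) = (h \<circ> inv_into UNIV f) x \<oplus>\<^bsub>matrix_product F {..<r} d\<^esub> (h \<circ> inv_into UNIV f) y"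
        unfolding u(1) v(1) ops fin by (rule hE(3)[OF u(2) v(2)])
    next
      note hE = ring_iso_memE[OF h, unfolded carrier_update_simps]
      show "(h \<circ> inv_into UNIV f) \<one>\<^bsub>?T\<lparr>carrier := f ` B1\<rparr>\<^esub> = \<one>\<^bsub>matrix_product F {..<r} d\<^esub>"
        unfolding carrier_update_simps transport_simps[OF f] comp_apply inv_f_f[OF f] by (rule hE(4))
    qed
    moreover have "(h \<circ> inv_into UNIV f) (a \<odot>\<^bsub>?T\<^esub> x) = a \<odot>\<^bsub>matrix_product F {..<r} d\<^esub> (h \<circ> inv_into UNIV f) x"
      if ax: "a \<in> carrier F" "x \<in> f ` B1" for a x
    proof -
      obtain u where u: "x = f u" "u \<in> B1" using ax(2) by (rule imageE)
      show ?thesis unfolding u(1) transport_simps(5)[OF f] comp_apply inv_f_f[OF f] by (rule sm[OF ax(1) u(2)])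
    qed
    ultimately show "matricial F (?T\<lparr>carrier := B'\<rparr>)"
      unfolding matricial_def algebra_isomorphic_def B1(2)
      by (intro exI[of _ r] exI[of _ d] conjI d bexI[of _ "h \<circ> inv_into UNIV f"] ballI) simp_all
  qed
qed

lemma transport_matrix_type:
  assumes f: "inj f" and A: "ring A"
  shows "matrix_type (transport f A) = matrix_type A"
proof -
  let ?T = "transport f A"
  have T: "ring ?T" by (rule transport_ring[OF f A])
  have "A \<simeq> ?T" using transport_iso[OF f] unfolding is_ring_iso_def by blast
  then have i: "matrix_ring n A \<simeq> matrix_ring n ?T" for n by (rule matrix_ring_cong_iso[OF A T])
  have j: "matrix_ring n ?T \<simeq> matrix_ring n A" for n by (rule ring_iso_sym[OF ring.matrix_ring_ring[OF A] i])
  have "matrix_ring n ?T \<simeq> matrix_ring m ?T \<longleftrightarrow> matrix_ring n A \<simeq> matrix_ring m A" for n m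
    by (rule iffI, rule ring_iso_trans[OF ring_iso_trans[OF i _] j], assumption, rule ring_iso_trans[OF ring_iso_trans[OF j _] i])
  then show ?thesis unfolding matrix_type_def by simp
qed

section \<open>Equivalence relations and subgroups of the positive rationals\<close>

definition ratio_group :: "(nat \<times> nat) set \<Rightarrow> rat set" where
  "ratio_group E = {of_nat n / of_nat m | n m. 0 < n \<and> 0 < m \<and> (n, m) \<in> E}"

text \<open>Equal fractions have equal cross products. Expanding both pairs to these products by the
  multiplicativity of \<open>E\<close> shows that membership does not depend on the chosen
  fraction.\<close>

lemma ratio_group_mem:
  assumes E: "equiv {n::nat. 0 < n} E" and i: "\<And>n m k. \<lbrakk>0 < n; 0 < m; 0 < k\<rbrakk> \<Longrightarrow> (n, m) \<in> E \<longleftrightarrow> (n * k, m * k) \<in> E"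
    and nm: "0 < n" "0 < m"
  shows "of_nat n / of_nat m \<in> ratio_group E \<longleftrightarrow> (n, m) \<in> E"
proof
  assume "(of_nat n / of_nat m :: rat) \<in> ratio_group E"
  then obtain n' m' where r: "0 < n'" "0 < m'" "(n', m') \<in> E" "(of_nat n / of_nat m :: rat) = of_nat n' / of_nat m'"
    unfolding ratio_group_def by blast
  have "(of_nat (n * m') :: rat) = of_nat (n' * m)" using r nm by (simp add: field_simps)
  then have "n * m' = n' * m" by (simp only: of_nat_eq_iff)
  then show "(n, m) \<in> E" using i[OF r(1,2) nm(2)] i[OF nm r(2)] r(3) by (simp add: mult.commute)
qed (use nm in \<open>auto simp: ratio_group_def\<close>)

lemma ratio_group_subgroup:
  assumes E: "equiv {n::nat. 0 < n} E" and i: "\<And>n m k. \<lbrakk>0 < n; 0 < m; 0 < k\<rbrakk> \<Longrightarrow> (n, m) \<in> E \<longleftrightarrow> (n * k, m * k) \<in> E"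
  shows "subgroup (ratio_group E) pos_rat_group"
proof
  show "ratio_group E \<subseteq> carrier pos_rat_group" by (auto simp: ratio_group_def pos_rat_group_def)
  have "(1, 1) \<in> E" using E by (auto simp: equiv_def refl_on_def)
  then show "\<one>\<^bsub>pos_rat_group\<^esub> \<in> ratio_group E"
    using ratio_group_mem[OF E i, of 1 1] by (simp add: pos_rat_group_def)
next
  fix x y assume "x \<in> ratio_group E" "y \<in> ratio_group E"
  then obtain n m n' m' where r: "0 < n" "0 < m" "(n, m) \<in> E" "x = of_nat n / of_nat m"
    "0 < n'" "0 < m'" "(n', m') \<in> E" "y = of_nat n' / of_nat m'" unfolding ratio_group_def by blast
  \<comment> \<open>The two pairs are expanded so that they share the middle term
    \<open>m * n'\<close>, and transitivity applies.\<close>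
  have "(n * n', m * n') \<in> E" using i[OF r(1,2,5)] r(3) by simp
  moreover have "(n' * m, m' * m) \<in> E" using i[OF r(5,6,2)] r(7) by simp
  ultimately have "(n * n', m * m') \<in> E" using E by (auto simp: equiv_def mult.commute elim: transE)
  then have "of_nat (n * n') / of_nat (m * m') \<in> ratio_group E" using ratio_group_mem[OF E i, of "n * n'" "m * m'"] r by simp
  then show "x \<otimes>\<^bsub>pos_rat_group\<^esub> y \<in> ratio_group E" using r by (simp add: pos_rat_group_def)
next
  fix x assume "x \<in> ratio_group E"
  then obtain n m where r: "0 < n" "0 < m" "(n, m) \<in> E" "x = of_nat n / of_nat m" unfolding ratio_group_def by blast
  have "(m, n) \<in> E" using r(3) E by (auto simp: equiv_def elim: symE)
  then have "of_nat m / of_nat n \<in> ratio_group E" using ratio_group_mem[OF E i r(2,1)] by blast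
  moreover have "inv\<^bsub>pos_rat_group\<^esub> x = of_nat m / of_nat n" using inv_pos_rat_group[of x] r by simp
  ultimately show "inv\<^bsub>pos_rat_group\<^esub> x \<in> ratio_group E" by simp
qed

lemma pos_rat_quotient:
  assumes "0 < (x :: rat)"
  obtains n m :: nat where "0 < n" "0 < m" "x = of_nat n / of_nat m"
proof -
  obtain a b where ab: "quotient_of x = (a, b)" by (cases "quotient_of x")
  have b: "0 < b" using quotient_of_denom_pos[OF ab] .
  have x: "x = of_int a / of_int b" using quotient_of_div[OF ab] .
  then have a: "0 < a" using assms b by (simp add: zero_less_divide_iff)
  have "x = of_nat (nat a) / of_nat (nat b)" using a b unfolding x by simp
  then show thesis using that[of "nat a" "nat b"] a b by simp
qed

lemma ultramatricial_multiple:
  assumes F: "principal_domain F" and A: "ultramatricial F A"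
  shows "\<forall>n m k. 0 < n \<and> 0 < m \<and> 0 < k \<longrightarrow> ((n, m) \<in> matrix_type A \<longleftrightarrow> (n * k, m * k) \<in> matrix_type A)"
proof (intro allI impI)
  have l: "locally_framed A" by (rule ultramatricial_locally_framed[OF F A])
  then have r: "ring A" unfolding locally_framed_def by (rule conjunct1)
  fix n m k :: nat assume "0 < n \<and> 0 < m \<and> 0 < k"
  then show "(n, m) \<in> matrix_type A \<longleftrightarrow> (n * k, m * k) \<in> matrix_type A"
    using matrix_ring_cancel[OF l, of n m k] matrix_ring_multiple[OF r, of n m k] unfolding matrix_type_def by auto
qed

theorem theorem1p2:
  fixes F :: "'a ring" and E :: "(nat \<times> nat) set"
  assumes "field F \<or> principal_domain F"
    and "equiv {n::nat. 0 < n} E"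
  shows "((\<forall>n m k. 0 < n \<and> 0 < m \<and> 0 < k \<longrightarrow> ((n, m) \<in> E \<longleftrightarrow> (n * k, m * k) \<in> E))
          \<longleftrightarrow>
          (\<exists>!H. subgroup H pos_rat_group \<and>
             (\<forall>n m. 0 < n \<and> 0 < m \<longrightarrow> ((n, m) \<in> E \<longleftrightarrow> (of_nat n / of_nat m :: rat) \<in> H))))
       \<and> ((\<exists>!H. subgroup H pos_rat_group \<and>
             (\<forall>n m. 0 < n \<and> 0 < m \<longrightarrow> ((n, m) \<in> E \<longleftrightarrow> (of_nat n / of_nat m :: rat) \<in> H)))
          \<longleftrightarrow>
          (\<exists>A :: ('a, nat \<Rightarrow> 'a) module. ultramatricial F A \<and> matrix_type A = E))
       \<and> ((\<exists>A :: ('a, 'b) module. ultramatricial F A \<and> matrix_type A = E)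
          \<longrightarrow>
          (\<exists>A :: ('a, nat \<Rightarrow> 'a) module. ultramatricial F A \<and> matrix_type A = E))"
    (is "(?i \<longleftrightarrow> ?ii) \<and> (?ii \<longleftrightarrow> ?iii) \<and> _")
proof -
  have F: "principal_domain F"
    using assms(1)
  proof
    assume "field F"
    then interpret field F .
    show ?thesis by (rule principal_domain_axioms)
  qed
  define rep where "rep H \<longleftrightarrow> subgroup H pos_rat_group \<and>
    (\<forall>n m. 0 < n \<and> 0 < m \<longrightarrow> ((n, m) \<in> E \<longleftrightarrow> (of_nat n / of_nat m :: rat) \<in> H))" for H
  have rep_E: "E = {(n, m). 0 < n \<and> 0 < m \<and> of_nat n / of_nat m \<in> H}" if "rep H" for H
    using that assms(2) unfolding rep_def by (auto simp: equiv_def)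
  have i_ii: "?ii" if ?i
  proof -
    have i: "(n, m) \<in> E \<longleftrightarrow> (n * k, m * k) \<in> E" if "0 < n" "0 < m" "0 < k" for n m k
      using \<open>?i\<close> that by blast
    have "rep (ratio_group E)"
      unfolding rep_def using ratio_group_subgroup[OF assms(2) i] ratio_group_mem[OF assms(2) i] by simp
    \<comment> \<open>Every positive rational is a quotient of positive integers, so
      \<open>E\<close> determines the subgroup; this is the uniqueness.\<close>
    moreover have "H \<subseteq> H'" if H: "rep H" "rep H'" for H H'
    proof
      fix x assume x: "x \<in> H"
      then have "0 < x" using H(1) subgroup.subset[of H pos_rat_group] unfolding rep_def by (auto simp: pos_rat_group_def)
      then obtain n m where "0 < n" "0 < m" "x = of_nat n / of_nat m" by (rule pos_rat_quotient)
      then show "x \<in> H'" using H x unfolding rep_def by auto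
    qed
    ultimately show ?ii unfolding rep_def[symmetric] by (meson subset_antisym)
  qed
  have ii_i: "?i" if ?ii
  proof -
    obtain H where H: "rep H" using \<open>?ii\<close> unfolding rep_def by blast
    show ?i unfolding rep_E[OF H] by auto
  qed
  have ii_iii: "?iii" if ?ii
  proof -
    obtain H where rH: "rep H" using \<open>?ii\<close> unfolding rep_def by blast
    interpret tower F H
      by (intro tower.intro tower_axioms.intro F conjunct1[OF rH[unfolded rep_def]])
    \<comment> \<open>The indices of kernels form a countable type. Reading a kernel along an
      enumeration of the indices gives a sequence, and the kernel can be recovered from it.\<close>
    define f :: "((rat \<times> nat) \<times> nat \<times> nat \<Rightarrow> 'a) \<Rightarrow> nat \<Rightarrow> 'a" where "f k = k \<circ> from_nat" for k
    have f: "inj f"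
    proof (rule injI)
      fix k l assume "f k = f l"
      then have "f k (to_nat z) = f l (to_nat z)" for z :: "(rat \<times> nat) \<times> nat \<times> nat" by simp
      then have "k z = l z" for z unfolding f_def comp_apply from_nat_to_nat .
      then show "k = l" by (rule ext)
    qed
    have "matrix_type (transport f (alg 1)) = E"
      using transport_matrix_type[OF f alg_ring[of 1]] matrix_type_alg rep_E[OF rH] by simp
    then show ?iii using transport_ultramatricial[OF f alg_ultramatricial] by blast
  qed
  \<comment> \<open>The element type is left general, because the fact is applied both to sequences
    in \<open>F\<close> and to algebras with elements in \<open>'b\<close>. Passing through (i) and
    (ii) then moves an algebra to the fixed element type.\<close>
  have iii_i: "?i" if "ultramatricial F A" "matrix_type A = E" for A :: "('a, 'c) module"
    using ultramatricial_multiple[OF F \<open>ultramatricial F A\<close>] unfolding \<open>matrix_type A = E\<close> .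
  have ii: "?i \<longleftrightarrow> ?ii" by (rule iffI, rule i_ii, assumption, rule ii_i, assumption)
  moreover have "?ii \<longleftrightarrow> ?iii"
    by (rule iffI, rule ii_iii, assumption, elim exE conjE, rule i_ii, rule iii_i, assumption, assumption)
  moreover have "(\<exists>A :: ('a, 'b) module. ultramatricial F A \<and> matrix_type A = E) \<longrightarrow> ?iii"
    by (rule impI, elim exE conjE, rule ii_iii, rule i_ii, rule iii_i, assumption, assumption)
  ultimately show ?thesis by (intro conjI)
qed

end
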